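(* There exists a set $T$ of $14$ generalized Wang tiles such that the problem of tiling finite simply connected regions with the fixed set $T$ is $\mathsf{NP}$-complete.
   Context: A polyomino is a simply connected shape obtained by gluing finitely many unit squares of the square grid together edge-to-edge. A generalized Wang tile is a polyomino with a color assigned to each unit segment of its boundary. Tiles are used only by translation (no rotation or reflection), and each tile of a set may be used an unlimited number of times (including zero). A finite simply connected region (for generalized Wang tiles) is a finite simply connected polyomino region $D$ (i.e. without holes) together with a color assigned to each unit segment of its boundary. A set $T$ of generalized Wang tiles tiles $D$ if $D$ is the union of translated copies of members of $T$, placed on the unit grid with pairwise disjoint interiors, such that whenever two copies share a unit boundary segment they have the same color on it, and every unit boundary segment of a copy lying on the boundary of $D$ has the color assigned to that segment of the boundary of $D$. For a fixed set $T$ of generalized Wang tiles, the problem of tiling finite simply connected regions with $T$ is the decision problem: given an arbitrary finite simply connected region $D$ (with its boundary colors), can $D$ be tiled with translated copies of tiles from $T$? The set $T$ is not part of the input; the region $D$ is given explicitly, as a list of its unit squares together with the colors of its boundary segments. *)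

theory Defs
  imports "HOL-Analysis.Analysis" "HOL-Computational_Algebra.Polynomial"
begin

section \<open>Polynomial time and NP\<close>

type_synonym language = "bool list set"

datatype move = Move_Left | Stay | Move_Right

text \<open>
  A single-tape (nondeterministic) machine is given by its transition table: an entry
  \<open>(q, a, q', b, m)\<close> allows a machine that is in state \<open>q\<close> and reads \<open>a\<close> to write \<open>b\<close>, to make
  the move \<open>m\<close> and to enter state \<open>q'\<close>.  Finiteness of the table makes the sets of relevant states
  and symbols finite.  State 0 is initial and state 1 is accepting; symbol 0 is the blank,
  and 1, 2 represent the bits 0, 1.  The tape is infinite in both directions.
\<close>

type_synonym machine = "(nat \<times> nat \<times> nat \<times> nat \<times> move) set"

type_synonym config = "nat \<times> int \<times> (int \<Rightarrow> nat)"

definition Turing_machine :: "machine \<Rightarrow> bool" where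
  "Turing_machine M \<longleftrightarrow> finite M"

definition deterministic :: "machine \<Rightarrow> bool" where
  "deterministic M \<longleftrightarrow>
     (\<forall>q a r r'. (q, a, r) \<in> M \<longrightarrow> (q, a, r') \<in> M \<longrightarrow> r = r')"

fun move_offset :: "move \<Rightarrow> int" where
  "move_offset Move_Left = - 1"
| "move_offset Stay = 0"
| "move_offset Move_Right = 1"

definition tape_of :: "bool list \<Rightarrow> int \<Rightarrow> nat" where
  "tape_of w i =
     (if 0 \<le> i \<and> i < int (length w) then (if w ! nat i then 2 else 1) else 0)"

definition initial_config :: "bool list \<Rightarrow> config" where
  "initial_config w = (0, 0, tape_of w)"

inductive step :: "machine \<Rightarrow> config \<Rightarrow> config \<Rightarrow> bool" for M where
  "(q, tp h, q', b, m) \<in> M \<Longrightarrow> step M (q, h, tp) (q', h + move_offset m, tp(h := b))"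

definition halting :: "machine \<Rightarrow> config \<Rightarrow> bool" where
  "halting M c \<longleftrightarrow> (\<nexists>c'. step M c c')"

definition accepts :: "machine \<Rightarrow> bool list \<Rightarrow> bool" where
  "accepts M w \<longleftrightarrow>
     (\<exists>c. (step M)\<^sup>*\<^sup>* (initial_config w) c \<and> halting M c \<and> fst c = 1)"

text \<open>The bound concerns all computation branches.\<close>

definition runs_in_time :: "machine \<Rightarrow> (nat \<Rightarrow> nat) \<Rightarrow> bool" where
  "runs_in_time M f \<longleftrightarrow>
     (\<forall>w n c. (step M ^^ n) (initial_config w) c \<longrightarrow> n \<le> f (length w))"

definition in_NP :: "language \<Rightarrow> bool" where
  "in_NP L \<longleftrightarrow>
     (\<exists>M (p :: nat poly). Turing_machine M \<and> runs_in_time M (poly p) \<and>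
        (\<forall>w. w \<in> L \<longleftrightarrow> accepts M w))"

definition polytime_computable :: "(bool list \<Rightarrow> bool list) \<Rightarrow> bool" where
  "polytime_computable f \<longleftrightarrow>
     (\<exists>M (p :: nat poly). Turing_machine M \<and> deterministic M \<and> runs_in_time M (poly p) \<and>
        (\<forall>w. \<exists>q h. (step M)\<^sup>*\<^sup>* (initial_config w) (q, h, tape_of (f w)) \<and>
           halting M (q, h, tape_of (f w))))"

definition polytime_reducible :: "language \<Rightarrow> language \<Rightarrow> bool" where
  "polytime_reducible A B \<longleftrightarrow> (\<exists>f. polytime_computable f \<and> (\<forall>w. w \<in> A \<longleftrightarrow> f w \<in> B))"

definition NP_hard :: "language \<Rightarrow> bool" where
  "NP_hard B \<longleftrightarrow> (\<forall>A. in_NP A \<longrightarrow> polytime_reducible A B)"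

definition NP_complete :: "language \<Rightarrow> bool" where
  "NP_complete B \<longleftrightarrow> in_NP B \<and> NP_hard B"


section \<open>Polyominoes and generalized Wang tiles\<close>

text \<open>A cell is named by the lower left corner of its unit square.\<close>

type_synonym cell = "int \<times> int"

text \<open>
  \<open>Hor (x, y)\<close> is the unit segment from \<open>(x, y)\<close> to \<open>(x + 1, y)\<close>, and \<open>Ver (x, y)\<close> the one from
  \<open>(x, y)\<close> to \<open>(x, y + 1)\<close>.
\<close>

datatype edge = Hor "int \<times> int" | Ver "int \<times> int"

fun square :: "cell \<Rightarrow> (real \<times> real) set" where
  "square (x, y) = {of_int x .. of_int x + 1} \<times> {of_int y .. of_int y + 1}"

fun cell_edges :: "cell \<Rightarrow> edge set" where
  "cell_edges (x, y) = {Hor (x, y), Hor (x, y + 1), Ver (x, y), Ver (x + 1, y)}"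

definition edge_connected :: "cell set \<Rightarrow> bool" where
  "edge_connected P \<longleftrightarrow>
     (\<forall>c\<in>P. \<forall>d\<in>P. (c, d) \<in> {(a, b). a \<in> P \<and> b \<in> P \<and> cell_edges a \<inter> cell_edges b \<noteq> {}}\<^sup>*)"

text \<open>
  The closed squares are used in the topological condition.  So a set of cells whose complement
  has a bounded part that meets the rest of the complement in a corner only is not a polyomino:
  it encloses a hole.
\<close>

definition polyomino :: "cell set \<Rightarrow> bool" where
  "polyomino P \<longleftrightarrow>
     finite P \<and> P \<noteq> {} \<and> edge_connected P \<and> simply_connected (\<Union>c\<in>P. square c)"

definition boundary_edges :: "cell set \<Rightarrow> edge set" where
  "boundary_edges P = {e. \<exists>!c. c \<in> P \<and> e \<in> cell_edges c}"

text \<open>Generalized Wang tiles and regions to be tiled are objects of the same kind.\<close>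

type_synonym colored_cells = "cell set \<times> (edge \<rightharpoonup> nat)"

definition colored_polyomino :: "colored_cells \<Rightarrow> bool" where
  "colored_polyomino t \<longleftrightarrow> polyomino (fst t) \<and> dom (snd t) = boundary_edges (fst t)"

fun translate_edge :: "int \<times> int \<Rightarrow> edge \<Rightarrow> edge" where
  "translate_edge v (Hor p) = Hor (p + v)"
| "translate_edge v (Ver p) = Ver (p + v)"

definition translate :: "int \<times> int \<Rightarrow> colored_cells \<Rightarrow> colored_cells" where
  "translate v t = ((\<lambda>c. c + v) ` fst t, \<lambda>e. snd t (translate_edge (- v) e))"

text \<open>
  Tiles are considered up to translation, so a set of tiles must not contain two different
  translates of the same tile.
\<close>

definition wang_tile_set :: "colored_cells set \<Rightarrow> bool" where
  "wang_tile_set T \<longleftrightarrow>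
     (\<forall>t\<in>T. colored_polyomino t) \<and> (\<forall>s\<in>T. \<forall>t\<in>T. \<forall>v. t = translate v s \<longrightarrow> s = t)"

definition tiles_region :: "colored_cells set \<Rightarrow> colored_cells \<Rightarrow> bool" where
  "tiles_region T D \<longleftrightarrow>
     (\<exists>Q. Q \<subseteq> {translate v t | v t. t \<in> T} \<and>
        (\<Union>q\<in>Q. fst q) = fst D \<and>
        (\<forall>q\<in>Q. \<forall>r\<in>Q. q \<noteq> r \<longrightarrow> fst q \<inter> fst r = {}) \<and>
        (\<forall>q\<in>Q. \<forall>r\<in>Q. \<forall>e \<in> boundary_edges (fst q) \<inter> boundary_edges (fst r).
           snd q e = snd r e) \<and>
        (\<forall>q\<in>Q. \<forall>e \<in> boundary_edges (fst q) \<inter> boundary_edges (fst D). snd q e = snd D e))"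


section \<open>The decision problem\<close>

text \<open>
  Instances are written as bit strings: numbers in binary (least significant bit first), lists
  with a bit \<open>True\<close> before each element and \<open>False\<close> at the end.
\<close>

fun bits :: "nat \<Rightarrow> bool list" where
  "bits n = (if n = 0 then [] else odd n # bits (n div 2))"

declare bits.simps [simp del]

definition list_code :: "('a \<Rightarrow> bool list) \<Rightarrow> 'a list \<Rightarrow> bool list" where
  "list_code f xs = concat (map (\<lambda>x. True # f x) xs) @ [False]"

definition nat_code :: "nat \<Rightarrow> bool list" where
  "nat_code n = list_code (\<lambda>b. [b]) (bits n)"

definition int_code :: "int \<Rightarrow> bool list" where
  "int_code z = (z < 0) # nat_code (nat \<bar>z\<bar>)"

fun cell_code :: "int \<times> int \<Rightarrow> bool list" where
  "cell_code (x, y) = int_code x @ int_code y"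

fun edge_code :: "edge \<Rightarrow> bool list" where
  "edge_code (Hor p) = False # cell_code p"
| "edge_code (Ver p) = True # cell_code p"

fun colored_edge_code :: "edge \<times> nat \<Rightarrow> bool list" where
  "colored_edge_code (e, k) = edge_code e @ nat_code k"

definition region_code :: "cell list \<Rightarrow> (edge \<times> nat) list \<Rightarrow> bool list" where
  "region_code cs bs = list_code cell_code cs @ list_code colored_edge_code bs"

definition tiling_problem :: "colored_cells set \<Rightarrow> language" where
  "tiling_problem T =
     {region_code cs bs | cs bs.
        distinct cs \<and> distinct (map fst bs) \<and>
        colored_polyomino (set cs, map_of bs) \<and> tiles_region T (set cs, map_of bs)}"


subsection \<open>The encoding is unambiguous\<close>

definition prefix_code :: "('a \<Rightarrow> bool list) \<Rightarrow> bool" where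
  "prefix_code f \<longleftrightarrow> (\<forall>x y u v. f x @ u = f y @ v \<longrightarrow> x = y \<and> u = v)"

lemma prefix_codeD:
  "prefix_code f \<Longrightarrow> f x @ u = f y @ v \<longleftrightarrow> x = y \<and> u = v"
  unfolding prefix_code_def by blast

lemma prefix_code_list_code:
  assumes f: "prefix_code f"
  shows "prefix_code (list_code f)"
proof -
  have "xs = ys \<and> u = v" if "list_code f xs @ u = list_code f ys @ v" for xs ys u v
    using that
  proof (induction xs arbitrary: ys)
    case Nil
    then show ?case by (cases ys) (auto simp: list_code_def)
  next
    case (Cons x xs)
    show ?case
    proof (cases ys)
      case Nil
      with Cons.prems show ?thesis by (simp add: list_code_def)
    next
      case (Cons y zs)
      with Cons.prems
      have "f x @ (list_code f xs @ u) = f y @ (list_code f zs @ v)"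
        by (simp add: list_code_def)
      then have "x = y" "list_code f xs @ u = list_code f zs @ v"
        by (simp_all only: prefix_codeD[OF f])
      with Cons.IH[of zs] Cons show ?thesis by simp
    qed
  qed
  then show ?thesis unfolding prefix_code_def by blast
qed

lemma bits_inject: "bits m = bits n \<Longrightarrow> m = n"
proof (induction m arbitrary: n rule: less_induct)
  case (less m)
  show ?case
  proof (cases "m = 0 \<or> n = 0")
    case True
    with less.prems show ?thesis
      by (auto simp: bits.simps[of m] bits.simps[of n] split: if_splits)
  next
    case False
    with less.prems have par: "odd m = odd n" and "bits (m div 2) = bits (n div 2)"
      by (auto simp: bits.simps[of m] bits.simps[of n])
    with less.IH[of "m div 2" "n div 2"] False have "m div 2 = n div 2" by simp
    with par show ?thesis by presburger
  qed
qed

lemma prefix_code_nat_code: "prefix_code nat_code"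
proof -
  have "prefix_code (list_code (\<lambda>b. [b]))"
    by (rule prefix_code_list_code) (simp add: prefix_code_def)
  then show ?thesis
    unfolding prefix_code_def nat_code_def by (blast intro: bits_inject)
qed

lemma prefix_code_int_code: "prefix_code int_code"
  by (subst prefix_code_def)
    (simp add: int_code_def prefix_codeD[OF prefix_code_nat_code] eq_nat_nat_iff, arith)

lemma prefix_code_cell_code: "prefix_code cell_code"
  by (subst prefix_code_def) (simp add: prefix_codeD[OF prefix_code_int_code])

lemma prefix_code_edge_code: "prefix_code edge_code"
proof -
  have "e = e' \<and> u = v" if "edge_code e @ u = edge_code e' @ v" for e e' u v
    using that
    by (cases e; cases e') (simp_all add: prefix_codeD[OF prefix_code_cell_code])
  then show ?thesis unfolding prefix_code_def by blast
qed

lemma prefix_code_colored_edge_code: "prefix_code colored_edge_code"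
  by (subst prefix_code_def)
    (simp add: prefix_codeD[OF prefix_code_edge_code] prefix_codeD[OF prefix_code_nat_code])

lemma region_code_inject:
  "region_code cs bs = region_code cs' bs' \<longleftrightarrow> cs = cs' \<and> bs = bs'"
  using prefix_codeD[OF prefix_code_list_code[OF prefix_code_colored_edge_code], of bs "[]" bs' "[]"]
  unfolding region_code_def prefix_codeD[OF prefix_code_list_code[OF prefix_code_cell_code]]
  by simp

end

(*
 Membership: a tiling, together with an enumeration of the region by horizontal runs of cells each of
 which touches exactly one earlier run, is a certificate of polynomial size.  Such an enumeration
 exists exactly for the simply connected regions, since runs are convex.

 Hardness: a row of tiles acts on the colors below it as on a queue of bits, in which the first two bits
 are replaced by a gate or the second one is moved to the end.  Constants enter and leave the queue
 through the boundary of the region.  Sweeping such instructions over the queue realizes every relation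
 on blocks of bits simultaneously on all blocks, so that a nondeterministic Turing machine can be
 simulated as a rewriting system on neighbouring pairs of letters; a tiling of the region is an
 accepting computation.
*)

theory Submission
 imports Defs "HOL-Library.Countable"
begin

section \<open>Stack programs on a single-tape machine\<close>

text \<open>The tile set is fixed while the machine varies, so the whole program has to be dictated
  by the shape and the colors of the boundary. A row offers boundary only near its ends; hence
  constants can enter and leave only at the front of the queue, and a result is out of reach until a
  sweep has treated all other blocks. The gate has inputs \<open>a\<close>, \<open>y\<close> and a
  doubled output \<open>t\<close> with \<open>y\<close> the nand of \<open>a\<close> and
  \<open>t\<close>. Read this way it is a constraint rather than a function: a true \<open>a\<close>
  determines \<open>t\<close>, a false one may leave it free. Therefore the same four tiles negate,
  copy, guess and reject; with four shift tiles, four crosses and two turns this makes 14. The upper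
  boundary must not depend on the computation, so an accepting configuration is turned into one
  fixed word within a number of rounds that depends only on the length of the input. Since
  polynomial time is defined by single-tape machines, the verifier and the layout of the region both
  need a calculus of polynomial-time functions; it is obtained from stack programs compiled to such
  machines.\<close>

definition forced :: "('c => 'c => bool) => 'c => 'c => bool" where
 "forced R c c' \<longleftrightarrow> R c c' \<and> (\<forall>x. R c x --> x = c')"

definition stops :: "('c => 'c => bool) => 'c => nat => bool" where
 "stops R c n \<longleftrightarrow> (\<forall>m x. (R ^^ m) c x --> m \<le> n)"

lemma stops_mono: "stops R c n ==> n \<le> n' ==> stops R c n'"
 unfolding stops_def using order_trans by blast

lemma stops_halt: "(!!x. \<not> R c x) ==> stops R c n"
 unfolding stops_def by (metis relpowp_E2 zero_le)

lemma stops_branch: "(!!x. R c x ==> stops R x n) ==> stops R c (Suc n)"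
 unfolding stops_def by (metis Suc_le_mono relpowp_E2 zero_le)

lemma stops_step: "stops R c (Suc n) ==> R c x ==> stops R x n"
 unfolding stops_def by (metis Suc_le_mono relpowp_Suc_I2)

lemma stops_zero: "stops R c 0 ==> \<not> R c x"
 unfolding stops_def by (metis relpowp_1 not_one_le_zero)

text \<open>Forced steps open no branch, so their number simply adds to the bound of the
  configuration they lead to.\<close>

lemma stops_det: "(forced R ^^ m) c c' ==> stops R c' n ==> stops R c (m + n)"
proof (induction m arbitrary: c)
 case 0
 then show ?case by simp
next
 case (Suc m)
 then obtain d where "forced R c d" "(forced R ^^ m) d c'" by (metis relpowp_Suc_D2)
 with Suc show ?case by (metis add_Suc forced_def stops_branch)
qed

lemma det_imp: "(forced R ^^ m) c c' ==> R\<^sup>*\<^sup>* c c'"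
proof -
 assume "(forced R ^^ m) c c'"
 then have "(R ^^ m) c c'"
  by (rule relpowp_mono[rotated]) (simp add: forced_def)
 then show ?thesis by (simp add: relpowp_imp_rtranclp)
qed

section \<open>Acceptance from an arbitrary configuration\<close>

definition macc :: "machine => config => bool" where
 "macc M c \<longleftrightarrow> (\<exists>c'. (step M)\<^sup>*\<^sup>* c c' \<and> halting M c' \<and> fst c' = 1)"

lemma macc_halt:
 assumes "halting M c"
 shows "macc M c \<longleftrightarrow> fst c = 1"
proof -
 have "c' = c" if "(step M)\<^sup>*\<^sup>* c c'" for c'
  using that assms unfolding halting_def by (cases rule: converse_rtranclpE) auto
 then show ?thesis unfolding macc_def using assms by blast
qed

lemma macc_step:
 assumes n: "\<not> halting M c"
 shows "macc M c \<longleftrightarrow> (\<exists>x. step M c x \<and> macc M x)"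
proof
 assume "macc M c"
 then obtain c' where "(step M)\<^sup>*\<^sup>* c c'" and c': "halting M c'" "fst c' = 1" unfolding macc_def by blast
 then show "\<exists>x. step M c x \<and> macc M x"
 proof (cases rule: converse_rtranclpE)
  case base
  with c' n show ?thesis by simp
 next
  case (step y)
  with c' show ?thesis unfolding macc_def by blast
 qed
next
 assume "\<exists>x. step M c x \<and> macc M x"
 then show "macc M c" unfolding macc_def by (blast intro: converse_rtranclp_into_rtranclp)
qed

lemma macc_det: "(forced (step M) ^^ m) c c' ==> macc M c \<longleftrightarrow> macc M c'"
proof (induction m arbitrary: c)
 case 0
 then show ?case by simp
next
 case (Suc m)
 then obtain d where d: "forced (step M) c d" "(forced (step M) ^^ m) d c'" by (metis relpowp_Suc_D2)
 then have "\<not> halting M c" unfolding halting_def forced_def[of _ c d] by blast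
 with macc_step[OF this] d(1) have "macc M c \<longleftrightarrow> macc M d" unfolding forced_def[of _ c d] by blast
 with Suc d show ?case by simp
qed

subsection \<open>Packing seven stacks into tracks of the tape\<close>

text \<open>Base 3, one digit per track: 0 for blank, 1 and 2 for the bits. Thus the symbol with all
  digits 0 is the blank of the machine, and a symbol whose only nonzero digit belongs to track 0 is
  the plain symbol 1 or 2.\<close>

fun dig :: "nat => nat => nat" where
 "dig 0 a = a mod 3"
| "dig (Suc i) a = dig i (a div 3)"

fun upd :: "nat => nat => nat => nat" where
 "upd 0 v a = 3 * (a div 3) + v"
| "upd (Suc i) v a = 3 * upd i v (a div 3) + a mod 3"

fun pack :: "nat => (nat => nat) => nat" where
 "pack 0 d = 0"
| "pack (Suc K) d = d 0 + 3 * pack K (\<lambda>i. d (Suc i))"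

lemma dig_pack: "i < K ==> (!!j. d j < 3) ==> dig i (pack K d) = d i"
proof (induction K arbitrary: i d)
 case (Suc K)
 then show ?case by (cases i) auto
qed simp

lemma upd_pack: "i < K ==> (!!j. d j < 3) ==> upd i v (pack K d) = pack K (d(i := v))"
proof (induction K arbitrary: i d)
 case (Suc K)
 show ?case
 proof (cases i)
  case 0
  with Suc.prems show ?thesis by (auto simp: fun_upd_def)
 next
  case (Suc i')
  with Suc.prems Suc.IH[of i' "\<lambda>i. d (Suc i)"] show ?thesis
   by (simp add: fun_upd_def)
 qed
qed simp

lemma pack_less: "(!!j. d j < 3) ==> pack K d < 3 ^ K"
proof (induction K arbitrary: d)
 case (Suc K)
 have "pack K (\<lambda>i. d (Suc i)) < 3 ^ K" using Suc by simp
 moreover have "d 0 < 3" by (rule Suc.prems)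
 ultimately show ?case by simp
qed simp

lemma pack_zero: "pack K (\<lambda>i. 0) = 0"
 by (induction K) auto

type_synonym stacks = "nat => bool list"

text \<open>The head of the list \<open>s i\<close> is the top of stack \<open>i\<close>; its bottom is in tape cell 0.\<close>

definition tp :: "stacks => int => nat" where
 "tp s j = pack 7 (\<lambda>i. tape_of (rev (s i)) j)"

lemma tape_of_less: "tape_of w j < 3"
 by (simp add: tape_of_def)

lemma dig_tp: "i < 7 ==> dig i (tp s j) = tape_of (rev (s i)) j"
 unfolding tp_def by (rule dig_pack) (auto simp: tape_of_less)

lemma tp_less: "tp s j < 3 ^ 7"
 unfolding tp_def by (rule pack_less) (auto simp: tape_of_less)

lemma tape_of_zero: "tape_of w j = 0 \<longleftrightarrow> \<not> (0 \<le> j \<and> j < int (length w))"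
 by (simp add: tape_of_def)

lemma tape_of_push:
 "tape_of (rev (b # xs)) = (tape_of (rev xs))(int (length xs) := if b then 2 else 1)"
proof
 fix j
 show "tape_of (rev (b # xs)) j = ((tape_of (rev xs))(int (length xs) := if b then 2 else 1)) j"
  by (cases "j = int (length xs)") (auto simp: tape_of_def nth_append)
qed

text \<open>Allows any change of one cell of one track, so that it covers pushes and pops alike:
  both alter one cell at the top of a stack.\<close>

lemma tp_upd:
 assumes "i < 7" and "tape_of (rev xs) = (tape_of (rev (s i)))(j := v)"
 shows "(tp s)(j := upd i v (tp s j)) = tp (s(i := xs))"
proof
 fix l
 have "upd i v (tp s j) = pack 7 ((\<lambda>i. tape_of (rev (s i)) j)(i := v))"
  unfolding tp_def by (rule upd_pack) (auto simp: assms tape_of_less)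
 also have "\<dots> = tp (s(i := xs)) j"
  unfolding tp_def by (rule arg_cong[where f="pack 7"]) (auto simp: assms(2))
 finally have 1: "upd i v (tp s j) = tp (s(i := xs)) j" .
 have 2: "tp (s(i := xs)) l = tp s l" if "l ~= j"
  unfolding tp_def by (rule arg_cong[where f="pack 7"]) (use that in \<open>auto simp: assms(2)\<close>)
 show "((tp s)(j := upd i v (tp s j))) l = tp (s(i := xs)) l"
  using 1 2 by auto
qed

lemma tp_push:
 assumes "i < 7"
 shows "(tp s)(int (length (s i)) := upd i (if b then 2 else 1) (tp s (int (length (s i)))))
  = tp (s(i := b # s i))"
 by (rule tp_upd[OF assms]) (simp only: tape_of_push)

lemma tp_pop:
 assumes "i < 7" "s i = b # r"
 shows "(tp s)(int (length r) := upd i 0 (tp s (int (length r)))) = tp (s(i := r))"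
proof (rule tp_upd[OF assms(1)])
 show "tape_of (rev r) = (tape_of (rev (s i)))(int (length r) := 0)"
  unfolding assms(2) tape_of_push by (auto simp: fun_eq_iff tape_of_zero)
qed

text \<open>Since bottoms lie in cell 0, an input or output tape is already the tape of a stack
  program with one nonempty stack; nothing has to be converted.\<close>

lemma tp_single: "tp ((\<lambda>_. [])(0 := rev w)) = tape_of w"
proof
 fix j
 have "tp ((\<lambda>_. [])(0 := rev w)) j = pack (Suc 6) (\<lambda>i. tape_of (rev (((\<lambda>_. [])(0 := rev w)) i)) j)"
  by (simp add: tp_def eval_nat_numeral)
 also have "\<dots> = tape_of w j + 3 * pack 6 (\<lambda>i. 0)"
  by (simp only: pack.simps) (simp add: tape_of_def)
 finally show "tp ((\<lambda>_. [])(0 := rev w)) j = tape_of w j" by (simp only: pack_zero)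
qed

subsection \<open>Stack programs\<close>

datatype com =
  Skip
 | Fail
 | Push nat bool
 | Guess nat
 | Seq com com (infixr ";;" 60)
 | Case nat com com com
 | Loop nat bool com com

text \<open>Countability allows control states, which are made of continuations, to be numbered by
  \<open>to_nat\<close>.\<close>

instance com :: countable by countable_datatype

text \<open>
 \<open>Case i e f t\<close> pops stack \<open>i\<close> and continues with \<open>e\<close> (empty stack), \<open>f\<close> or \<open>t\<close>.
 \<open>Loop i x f t\<close> does the same repeatedly until the stack is empty; with \<open>x\<close> set it also
 ends after a popped \<open>False\<close>.
\<close>

fun snx :: "com list \<times> stacks => (com list \<times> stacks) set" where
 "snx ([], s) = {}"
| "snx (Skip # k, s) = {(k, s)}"
| "snx (Fail # k, s) = {}"
| "snx (Push i b # k, s) = {(k, s(i := b # s i))}"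
| "snx (Guess i # k, s) = {(k, s(i := True # s i)), (k, s(i := False # s i))}"
| "snx ((a ;; b) # k, s) = {(a # b # k, s)}"
| "snx (Case i e f t # k, s) =
  (case s i of [] => {(e # k, s)} | b # r => {((if b then t else f) # k, s(i := r))})"
| "snx (Loop i x f t # k, s) =
  (case s i of [] => {(k, s)}
   | b # r => {(if b then t # Loop i x f t # k else if x then f # k else f # Loop i x f t # k, s(i := r))})"

definition sstep :: "com list \<times> stacks => com list \<times> stacks => bool" where
 "sstep c c' \<longleftrightarrow> c' \<in> snx c"

definition sacc :: "com list \<times> stacks => bool" where
 "sacc c \<longleftrightarrow> (\<exists>s'. sstep\<^sup>*\<^sup>* c ([], s'))"

fun okc :: "com => bool" where
 "okc Skip \<longleftrightarrow> True"
| "okc Fail \<longleftrightarrow> True"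
| "okc (Push i b) \<longleftrightarrow> i < 7"
| "okc (Guess i) \<longleftrightarrow> i < 7"
| "okc (a ;; b) \<longleftrightarrow> okc a \<and> okc b"
| "okc (Case i e f t) \<longleftrightarrow> i < 7 \<and> okc e \<and> okc f \<and> okc t"
| "okc (Loop i x f t) \<longleftrightarrow> i < 7 \<and> okc f \<and> okc t"

fun nog :: "com => bool" where
 "nog (Guess i) \<longleftrightarrow> False"
| "nog (a ;; b) \<longleftrightarrow> nog a \<and> nog b"
| "nog (Case i e f t) \<longleftrightarrow> nog e \<and> nog f \<and> nog t"
| "nog (Loop i x f t) \<longleftrightarrow> nog f \<and> nog t"
| "nog _ \<longleftrightarrow> True"

text \<open>The list of pending programs plays the role of a program counter. A loop puts itself
  back onto the list, yet only finitely many lists arise, and they become the control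
  states.\<close>

fun conts :: "com => com list => com list set" where
 "conts (a ;; b) k = insert ((a ;; b) # k) (conts a (b # k) \<union> conts b k)"
| "conts (Case i e f t) k = insert (Case i e f t # k) (conts e k \<union> conts f k \<union> conts t k)"
| "conts (Loop i x f t) k = insert (Loop i x f t # k)
  (conts f (if x then k else Loop i x f t # k) \<union> conts t (Loop i x f t # k))"
| "conts c k = {c # k}"

fun nxt :: "com list => com list set" where
 "nxt [] = {}"
| "nxt (Fail # k) = {}"
| "nxt ((a ;; b) # k) = {a # b # k}"
| "nxt (Case i e f t # k) = {e # k, f # k, t # k}"
| "nxt (Loop i x f t # k) = {k, if x then f # k else f # Loop i x f t # k, t # Loop i x f t # k}"
| "nxt (c # k) = {k}"

lemma finite_conts: "finite (conts c k)"
 by (induction c k rule: conts.induct) auto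

lemma conts_self: "c # k \<in> conts c k"
 by (cases c) auto

lemma conts_closed: "l \<in> conts c k ==> nxt l \<subseteq> insert k (conts c k)"
proof (induction c arbitrary: k l)
 case (Seq a b)
 then show ?case using conts_self by fastforce
next
 case (Case i e f t)
 then show ?case using conts_self by fastforce
next
 case (Loop i x f t)
 consider "l = Loop i x f t # k" | "l \<in> conts f (if x then k else Loop i x f t # k)"
  | "l \<in> conts t (Loop i x f t # k)" using Loop.prems by auto
 then show ?case
 proof cases
  case 1
  then show ?thesis using conts_self[of f] conts_self[of t] by auto
 next
  case 2
  then show ?thesis using Loop.IH(1)[OF 2] by (auto split: if_splits)
 next
  case 3
  then show ?thesis using Loop.IH(2)[OF 3] by auto
 qed
qed auto

text \<open>The assumptions say that \<open>P\<close> passes to subprograms; the instances are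
  \<open>okc\<close> and \<open>nog\<close>.\<close>

lemma conts_all:
 assumes "!!a b. P (a ;; b) ==> P a \<and> P b" "!!i e f t. P (Case i e f t) ==> P e \<and> P f \<and> P t"
  "!!i x f t. P (Loop i x f t) ==> P f \<and> P t"
 shows "P c ==> list_all P k ==> l \<in> conts c k ==> list_all P l"
proof (induction c arbitrary: k l)
 case (Seq a b)
 have P: "P a" "P b" using assms(1)[OF Seq.prems(1)] by simp_all
 have "list_all P l" if "l \<in> conts a (b # k)"
  by (rule Seq.IH(1)[OF P(1) _ that]) (use Seq.prems P in simp)
 moreover have "list_all P l" if "l \<in> conts b k"
  by (rule Seq.IH(2)[OF P(2) _ that]) (use Seq.prems in simp)
 ultimately show ?case using Seq.prems by auto
next
 case (Case i e f t)
 have P: "P e" "P f" "P t" using assms(2)[OF Case.prems(1)] by simp_all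
 from Case.prems(3) consider "l = Case i e f t # k" | "l \<in> conts e k" | "l \<in> conts f k" | "l \<in> conts t k"
  by auto
 then show ?case
 proof cases
  case 1
  then show ?thesis using Case.prems by simp
 next
  case 2
  then show ?thesis using Case.IH(1)[OF P(1) Case.prems(2)] by simp
 next
  case 3
  then show ?thesis using Case.IH(2)[OF P(2) Case.prems(2)] by simp
 next
  case 4
  then show ?thesis using Case.IH(3)[OF P(3) Case.prems(2)] by simp
 qed
next
 case (Loop i x f t)
 have P: "P f" "P t" using assms(3)[OF Loop.prems(1)] by simp_all
 have "list_all P l" if "l \<in> conts f (if x then k else Loop i x f t # k)"
  by (rule Loop.IH(1)[OF P(1) _ that]) (use Loop.prems(1,2) in \<open>cases x; simp\<close>)
 moreover have "list_all P l" if "l \<in> conts t (Loop i x f t # k)"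
  by (rule Loop.IH(2)[OF P(2) _ that]) (use Loop.prems in simp)
 ultimately show ?case using Loop.prems by auto
qed auto

subsection \<open>Compilation\<close>

text \<open>
 A control state is a continuation with a phase: 0 (walk right to the first blank of the track
 concerned, or dispatch), 1 (inspect the top symbol), and \<open>i + 2\<close> (walk back left on track \<open>i\<close>).
\<close>

fun tm :: "com list => nat => nat => ((com list \<times> nat) \<times> nat \<times> move) set" where
 "tm k (Suc (Suc i)) a =
  (if dig i a ~= 0 then {((k, Suc (Suc i)), a, Move_Left)} else {((k, 0), a, Move_Right)})"
| "tm (Skip # k) 0 a = {((k, 0), a, Stay)}"
| "tm ((c ;; d) # k) 0 a = {((c # d # k, 0), a, Stay)}"
| "tm (Push i b # k) 0 a =
  (if dig i a ~= 0 then {((Push i b # k, 0), a, Move_Right)}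
   else {((k, Suc (Suc i)), upd i (if b then 2 else 1) a, Move_Left)})"
| "tm (Guess i # k) 0 a =
  (if dig i a ~= 0 then {((Guess i # k, 0), a, Move_Right)}
   else (\<lambda>b. ((k, Suc (Suc i)), upd i (if b then 2 else 1) a, Move_Left)) ` UNIV)"
| "tm (Case i e f t # k) 0 a =
  (if dig i a ~= 0 then {((Case i e f t # k, 0), a, Move_Right)}
   else {((Case i e f t # k, Suc 0), a, Move_Left)})"
| "tm (Loop i x f t # k) 0 a =
  (if dig i a ~= 0 then {((Loop i x f t # k, 0), a, Move_Right)}
   else {((Loop i x f t # k, Suc 0), a, Move_Left)})"
| "tm (Case i e f t # k) (Suc 0) a =
  (if dig i a = 0 then {((e # k, 0), a, Move_Right)}
   else {(((if dig i a = 2 then t else f) # k, Suc (Suc i)), upd i 0 a, Move_Left)})"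
| "tm (Loop i x f t # k) (Suc 0) a =
  (if dig i a = 0 then {((k, 0), a, Move_Right)}
   else {((if dig i a = 2 then t # Loop i x f t # k
       else if x then f # k else f # Loop i x f t # k, Suc (Suc i)), upd i 0 a, Move_Left)})"
| "tm _ _ a = {}"

text \<open>The start and the end of the program get the states 0 and 1 that the machine model
  prescribes; the offset 2 keeps all other numbers away from them.\<close>

definition scode :: "com => com list \<times> nat => nat" where
 "scode c st = (if st = ([c], 0) then 0 else if st = ([], 0) then 1 else 2 + to_nat st)"

lemma scode_inject: "scode c st = scode c st' \<longleftrightarrow> st = st'"
 unfolding scode_def by (auto split: if_splits)

text \<open>Walking back on track \<open>i < 7\<close> is phase \<open>i + 2\<close>, hence the
  bound 9; seven ternary digits give the bound \<open>3 ^ 7\<close>. Both bounds make the table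
  finite.\<close>

definition compile :: "com => machine" where
 "compile c = {(scode c (k, ph), a, scode c st', b, m) | k ph a st' b m.
  k \<in> insert [] (conts c []) \<and> ph < 9 \<and> a < 3 ^ 7 \<and> (st', b, m) \<in> tm k ph a}"

lemma finite_tm: "finite (tm k ph a)"
 by (induction k ph a rule: tm.induct) auto

lemma finite_compile: "finite (compile c)"
proof -
 have "compile c \<subseteq> (\<Union>k\<in>insert [] (conts c []). \<Union>ph\<in>{..<9}. \<Union>a\<in>{..<3^7}.
   (\<lambda>(st', b, m). (scode c (k, ph), a, scode c st', b, m)) ` tm k ph a)"
 proof
  fix x assume "x \<in> compile c"
  then obtain k ph a st b m where x: "x = (scode c (k, ph), a, scode c st, b, m)"
   and k: "k \<in> insert [] (conts c [])" "ph < 9" "a < 3 ^ 7" and t: "(st, b, m) \<in> tm k ph a"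
   unfolding compile_def mem_Collect_eq by (elim exE conjE)
  have "x \<in> (\<lambda>(st', b, m). (scode c (k, ph), a, scode c st', b, m)) ` tm k ph a"
   using t unfolding x by (rule rev_image_eqI) simp
  then show "x \<in> (\<Union>k\<in>insert [] (conts c []). \<Union>ph\<in>{..<9}. \<Union>a\<in>{..<3^7}.
    (\<lambda>(st', b, m). (scode c (k, ph), a, scode c st', b, m)) ` tm k ph a)"
   using k by blast
 qed
 then show ?thesis by (rule finite_subset) (simp add: finite_conts finite_tm)
qed

lemma tm_single: "list_all nog k ==> r \<in> tm k ph a ==> r' \<in> tm k ph a ==> r = r'"
 by (induction k ph a rule: tm.induct) (auto split: if_splits)

lemma deterministic_compile:
 assumes "nog c"
 shows "deterministic (compile c)"
proof -
 have "list_all nog k" if "k \<in> insert [] (conts c [])" for k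
  using that conts_all[of nog c "[]" k] assms by fastforce
 note nogk = this
 show ?thesis unfolding deterministic_def
 proof (intro allI impI)
  fix q a and r r' :: "nat \<times> nat \<times> move"
  assume *: "(q, a, r) \<in> compile c" "(q, a, r') \<in> compile c"
  obtain k ph st b m where
   1: "k \<in> insert [] (conts c [])" "q = scode c (k, ph)" "(st, b, m) \<in> tm k ph a" "r = (scode c st, b, m)"
   using *(1) unfolding compile_def mem_Collect_eq by (elim exE conjE) simp
  obtain k' ph' st' b' m' where
   2: "q = scode c (k', ph')" "(st', b', m') \<in> tm k' ph' a" "r' = (scode c st', b', m')"
   using *(2) unfolding compile_def mem_Collect_eq by (elim exE conjE) simp
  from 1(2) 2(1) have "k' = k" "ph' = ph" by (simp_all add: scode_inject)
  with 2(2) have "(st', b', m') \<in> tm k ph a" by simp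
  then have "(st', b', m') = (st, b, m)" using tm_single[OF nogk[OF 1(1)] 1(3)] by simp
  then show "r = r'" using 1 2 by simp
 qed
qed

section \<open>Simulation of stack programs by their compiled machines\<close>

locale program =
 fixes c0 :: com
 assumes ok: "okc c0"
begin

abbreviation "MM \<equiv> compile c0"
abbreviation "KK \<equiv> insert [] (conts c0 [])"

text \<open>The resting position between two steps of the stack program: phase 0 with the head on
  the cell that holds the bottom of every stack.\<close>

definition home :: "com list \<times> stacks => config" where
 "home c = (scode c0 (fst c, 0), 0, tp (snd c))"

lemma KK_ok: "k \<in> KK ==> list_all okc k"
 using conts_all[of okc c0 "[]" k] ok by fastforce

lemma KK_closed: "k \<in> KK ==> nxt k \<subseteq> KK"
 using conts_closed[of k c0 "[]"] by auto

lemma snx_nxt: "c' \<in> snx c ==> fst c' \<in> nxt (fst c)"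
 by (induction c rule: snx.induct) (auto split: list.splits if_splits)

lemma step_iff:
 assumes "k \<in> KK" "ph < 9"
 shows "step MM (scode c0 (k, ph), h, tp s) x \<longleftrightarrow>
  (\<exists>st' b m. (st', b, m) \<in> tm k ph (tp s h) \<and> x = (scode c0 st', h + move_offset m, (tp s)(h := b)))"
 (is "?L \<longleftrightarrow> ?R")
proof
 assume ?L
 then show ?R
  by (cases rule: step.cases) (auto simp: compile_def scode_inject)
next
 assume ?R
 then obtain st' b m where
  *: "(st', b, m) \<in> tm k ph (tp s h)" "x = (scode c0 st', h + move_offset m, (tp s)(h := b))" by blast
 then have "(scode c0 (k, ph), tp s h, scode c0 st', b, m) \<in> MM"
  unfolding compile_def mem_Collect_eq
  by (intro exI[of _ k] exI[of _ ph] exI[of _ "tp s h"] exI[of _ st'] exI[of _ b] exI[of _ m])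
   (use assms tp_less[of s h] in auto)
 then show ?L unfolding *(2) by (rule step.intros)
qed

lemma det_stepI:
 assumes "k \<in> KK" "ph < 9" "tm k ph (tp s h) = {(st', b, m)}"
  "x = (scode c0 st', h + move_offset m, (tp s)(h := b))"
 shows "forced (step MM) (scode c0 (k, ph), h, tp s) x"
proof -
 have "step MM (scode c0 (k, ph), h, tp s) y \<longleftrightarrow> y = x" for y
  unfolding step_iff[OF assms(1,2)] assms(3,4) by blast
 then show ?thesis unfolding forced_def by blast
qed

lemma walk_right:
 assumes "k \<in> KK" "i < 7" "!!a. dig i a ~= 0 ==> tm k 0 a = {((k, 0), a, Move_Right)}"
 shows "n \<le> length (s i) ==> (forced (step MM) ^^ n) (home (k, s)) (scode c0 (k, 0), int n, tp s)"
proof (induction n)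
 case 0
 then show ?case by (simp add: home_def)
next
 case (Suc n)
 have "forced (step MM) (scode c0 (k, 0), int n, tp s) (scode c0 (k, 0), int (Suc n), tp s)"
  by (rule det_stepI[OF assms(1) _ assms(3)])
   (use Suc.prems assms(2) in \<open>auto simp: dig_tp tape_of_zero\<close>)
 with Suc show ?case by auto
qed

text \<open>The walk overshoots to cell -1, which is blank on every track, and comes back to cell 0;
  this accounts for the step beyond \<open>n\<close>.\<close>

lemma walk_left:
 assumes "k \<in> KK" "i < 7"
 shows "n \<le> length (s i) ==>
  (forced (step MM) ^^ Suc n) (scode c0 (k, Suc (Suc i)), int n - 1, tp s) (home (k, s))"
proof (induction n)
 case 0
 have "forced (step MM) (scode c0 (k, Suc (Suc i)), int 0 - 1, tp s) (home (k, s))"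
  unfolding home_def
  by (rule det_stepI[where m=Move_Right and b="tp s (- 1)" and st'="(k,0)"])
   (use assms in \<open>auto simp: dig_tp tape_of_zero\<close>)
 then show ?case by auto
next
 case (Suc n)
 have "forced (step MM) (scode c0 (k, Suc (Suc i)), int (Suc n) - 1, tp s)
   (scode c0 (k, Suc (Suc i)), int n - 1, tp s)"
  by (rule det_stepI[where m=Move_Left and b="tp s (int n)"])
   (use assms Suc.prems in \<open>auto simp: dig_tp tape_of_zero\<close>)
 with Suc show ?case by (metis Suc_leD relpowp_Suc_I2)
qed

text \<open>One step of the stack program: a forced run, one step that may branch, and forced runs.\<close>

definition simulates :: "com list \<times> stacks => nat => bool" where
 "simulates c l \<longleftrightarrow> (\<exists>n\<le>l. \<exists>d. (forced (step MM) ^^ n) (home c) d \<and>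
  (\<forall>c'\<in>snx c. \<exists>m\<le>l. \<exists>x. step MM d x \<and> (forced (step MM) ^^ m) x (home c')) \<and>
  (\<forall>x. step MM d x --> (\<exists>c'\<in>snx c. \<exists>m\<le>l. (forced (step MM) ^^ m) x (home c'))))"

lemma simulates_detI:
 assumes "(forced (step MM) ^^ n) (home c) d" "forced (step MM) d x" "(forced (step MM) ^^ m) x (home c')"
  "snx c = {c'}" "n \<le> l" "m \<le> l"
 shows "simulates c l"
proof -
 have "step MM d x" "!!y. step MM d y ==> y = x" using assms(2) unfolding forced_def by blast+
 then show ?thesis unfolding simulates_def assms(4) using assms(1,3,5,6) by blast
qed

text \<open>Common to \<open>Case\<close> and \<open>Loop\<close>, which find the top bit in the
  same way and differ only in the three continuations.\<close>

lemma simulates_pop: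
 assumes k: "k \<in> KK" and i: "i < 7"
  and 0: "!!a. tm k 0 a = (if dig i a ~= 0 then {((k, 0), a, Move_Right)} else {((k, Suc 0), a, Move_Left)})"
  and 1: "!!a. tm k (Suc 0) a = (if dig i a = 0 then {((ke, 0), a, Move_Right)}
    else {((if dig i a = 2 then kt else kf, Suc (Suc i)), upd i 0 a, Move_Left)})"
  and KK: "ke \<in> KK" "kt \<in> KK" "kf \<in> KK"
  and snx: "snx (k, s) = (case s i of [] => {(ke, s)} | b # r => {(if b then kt else kf, s(i := r))})"
  and h: "length (s i) \<le> h"
 shows "simulates (k, s) (Suc h)"
proof -
 let ?n = "length (s i)"
 have A: "(forced (step MM) ^^ ?n) (home (k, s)) (scode c0 (k, 0), int ?n, tp s)"
  by (rule walk_right[OF k i]) (auto simp: 0)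
 have B: "forced (step MM) (scode c0 (k, 0), int ?n, tp s) (scode c0 (k, Suc 0), int ?n - 1, tp s)"
  by (rule det_stepI[where m=Move_Left and b="tp s (int ?n)"])
   (use k i in \<open>auto simp: 0 dig_tp tape_of_zero\<close>)
 have AB: "(forced (step MM) ^^ Suc ?n) (home (k, s)) (scode c0 (k, Suc 0), int ?n - 1, tp s)"
  using A B by auto
 show ?thesis
 proof (cases "s i")
  case Nil
  have C: "forced (step MM) (scode c0 (k, Suc 0), int ?n - 1, tp s) (home (ke, s))"
   unfolding home_def
   by (rule det_stepI[where m=Move_Right and b="tp s (int ?n - 1)"])
    (use k i Nil in \<open>auto simp: 1 dig_tp tape_of_zero\<close>)
  show ?thesis
   by (rule simulates_detI[OF AB C, of 0 "(ke, s)"]) (use snx Nil h in auto)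
 next
  case (Cons b r)
  let ?k' = "if b then kt else kf"
  have top: "tape_of (rev (s i)) (int (length r)) = (if b then 2 else 1)"
   unfolding Cons tape_of_push by simp
  have C: "forced (step MM) (scode c0 (k, Suc 0), int ?n - 1, tp s)
    (scode c0 (?k', Suc (Suc i)), int (length r) - 1, tp (s(i := r)))"
   by (rule det_stepI[where m=Move_Left and b="upd i 0 (tp s (int (length r)))"])
    (use k i Cons top tp_pop[where s=s, OF i Cons] in \<open>auto simp: 1 dig_tp\<close>)
  have D: "(forced (step MM) ^^ Suc (length r)) (scode c0 (?k', Suc (Suc i)), int (length r) - 1, tp (s(i := r)))
    (home (?k', s(i := r)))"
   by (rule walk_left) (use KK i in auto)
  show ?thesis
   by (rule simulates_detI[OF AB C D]) (use snx Cons h in auto)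
 qed
qed

lemma simulates:
 assumes k: "k \<in> KK" and h: "!!i. i < 7 ==> length (s i) \<le> h" and ne: "snx (k, s) ~= {}"
 shows "simulates (k, s) (Suc h)"
proof -
 obtain c l where cl: "k = c # l" using ne by (cases k) auto
 have okl: "okc c" using KK_ok[OF k] cl by simp
 have nx: "nxt k \<subseteq> KK" by (rule KK_closed[OF k])
 show ?thesis
 proof (cases c)
  case Skip
  have "forced (step MM) (home (k, s)) (home (l, s))"
   unfolding home_def fst_conv by (rule det_stepI[OF k]) (auto simp: cl Skip)
  then show ?thesis
   by (intro simulates_detI[of 0 _ _ _ 0 "(l, s)"]) (auto simp: cl Skip)
 next
  case Fail
  then show ?thesis using ne cl by simp
 next
  case (Seq a b)
  have "forced (step MM) (home (k, s)) (home (a # b # l, s))"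
   unfolding home_def fst_conv by (rule det_stepI[OF k]) (auto simp: cl Seq)
  then show ?thesis
   by (intro simulates_detI[of 0 _ _ _ 0 "(a # b # l, s)"]) (auto simp: cl Seq)
 next
  case (Push i b)
  have i: "i < 7" using okl Push by simp
  let ?n = "length (s i)"
  have A: "(forced (step MM) ^^ ?n) (home (k, s)) (scode c0 (k, 0), int ?n, tp s)"
   by (rule walk_right[OF k i]) (auto simp: cl Push)
  have B: "forced (step MM) (scode c0 (k, 0), int ?n, tp s)
    (scode c0 (l, Suc (Suc i)), int ?n - 1, tp (s(i := b # s i)))"
   by (rule det_stepI[where m=Move_Left and b="upd i (if b then 2 else 1) (tp s (int ?n))"])
    (use k i in \<open>auto simp: cl Push dig_tp tape_of_zero tp_push\<close>)
  have C: "(forced (step MM) ^^ Suc ?n) (scode c0 (l, Suc (Suc i)), int ?n - 1, tp (s(i := b # s i)))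
    (home (l, s(i := b # s i)))"
   by (rule walk_left) (use nx i cl Push in auto)
  show ?thesis
   by (rule simulates_detI[OF A B C]) (use h[OF i] in \<open>auto simp: cl Push\<close>)
 next
  case (Guess i)
  have i: "i < 7" using okl Guess by simp
  let ?n = "length (s i)"
  let ?d = "(scode c0 (k, 0), int ?n, tp s)"
  let ?x = "\<lambda>b. (scode c0 (l, Suc (Suc i)), int ?n - 1, tp (s(i := b # s i)))"
  have A: "(forced (step MM) ^^ ?n) (home (k, s)) ?d"
   by (rule walk_right[OF k i]) (auto simp: cl Guess)
  have tmd: "tm k 0 (tp s (int ?n)) =
    range (\<lambda>b. ((l, Suc (Suc i)), upd i (if b then 2 else 1) (tp s (int ?n)), Move_Left))"
   using i by (simp add: cl Guess dig_tp tape_of_zero)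
  have "step MM ?d x \<longleftrightarrow> (\<exists>b. x = (scode c0 (l, Suc (Suc i)), int ?n + move_offset Move_Left,
    (tp s)(int ?n := upd i (if b then 2 else 1) (tp s (int ?n)))))" for x
   unfolding step_iff[OF k, of 0, simplified] tmd by blast
  then have B: "step MM ?d x \<longleftrightarrow> (\<exists>b. x = ?x b)" for x
   by (simp only: tp_push[OF i] move_offset.simps add_uminus_conv_diff)
  have C: "(forced (step MM) ^^ Suc ?n) (?x b) (home (l, s(i := b # s i)))" for b
   by (rule walk_left) (use nx i cl Guess in auto)
  have sn: "snx (k, s) = range (\<lambda>b. (l, s(i := b # s i)))"
   by (auto simp: cl Guess UNIV_bool)
  have le: "Suc ?n \<le> Suc h" using h[OF i] by simp
  have D1: "\<forall>c'\<in>snx (k, s). \<exists>m\<le>Suc h. \<exists>x. step MM ?d x \<and> (forced (step MM) ^^ m) x (home c')"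
  proof
   fix c' assume "c' \<in> snx (k, s)"
   then obtain b where "c' = (l, s(i := b # s i))" unfolding sn by blast
   then show "\<exists>m\<le>Suc h. \<exists>x. step MM ?d x \<and> (forced (step MM) ^^ m) x (home c')"
    using B C[of b] le by blast
  qed
  have D2: "\<forall>x. step MM ?d x --> (\<exists>c'\<in>snx (k, s). \<exists>m\<le>Suc h. (forced (step MM) ^^ m) x (home c'))"
  proof (intro allI impI)
   fix x assume "step MM ?d x"
   then obtain b where "x = ?x b" unfolding B by blast
   then show "\<exists>c'\<in>snx (k, s). \<exists>m\<le>Suc h. (forced (step MM) ^^ m) x (home c')"
    unfolding sn using C[of b] le by blast
  qed
  have "?n \<le> Suc h" using le by simp
  with A D1 D2 show ?thesis unfolding simulates_def by blast
 next
  case (Case i e f t)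
  have i: "i < 7" using okl Case by simp
  show ?thesis
   by (rule simulates_pop[OF k i, of "e # l" "t # l" "f # l"]) (use nx h[OF i] in \<open>auto simp: cl Case split: list.splits\<close>)
 next
  case (Loop i x f t)
  have i: "i < 7" using okl Loop by simp
  show ?thesis
   by (rule simulates_pop[OF k i, of "l" "t # k" "if x then f # l else f # k"])
    (use nx h[OF i] in \<open>auto simp: cl Loop split: list.splits if_splits\<close>)
 qed
qed

lemma no_step_home:
 assumes k: "k \<in> KK" and "snx (k, s) = {}"
 shows "\<not> step MM (home (k, s)) x"
proof -
 have "k = [] \<or> (\<exists>l. k = Fail # l)"
  using assms(2) by (induction "(k, s)" rule: snx.induct) (auto split: list.splits)
 then have "tm k 0 (tp s 0) = {}" by auto
 then show ?thesis unfolding home_def fst_conv snd_conv using step_iff[OF k, of 0] by auto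
qed

lemma snx_length: "c' \<in> snx c ==> length (snd c' i) \<le> Suc (length (snd c i))"
 by (induction c rule: snx.induct) (auto split: list.splits if_splits)

lemma snx_KK: "c' \<in> snx c ==> fst c \<in> KK ==> fst c' \<in> KK"
 using snx_nxt[of c' c] KK_closed[of "fst c"] by blast

text \<open>Apart from a few extra steps, a step of the stack program costs at most two walks over a
  stack, and within \<open>n\<close> steps no stack grows beyond \<open>h + n\<close>.\<close>

lemma stops_home:
 "stops sstep c n ==> fst c \<in> KK ==> (!!i. i < 7 ==> length (snd c i) \<le> h) ==>
  stops (step MM) (home c) (n * (2 * (h + n) + 4))"
proof (induction n arbitrary: c h)
 case 0
 then have "snx c = {}" using stops_zero[OF 0(1)] by (auto simp: sstep_def)
 then show ?case using no_step_home[of "fst c" "snd c"] 0 by (auto intro!: stops_halt)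
next
 case (Suc n)
 show ?case
 proof (cases "snx c = {}")
  case True
  then show ?thesis using no_step_home[of "fst c" "snd c"] Suc by (auto intro!: stops_halt)
 next
  case False
  have "simulates c (Suc h)" using simulates[of "fst c" "snd c" h] Suc False by auto
  then obtain m d where md: "m \<le> Suc h" "(forced (step MM) ^^ m) (home c) d"
   and d: "!!x. step MM d x ==> \<exists>c'\<in>snx c. \<exists>m\<le>Suc h. (forced (step MM) ^^ m) x (home c')"
   unfolding simulates_def by blast
  let ?N = "n * (2 * (Suc h + n) + 4)"
  have "stops (step MM) x (Suc h + ?N)" if x: "step MM d x" for x
  proof -
   obtain c' m' where c': "c' \<in> snx c" "m' \<le> Suc h" "(forced (step MM) ^^ m') x (home c')"
    using d[OF x] by blast
   have "stops (step MM) (home c') ?N"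
   proof (rule Suc.IH)
    show "stops sstep c' n" using stops_step[OF Suc.prems(1) sstep_def[THEN iffD2, OF c'(1)]] .
    show "fst c' \<in> KK" using snx_KK[OF c'(1)] Suc.prems by simp
    show "length (snd c' i) \<le> Suc h" if "i < 7" for i
     using snx_length[OF c'(1), of i] Suc.prems(3)[OF that] by simp
   qed
   then have "stops (step MM) x (m' + ?N)" using stops_det[OF c'(3)] by blast
   then show ?thesis by (rule stops_mono) (use c'(2) in simp)
  qed
  then have "stops (step MM) d (Suc (Suc h + ?N))" by (rule stops_branch)
  then have "stops (step MM) (home c) (m + Suc (Suc h + ?N))" using stops_det[OF md(2)] by blast
  then show ?thesis by (rule stops_mono) (use md(1) in \<open>simp add: algebra_simps\<close>)
 qed
qed

lemma fst_home: "fst (home c) = 1 \<longleftrightarrow> fst c = []"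
 unfolding home_def scode_def by auto

lemma sacc_Nil: "sacc ([], s)"
 unfolding sacc_def by blast

lemma sacc_step:
 assumes "fst c ~= []"
 shows "sacc c \<longleftrightarrow> (\<exists>c'\<in>snx c. sacc c')"
proof
 assume "sacc c"
 then obtain s where "sstep\<^sup>*\<^sup>* c ([], s)" unfolding sacc_def by blast
 then show "\<exists>c'\<in>snx c. sacc c'"
 proof (cases rule: converse_rtranclpE)
  case base
  with assms show ?thesis by simp
 next
  case (step y)
  then show ?thesis unfolding sacc_def sstep_def by blast
 qed
next
 assume "\<exists>c'\<in>snx c. sacc c'"
 then show "sacc c" unfolding sacc_def
  by (blast intro: converse_rtranclp_into_rtranclp[of sstep] sstep_def[THEN iffD2])
qed

text \<open>Induction on the remaining time: on both sides a configuration that can move accepts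
  exactly if some successor accepts, and the forced parts of the simulation do not change
  acceptance.\<close>

lemma macc_home: "stops sstep c n ==> fst c \<in> KK ==> macc MM (home c) \<longleftrightarrow> sacc c"
proof (induction n arbitrary: c)
 case 0
 then have e: "snx c = {}" using stops_zero[OF 0(1)] by (auto simp: sstep_def)
 then have "halting MM (home c)" using no_step_home[of "fst c" "snd c"] 0 by (auto simp: halting_def)
 then have "macc MM (home c) \<longleftrightarrow> fst c = []" by (simp only: macc_halt fst_home)
 also have "\<dots> \<longleftrightarrow> sacc c" using sacc_Nil[of "snd c"] sacc_step[of c] e by (cases c) auto
 finally show ?case .
next
 case (Suc n)
 show ?case
 proof (cases "snx c = {}")
  case True
  then have "halting MM (home c)" using no_step_home[of "fst c" "snd c"] Suc by (auto simp: halting_def)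
  then have "macc MM (home c) \<longleftrightarrow> fst c = []" by (simp only: macc_halt fst_home)
  also have "\<dots> \<longleftrightarrow> sacc c" using sacc_Nil[of "snd c"] sacc_step[of c] True by (cases c) auto
  finally show ?thesis .
 next
  case False
  obtain h where h: "!!i. i < 7 ==> length (snd c i) \<le> h"
  proof
   show "length (snd c i) \<le> (\<Sum>j<7. length (snd c j))" if "i < 7" for i
    using that by (intro member_le_sum) auto
  qed
  have "simulates c (Suc h)" using simulates[of "fst c" "snd c" h] Suc False h by auto
  then obtain m d where md: "(forced (step MM) ^^ m) (home c) d"
   and d1: "!!c'. c' \<in> snx c ==> \<exists>m x. step MM d x \<and> (forced (step MM) ^^ m) x (home c')"
   and d2: "!!x. step MM d x ==> \<exists>c'\<in>snx c. \<exists>m. (forced (step MM) ^^ m) x (home c')"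
   unfolding simulates_def by blast
  have IH: "macc MM (home c') \<longleftrightarrow> sacc c'" if "c' \<in> snx c" for c'
   by (rule Suc.IH[OF stops_step[OF Suc.prems(1) sstep_def[THEN iffD2, OF that]]])
    (use that snx_KK Suc.prems in auto)
  have "\<not> halting MM d" using False d1 by (auto simp: halting_def)
  then have "macc MM (home c) \<longleftrightarrow> (\<exists>x. step MM d x \<and> macc MM x)"
   using macc_det[OF md] macc_step by blast
  also have "\<dots> \<longleftrightarrow> (\<exists>c'\<in>snx c. macc MM (home c'))"
  proof
   assume "\<exists>x. step MM d x \<and> macc MM x"
   then obtain x where x: "step MM d x" "macc MM x" by blast
   then obtain c' m' where "c' \<in> snx c" "(forced (step MM) ^^ m') x (home c')" using d2 by blast
   with macc_det[OF this(2)] x(2) show "\<exists>c'\<in>snx c. macc MM (home c')" by blast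
  next
   assume "\<exists>c'\<in>snx c. macc MM (home c')"
   then obtain c' where c': "c' \<in> snx c" "macc MM (home c')" by blast
   then obtain m' x where "step MM d x" "(forced (step MM) ^^ m') x (home c')" using d1 by blast
   with macc_det[OF this(2)] c'(2) show "\<exists>x. step MM d x \<and> macc MM x" by blast
  qed
  also have "\<dots> \<longleftrightarrow> sacc c"
  proof -
   have "fst c ~= []" using False by (cases c) auto
   then show ?thesis using IH sacc_step[of c] by simp
  qed
  finally show ?thesis .
 qed
qed

lemma reach_home: "sstep\<^sup>*\<^sup>* c c' ==> fst c \<in> KK ==> (step MM)\<^sup>*\<^sup>* (home c) (home c')"
proof (induction rule: converse_rtranclp_induct)
 case (step c d)
 have cd: "d \<in> snx c" using step.hyps by (simp add: sstep_def)
 obtain h where h: "!!i. i < 7 ==> length (snd c i) \<le> h"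
 proof
  show "length (snd c i) \<le> (\<Sum>j<7. length (snd c j))" if "i < 7" for i
   using that by (intro member_le_sum) auto
 qed
 have "simulates c (Suc h)" using simulates[of "fst c" "snd c" h] step.prems cd h by auto
 then obtain m e m' x where *: "(forced (step MM) ^^ m) (home c) e" "step MM e x"
   "(forced (step MM) ^^ m') x (home d)"
  unfolding simulates_def using cd by blast
 have "(step MM)\<^sup>*\<^sup>* (home c) (home d)"
  by (rule rtranclp_trans[OF rtranclp.rtrancl_into_rtrancl[OF det_imp[OF *(1)] *(2)] det_imp[OF *(3)]])
 with step.IH snx_KK[OF cd] step.prems show ?case by auto
qed simp

end

section \<open>Polynomial bounds and the passage to machines\<close>

definition input :: "bool list => stacks" where
 "input w = (\<lambda>_. [])(0 := rev w)"

text \<open>Step counts are kept as explicit functions; this predicate lets polynomial bounds be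
  derived from the shape of the expression.\<close>

definition pb :: "(nat => nat) => bool" where
 "pb g \<longleftrightarrow> (\<exists>p :: nat poly. \<forall>n. g n \<le> poly p n)"

lemma pb_const: "pb (\<lambda>n. c)"
 unfolding pb_def by (rule exI[of _ "[:c:]"]) simp

lemma pb_id: "pb (\<lambda>n. n)"
 unfolding pb_def by (rule exI[of _ "[:0, 1:]"]) simp

lemma pb_add: "pb f ==> pb g ==> pb (\<lambda>n. f n + g n)"
 unfolding pb_def by (metis add_mono poly_add)

lemma pb_Suc: "pb f ==> pb (\<lambda>n. Suc (f n))"
 using pb_add[of f "\<lambda>_. 1"] pb_const[of 1] by simp

lemma pb_mult: "pb f ==> pb g ==> pb (\<lambda>n. f n * g n)"
 unfolding pb_def by (metis mult_le_mono poly_mult)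

text \<open>Coefficients in \<open>nat\<close> are nonnegative.\<close>

lemma poly_nat_mono: "m \<le> n ==> poly (p :: nat poly) m \<le> poly p n"
 by (induction p) (auto intro!: add_mono mult_mono)

lemma pb_comp:
 assumes "pb f" "pb g"
 shows "pb (\<lambda>n. f (g n))"
proof -
 obtain p q where "!!n. f n \<le> poly p n" "!!n. g n \<le> poly q n" using assms unfolding pb_def by blast
 then have "f (g n) \<le> poly (pcompose p q) n" for n
  using poly_nat_mono[of "g n" "poly q n" p] order_trans by (metis poly_pcompose)
 then show ?thesis unfolding pb_def by blast
qed

lemma pb_poly: "pb (poly p)"
 unfolding pb_def by blast

lemmas pb_intros = pb_const pb_id pb_add pb_Suc pb_mult pb_poly

lemma initial_config_home:
 assumes "okc c"
 shows "initial_config w = program.home c ([c], input w)"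
proof -
 interpret program c by standard (rule assms)
 show ?thesis unfolding initial_config_def home_def input_def by (simp add: tp_single scode_def)
qed

lemma runs_in_time_compile:
 assumes "okc c" "pb q" "!!w. stops sstep ([c], input w) (q (length w))"
 shows "\<exists>p :: nat poly. runs_in_time (compile c) (poly p)"
proof -
 interpret program c by standard (rule assms)
 \<comment> \<open>The initial stacks are at most \<open>n\<close> high, which is the value of
   \<open>h\<close> in \<open>stops_home\<close>.\<close>
 have "pb (\<lambda>n. q n * (2 * (n + q n) + 4))"
  by (intro pb_intros assms(2))
 then obtain p :: "nat poly" where p: "!!n. q n * (2 * (n + q n) + 4) \<le> poly p n"
  unfolding pb_def by blast
 have "stops (step MM) (initial_config w) (poly p (length w))" for w
  unfolding initial_config_home[OF assms(1)]
  by (rule stops_mono[OF stops_home[OF assms(3)]])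
   (use conts_self[of c "[]"] p in \<open>auto simp: input_def\<close>)
 then show ?thesis unfolding runs_in_time_def stops_def by blast
qed

lemma in_NP_program:
 assumes "okc c" "pb q" "!!w. stops sstep ([c], input w) (q (length w))"
  "!!w. w \<in> L \<longleftrightarrow> sacc ([c], input w)"
 shows "in_NP L"
proof -
 interpret program c by standard (rule assms)
 have "accepts MM w \<longleftrightarrow> macc MM (home ([c], input w))" for w
  unfolding accepts_def macc_def initial_config_home[OF assms(1)] by simp
 also have "\<dots> w \<longleftrightarrow> w \<in> L" for w
  using macc_home[OF assms(3)[of w]] conts_self[of c "[]"] assms(4)[of w] by simp
 finally have "!!w. w \<in> L \<longleftrightarrow> accepts MM w" by blast
 with runs_in_time_compile[OF assms(1-3)] finite_compile[of c] show ?thesis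
  unfolding in_NP_def Turing_machine_def by blast
qed

lemma polytime_computable_program:
 assumes "okc c" "nog c" "pb q" "!!w. stops sstep ([c], input w) (q (length w))"
  "!!w. sstep\<^sup>*\<^sup>* ([c], input w) ([], input (f w))"
 shows "polytime_computable f"
proof -
 interpret program c by standard (rule assms)
 have "(step MM)\<^sup>*\<^sup>* (initial_config w) (scode c ([], 0), 0, tape_of (f w))" for w
  using reach_home[OF assms(5)[of w]] conts_self[of c "[]"]
  unfolding initial_config_home[OF assms(1)] by (simp add: home_def input_def tp_single)
 moreover have "halting MM (scode c ([], 0), 0, tape_of (f w))" for w
  using no_step_home[of "[]" "input (f w)"] by (auto simp: halting_def home_def input_def tp_single)
 ultimately show ?thesis
  using runs_in_time_compile[OF assms(1,3,4)] finite_compile[of c] deterministic_compile[OF assms(2)]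
  unfolding polytime_computable_def Turing_machine_def by blast
qed

section \<open>Polynomial-time functions on encoded data\<close>

subsection \<open>Running stack programs\<close>

text \<open>Quantifying over the pending programs \<open>k\<close> makes fragments composable, and
  forced steps make the described run the only one.\<close>

definition runs :: "com => stacks => nat => stacks => bool" where
 "runs c s n s' \<longleftrightarrow> (\<forall>k. \<exists>m\<le>n. (forced sstep ^^ m) (c # k, s) (k, s'))"

lemma forced_sstep: "snx c = {c'} ==> forced sstep c c'"
 unfolding forced_def sstep_def by simp

lemma runs_one: "(!!k. snx (c # k, s) = {(k, s')}) ==> runs c s (Suc 0) s'"
 unfolding runs_def
 by (intro allI exI[of _ "Suc 0"] conjI le_refl) (simp add: forced_sstep relpowp_1[simplified])

lemma runs_weaken: "runs c s n s' ==> s' = s'' ==> n \<le> n' ==> runs c s n' s''"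
 unfolding runs_def by (meson order_trans)

lemma runs_step:
 assumes "!!k. snx (c # k, s) = {(d # k, s1)}" "runs d s1 n s'"
 shows "runs c s (Suc n) s'"
 unfolding runs_def
proof
 fix k
 obtain m where "m \<le> n" and "(forced sstep ^^ m) (d # k, s1) (k, s')"
  using assms(2) unfolding runs_def by blast
 moreover have "forced sstep (c # k, s) (d # k, s1)" by (rule forced_sstep[OF assms(1)])
 ultimately have "(forced sstep ^^ Suc m) (c # k, s) (k, s')" by (intro relpowp_Suc_I2)
 moreover have "Suc m \<le> Suc n" using \<open>m \<le> n\<close> by simp
 ultimately show "\<exists>m\<le>Suc n. (forced sstep ^^ m) (c # k, s) (k, s')" by (intro exI[of _ "Suc m"] conjI)
qed

lemma runs_step2:
 assumes "!!k. snx (c # k, s) = {(d # e # k, s1)}" "runs d s1 n s2" "runs e s2 m s3"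
 shows "runs c s (Suc (n + m)) s3"
 unfolding runs_def
proof
 fix k
 obtain a where a: "a \<le> n" "(forced sstep ^^ a) (d # e # k, s1) (e # k, s2)"
  using assms(2) unfolding runs_def by blast
 obtain b where b: "b \<le> m" "(forced sstep ^^ b) (e # k, s2) (k, s3)"
  using assms(3) unfolding runs_def by blast
 have "(forced sstep ^^ (a + b)) (d # e # k, s1) (k, s3)"
  using a(2) b(2) by (auto simp: relpowp_add)
 moreover have "forced sstep (c # k, s) (d # e # k, s1)" by (rule forced_sstep[OF assms(1)])
 ultimately have "(forced sstep ^^ Suc (a + b)) (c # k, s) (k, s3)" by (intro relpowp_Suc_I2)
 moreover have "Suc (a + b) \<le> Suc (n + m)" using a(1) b(1) by simp
 ultimately show "\<exists>j\<le>Suc (n + m). (forced sstep ^^ j) (c # k, s) (k, s3)" by (intro exI[of _ "Suc (a + b)"] conjI)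
qed

lemma runs_Skip: "runs Skip s (Suc 0) s"
 by (rule runs_one) simp

lemma runs_Push: "runs (Push i b) s (Suc 0) (s(i := b # s i))"
 by (rule runs_one) simp

lemma runs_Seq: "runs a s n s1 ==> runs b s1 m s2 ==> runs (a ;; b) s (Suc (n + m)) s2"
 by (rule runs_step2[where d=a and e=b]) auto

lemma runs_Case_Nil: "s i = [] ==> runs e s n s' ==> runs (Case i e f t) s (Suc n) s'"
 by (rule runs_step[where d=e]) auto

lemma runs_Case_False: "s i = False # r ==> runs f (s(i := r)) n s' ==> runs (Case i e f t) s (Suc n) s'"
 by (rule runs_step[where d=f]) auto

lemma runs_Case_True: "s i = True # r ==> runs t (s(i := r)) n s' ==> runs (Case i e f t) s (Suc n) s'"
 by (rule runs_step[where d=t]) auto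

lemma runs_Loop_Nil: "s i = [] ==> runs (Loop i x f t) s (Suc 0) s"
 by (rule runs_one) simp

lemma runs_Loop_exit: "s i = False # r ==> runs f (s(i := r)) n s' ==> runs (Loop i True f t) s (Suc n) s'"
 by (rule runs_step[where d=f]) auto

lemma runs_Loop_False:
 "s i = False # r ==> runs f (s(i := r)) n s1 ==> runs (Loop i False f t) s1 m s2 ==>
  runs (Loop i False f t) s (Suc (n + m)) s2"
 by (rule runs_step2[where d=f and e="Loop i False f t"]) auto

lemma runs_Loop_True:
 "s i = True # r ==> runs t (s(i := r)) n s1 ==> runs (Loop i x f t) s1 m s2 ==>
  runs (Loop i x f t) s (Suc (n + m)) s2"
 by (rule runs_step2[where d=t and e="Loop i x f t"]) auto

lemma sstep_length: "sstep c c' ==> length (snd c' i) \<le> Suc (length (snd c i))"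
 unfolding sstep_def by (induction c rule: snx.induct) (auto split: list.splits if_splits)

lemma forced_length: "(forced sstep ^^ m) c c' ==> length (snd c' i) \<le> length (snd c i) + m"
proof (induction m arbitrary: c')
 case (Suc m)
 then obtain d where d: "(forced sstep ^^ m) c d" "forced sstep d c'" by auto
 have "length (snd c' i) \<le> Suc (length (snd d i))"
  using d(2) sstep_length unfolding forced_def by blast
 with Suc.IH[OF d(1)] show ?case by simp
qed simp

text \<open>A step pushes at most one bit, so running time bounds the size of results.\<close>

lemma runs_length: "runs c s n s' ==> length (s' i) \<le> length (s i) + n"
proof -
 assume "runs c s n s'"
 then obtain m where "m \<le> n" "(forced sstep ^^ m) ([c], s) ([], s')" unfolding runs_def by blast
 with forced_length[OF this(2), of i] show ?thesis by simp
qed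

subsection \<open>Trees on stacks\<close>

datatype tree = Lf | Nd tree tree

text \<open>Preorder traversal is self-delimiting, so a tree can be taken off a stack without
  knowing what lies below it.\<close>

fun code :: "tree => bool list" where
 "code Lf = [False]"
| "code (Nd a b) = True # code a @ code b"

definition unload :: "nat => com" where
 "unload j = Loop 3 False (Push j False) (Push j True)"

text \<open>Stack 4 counts in unary the subtrees still to be read: a leaf uses up one, an inner node
  trades one for two. The tree arrives reversed on stack 3.\<close>

definition load :: "nat => com" where
 "load i = Push 4 True ;; Loop 4 True Skip (Case i Fail (Push 3 False) (Push 3 True ;; Push 4 True ;; Push 4 True))"

definition shift :: "nat => nat => com" where
 "shift i j = load i ;; unload j"

definition dup :: "nat => nat => com" where
 "dup i j = load i ;; Loop 3 False (Push i False ;; Push j False) (Push i True ;; Push j True)"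

definition drop1 :: "nat => com" where
 "drop1 i = load i ;; Loop 3 False Skip Skip"

fun pushl :: "nat => bool list => com" where
 "pushl i [] = Skip"
| "pushl i (b # bs) = pushl i bs ;; Push i b"

lemma ok_unload: "j < 7 ==> okc (unload j)" "nog (unload j)"
 by (simp_all add: unload_def)

lemma ok_load: "i < 7 ==> okc (load i)" "nog (load i)"
 by (simp_all add: load_def)

lemma ok_shift: "i < 7 ==> j < 7 ==> okc (shift i j)" "nog (shift i j)"
 by (simp_all add: shift_def ok_load ok_unload)

lemma ok_dup: "i < 7 ==> j < 7 ==> okc (dup i j)" "nog (dup i j)"
 by (simp_all add: dup_def ok_load)

lemma ok_drop1: "i < 7 ==> okc (drop1 i)" "nog (drop1 i)"
 by (simp_all add: drop1_def ok_load)

lemma ok_pushl: "i < 7 ==> okc (pushl i bs)" "nog (pushl i bs)"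
 by (induction bs) auto

lemmas ok_progs = ok_unload ok_load ok_shift ok_dup ok_drop1 ok_pushl

lemma runs_pushl: "runs (pushl i bs) s (2 * length bs + 1) (s(i := bs @ s i))"
proof (induction bs)
 case Nil
 show ?case using runs_Skip[of s] by simp
next
 case (Cons b bs)
 show ?case unfolding pushl.simps
  by (rule runs_weaken[OF runs_Seq[OF Cons runs_Push]]) (auto simp: fun_eq_iff)
qed

lemma runs_unload:
 "s 3 = xs ==> j ~= 3 ==> runs (unload j) s (2 * length xs + 1) (s(3 := [], j := rev xs @ s j))"
proof (induction xs arbitrary: s)
 case Nil
 show ?case unfolding unload_def
  by (rule runs_weaken[OF runs_Loop_Nil]) (use Nil in \<open>auto simp: fun_eq_iff\<close>)
next
 case (Cons b xs)
 let ?s1 = "(s(3 := xs))(j := b # (s(3 := xs)) j)"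
 have 1: "runs (unload j) ?s1 (2 * length xs + 1) (?s1(3 := [], j := rev xs @ ?s1 j))"
  by (rule Cons.IH) (use Cons.prems in auto)
 have 2: "?s1(3 := [], j := rev xs @ ?s1 j) = s(3 := [], j := rev (b # xs) @ s j)"
  using Cons.prems by (auto simp: fun_eq_iff)
 show ?case
 proof (cases b)
  case True
  then have b: "b = True" by simp
  show ?thesis unfolding unload_def
   by (rule runs_weaken[OF runs_Loop_True[OF _ runs_Push 1[unfolded unload_def 2, unfolded b]]])
    (use Cons.prems b in auto)
 next
  case False
  then have b: "b = False" by simp
  show ?thesis unfolding unload_def
   by (rule runs_weaken[OF runs_Loop_False[OF _ runs_Push 1[unfolded unload_def 2, unfolded b]]])
    (use Cons.prems b in auto)
 qed
qed

text \<open>Generalized from one tree to the list \<open>ts\<close> of subtrees still expected. The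
  induction is on the total code length, because an inner node lengthens the list while using up a
  bit.\<close>

lemma runs_load_aux:
 "s i = concat (map code ts) @ r ==> s 4 = replicate (length ts) True ==> i ~= 3 ==> i ~= 4 ==>
  runs (Loop 4 True Skip (Case i Fail (Push 3 False) (Push 3 True ;; Push 4 True ;; Push 4 True))) s
   (7 * length (concat (map code ts)) + 1)
   (s(i := r, 4 := [], 3 := rev (concat (map code ts)) @ s 3))"
 (is "_ ==> _ ==> _ ==> _ ==> runs ?P s _ _")
proof (induction "length (concat (map code ts))" arbitrary: ts s rule: less_induct)
 case less
 show ?case
 proof (cases ts)
  case Nil
  show ?thesis
   by (rule runs_weaken[OF runs_Loop_Nil]) (use less.prems Nil in \<open>auto simp: fun_eq_iff\<close>)
 next
  case (Cons t ts')
  let ?s0 = "s(4 := replicate (length ts') True)"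
  have s4: "s 4 = True # replicate (length ts') True" using less.prems Cons by simp
  show ?thesis
  proof (cases t)
   case Lf
   let ?s1 = "?s0(i := concat (map code ts') @ r)"
   let ?s2 = "?s1(3 := False # ?s1 3)"
   have 1: "runs (Case i Fail (Push 3 False) (Push 3 True ;; Push 4 True ;; Push 4 True)) ?s0 (Suc (Suc 0)) ?s2"
    by (rule runs_Case_False[OF _ runs_Push]) (use less.prems Cons Lf in auto)
   have 2: "runs ?P ?s2 (7 * length (concat (map code ts')) + 1)
     (?s2(i := r, 4 := [], 3 := rev (concat (map code ts')) @ ?s2 3))"
    by (rule less.hyps) (use less.prems Cons Lf in auto)
   show ?thesis
    by (rule runs_weaken[OF runs_Loop_True[OF s4 1 2]])
     (use less.prems Cons Lf in \<open>auto simp: fun_eq_iff\<close>)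
  next
   case (Nd a b)
   let ?ts = "a # b # ts'"
   let ?s1 = "?s0(i := concat (map code ?ts) @ r)"
   let ?s2 = "?s1(3 := True # ?s1 3)"
   let ?s3 = "?s2(4 := True # ?s2 4)"
   let ?s4 = "?s3(4 := True # ?s3 4)"
   have 1: "runs (Case i Fail (Push 3 False) (Push 3 True ;; Push 4 True ;; Push 4 True)) ?s0
     (Suc (Suc (Suc 0 + Suc (Suc 0 + Suc 0)))) ?s4"
    by (rule runs_Case_True[OF _ runs_Seq[OF runs_Push runs_Seq[OF runs_Push runs_Push]]])
     (use less.prems Cons Nd in auto)
   have 2: "runs ?P ?s4 (7 * length (concat (map code ?ts)) + 1)
     (?s4(i := r, 4 := [], 3 := rev (concat (map code ?ts)) @ ?s4 3))"
    by (rule less.hyps) (use less.prems Cons Nd in auto)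
   show ?thesis
    by (rule runs_weaken[OF runs_Loop_True[OF s4 1 2]])
     (use less.prems Cons Nd in \<open>auto simp: fun_eq_iff\<close>)
  qed
 qed
qed

lemma runs_load:
 assumes "s i = code t @ r" "s 3 = []" "s 4 = []" "i ~= 3" "i ~= 4"
 shows "runs (load i) s (7 * length (code t) + 3) (s(i := r, 3 := rev (code t)))"
proof -
 let ?s1 = "s(4 := True # s 4)"
 have 1: "runs (Loop 4 True Skip (Case i Fail (Push 3 False) (Push 3 True ;; Push 4 True ;; Push 4 True))) ?s1
   (7 * length (concat (map code [t])) + 1)
   (?s1(i := r, 4 := [], 3 := rev (concat (map code [t])) @ ?s1 3))"
  by (rule runs_load_aux) (use assms in auto)
 show ?thesis unfolding load_def
  by (rule runs_weaken[OF runs_Seq[OF runs_Push 1]]) (use assms in \<open>auto simp: fun_eq_iff\<close>)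
qed

lemma runs_shift:
 assumes "s i = code t @ r" "s 3 = []" "s 4 = []" "i ~= 3" "i ~= 4" "j ~= 3" "j ~= i"
 shows "runs (shift i j) s (20 * length (code t) + 20) (s(i := r, j := code t @ s j))"
proof -
 let ?s1 = "s(i := r, 3 := rev (code t))"
 have 2: "runs (unload j) ?s1 (2 * length (rev (code t)) + 1) (?s1(3 := [], j := rev (rev (code t)) @ ?s1 j))"
  by (rule runs_unload) (use assms in auto)
 show ?thesis unfolding shift_def
  by (rule runs_weaken[OF runs_Seq[OF runs_load[OF assms(1-5)] 2]])
   (use assms in \<open>auto simp: fun_eq_iff\<close>)
qed

lemma runs_dup_aux:
 "s 3 = xs ==> i ~= 3 ==> j ~= 3 ==> i ~= j ==>
  runs (Loop 3 False (Push i False ;; Push j False) (Push i True ;; Push j True)) s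
   (4 * length xs + 1) (s(3 := [], i := rev xs @ s i, j := rev xs @ s j))"
 (is "_ ==> _ ==> _ ==> _ ==> runs ?P s _ _")
proof (induction xs arbitrary: s)
 case Nil
 show ?case
  by (rule runs_weaken[OF runs_Loop_Nil]) (use Nil in \<open>auto simp: fun_eq_iff\<close>)
next
 case (Cons b xs)
 let ?s0 = "s(3 := xs)"
 let ?s1 = "?s0(i := b # ?s0 i)"
 let ?s2 = "?s1(j := b # ?s1 j)"
 have 0: "runs (Push i b ;; Push j b) ?s0 (Suc (Suc 0 + Suc 0)) ?s2"
  by (rule runs_Seq[OF runs_Push runs_Push])
 have 1: "runs ?P ?s2 (4 * length xs + 1) (?s2(3 := [], i := rev xs @ ?s2 i, j := rev xs @ ?s2 j))"
  by (rule Cons.IH) (use Cons.prems in auto)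
 have 2: "?s2(3 := [], i := rev xs @ ?s2 i, j := rev xs @ ?s2 j) =
   s(3 := [], i := rev (b # xs) @ s i, j := rev (b # xs) @ s j)"
  using Cons.prems by (auto simp: fun_eq_iff)
 show ?case
 proof (cases b)
  case True
  then have b: "b = True" by simp
  show ?thesis
   by (rule runs_weaken[OF runs_Loop_True[OF _ 0[unfolded b] 1[unfolded 2, unfolded b]]])
    (use Cons.prems b in auto)
 next
  case False
  then have b: "b = False" by simp
  show ?thesis
   by (rule runs_weaken[OF runs_Loop_False[OF _ 0[unfolded b] 1[unfolded 2, unfolded b]]])
    (use Cons.prems b in auto)
 qed
qed

lemma runs_dup:
 assumes "s i = code t @ r" "s 3 = []" "s 4 = []" "i ~= 3" "i ~= 4" "j ~= 3" "i ~= j"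
 shows "runs (dup i j) s (20 * length (code t) + 20) (s(j := code t @ s j))"
proof -
 let ?s1 = "s(i := r, 3 := rev (code t))"
 have 2: "runs (Loop 3 False (Push i False ;; Push j False) (Push i True ;; Push j True)) ?s1
   (4 * length (rev (code t)) + 1)
   (?s1(3 := [], i := rev (rev (code t)) @ ?s1 i, j := rev (rev (code t)) @ ?s1 j))"
  by (rule runs_dup_aux) (use assms in auto)
 show ?thesis unfolding dup_def
  by (rule runs_weaken[OF runs_Seq[OF runs_load[OF assms(1-5)] 2]])
   (use assms in \<open>auto simp: fun_eq_iff\<close>)
qed

lemma runs_clear:
 "s i = xs ==> runs (Loop i False Skip Skip) s (2 * length xs + 1) (s(i := []))"
proof (induction xs arbitrary: s)
 case Nil
 show ?case by (rule runs_weaken[OF runs_Loop_Nil]) (use Nil in \<open>auto simp: fun_eq_iff\<close>)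
next
 case (Cons b xs)
 have 1: "runs (Loop i False Skip Skip) (s(i := xs)) (2 * length xs + 1) ((s(i := xs))(i := []))"
  by (rule Cons.IH) simp
 show ?case
  by (cases b) (rule runs_weaken[OF runs_Loop_True[OF _ runs_Skip 1]] runs_weaken[OF runs_Loop_False[OF _ runs_Skip 1]],
   use Cons.prems in auto)+
qed

lemma runs_drop1:
 assumes "s i = code t @ r" "s 3 = []" "s 4 = []" "i ~= 3" "i ~= 4"
 shows "runs (drop1 i) s (20 * length (code t) + 20) (s(i := r))"
proof -
 let ?s1 = "s(i := r, 3 := rev (code t))"
 have 2: "runs (Loop 3 False Skip Skip) ?s1 (2 * length (rev (code t)) + 1) (?s1(3 := []))"
  by (rule runs_clear) simp
 show ?thesis unfolding drop1_def
  by (rule runs_weaken[OF runs_Seq[OF runs_load[OF assms] 2]])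
   (use assms in \<open>auto simp: fun_eq_iff\<close>)
qed

subsection \<open>Encodings\<close>

text \<open>Injectivity lets equality of values be tested by comparing codes.\<close>

class enc =
 fixes enc :: "'a => tree"
 assumes enc_inject: "enc x = enc y \<longleftrightarrow> x = y"

definition sz :: "'a::enc => nat" where
 "sz x = length (code (enc x))"

instantiation tree :: enc
begin
definition enc_tree :: "tree => tree" where "enc_tree t = t"
instance by standard (simp add: enc_tree_def)
end

instantiation unit :: enc
begin
definition enc_unit :: "unit => tree" where "enc_unit u = Lf"
instance by standard simp
end

instantiation bool :: enc
begin
definition enc_bool :: "bool => tree" where "enc_bool b = (if b then Nd Lf Lf else Lf)"
instance by standard (simp add: enc_bool_def)
end

instantiation prod :: (enc, enc) enc
begin
fun enc_prod :: "'a \<times> 'b => tree" where "enc_prod (a, b) = Nd (enc a) (enc b)"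
instance by standard (auto simp: enc_inject)
end

instantiation list :: (enc) enc
begin
fun enc_list :: "'a list => tree" where
 "enc_list [] = Lf"
| "enc_list (a # as) = Nd (enc a) (enc_list as)"
instance
proof
 fix x y :: "'a list"
 show "enc x = enc y \<longleftrightarrow> x = y"
 proof (induction x arbitrary: y)
  case Nil
  then show ?case by (cases y) auto
 next
  case (Cons a x)
  then show ?case by (cases y) (auto simp: enc_inject)
 qed
qed
end

text \<open>Unary, so that a number can control a loop within polynomial time. Coordinates, which
  the input gives in binary, are integers and are kept in binary below; in unary they might be
  exponentially long.\<close>

instantiation nat :: enc
begin
definition enc_nat :: "nat => tree" where "enc_nat n = enc (replicate n ())"
instance by standard (auto simp: enc_nat_def enc_inject dest: arg_cong[where f=length])
end

instantiation int :: enc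
begin
definition enc_int :: "int => tree" where "enc_int z = enc (z < 0, bits (nat \<bar>z\<bar>))"
instance
proof
 fix x y :: int
 have "x = y" if "(x < 0) = (y < 0)" "nat \<bar>x\<bar> = nat \<bar>y\<bar>"
  using that by linarith
 then show "enc x = enc y \<longleftrightarrow> x = y"
  unfolding enc_int_def enc_inject using bits_inject by auto
qed
end

instantiation edge :: enc
begin
fun enc_edge :: "edge => tree" where
 "enc_edge (Hor p) = enc (False, p)"
| "enc_edge (Ver p) = enc (True, p)"
instance
proof
 fix x y :: edge
 show "enc x = enc y \<longleftrightarrow> x = y"
  by (cases x; cases y) (auto simp: enc_inject)
qed
end

lemma sz_pos: "0 < sz x"
proof -
 have "code t ~= []" for t by (cases t) auto
 then show ?thesis unfolding sz_def by simp
qed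

lemma sz_Pair [simp]: "sz (a, b) = Suc (sz a + sz b)"
 by (simp add: sz_def)

lemma sz_Nil [simp]: "sz [] = 1"
 by (simp add: sz_def)

lemma sz_Cons [simp]: "sz (a # as) = Suc (sz a + sz as)"
 by (simp add: sz_def)

lemma sz_append: "sz (xs @ ys) = sz xs + sz ys - 1"
 by (induction xs) (use sz_pos[of ys] in auto)

lemma sz_append_le: "sz (xs @ ys) \<le> sz xs + sz ys"
 by (simp add: sz_append)

lemma length_le_sz: "length xs \<le> sz xs"
 by (induction xs) auto

lemma sz_bool: "sz (b :: bool) \<le> 3"
 by (simp add: sz_def enc_bool_def)

lemma sz_nat: "sz (n :: nat) = 2 * n + 1"
proof -
 have "sz (replicate n ()) = 2 * n + 1"
  by (induction n) (auto simp: sz_def enc_unit_def)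
 then show ?thesis by (simp add: sz_def enc_nat_def)
qed

lemma sz_mem: "x \<in> set xs ==> sz x \<le> sz xs"
 by (induction xs) auto

lemma sz_list_le: "(!!x. x \<in> set xs ==> sz x \<le> m) ==> sz xs \<le> length xs * (m + 1) + 1"
proof (induction xs)
 case (Cons x xs)
 have "sz xs \<le> length xs * (m + 1) + 1" "sz x \<le> m" using Cons by auto
 then show ?case by simp
qed simp

subsection \<open>Polynomial-time functions\<close>

definition free :: "stacks => bool" where
 "free s \<longleftrightarrow> s 0 = [] \<and> s 3 = [] \<and> s 4 = [] \<and> s 6 = []"

text \<open>
 A program computing \<open>f\<close> replaces the code on top of stack 1.  Stacks 2 and 5 are used as
 auxiliary stacks that are restored; the others are scratch space.
\<close>

definition computes :: "com => ('a::enc => 'b::enc) => nat poly => bool" where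
 "computes c f p \<longleftrightarrow> okc c \<and> nog c \<and> (\<forall>x s r. s 1 = code (enc x) @ r --> free s -->
  runs c s (poly p (sz x)) (s(1 := code (enc (f x)) @ r)))"

definition PT :: "('a::enc => 'b::enc) => bool" where
 "PT f \<longleftrightarrow> (\<exists>c p. computes c f p)"

lemma PT_I:
 assumes "okc c" "nog c" "pb g"
  "!!x s r. s 1 = code (enc x) @ r ==> free s ==> runs c s (g (sz x)) (s(1 := code (enc (f x)) @ r))"
 shows "PT f"
proof -
 obtain p :: "nat poly" where "!!n. g n \<le> poly p n" using assms(3) unfolding pb_def by blast
 then have "computes c f p"
  unfolding computes_def using assms runs_weaken by blast
 then show ?thesis unfolding PT_def by blast
qed

lemma computes_runs:
 assumes "computes c f p" "s 1 = code (enc x) @ r" "free s" "sz x \<le> n"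
 shows "runs c s (poly p n) (s(1 := code (enc (f x)) @ r))"
 using assms runs_weaken[OF _ refl poly_nat_mono[OF assms(4), of p]] unfolding computes_def by blast

lemma computes_size:
 assumes "computes c f p"
 shows "sz (f x) \<le> sz x + poly p (sz x)"
proof -
 let ?s = "(\<lambda>_. [])(1 := code (enc x))"
 have "runs c ?s (poly p (sz x)) (?s(1 := code (enc (f x)) @ []))"
  by (rule computes_runs[OF assms]) (auto simp: free_def)
 from runs_length[OF this, of 1] show ?thesis by (simp add: sz_def)
qed

lemma PT_size:
 assumes "PT f"
 obtains p where "!!x. sz (f x) \<le> poly p (sz x)"
proof -
 obtain c q where "computes c f q" using assms unfolding PT_def by blast
 from computes_size[OF this] have "sz (f x) \<le> poly ([:0, 1:] + q) (sz x)" for x by simp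
 then show ?thesis by (rule that)
qed

text \<open>Codes are untyped, so passing to another type with the same code costs nothing; for
  example a nonempty list has the code of the pair of its head and its tail.\<close>

lemma PT_recode: "(!!x. enc (f x) = enc x) ==> PT f"
 by (rule PT_I[of Skip "\<lambda>_. 1"]) (auto intro!: pb_intros runs_weaken[OF runs_Skip] simp: fun_eq_iff)

lemma PT_id: "PT (\<lambda>x. x)"
 by (rule PT_recode) simp

lemma PT_comp:
 fixes f :: "'b::enc => 'c::enc" and g :: "'a::enc => 'b"
 assumes "PT f" "PT g"
 shows "PT (\<lambda>x. f (g x))"
proof -
 obtain c p where c: "computes c f p" using assms(1) unfolding PT_def by blast
 obtain d q where d: "computes d g q" using assms(2) unfolding PT_def by blast
 show ?thesis
 proof (rule PT_I)
  show "okc (d ;; c)" "nog (d ;; c)" using c d by (auto simp: computes_def)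
  show "pb (\<lambda>n. Suc (poly q n + poly p (n + poly q n)))"
   by (intro pb_intros pb_comp[of "poly p"])
  fix x :: 'a and s r assume s: "s 1 = code (enc x) @ r" "free s"
  let ?s1 = "s(1 := code (enc (g x)) @ r)"
  have 1: "runs d s (poly q (sz x)) ?s1" by (rule computes_runs[OF d s order_refl])
  have 2: "runs c ?s1 (poly p (sz x + poly q (sz x))) (?s1(1 := code (enc (f (g x))) @ r))"
   by (rule computes_runs[OF c _ _ computes_size[OF d]]) (use s in \<open>auto simp: free_def\<close>)
  show "runs (d ;; c) s (Suc (poly q (sz x) + poly p (sz x + poly q (sz x)))) (s(1 := code (enc (f (g x))) @ r))"
   by (rule runs_weaken[OF runs_Seq[OF 1 2]]) auto
 qed
qed

lemma PT_const: "PT (\<lambda>x. y)"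
proof (rule PT_I)
 let ?t = "code (enc y)"
 show "okc (drop1 1 ;; pushl 1 ?t)" "nog (drop1 1 ;; pushl 1 ?t)" by (simp_all add: ok_progs)
 show "pb (\<lambda>n. Suc ((20 * n + 20) + (2 * length ?t + 1)))" by (intro pb_intros)
 fix x :: 'a and s r assume s: "s 1 = code (enc x) @ r" "free s"
 have 1: "runs (drop1 1) s (20 * length (code (enc x)) + 20) (s(1 := r))"
  by (rule runs_drop1) (use s in \<open>auto simp: free_def\<close>)
 show "runs (drop1 1 ;; pushl 1 ?t) s (Suc ((20 * sz x + 20) + (2 * length ?t + 1))) (s(1 := code (enc y) @ r))"
  unfolding sz_def
  by (rule runs_weaken[OF runs_Seq[OF 1 runs_pushl]]) auto
qed

lemma PT_Pair:
 fixes f :: "'a::enc => 'b::enc" and g :: "'a => 'c::enc"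
 assumes "PT f" "PT g"
 shows "PT (\<lambda>x. (f x, g x))"
proof -
 obtain c p where c: "computes c f p" using assms(1) unfolding PT_def by blast
 obtain d q where d: "computes d g q" using assms(2) unfolding PT_def by blast
 show ?thesis
 proof (rule PT_I)
  \<comment> \<open>The second component is computed first because it must lie below the first; the
    final \<open>True\<close> is the node of the pair.\<close>
  let ?P = "dup 1 2 ;; d ;; shift 2 1 ;; c ;; Push 1 True"
  show "okc ?P" "nog ?P" using c d by (auto simp: computes_def ok_progs)
  let ?g = "\<lambda>n. Suc ((20 * n + 20) + Suc (poly q n + Suc ((20 * n + 20) + Suc (poly p n + Suc 0))))"
  show "pb ?g" by (intro pb_intros)
  fix x :: 'a and s r assume s: "s 1 = code (enc x) @ r" "free s"
  let ?s1 = "s(2 := code (enc x) @ s 2)"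
  let ?s2 = "?s1(1 := code (enc (g x)) @ r)"
  let ?s3 = "?s2(2 := s 2, 1 := code (enc x) @ ?s2 1)"
  let ?s4 = "?s3(1 := code (enc (f x)) @ code (enc (g x)) @ r)"
  have 1: "runs (dup 1 2) s (20 * sz x + 20) ?s1"
   unfolding sz_def by (rule runs_dup) (use s in \<open>auto simp: free_def\<close>)
  have 2: "runs d ?s1 (poly q (sz x)) ?s2"
   by (rule computes_runs[OF d _ _ order_refl]) (use s in \<open>auto simp: free_def\<close>)
  have 3: "runs (shift 2 1) ?s2 (20 * sz x + 20) ?s3"
   unfolding sz_def by (rule runs_shift) (use s in \<open>auto simp: free_def\<close>)
  have 4: "runs c ?s3 (poly p (sz x)) ?s4"
   by (rule computes_runs[OF c _ _ order_refl]) (use s in \<open>auto simp: free_def\<close>)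
  show "runs ?P s (?g (sz x)) (s(1 := code (enc (f x, g x)) @ r))"
   by (rule runs_weaken[OF runs_Seq[OF 1 runs_Seq[OF 2 runs_Seq[OF 3 runs_Seq[OF 4 runs_Push]]]]])
    (auto simp: fun_eq_iff)
 qed
qed

lemma PT_fst0: "PT (fst :: 'a::enc \<times> 'b::enc => 'a)"
proof (rule PT_I)
 let ?P = "Case 1 Skip Skip Skip ;; shift 1 2 ;; drop1 1 ;; shift 2 1"
 show "okc ?P" "nog ?P" by (auto simp: ok_progs)
 let ?g = "\<lambda>n. Suc (Suc (Suc 0) + Suc ((20 * n + 20) + Suc ((20 * n + 20) + (20 * n + 20))))"
 show "pb ?g" by (intro pb_intros)
 fix x :: "'a \<times> 'b" and s r assume s: "s 1 = code (enc x) @ r" "free s"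
 obtain a b where x: "x = (a, b)" by (cases x)
 let ?s1 = "s(1 := code (enc a) @ code (enc b) @ r)"
 let ?s2 = "?s1(1 := code (enc b) @ r, 2 := code (enc a) @ ?s1 2)"
 let ?s3 = "?s2(1 := r)"
 let ?s4 = "?s3(2 := s 2, 1 := code (enc a) @ ?s3 1)"
 have 1: "runs (Case 1 Skip Skip Skip) s (Suc (Suc 0)) ?s1"
  by (rule runs_Case_True[OF _ runs_Skip]) (use s x in simp)
 have 2: "runs (shift 1 2) ?s1 (20 * length (code (enc a)) + 20) ?s2"
  by (rule runs_shift) (use s in \<open>auto simp: free_def\<close>)
 have 3: "runs (drop1 1) ?s2 (20 * length (code (enc b)) + 20) ?s3"
  by (rule runs_drop1) (use s in \<open>auto simp: free_def\<close>)
 have 4: "runs (shift 2 1) ?s3 (20 * length (code (enc a)) + 20) ?s4"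
  by (rule runs_shift) (use s in \<open>auto simp: free_def\<close>)
 show "runs ?P s (?g (sz x)) (s(1 := code (enc (fst x)) @ r))"
  by (rule runs_weaken[OF runs_Seq[OF 1 runs_Seq[OF 2 runs_Seq[OF 3 4]]]])
   (auto simp: fun_eq_iff x sz_def)
qed

lemma PT_snd0: "PT (snd :: 'a::enc \<times> 'b::enc => 'b)"
proof (rule PT_I)
 let ?P = "Case 1 Skip Skip Skip ;; drop1 1"
 show "okc ?P" "nog ?P" by (auto simp: ok_progs)
 let ?g = "\<lambda>n. Suc (Suc (Suc 0) + (20 * n + 20))"
 show "pb ?g" by (intro pb_intros)
 fix x :: "'a \<times> 'b" and s r assume s: "s 1 = code (enc x) @ r" "free s"
 obtain a b where x: "x = (a, b)" by (cases x)
 let ?s1 = "s(1 := code (enc a) @ code (enc b) @ r)"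
 have 1: "runs (Case 1 Skip Skip Skip) s (Suc (Suc 0)) ?s1"
  by (rule runs_Case_True[OF _ runs_Skip]) (use s x in simp)
 have 2: "runs (drop1 1) ?s1 (20 * length (code (enc a)) + 20) (?s1(1 := code (enc b) @ r))"
  by (rule runs_drop1) (use s in \<open>auto simp: free_def\<close>)
 show "runs ?P s (?g (sz x)) (s(1 := code (enc (snd x)) @ r))"
  by (rule runs_weaken[OF runs_Seq[OF 1 2]]) (auto simp: fun_eq_iff x sz_def)
qed

lemmas PT_fst = PT_comp[OF PT_fst0]
lemmas PT_snd = PT_comp[OF PT_snd0]

lemma PT_If:
 fixes f g :: "'a::enc => 'b::enc"
 assumes "PT b" "PT f" "PT g"
 shows "PT (\<lambda>x. if b x then f x else g x)"
proof -
 obtain c p where c: "computes c b p" using assms(1) unfolding PT_def by blast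
 obtain d q where d: "computes d f q" using assms(2) unfolding PT_def by blast
 obtain e o' where e: "computes e g o'" using assms(3) unfolding PT_def by blast
 show ?thesis
 proof (rule PT_I)
  \<comment> \<open>The code of \<open>True\<close> is a node with two leaves, so after its first
    bit two more have to be popped; that of \<open>False\<close> is a single bit.\<close>
  let ?Q = "Case 1 Fail (shift 2 1 ;; e) (Case 1 Skip Skip Skip ;; Case 1 Skip Skip Skip ;; shift 2 1 ;; d)"
  let ?P = "dup 1 2 ;; c ;; ?Q"
  show "okc ?P" "nog ?P" using c d e by (auto simp: computes_def ok_progs)
  let ?g = "\<lambda>n. Suc ((20 * n + 20) + Suc (poly p n + (Suc (Suc (2 + Suc (2 + Suc ((20 * n + 20) + poly q n)))) + poly o' n)))"
  show "pb ?g" by (intro pb_intros)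
  fix x :: 'a and s r assume s: "s 1 = code (enc x) @ r" "free s"
  let ?s1 = "s(2 := code (enc x) @ s 2)"
  let ?s2 = "?s1(1 := code (enc (b x)) @ r)"
  have 1: "runs (dup 1 2) s (20 * sz x + 20) ?s1"
   unfolding sz_def by (rule runs_dup) (use s in \<open>auto simp: free_def\<close>)
  have 2: "runs c ?s1 (poly p (sz x)) ?s2"
   by (rule computes_runs[OF c _ _ order_refl]) (use s in \<open>auto simp: free_def\<close>)
  show "runs ?P s (?g (sz x)) (s(1 := code (enc (if b x then f x else g x)) @ r))"
  proof (cases "b x")
   case True
   let ?s3 = "?s2(1 := False # False # r)"
   let ?s4 = "?s3(1 := False # r)"
   let ?s5 = "?s4(1 := r)"
   let ?s6 = "?s5(2 := s 2, 1 := code (enc x) @ ?s5 1)"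
   let ?s7 = "?s6(1 := code (enc (f x)) @ r)"
   have 3: "runs (Case 1 Skip Skip Skip) ?s3 2 ?s4"
    by (rule runs_weaken[OF runs_Case_False[OF _ runs_Skip]]) auto
   have 4: "runs (Case 1 Skip Skip Skip) ?s4 2 ?s5"
    by (rule runs_weaken[OF runs_Case_False[OF _ runs_Skip]]) auto
   have 5: "runs (shift 2 1) ?s5 (20 * sz x + 20) ?s6"
    unfolding sz_def by (rule runs_shift) (use s in \<open>auto simp: free_def\<close>)
   have 6: "runs d ?s6 (poly q (sz x)) ?s7"
    by (rule computes_runs[OF d _ _ order_refl]) (use s in \<open>auto simp: free_def\<close>)
   have 7: "runs ?Q ?s2 (Suc (Suc (2 + Suc (2 + Suc ((20 * sz x + 20) + poly q (sz x)))))) ?s7"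
    by (rule runs_Case_True[OF _ runs_Seq[OF 3 runs_Seq[OF 4 runs_Seq[OF 5 6]]]])
     (simp add: True enc_bool_def)
   show ?thesis
    by (rule runs_weaken[OF runs_Seq[OF 1 runs_Seq[OF 2 7]]]) (auto simp: fun_eq_iff True)
  next
   case False
   let ?s5 = "?s2(1 := r)"
   let ?s6 = "?s5(2 := s 2, 1 := code (enc x) @ ?s5 1)"
   let ?s7 = "?s6(1 := code (enc (g x)) @ r)"
   have 5: "runs (shift 2 1) ?s5 (20 * sz x + 20) ?s6"
    unfolding sz_def by (rule runs_shift) (use s in \<open>auto simp: free_def\<close>)
   have 6: "runs e ?s6 (poly o' (sz x)) ?s7"
    by (rule computes_runs[OF e _ _ order_refl]) (use s in \<open>auto simp: free_def\<close>)
   have 7: "runs ?Q ?s2 (Suc (Suc ((20 * sz x + 20) + poly o' (sz x)))) ?s7"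
    by (rule runs_Case_False[OF _ runs_Seq[OF 5 6]]) (simp add: False enc_bool_def)
   show ?thesis
    by (rule runs_weaken[OF runs_Seq[OF 1 runs_Seq[OF 2 7]]]) (auto simp: fun_eq_iff False)
  qed
 qed
qed

text \<open>Equality: the two codes are put on the stacks 0 and 6 and compared symbol by symbol.\<close>

lemma runs_compare:
 "s 0 = xs ==> s 6 = ys ==>
  \<exists>zs m. runs (Loop 0 False (Case 6 (Push 4 True) Skip (Push 4 True)) (Case 6 (Push 4 True) (Push 4 True) Skip)) s
   (3 * length xs + 1) (s(0 := [], 6 := zs, 4 := replicate m True @ s 4)) \<and>
   (m = 0 \<and> zs = [] \<longleftrightarrow> xs = ys) \<and> length zs \<le> length ys \<and> m \<le> length xs"
 (is "_ ==> _ ==> \<exists>zs m. runs ?P s _ (?Q zs m) \<and> ?R zs m")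
proof (induction xs arbitrary: s ys)
 case Nil
 show ?case
 proof (intro exI conjI)
  show "runs ?P s (3 * length [] + 1) (s(0 := [], 6 := ys, 4 := replicate 0 True @ s 4))"
   by (rule runs_weaken[OF runs_Loop_Nil]) (use Nil in \<open>auto simp: fun_eq_iff\<close>)
 qed auto
next
 case (Cons b xs)
 let ?B = "if b then Case 6 (Push 4 True) (Push 4 True) Skip else Case 6 (Push 4 True) Skip (Push 4 True)"
 let ?s0 = "s(0 := xs)"
 define ok where "ok \<longleftrightarrow> ys ~= [] \<and> hd ys = b"
 define s1 where "s1 = ?s0(6 := tl ys, 4 := (if ok then [] else [True]) @ s 4)"
 have 1: "runs ?B ?s0 2 s1"
 proof (cases ys)
  case Nil
  have "runs (Case 6 (Push 4 True) f t) ?s0 2 s1" for f t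
   by (rule runs_weaken[OF runs_Case_Nil[OF _ runs_Push]])
    (use Nil Cons.prems in \<open>auto simp: s1_def ok_def fun_eq_iff\<close>)
  then show ?thesis by simp
 next
  case ys: (Cons a zs)
  have F: "runs (Case 6 (Push 4 True) Skip (Push 4 True)) ?s0 2 s1" if "\<not> b"
   by (cases a) (rule runs_weaken[OF runs_Case_True[OF _ runs_Push]] runs_weaken[OF runs_Case_False[OF _ runs_Skip]],
    use ys Cons.prems that in \<open>auto simp: s1_def ok_def fun_eq_iff\<close>)+
  have T: "runs (Case 6 (Push 4 True) (Push 4 True) Skip) ?s0 2 s1" if "b"
   by (cases a) (rule runs_weaken[OF runs_Case_True[OF _ runs_Skip]] runs_weaken[OF runs_Case_False[OF _ runs_Push]],
    use ys Cons.prems that in \<open>auto simp: s1_def ok_def fun_eq_iff\<close>)+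
  show ?thesis using F T by simp
 qed
 have s1: "s1 0 = xs" "s1 6 = tl ys" by (simp_all add: s1_def)
 obtain zs m where zm: "runs ?P s1 (3 * length xs + 1) (s1(0 := [], 6 := zs, 4 := replicate m True @ s1 4))"
   "m = 0 \<and> zs = [] \<longleftrightarrow> xs = tl ys" "length zs \<le> length (tl ys)" "m \<le> length xs"
  using Cons.IH[OF s1] by blast
 define m' where "m' = m + (if ok then 0 else 1)"
 have rep: "replicate m True @ (if ok then [] else [True]) = replicate m' True"
  by (simp add: m'_def replicate_append_same)
 have st: "s1(0 := [], 6 := zs, 4 := replicate m True @ s1 4) = s(0 := [], 6 := zs, 4 := replicate m' True @ s 4)"
  unfolding rep[symmetric] by (auto simp: s1_def fun_eq_iff)
 have "runs ?P s (Suc (2 + (3 * length xs + 1))) (s(0 := [], 6 := zs, 4 := replicate m' True @ s 4))"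
 proof (cases b)
  case True
  show ?thesis
   by (rule runs_Loop_True[OF _ _ zm(1)[unfolded st]]) (use Cons.prems 1 True in auto)
 next
  case False
  show ?thesis
   by (rule runs_Loop_False[OF _ _ zm(1)[unfolded st]]) (use Cons.prems 1 False in auto)
 qed
 then have "runs ?P s (3 * length (b # xs) + 1) (s(0 := [], 6 := zs, 4 := replicate m' True @ s 4))"
  by (rule runs_weaken[OF _ refl]) simp
 moreover have "m' = 0 \<and> zs = [] \<longleftrightarrow> b # xs = ys"
  using zm(2) unfolding m'_def ok_def by (cases ys) auto
 moreover have "length zs \<le> length ys" "m' \<le> length (b # xs)" using zm(3,4) by (auto simp: m'_def)
 ultimately show ?case by blast
qed

text \<open>Bits left over from the second code count as mismatches too; then equality means that
  stack 4 is empty.\<close>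

lemma runs_flag:
 "s 6 = zs ==> runs (Loop 6 False (Push 4 True) (Push 4 True)) s (2 * length zs + 1)
  (s(6 := [], 4 := replicate (length zs) True @ s 4))"
proof (induction zs arbitrary: s)
 case Nil
 show ?case by (rule runs_weaken[OF runs_Loop_Nil]) (use Nil in \<open>auto simp: fun_eq_iff\<close>)
next
 case (Cons b zs)
 let ?s1 = "(s(6 := zs))(4 := True # (s(6 := zs)) 4)"
 have 1: "runs (Loop 6 False (Push 4 True) (Push 4 True)) ?s1 (2 * length zs + 1)
   (?s1(6 := [], 4 := replicate (length zs) True @ ?s1 4))"
  by (rule Cons.IH) simp
 have 2: "?s1(6 := [], 4 := replicate (length zs) True @ ?s1 4) =
   s(6 := [], 4 := replicate (length (b # zs)) True @ s 4)"
  by (auto simp: fun_eq_iff replicate_app_Cons_same)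
 show ?case
  by (cases b) (rule runs_weaken[OF runs_Loop_True[OF _ runs_Push 1[unfolded 2]]]
    runs_weaken[OF runs_Loop_False[OF _ runs_Push 1[unfolded 2]]],
   use Cons.prems in auto)+
qed

lemma code_append_inject: "code a @ u = code b @ v ==> a = b \<and> u = v"
proof (induction a arbitrary: b u v)
 case Lf
 then show ?case by (cases b) auto
next
 case (Nd a1 a2)
 from Nd.prems obtain b1 b2 where b: "b = Nd b1 b2" by (cases b) auto
 with Nd.prems have "code a1 @ (code a2 @ u) = code b1 @ (code b2 @ v)" by simp
 from Nd.IH(1)[OF this] Nd.IH(2) show ?case unfolding b by blast
qed

lemma PT_eq0: "PT (\<lambda>p :: 'a::enc \<times> 'a. fst p = snd p)"
proof (rule PT_I)
 let ?L = "Loop 0 False (Case 6 (Push 4 True) Skip (Push 4 True)) (Case 6 (Push 4 True) (Push 4 True) Skip)"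
 let ?F = "Loop 6 False (Push 4 True) (Push 4 True)"
 let ?E = "Case 4 (pushl 1 (code (enc True))) Skip (Loop 4 False Skip Skip ;; pushl 1 (code (enc False)))"
 let ?P = "Case 1 Skip Skip Skip ;; shift 1 0 ;; shift 1 6 ;; ?L ;; ?F ;; ?E"
 show "okc ?P" "nog ?P" by (auto simp: ok_progs)
 let ?g = "\<lambda>n. Suc (2 + Suc ((20 * n + 20) + Suc ((20 * n + 20) + Suc ((3 * n + 1) + Suc ((2 * n + 1) + (10 * n + 20))))))"
 show "pb ?g" by (intro pb_intros)
 fix x :: "'a \<times> 'a" and s r assume s: "s 1 = code (enc x) @ r" "free s"
 obtain a b where x: "x = (a, b)" by (cases x)
 let ?a = "code (enc a)" and ?b = "code (enc b)"
 let ?s1 = "s(1 := ?a @ ?b @ r)"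
 let ?s2 = "?s1(1 := ?b @ r, 0 := ?a @ ?s1 0)"
 let ?s3 = "?s2(1 := r, 6 := ?b @ ?s2 6)"
 have le: "length ?a \<le> sz x" "length ?b \<le> sz x" by (simp_all add: x sz_def)
 have 1: "runs (Case 1 Skip Skip Skip) s 2 ?s1"
  by (rule runs_weaken[OF runs_Case_True[OF _ runs_Skip]]) (use s x in auto)
 have 2: "runs (shift 1 0) ?s1 (20 * length ?a + 20) ?s2"
  by (rule runs_shift) (use s in \<open>auto simp: free_def\<close>)
 have 3: "runs (shift 1 6) ?s2 (20 * length ?b + 20) ?s3"
  by (rule runs_shift) (use s in \<open>auto simp: free_def\<close>)
 obtain zs m where 4: "runs ?L ?s3 (3 * length ?a + 1) (?s3(0 := [], 6 := zs, 4 := replicate m True @ ?s3 4))"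
  and zm: "m = 0 \<and> zs = [] \<longleftrightarrow> ?a = ?b" "length zs \<le> length ?b" "m \<le> length ?a"
  using runs_compare[of ?s3 ?a ?b] s by (auto simp: free_def)
 let ?s4 = "?s3(0 := [], 6 := zs, 4 := replicate m True @ ?s3 4)"
 let ?s5 = "?s4(6 := [], 4 := replicate (length zs) True @ ?s4 4)"
 have 5: "runs ?F ?s4 (2 * length zs + 1) ?s5"
  by (rule runs_flag) simp
 have s54: "?s5 4 = replicate (length zs + m) True" using s by (simp add: free_def replicate_add)
 have ab: "length zs + m = 0 \<longleftrightarrow> a = b"
  using zm(1) code_append_inject[of "enc a" "[]" "enc b" "[]"] by (auto simp: enc_inject)
 have 6: "runs ?E ?s5 (10 * sz x + 20) (s(1 := code (enc (a = b)) @ r))"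
 proof (cases "a = b")
  case True
  have "runs ?E ?s5 (Suc (2 * length (code (enc True)) + 1)) (?s5(1 := code (enc True) @ ?s5 1))"
   by (rule runs_Case_Nil[OF _ runs_pushl]) (use s54 ab True in simp)
  then show ?thesis
   by (rule runs_weaken) (use s ab True in \<open>auto simp: free_def fun_eq_iff enc_bool_def\<close>)
 next
  case False
  then obtain k where k: "length zs + m = Suc k" using ab by (cases "length zs + m") auto
  let ?s6 = "?s5(4 := replicate k True)"
  have 7: "runs (Loop 4 False Skip Skip) ?s6 (2 * length (replicate k True) + 1) (?s6(4 := []))"
   by (rule runs_clear) simp
  have "runs ?E ?s5 (Suc (Suc ((2 * length (replicate k True) + 1) + (2 * length (code (enc False)) + 1))))
    ((?s6(4 := []))(1 := code (enc False) @ (?s6(4 := [])) 1))"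
   by (rule runs_Case_True[OF _ runs_Seq[OF 7 runs_pushl]]) (simp only: s54 k replicate_Suc)
  then show ?thesis
   by (rule runs_weaken) (use s False k zm(2,3) le in \<open>auto simp: free_def fun_eq_iff enc_bool_def\<close>)
 qed
 show "runs ?P s (?g (sz x)) (s(1 := code (enc (fst x = snd x)) @ r))"
  by (rule runs_weaken[OF runs_Seq[OF 1 runs_Seq[OF 2 runs_Seq[OF 3 runs_Seq[OF 4 runs_Seq[OF 5 6]]]]]])
   (use le zm(2) in \<open>auto simp: x\<close>)
qed

lemma PT_eq: "PT f ==> PT g ==> PT (\<lambda>x. f x = g x)"
 using PT_comp[OF PT_eq0 PT_Pair] by simp

lemma PT_hd0: "PT (hd :: 'a::enc list => 'a)"
proof (rule PT_I)
 let ?t = "code (enc (hd [] :: 'a))"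
 let ?P = "Case 1 Fail (pushl 1 ?t) (shift 1 2 ;; drop1 1 ;; shift 2 1)"
 show "okc ?P" "nog ?P" by (auto simp: ok_progs)
 let ?g = "\<lambda>n. Suc (Suc ((20 * n + 20) + Suc ((20 * n + 20) + (20 * n + 20))) + (2 * length ?t + 1))"
 show "pb ?g" by (intro pb_intros)
 fix x :: "'a list" and s r assume s: "s 1 = code (enc x) @ r" "free s"
 show "runs ?P s (?g (sz x)) (s(1 := code (enc (hd x)) @ r))"
 proof (cases x)
  case Nil
  have "runs ?P s (Suc (2 * length ?t + 1)) ((s(1 := r))(1 := ?t @ (s(1 := r)) 1))"
   by (rule runs_Case_False[OF _ runs_pushl]) (use s Nil in simp)
  then show ?thesis by (rule runs_weaken) (auto simp: Nil)
 next
  case (Cons a b)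
  let ?s1 = "s(1 := code (enc a) @ code (enc b) @ r)"
  let ?s2 = "?s1(1 := code (enc b) @ r, 2 := code (enc a) @ ?s1 2)"
  let ?s3 = "?s2(1 := r)"
  let ?s4 = "?s3(2 := s 2, 1 := code (enc a) @ ?s3 1)"
  have 2: "runs (shift 1 2) ?s1 (20 * length (code (enc a)) + 20) ?s2"
   by (rule runs_shift) (use s in \<open>auto simp: free_def\<close>)
  have 3: "runs (drop1 1) ?s2 (20 * length (code (enc b)) + 20) ?s3"
   by (rule runs_drop1) (use s in \<open>auto simp: free_def\<close>)
  have 4: "runs (shift 2 1) ?s3 (20 * length (code (enc a)) + 20) ?s4"
   by (rule runs_shift) (use s in \<open>auto simp: free_def\<close>)
  show ?thesis
   by (rule runs_weaken[OF runs_Case_True[OF _ runs_Seq[OF 2 runs_Seq[OF 3 4]]]])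
    (use s in \<open>auto simp: fun_eq_iff Cons sz_def\<close>)
 qed
qed

lemma PT_tl0: "PT (tl :: 'a::enc list => 'a list)"
proof (rule PT_I)
 let ?P = "Case 1 Fail (Push 1 False) (drop1 1)"
 show "okc ?P" "nog ?P" by (auto simp: ok_progs)
 let ?g = "\<lambda>n. Suc (20 * n + 20)"
 show "pb ?g" by (intro pb_intros)
 fix x :: "'a list" and s r assume s: "s 1 = code (enc x) @ r" "free s"
 show "runs ?P s (?g (sz x)) (s(1 := code (enc (tl x)) @ r))"
 proof (cases x)
  case Nil
  have "runs ?P s (Suc (Suc 0)) ((s(1 := r))(1 := False # (s(1 := r)) 1))"
   by (rule runs_Case_False[OF _ runs_Push]) (use s Nil in simp)
  then show ?thesis by (rule runs_weaken) (auto simp: Nil)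
 next
  case (Cons a b)
  let ?s1 = "s(1 := code (enc a) @ code (enc b) @ r)"
  have 2: "runs (drop1 1) ?s1 (20 * length (code (enc a)) + 20) (?s1(1 := code (enc b) @ r))"
   by (rule runs_drop1) (use s in \<open>auto simp: free_def\<close>)
  show ?thesis
   by (rule runs_weaken[OF runs_Case_True[OF _ 2]]) (use s in \<open>auto simp: fun_eq_iff Cons sz_def\<close>)
 qed
qed

lemmas PT_hd = PT_comp[OF PT_hd0]
lemmas PT_tl = PT_comp[OF PT_tl0]

lemma PT_Cons: "PT f ==> PT g ==> PT (\<lambda>x. f x # g x)"
 using PT_comp[OF PT_recode[of "\<lambda>p. fst p # snd p"] PT_Pair, of f g] by (simp add: split_paired_all)

text \<open>The list lies on top of the state. Its tail waits on stack 5 while \<open>c\<close>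
  works on the pair of the current element and the state, whose node is the pushed
  \<open>True\<close>. The time of \<open>c\<close> depends on the state, hence the bound
  \<open>M\<close> on all intermediate states.\<close>

lemma runs_fold:
 assumes c: "computes c (\<lambda>p. F (fst p) (snd p)) p"
 shows "s 1 = code (enc xs) @ code (enc st) @ r ==> free s ==> sz xs \<le> S ==>
  (!!ys zs. xs = ys @ zs ==> sz (fold F ys st) \<le> M) ==>
  runs (Loop 1 True Skip (shift 1 2 ;; shift 1 5 ;; shift 2 1 ;; Push 1 True ;; c ;; shift 5 1)) s
   (2 + length xs * (poly p (S + M) + 80 * S + 100)) (s(1 := code (enc (fold F xs st)) @ r))"
proof (induction xs arbitrary: s st)
 case Nil
 show ?case
  by (rule runs_weaken[OF runs_Loop_exit[OF _ runs_Skip]]) (use Nil in auto)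
next
 case (Cons a xs)
 let ?B = "shift 1 2 ;; shift 1 5 ;; shift 2 1 ;; Push 1 True ;; c ;; shift 5 1"
 let ?a = "code (enc a)" and ?xs = "code (enc xs)"
 let ?s1 = "s(1 := ?a @ ?xs @ code (enc st) @ r)"
 let ?s2 = "?s1(1 := ?xs @ code (enc st) @ r, 2 := ?a @ ?s1 2)"
 let ?s3 = "?s2(1 := code (enc st) @ r, 5 := ?xs @ ?s2 5)"
 let ?s4 = "?s3(2 := s 2, 1 := ?a @ ?s3 1)"
 let ?s5 = "?s4(1 := True # ?s4 1)"
 let ?s6 = "?s5(1 := code (enc (F a st)) @ r)"
 let ?s7 = "?s6(5 := s 5, 1 := ?xs @ ?s6 1)"
 have le: "length ?a \<le> S" "length ?xs \<le> S" using Cons.prems(3) by (auto simp: sz_def)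
 have 2: "runs (shift 1 2) ?s1 (20 * length ?a + 20) ?s2"
  by (rule runs_shift) (use Cons.prems(2) in \<open>auto simp: free_def\<close>)
 have 3: "runs (shift 1 5) ?s2 (20 * length ?xs + 20) ?s3"
  by (rule runs_shift) (use Cons.prems(2) in \<open>auto simp: free_def\<close>)
 have 4: "runs (shift 2 1) ?s3 (20 * length ?a + 20) ?s4"
  by (rule runs_shift) (use Cons.prems(2) in \<open>auto simp: free_def\<close>)
 have M: "sz st \<le> M" using Cons.prems(4)[of "[]"] by simp
 have 5: "runs c ?s5 (poly p (S + M)) (?s5(1 := code (enc (F (fst (a, st)) (snd (a, st)))) @ r))"
 proof (rule computes_runs[OF c])
  show "sz (a, st) \<le> S + M" using Cons.prems(3) M sz_pos[of xs] by simp
 qed (use Cons.prems(2) in \<open>auto simp: free_def\<close>)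
 have 6: "runs (shift 5 1) ?s6 (20 * length ?xs + 20) ?s7"
  by (rule runs_shift) (use Cons.prems(2) in \<open>auto simp: free_def\<close>)
 have B: "runs ?B ?s1 (poly p (S + M) + 80 * S + 98) ?s7"
  by (rule runs_weaken[OF runs_Seq[OF 2 runs_Seq[OF 3 runs_Seq[OF 4 runs_Seq[OF runs_Push
   runs_Seq[OF 5[unfolded fst_conv snd_conv] 6]]]]] refl]) (use le in simp)
 have 7: "runs (Loop 1 True Skip ?B) ?s7 (2 + length xs * (poly p (S + M) + 80 * S + 100))
   (?s7(1 := code (enc (fold F xs (F a st))) @ r))"
 proof (rule Cons.IH)
  show "?s7 1 = ?xs @ code (enc (F a st)) @ r" by simp
  show "free ?s7" using Cons.prems(2) by (auto simp: free_def)
  show "sz xs \<le> S" using Cons.prems(3) by simp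
  show "sz (fold F ys (F a st)) \<le> M" if "xs = ys @ zs" for ys zs
   using Cons.prems(4)[of "a # ys" zs] that by simp
 qed
 have 8: "s 1 = True # (?a @ ?xs @ code (enc st) @ r)" using Cons.prems(1) by simp
 show ?case
  by (rule runs_weaken[OF runs_Loop_True[OF 8 B 7]]) (auto simp: fun_eq_iff)
qed

text \<open>Iterating a polynomial-time step can blow up the state exponentially, hence the
  requirement that all intermediate states have polynomial size.\<close>

lemma PT_fold0:
 fixes F :: "'a::enc => 's::enc => 's" and l :: "'x::enc => 'a list"
 assumes F: "PT (\<lambda>p. F (fst p) (snd p))" and l: "PT l" and i: "PT i" and B: "pb B"
  and bound: "!!x ys zs. l x = ys @ zs ==> sz (fold F ys (i x)) \<le> B (sz x)"
 shows "PT (\<lambda>x. fold F (l x) (i x))"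
proof -
 obtain c p where c: "computes c (\<lambda>p. F (fst p) (snd p)) p" using F unfolding PT_def by blast
 obtain d q where d: "computes d (\<lambda>x. (l x, i x)) q" using PT_Pair[OF l i] unfolding PT_def by blast
 obtain o' where o: "!!x. sz (l x) \<le> poly o' (sz x)" using PT_size[OF l] by blast
 show ?thesis
 proof (rule PT_I)
  let ?L = "Loop 1 True Skip (shift 1 2 ;; shift 1 5 ;; shift 2 1 ;; Push 1 True ;; c ;; shift 5 1)"
  let ?P = "d ;; Case 1 Skip Skip Skip ;; ?L"
  show "okc ?P" "nog ?P" using c d by (auto simp: computes_def ok_progs)
  let ?h = "\<lambda>n. 2 + poly o' n * (poly p (poly o' n + B n) + 80 * poly o' n + 100)"
  let ?g = "\<lambda>n. Suc (poly q n + Suc (2 + ?h n))"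
  show "pb ?g" by (intro pb_intros B pb_comp[of "poly p"])
  fix x :: 'x and s r assume s: "s 1 = code (enc x) @ r" "free s"
  let ?s1 = "s(1 := code (enc (l x, i x)) @ r)"
  let ?s2 = "?s1(1 := code (enc (l x)) @ code (enc (i x)) @ r)"
  have 1: "runs d s (poly q (sz x)) ?s1" by (rule computes_runs[OF d s order_refl])
  have 2: "runs (Case 1 Skip Skip Skip) ?s1 2 ?s2"
   by (rule runs_weaken[OF runs_Case_True[OF _ runs_Skip]]) auto
  have 3: "runs ?L ?s2 (2 + length (l x) * (poly p (poly o' (sz x) + B (sz x)) + 80 * poly o' (sz x) + 100))
    (?s2(1 := code (enc (fold F (l x) (i x))) @ r))"
   by (rule runs_fold[OF c _ _ o bound]) (use s in \<open>auto simp: free_def\<close>)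
  have 4: "length (l x) \<le> poly o' (sz x)" using length_le_sz[of "l x"] o[of x] by simp
  show "runs ?P s (?g (sz x)) (s(1 := code (enc (fold F (l x) (i x))) @ r))"
   by (rule runs_weaken[OF runs_Seq[OF 1 runs_Seq[OF 2 3]]])
    (use mult_le_mono1[OF 4] in \<open>auto simp: fun_eq_iff\<close>)
 qed
qed

subsection \<open>Lists, numbers and codes\<close>

named_theorems PT_rules

lemma PT_enc_cong: "PT F ==> (!!x. enc (f x) = enc (F x)) ==> PT f"
 unfolding PT_def computes_def by simp

lemmas [PT_rules] = PT_id PT_const PT_Pair PT_fst PT_snd PT_If PT_eq PT_hd PT_tl PT_Cons

lemma PT_not [PT_rules]: "PT P ==> PT (\<lambda>x. \<not> P x)"
 by (rule PT_enc_cong[OF PT_If[OF _ PT_const[of False] PT_const[of True]]]) auto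

lemma PT_conj [PT_rules]: "PT P ==> PT Q ==> PT (\<lambda>x. P x \<and> Q x)"
 by (rule PT_enc_cong[OF PT_If[where b=P and f=Q, OF _ _ PT_const[of False]]]) auto

lemma PT_disj [PT_rules]: "PT P ==> PT Q ==> PT (\<lambda>x. P x \<or> Q x)"
 by (rule PT_enc_cong[OF PT_If[where b=P and g=Q, OF _ PT_const[of True]]]) auto

lemma PT_imp [PT_rules]: "PT P ==> PT Q ==> PT (\<lambda>x. P x --> Q x)"
 by (rule PT_enc_cong[OF PT_If[where b=P and f=Q, OF _ _ PT_const[of True]]]) auto

text \<open>Here the step may depend on the argument \<open>x\<close> as well; it is carried along
  in the state.\<close>

lemma PT_fold:
 fixes F :: "'x::enc => 'a::enc => 's::enc => 's"
 assumes F: "PT (\<lambda>p. F (fst p) (fst (snd p)) (snd (snd p)))" and l: "PT l" and i: "PT i" and B: "pb B"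
  and bound: "!!x ys zs. l x = ys @ zs ==> sz (fold (F x) ys (i x)) \<le> B (sz x)"
 shows "PT (\<lambda>x. fold (F x) (l x) (i x))"
proof -
 define G where "G = (\<lambda>a e. (fst e, F (fst e) a (snd e)))"
 have G: "fold G ys (x, st) = (x, fold (F x) ys st)" for ys x st
  by (induction ys arbitrary: st) (auto simp: G_def)
 have "PT (\<lambda>p. F (fst (snd p)) (fst p) (snd (snd p)))"
  by (rule PT_comp[OF F, of "\<lambda>p. (fst (snd p), fst p, snd (snd p))", simplified]) (intro PT_rules)
 then have PG: "PT (\<lambda>p. G (fst p) (snd p))"
  unfolding G_def by (intro PT_rules)
 have "PT (\<lambda>x. fold G (l x) (x, i x))"
 proof (rule PT_fold0[OF PG l])
  show "PT (\<lambda>x. (x, i x))" by (intro PT_rules i)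
  show "pb (\<lambda>n. Suc (n + B n))" by (intro pb_intros B)
  show "sz (fold G ys (x, i x)) \<le> Suc (sz x + B (sz x))" if "l x = ys @ zs" for x ys zs
   using bound[OF that] by (simp add: G)
 qed
 from PT_snd[OF this] show ?thesis by (simp add: G)
qed

text \<open>If a step adds an amount that depends only on the argument and the list element, then
  polynomially many steps keep the state polynomial.\<close>

lemma PT_fold_add:
 fixes F :: "'x::enc => 'a::enc => 's::enc => 's"
 assumes F: "PT (\<lambda>p. F (fst p) (fst (snd p)) (snd (snd p)))" and l: "PT l" and i: "PT i" and h: "pb h"
  and bound: "!!x a st. sz (F x a st) \<le> sz st + h (sz x + sz a)"
 shows "PT (\<lambda>x. fold (F x) (l x) (i x))"
proof -
 obtain p where p: "!!x. sz (l x) \<le> poly p (sz x)" using PT_size[OF l] by blast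
 obtain q where q: "!!x. sz (i x) \<le> poly q (sz x)" using PT_size[OF i] by blast
 obtain r :: "nat poly" where r: "!!n. h n \<le> poly r n" using h unfolding pb_def by blast
 have step: "sz (F x a st) \<le> sz st + poly r (sz x + poly p (sz x))" if "a \<in> set (l x)" for x a st
 proof -
  have "sz x + sz a \<le> sz x + poly p (sz x)" using sz_mem[OF that] p[of x] by simp
  from poly_nat_mono[OF this, of r] bound[of x a st] r[of "sz x + sz a"] show ?thesis by linarith
 qed
 show ?thesis
 proof (rule PT_fold[OF F l i])
  let ?B = "\<lambda>n. poly q n + poly p n * poly r (n + poly p n)"
  show "pb ?B" by (intro pb_intros pb_comp[of "poly r"])
  fix x ys zs assume ys: "l x = ys @ zs"
  have "sz (fold (F x) ys st) \<le> sz st + length ys * poly r (sz x + poly p (sz x))"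
   if "set ys \<subseteq> set (l x)" for ys st
   using that
  proof (induction ys arbitrary: st)
   case (Cons a ys)
   then have "sz (fold (F x) ys (F x a st)) \<le> sz (F x a st) + length ys * poly r (sz x + poly p (sz x))"
    by simp
   moreover have "sz (F x a st) \<le> sz st + poly r (sz x + poly p (sz x))" using step Cons.prems by simp
   ultimately show ?case by simp
  qed simp
  then have "sz (fold (F x) ys (i x)) \<le> sz (i x) + length ys * poly r (sz x + poly p (sz x))"
   using ys by simp
  also have "length ys \<le> poly p (sz x)" using p[of x] length_le_sz[of "l x"] ys by simp
  finally show "sz (fold (F x) ys (i x)) \<le> ?B (sz x)" using q[of x] by (simp add: add_mono)
 qed
qed

lemma PT_rev [PT_rules]:
 assumes "PT l"
 shows "PT (\<lambda>x. rev (l x))"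
 unfolding rev_conv_fold
 by (rule PT_fold_add[where F="\<lambda>_. Cons" and h=Suc]) (auto intro!: PT_rules assms pb_intros)

lemma PT_append [PT_rules]:
 assumes "PT l" "PT m"
 shows "PT (\<lambda>x. l x @ m x)"
proof -
 have "xs @ ys = fold Cons (rev xs) ys" for xs ys :: "'b list"
  by (induction xs) auto
 moreover have "PT (\<lambda>x. fold Cons (rev (l x)) (m x))"
  by (rule PT_fold_add[where F="\<lambda>_. Cons" and h=Suc]) (auto intro!: PT_rules assms pb_intros)
 ultimately show ?thesis by simp
qed

lemma PT_map [PT_rules]:
 fixes f :: "'x::enc => 'a::enc => 'b::enc"
 assumes f: "PT (\<lambda>p. f (fst p) (snd p))" and l: "PT l"
 shows "PT (\<lambda>x. map (f x) (l x))"
proof -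
 obtain q where q: "!!p. sz (f (fst p) (snd p)) \<le> poly q (sz p)" using PT_size[OF f] by blast
 have b: "sz (f x a # st) \<le> sz st + Suc (poly q (Suc (sz x + sz a)))" for x a st
  using q[of "(x, a)"] by simp
 have PF: "PT (\<lambda>p. f (fst p) (fst (snd p)))"
  by (rule PT_comp[OF f, of "\<lambda>p. (fst p, fst (snd p))", simplified]) (intro PT_rules)
 have "PT (\<lambda>x. fold (\<lambda>a acc. f x a # acc) (l x) [])"
 proof (rule PT_fold_add[where h="\<lambda>n. Suc (poly q (Suc n))", OF _ l PT_const])
  show "PT (\<lambda>p :: 'x \<times> 'a \<times> 'b list. f (fst p) (fst (snd p)) # snd (snd p))"
   by (intro PT_Cons PF PT_snd PT_id)
  show "pb (\<lambda>n. Suc (poly q (Suc n)))" by (intro pb_intros pb_comp[of "poly q"])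
 qed (rule b)
 then have "PT (\<lambda>x. rev (fold (\<lambda>a acc. f x a # acc) (l x) []))" by (rule PT_rev)
 moreover have "fold (\<lambda>a acc. f x a # acc) l ys = rev (map (f x) l) @ ys" for x l ys
  by (induction l arbitrary: ys) auto
 ultimately show ?thesis by simp
qed

lemma PT_filter [PT_rules]:
 fixes P :: "'x::enc => 'a::enc => bool"
 assumes P: "PT (\<lambda>p. P (fst p) (snd p))" and l: "PT l"
 shows "PT (\<lambda>x. filter (P x) (l x))"
proof -
 have PF: "PT (\<lambda>p. P (fst p) (fst (snd p)))"
  by (rule PT_comp[OF P, of "\<lambda>p. (fst p, fst (snd p))", simplified]) (intro PT_rules)
 have "PT (\<lambda>x. fold (\<lambda>a acc. if P x a then a # acc else acc) (l x) [])"
  by (rule PT_fold_add[where h=Suc, OF _ l PT_const]) (auto intro!: PT_rules PF pb_intros)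
 then have "PT (\<lambda>x. rev (fold (\<lambda>a acc. if P x a then a # acc else acc) (l x) []))" by (rule PT_rev)
 moreover have "fold (\<lambda>a acc. if P x a then a # acc else acc) l ys = rev (filter (P x) l) @ ys" for x l ys
  by (induction l arbitrary: ys) auto
 ultimately show ?thesis by simp
qed

lemma PT_list_all [PT_rules]:
 fixes P :: "'x::enc => 'a::enc => bool"
 assumes P: "PT (\<lambda>p. P (fst p) (snd p))" and l: "PT l"
 shows "PT (\<lambda>x. list_all (P x) (l x))"
proof -
 have "list_all (P x) xs \<longleftrightarrow> filter (\<lambda>a. \<not> P x a) xs = []" for x xs
  by (induction xs) auto
 then show ?thesis by (simp only:) (intro PT_rules assms)
qed

lemma PT_list_ex [PT_rules]:
 fixes P :: "'x::enc => 'a::enc => bool"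
 assumes P: "PT (\<lambda>p. P (fst p) (snd p))" and l: "PT l"
 shows "PT (\<lambda>x. list_ex (P x) (l x))"
proof -
 have "list_ex (P x) xs \<longleftrightarrow> filter (P x) xs ~= []" for x xs
  by (induction xs) auto
 then show ?thesis by (simp only:) (intro PT_rules assms)
qed

lemma PT_member [PT_rules]:
 assumes "PT f" "PT l"
 shows "PT (\<lambda>x. f x \<in> set (l x))"
proof -
 have "f x \<in> set (l x) \<longleftrightarrow> list_ex (\<lambda>y. y = f x) (l x)" for x
  by (auto simp: list_ex_iff)
 then show ?thesis
  by (simp only:) (intro PT_rules assms PT_comp[OF assms(1)])
qed

lemma PT_concat [PT_rules]:
 fixes l :: "'x::enc => 'a::enc list list"
 assumes "PT l"
 shows "PT (\<lambda>x. concat (l x))"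
proof -
 have b: "sz (st @ a) \<le> sz st + (sz x + sz a)" for x :: 'x and a st :: "'a list"
  using sz_append_le[of st a] by simp
 have "PT (\<lambda>x. fold (\<lambda>a st. st @ a) (l x) [])"
 proof (rule PT_fold_add[where F="\<lambda>_ a st. st @ a" and h="\<lambda>n. n", OF _ assms PT_const])
  show "PT (\<lambda>p :: 'x \<times> 'a list \<times> 'a list. snd (snd p) @ fst (snd p))" by (intro PT_rules)
 qed (rule pb_id, rule b)
 moreover have "fold (\<lambda>a st. st @ a) xs ys = ys @ concat xs" for xs and ys :: "'a list"
  by (induction xs arbitrary: ys) auto
 ultimately show ?thesis by simp
qed

text \<open>Checking every element against the list of its predecessors (latest first).\<close>

definition chk :: "('a => 'a list => bool) => 'a list => bool" where
 "chk P xs = fst (fold (\<lambda>a st. (fst st \<and> P a (snd st), a # snd st)) xs (True, []))"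

lemma chk_Nil [simp]: "chk P []"
 by (simp add: chk_def)

lemma chk_snd: "snd (fold (\<lambda>a st. (fst st \<and> P a (snd st), a # snd st)) xs st) = rev xs @ snd st"
 by (induction xs arbitrary: st) auto

lemma chk_snoc [simp]: "chk P (xs @ [a]) \<longleftrightarrow> chk P xs \<and> P a (rev xs)"
 by (simp add: chk_def chk_snd)

lemma PT_chk [PT_rules]:
 fixes P :: "'x::enc => 'a::enc => 'a list => bool"
 assumes P: "PT (\<lambda>p. P (fst p) (fst (snd p)) (snd (snd p)))" and l: "PT l"
 shows "PT (\<lambda>x. chk (P x) (l x))"
proof -
 define G where "G = (\<lambda>x a (st :: bool \<times> 'a list). (fst st \<and> P x a (snd st), a # snd st))"
 have PP: "PT (\<lambda>p. P (fst p) (fst (snd p)) (snd (snd (snd p))))"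
  by (rule PT_comp[OF P, of "\<lambda>p. (fst p, fst (snd p), snd (snd (snd p)))", simplified]) (intro PT_rules)
 have b: "sz (G x a st) \<le> sz st + (sz x + sz a + 3)" for x a st
  using sz_bool[of "fst st \<and> P x a (snd st)"] sz_pos[of "fst st"] by (cases st) (simp add: G_def)
 have "PT (\<lambda>x. fold (G x) (l x) (True, []))"
  by (rule PT_fold_add[where h="\<lambda>n. n + 3", OF _ l PT_const, OF _ _ b])
   (unfold G_def, intro PT_rules PP, intro pb_intros)
 from PT_fst[OF this] show ?thesis by (simp add: G_def chk_def)
qed

lemma distinct_chk: "distinct xs \<longleftrightarrow> chk (\<lambda>a seen. a \<notin> set seen) xs"
 by (induction xs rule: rev_induct) auto

lemma PT_distinct [PT_rules]: "PT l ==> PT (\<lambda>x. distinct (l x))"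
 unfolding distinct_chk by (intro PT_rules)

subsubsection \<open>Natural numbers\<close>

lemma PT_replicate_unit: "PT (\<lambda>n. replicate n ())"
 by (rule PT_recode) (simp add: enc_nat_def)

lemma PT_length [PT_rules]:
 assumes "PT l"
 shows "PT (\<lambda>x. length (l x))"
proof -
 have "PT (\<lambda>x. map (\<lambda>_. ()) (l x))" by (intro PT_rules assms)
 then show ?thesis by (rule PT_enc_cong) (simp add: enc_nat_def map_replicate_const)
qed

lemma PT_replicate [PT_rules]:
 assumes "PT n" "PT a"
 shows "PT (\<lambda>x. replicate (n x) (a x))"
proof -
 have "replicate (n x) (a x) = map (\<lambda>_. a x) (replicate (n x) ())" for x
  by simp
 then show ?thesis
  by (simp only:) (intro PT_rules PT_comp[OF PT_replicate_unit] PT_comp[OF assms(2)] assms)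
qed

lemma PT_add [PT_rules]:
 fixes f g :: "'x::enc => nat"
 assumes "PT f" "PT g"
 shows "PT (\<lambda>x. f x + g x)"
proof -
 have "PT (\<lambda>x. length (replicate (f x) () @ replicate (g x) ()))" by (intro PT_rules assms)
 then show ?thesis by simp
qed

lemma PT_mult [PT_rules]:
 fixes f g :: "'x::enc => nat"
 assumes "PT f" "PT g"
 shows "PT (\<lambda>x. f x * g x)"
proof -
 have "PT (\<lambda>x. length (concat (replicate (f x) (replicate (g x) ()))))" by (intro PT_rules assms)
 then show ?thesis by (simp add: length_concat sum_list_replicate)
qed

lemma PT_poly [PT_rules]:
 fixes f :: "'x::enc => nat"
 assumes "PT f"
 shows "PT (\<lambda>x. poly p (f x))"
proof (induction p)
 case 0
 show ?case by (simp add: PT_const)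
next
 case (pCons a p)
 then show ?case by (simp only: poly_pCons) (intro PT_rules assms)
qed

subsubsection \<open>Binary numbers\<close>

fun val :: "bool list => nat" where
 "val [] = 0"
| "val (b # bs) = of_bool b + 2 * val bs"

lemma bits_0 [simp]: "bits 0 = []"
 by (simp add: bits.simps)

lemma val_bits: "val (bits n) = n"
proof (induction n rule: less_induct)
 case (less n)
 then show ?case by (cases "n = 0") (auto simp: bits.simps[of n])
qed

lemma val_append: "val (xs @ ys) = val xs + 2 ^ length xs * val ys"
 by (induction xs) (auto simp: algebra_simps)

lemma val_less: "val xs < 2 ^ length xs"
 by (induction xs) auto

text \<open>\<open>bits\<close> never has a zero in its most significant place; folding from that
  end drops such zeros.\<close>

lemma bits_val: "bits (val bs) = fold (\<lambda>b acc. if b \<or> acc ~= [] then b # acc else []) (rev bs) []"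
proof (induction bs)
 case Nil
 show ?case by (simp add: bits.simps)
next
 case (Cons b bs)
 have nil: "bits n = [] \<longleftrightarrow> n = 0" for n by (simp add: bits.simps[of n])
 have "bits (val (b # bs)) = (if b \<or> bits (val bs) ~= [] then b # bits (val bs) else [])"
 proof (cases "val (b # bs) = 0")
  case True
  then have "\<not> b" "val bs = 0" by (auto split: if_splits)
  then show ?thesis by simp
 next
  case False
  have "bits (val (b # bs)) = odd (val (b # bs)) # bits (val (b # bs) div 2)"
   by (subst bits.simps) (simp only: False if_False)
  also have "\<dots> = b # bits (val bs)" by (cases b) auto
  finally show ?thesis using False unfolding nil by auto
 qed
 with Cons show ?case by simp
qed

lemma PT_bits_val [PT_rules]:
 assumes "PT bs"
 shows "PT (\<lambda>x. bits (val (bs x)))"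
proof -
 have "PT (\<lambda>x. fold (\<lambda>b acc. if b \<or> acc ~= [] then b # acc else []) (rev (bs x)) [])"
  by (rule PT_fold_add[where F="\<lambda>_ b acc. if b \<or> acc ~= [] then b # acc else []" and h=Suc])
   (auto intro!: PT_rules assms pb_intros)
 then show ?thesis by (simp add: bits_val)
qed

text \<open>Ripple carry: the flag is the carry of an increment when \<open>f\<close> is the
  identity and the borrow of a decrement when \<open>f\<close> is negation; the digit is the
  exclusive or in both cases.\<close>

definition bit_step :: "(bool => bool) => bool => bool \<times> bool list => bool \<times> bool list" where
 "bit_step f b st = (f b \<and> fst st, (b ~= fst st) # snd st)"

lemma PT_bit_step:
 assumes "PT f" "PT bs"
 shows "PT (\<lambda>x. fold (bit_step f) (bs x) (True, []))"
proof -
 have b: "sz (bit_step f a st) \<le> sz st + (n + 7)" for a st n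
  using sz_bool[of "a ~= fst st"] sz_bool[of "f a \<and> fst st"] by (cases st) (auto simp: bit_step_def)
 show ?thesis
  by (rule PT_fold_add[where F="\<lambda>_. bit_step f" and h="\<lambda>n. n + 7", OF _ assms(2) PT_const, OF _ _ b])
   (unfold bit_step_def, intro PT_rules PT_comp[OF assms(1)], intro pb_intros)
qed

lemma val_inc:
 "val (rev (snd (fold (bit_step (\<lambda>b. b)) bs st))) +
  2 ^ length (snd (fold (bit_step (\<lambda>b. b)) bs st)) * of_bool (fst (fold (bit_step (\<lambda>b. b)) bs st)) =
 val (rev (snd st)) + 2 ^ length (snd st) * (val bs + of_bool (fst st))"
proof (induction bs arbitrary: st)
 case (Cons b bs)
 show ?case
  unfolding fold_simps comp_def Cons.IH
  by (cases b; cases "fst st") (auto simp: bit_step_def val_append algebra_simps)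
qed simp

lemma val_dec:
 "val (rev (snd (fold (bit_step Not) bs st))) + 2 ^ length (snd st) * of_bool (fst st) =
 val (rev (snd st)) + 2 ^ length (snd st) * val bs +
 2 ^ length (snd (fold (bit_step Not) bs st)) * of_bool (fst (fold (bit_step Not) bs st))"
proof (induction bs arbitrary: st)
 case (Cons b bs)
 from Cons.IH[of "bit_step Not b st"] show ?case
  by (cases b; cases "fst st") (auto simp: bit_step_def val_append algebra_simps)
qed simp

lemma PT_bits_Suc:
 assumes "PT bs"
 shows "PT (\<lambda>x. bits (Suc (val (bs x))))"
proof -
 let ?r = "\<lambda>x. fold (bit_step (\<lambda>b. b)) (bs x) (True, [])"
 have "PT (\<lambda>x. bits (val (rev (snd (?r x)) @ [fst (?r x)])))"
  by (intro PT_rules PT_bit_step assms)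
 moreover have "val (rev (snd (?r x)) @ [fst (?r x)]) = Suc (val (bs x))" for x
  using val_inc[of "bs x" "(True, [])"] by (simp add: val_append)
 ultimately show ?thesis by simp
qed

lemma PT_bits_pred:
 assumes "PT bs"
 shows "PT (\<lambda>x. bits (val (bs x) - 1))"
proof -
 let ?r = "\<lambda>x. fold (bit_step Not) (bs x) (True, [])"
 have "PT (\<lambda>x. if bits (val (bs x)) = [] then [] else bits (val (rev (snd (?r x)))))"
  by (intro PT_rules PT_bit_step assms PT_comp[OF PT_not[OF PT_id]])
 moreover have "(if bits (val (bs x)) = [] then [] else bits (val (rev (snd (?r x))))) = bits (val (bs x) - 1)" for x
 proof (cases "val (bs x) = 0")
  case True
  then show ?thesis by (simp add: bits.simps)
 next
  case False
  have "val (rev (snd (?r x))) < 2 ^ length (snd (?r x))" using val_less[of "rev (snd (?r x))"] by simp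
  with val_dec[of "bs x" "(True, [])"] False have "val (rev (snd (?r x))) = val (bs x) - 1"
   by (cases "fst (?r x)") auto
  moreover have "bits (val (bs x)) ~= []" using False by (simp add: bits.simps[of "val (bs x)"])
  ultimately show ?thesis by simp
 qed
 ultimately show ?thesis by simp
qed

lemma length_bits: "length (bits n) \<le> n"
proof (induction n rule: less_induct)
 case (less n)
 then have "n ~= 0 ==> length (bits (n div 2)) \<le> n div 2" by simp
 then show ?case by (cases "n = 0") (auto simp: bits.simps[of n])
qed

lemma sz_bool_list: "sz (bs :: bool list) \<le> 4 * length bs + 1"
 using sz_list_le[of bs 3] sz_bool by simp

text \<open>Unary to binary by counting up with the binary successor.\<close>

lemma PT_bits [PT_rules]:
 assumes "PT n"
 shows "PT (\<lambda>x. bits (n x))"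
proof -
 have f: "fold (\<lambda>_ bs. bits (Suc (val bs))) us (bits k) = bits (length us + k)" for us :: "unit list" and k
  by (induction us arbitrary: k) (auto simp: val_bits)
 have "PT (\<lambda>n :: nat. fold (\<lambda>_ bs. bits (Suc (val bs))) (replicate n ()) (bits 0))"
 proof (rule PT_fold[where F="\<lambda>_ _ bs. bits (Suc (val bs))"])
  show "PT (\<lambda>p :: nat \<times> unit \<times> bool list. bits (Suc (val (snd (snd p)))))"
   by (intro PT_bits_Suc PT_rules)
  show "pb (\<lambda>n. 4 * n + 1)" by (intro pb_intros)
  fix n :: nat and ys zs assume "replicate n () = ys @ zs"
  from arg_cong[OF this, of length] have le: "length ys \<le> n" by simp
  have "sz (bits (length ys)) \<le> 4 * length (bits (length ys)) + 1" by (rule sz_bool_list)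
  also have "length (bits (length ys)) \<le> length ys" by (rule length_bits)
  finally have "sz (bits (length ys)) \<le> 4 * sz n + 1" using le by (simp add: sz_nat)
  then show "sz (fold (\<lambda>_ bs. bits (Suc (val bs))) ys (bits 0)) \<le> 4 * sz n + 1"
   unfolding f by simp
 qed (intro PT_rules)+
 then have "PT (\<lambda>n :: nat. bits n)" unfolding f by simp
 from PT_comp[OF this assms] show ?thesis .
qed

lemma PT_int [PT_rules]:
 assumes "PT n"
 shows "PT (\<lambda>x. int (n x))"
proof -
 have "PT (\<lambda>x. (False, bits (n x)))" by (intro PT_rules assms)
 then show ?thesis by (rule PT_enc_cong) (simp add: enc_int_def)
qed

lemma PT_int_rep: "PT (\<lambda>z :: int. (z < 0, bits (nat \<bar>z\<bar>)))"
 by (rule PT_recode) (simp add: enc_int_def)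

lemma PT_int_abs:
 assumes "PT s" "PT bs"
 shows "PT (\<lambda>x. if s x then - int (val (bs x)) else int (val (bs x)))"
proof -
 \<comment> \<open>The sign of zero has to be cleared, because 0 is encoded as not negative.\<close>
 have "PT (\<lambda>x. (s x \<and> bits (val (bs x)) ~= [], bits (val (bs x))))" by (intro PT_rules assms)
 then show ?thesis
 proof (rule PT_enc_cong)
  have nil: "bits n = [] \<longleftrightarrow> n = 0" for n by (simp add: bits.simps[of n])
  show "enc (if s x then - int (val (bs x)) else int (val (bs x))) =
    enc (s x \<and> bits (val (bs x)) ~= [], bits (val (bs x)))" for x
   by (auto simp: enc_int_def nil)
 qed
qed

lemma PT_int_succ [PT_rules]:
 assumes "PT z"
 shows "PT (\<lambda>x. z x + (1 :: int))"
proof -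
 let ?r = "\<lambda>x. (z x < 0, bits (nat \<bar>z x\<bar>))"
 let ?s = "\<lambda>x. fst (?r x)" and ?b = "\<lambda>x. snd (?r x)"
 have r: "PT ?r" by (rule PT_comp[OF PT_int_rep assms])
 \<comment> \<open>The constant conditions provide the sign that \<open>PT_int_abs\<close> expects;
   the magnitude of -1 becomes 0 there and loses its sign.\<close>
 have "PT (\<lambda>x. if ?s x then (if True then - int (val (bits (val (?b x) - 1))) else int (val (bits (val (?b x) - 1))))
   else (if False then - int (val (bits (Suc (val (?b x))))) else int (val (bits (Suc (val (?b x)))))))"
  by (intro PT_If[OF PT_fst[OF r]] PT_int_abs PT_bits_pred PT_bits_Suc PT_snd[OF r] PT_const)
 moreover have "(if ?s x then (if True then - int (val (bits (val (?b x) - 1))) else int (val (bits (val (?b x) - 1))))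
   else (if False then - int (val (bits (Suc (val (?b x))))) else int (val (bits (Suc (val (?b x))))))) = z x + 1" for x
  by (auto simp: val_bits)
 ultimately show ?thesis by simp
qed

subsubsection \<open>The encoding of regions\<close>

lemma PT_list_code [PT_rules]:
 assumes "PT f" "PT l"
 shows "PT (\<lambda>x. list_code f (l x))"
 unfolding list_code_def by (intro PT_rules PT_comp[OF assms(1)] assms)

lemma PT_nat_code [PT_rules]: "PT n ==> PT (\<lambda>x. nat_code (n x))"
 unfolding nat_code_def by (intro PT_rules)

lemma PT_int_code [PT_rules]:
 assumes "PT z"
 shows "PT (\<lambda>x. int_code (z x))"
proof -
 have r: "PT (\<lambda>x. (z x < 0, bits (nat \<bar>z x\<bar>)))" by (rule PT_comp[OF PT_int_rep assms])
 have a: "PT (\<lambda>x. z x < 0)" "PT (\<lambda>x. bits (nat \<bar>z x\<bar>))"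
  using PT_fst[OF r] PT_snd[OF r] by simp_all
 have b: "PT (\<lambda>b :: bool. [b])" by (intro PT_rules)
 show ?thesis unfolding int_code_def nat_code_def by (rule PT_Cons[OF a(1) PT_list_code[OF b a(2)]])
qed

lemma PT_cell_code [PT_rules]: "PT c ==> PT (\<lambda>x. cell_code (c x))"
proof -
 assume "PT c"
 then have "PT (\<lambda>x. int_code (fst (c x)) @ int_code (snd (c x)))" by (intro PT_rules)
 moreover have "cell_code c = int_code (fst c) @ int_code (snd c)" for c by (cases c) simp
 ultimately show ?thesis by simp
qed

fun edge_rep :: "edge => bool \<times> int \<times> int" where
 "edge_rep (Hor p) = (False, p)"
| "edge_rep (Ver p) = (True, p)"

lemma PT_edge_rep [PT_rules]:
 assumes "PT e"
 shows "PT (\<lambda>x. edge_rep (e x))"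
proof -
 have "enc (edge_rep e) = enc e" for e by (cases e) auto
 then show ?thesis using PT_comp[OF PT_recode assms] by blast
qed

lemma PT_Hor [PT_rules]: "PT c ==> PT (\<lambda>x. Hor (c x))"
 by (rule PT_enc_cong[OF PT_Pair[OF PT_const[of False]]]) auto

lemma PT_Ver [PT_rules]: "PT c ==> PT (\<lambda>x. Ver (c x))"
 by (rule PT_enc_cong[OF PT_Pair[OF PT_const[of True]]]) auto

lemma PT_edge_code [PT_rules]: "PT e ==> PT (\<lambda>x. edge_code (e x))"
proof -
 assume "PT e"
 then have "PT (\<lambda>x. fst (edge_rep (e x)) # cell_code (snd (edge_rep (e x))))" by (intro PT_rules)
 moreover have "edge_code e = fst (edge_rep e) # cell_code (snd (edge_rep e))" for e by (cases e) auto
 ultimately show ?thesis by simp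
qed

lemma PT_colored_edge_code: "PT colored_edge_code"
proof -
 have "PT (\<lambda>p. edge_code (fst p) @ nat_code (snd p))" by (intro PT_rules)
 then show ?thesis
 proof (rule PT_enc_cong)
  show "enc (colored_edge_code p) = enc (edge_code (fst p) @ nat_code (snd p))" for p
   by (cases p) simp
 qed
qed

lemma PT_cell_code0: "PT cell_code"
 using PT_cell_code[OF PT_id] .

lemma PT_region_code [PT_rules]: "PT c ==> PT b ==> PT (\<lambda>x. region_code (c x) (b x))"
 unfolding region_code_def by (intro PT_rules PT_cell_code0 PT_colored_edge_code)

subsection \<open>From functions to machines\<close>

text \<open>The last bit of the input is on top of stack 0, so prepending the bits one by one to the
  empty list restores their order. The two constants are the codes of a bit preceded by the node of
  a list.\<close>

definition read_in :: com where
 "read_in = Push 1 False ;; Loop 0 False (pushl 1 [True, False]) (pushl 1 [True, True, False, False])"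

definition write_out :: com where
 "write_out = Loop 1 False Skip (Case 1 Fail (Push 0 False) (Case 1 Skip Skip Skip ;; Case 1 Skip Skip Skip ;; Push 0 True))"

lemma ok_read_in: "okc read_in" "nog read_in"
 by (simp_all add: read_in_def)

lemma ok_write_out: "okc write_out" "nog write_out"
 by (simp_all add: write_out_def)

lemma runs_read_aux:
 "s 0 = zs ==> s 1 = code (enc l) ==>
  runs (Loop 0 False (pushl 1 [True, False]) (pushl 1 [True, True, False, False])) s (20 * length zs + 1)
   (s(0 := [], 1 := code (enc (rev zs @ l))))"
proof (induction zs arbitrary: s l)
 case Nil
 show ?case by (rule runs_weaken[OF runs_Loop_Nil]) (use Nil in \<open>auto simp: fun_eq_iff\<close>)
next
 case (Cons b zs)
 let ?s0 = "s(0 := zs)"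
 let ?s1 = "?s0(1 := code (enc (b # l)))"
 have 1: "runs (Loop 0 False (pushl 1 [True, False]) (pushl 1 [True, True, False, False])) ?s1 (20 * length zs + 1)
   (?s1(0 := [], 1 := code (enc (rev zs @ b # l))))"
  by (rule Cons.IH) auto
 have 2: "?s1(0 := [], 1 := code (enc (rev zs @ b # l))) = s(0 := [], 1 := code (enc (rev (b # zs) @ l)))"
  by (auto simp: fun_eq_iff)
 show ?case
 proof (cases b)
  case True
  have 3: "runs (pushl 1 [True, True, False, False]) ?s0 9 ?s1"
   by (rule runs_weaken[OF runs_pushl]) (use Cons.prems True in \<open>auto simp: fun_eq_iff enc_bool_def\<close>)
  show ?thesis
   by (rule runs_weaken[OF runs_Loop_True[OF _ 3 1[unfolded 2]]]) (use Cons.prems True in auto)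
 next
  case False
  have 3: "runs (pushl 1 [True, False]) ?s0 5 ?s1"
   by (rule runs_weaken[OF runs_pushl]) (use Cons.prems False in \<open>auto simp: fun_eq_iff enc_bool_def\<close>)
  show ?thesis
   by (rule runs_weaken[OF runs_Loop_False[OF _ 3 1[unfolded 2]]]) (use Cons.prems False in auto)
 qed
qed

lemma runs_read_in:
 "runs read_in (input w) (20 * length w + 3) ((\<lambda>_. [])(1 := code (enc w)))"
proof -
 let ?s = "(input w)(1 := False # input w 1)"
 have "runs (Loop 0 False (pushl 1 [True, False]) (pushl 1 [True, True, False, False])) ?s
   (20 * length (rev w) + 1) (?s(0 := [], 1 := code (enc (rev (rev w) @ []))))"
  by (rule runs_read_aux) (auto simp: input_def)
 from runs_Seq[OF runs_Push this] show ?thesis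
  unfolding read_in_def by (rule runs_weaken) (auto simp: input_def fun_eq_iff)
qed

lemma runs_write_out:
 "s 1 = code (enc (l :: bool list)) ==> runs write_out s (20 * length l + 3) (s(0 := rev l @ s 0, 1 := []))"
proof (induction l arbitrary: s)
 case Nil
 show ?case unfolding write_out_def
  by (rule runs_weaken[OF runs_Loop_False[OF _ runs_Skip runs_Loop_Nil]]) (use Nil in \<open>auto simp: fun_eq_iff\<close>)
next
 case (Cons b l)
 let ?B = "Case 1 Fail (Push 0 False) (Case 1 Skip Skip Skip ;; Case 1 Skip Skip Skip ;; Push 0 True)"
 let ?s0 = "s(1 := code (enc b) @ code (enc l))"
 let ?s1 = "s(1 := code (enc l), 0 := b # s 0)"
 have 1: "runs write_out ?s1 (20 * length l + 3) (?s1(0 := rev l @ ?s1 0, 1 := []))"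
  by (rule Cons.IH) auto
 have 2: "?s1(0 := rev l @ ?s1 0, 1 := []) = s(0 := rev (b # l) @ s 0, 1 := [])"
  by (auto simp: fun_eq_iff)
 have 3: "runs ?B ?s0 10 ?s1"
 proof (cases b)
  case True
  show ?thesis
   by (rule runs_weaken[OF runs_Case_True[OF _ runs_Seq[OF runs_Case_False[OF _ runs_Skip]
    runs_Seq[OF runs_Case_False[OF _ runs_Skip] runs_Push]]]])
    (use True in \<open>auto simp: fun_eq_iff enc_bool_def\<close>)
 next
  case False
  show ?thesis
   by (rule runs_weaken[OF runs_Case_False[OF _ runs_Push]])
    (use False in \<open>auto simp: fun_eq_iff enc_bool_def\<close>)
 qed
 have s1: "s 1 = True # code (enc b) @ code (enc l)" using Cons.prems by simp
 show ?case unfolding write_out_def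
  by (rule runs_weaken[OF runs_Loop_True[OF s1 3 1[unfolded 2 write_out_def]]]) auto
qed

lemma runs_stops: "runs c s n s' ==> stops sstep ([c], s) n"
proof -
 assume "runs c s n s'"
 then obtain m where m: "m \<le> n" "(forced sstep ^^ m) ([c], s) ([], s')" unfolding runs_def by blast
 have "stops sstep ([], s') 0" by (rule stops_halt) (simp add: sstep_def)
 from stops_mono[OF stops_det[OF m(2) this]] m(1) show ?thesis by simp
qed

lemma polytime_computable_PT:
 assumes "PT f"
 shows "polytime_computable f"
proof -
 obtain c p where c: "computes c f p" using assms unfolding PT_def by blast
 let ?P = "read_in ;; c ;; write_out"
 let ?q = "\<lambda>n. poly p (4 * n + 1)"
 let ?r = "\<lambda>n. 20 * (4 * n + 1 + ?q n) + 3"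
 let ?g = "\<lambda>n. Suc ((20 * n + 3) + Suc (?q n + ?r n))"
 have run: "runs ?P (input w) (?g (length w)) (input (f w))" for w
 proof -
  let ?s1 = "(\<lambda>_. [])(1 := code (enc w)) :: stacks"
  have w: "sz w \<le> 4 * length w + 1" by (rule sz_bool_list)
  have 2: "runs c ?s1 (?q (length w)) (?s1(1 := code (enc (f w)) @ []))"
   by (rule computes_runs[OF c _ _ w]) (auto simp: free_def)
  have 3: "runs write_out (?s1(1 := code (enc (f w)) @ [])) (20 * length (f w) + 3)
    ((?s1(1 := code (enc (f w)) @ []))(0 := rev (f w) @ (?s1(1 := code (enc (f w)) @ [])) 0, 1 := []))"
   by (rule runs_write_out) simp
  have "length (f w) \<le> sz w + poly p (sz w)"
   using computes_size[OF c, of w] length_le_sz[of "f w"] by simp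
  also have "\<dots> \<le> 4 * length w + 1 + ?q (length w)"
   using w poly_nat_mono[OF w, of p] by simp
  finally have le: "20 * length (f w) + 3 \<le> ?r (length w)" by simp
  show ?thesis
   by (rule runs_weaken[OF runs_Seq[OF runs_read_in runs_Seq[OF 2 3]]])
    (use le in \<open>auto simp: input_def fun_eq_iff\<close>)
 qed
 show ?thesis
 proof (rule polytime_computable_program)
  show "okc ?P" "nog ?P" using c ok_read_in ok_write_out by (auto simp: computes_def)
  show "pb ?g" by (intro pb_intros pb_comp[of "poly p"])
  show "stops sstep ([?P], input w) (?g (length w))" for w by (rule runs_stops[OF run])
  show "sstep\<^sup>*\<^sup>* ([?P], input w) ([], input (f w))" for w
  proof -
   obtain m where "(forced sstep ^^ m) ([?P], input w) ([], input (f w))"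
    using run[of w] unfolding runs_def by blast
   then show ?thesis by (rule det_imp)
  qed
 qed
qed

section \<open>Guessing and checking a certificate\<close>

lemma relpowp_trans:
 fixes R :: "'a => 'a => bool"
 shows "(R ^^ m) a b ==> (R ^^ n) b c ==> (R ^^ (m + n)) a c"
 unfolding relpowp_add by (rule relcomppI)

lemma sacc_step': "fst c ~= [] ==> sacc c \<longleftrightarrow> (\<exists>c'\<in>snx c. sacc c')"
 using program.sacc_step[of Skip c] by (simp add: program_def)

lemma sacc_forced: "(forced sstep ^^ m) c c' ==> sacc c \<longleftrightarrow> sacc c'"
proof (induction m arbitrary: c)
 case (Suc m)
 then obtain d where d: "forced sstep c d" "(forced sstep ^^ m) d c'" by (metis relpowp_Suc_D2)
 then have s: "snx c = {d}" unfolding forced_def sstep_def by blast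
 then have "fst c ~= []" by (cases c) auto
 with s sacc_step'[of c] have "sacc c \<longleftrightarrow> sacc d" by simp
 with Suc.IH[OF d(2)] show ?case by simp
qed simp

text \<open>Stack 6 serves as a clock: each of its bits, whatever its value, permits one
  guess.\<close>

definition fill :: com where
 "fill = Loop 6 False (Guess 1) (Guess 1)"

lemma fill_step:
 "snx (fill # k, s) = (case s 6 of [] => {(k, s)} | b # r => {(Guess 1 # fill # k, s(6 := r))})"
 by (auto simp: fill_def split: list.splits)

lemma stops_fill:
 "s 6 = xs ==> (!!ys. length ys = length xs ==> stops sstep (k, s(6 := [], 1 := ys @ s 1)) n) ==>
  stops sstep (fill # k, s) (2 * length xs + Suc n)"
proof (induction xs arbitrary: s)
 case Nil
 have eq: "s(6 := [], 1 := [] @ s 1) = s" using Nil(1) by (auto simp: fun_eq_iff)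
 have "stops sstep (k, s(6 := [], 1 := [] @ s 1)) n" by (rule Nil(2)) simp
 then have "stops sstep (k, s) n" by (simp only: eq)
 then have "stops sstep x n" if "sstep (fill # k, s) x" for x
  using that Nil(1) unfolding sstep_def fill_step by simp
 from stops_branch[OF this] show ?case by simp
next
 case (Cons a xs)
 have "stops sstep (fill # k, s(6 := xs, 1 := b # s 1)) (2 * length xs + Suc n)" for b
 proof (rule Cons.IH)
  fix ys :: "bool list" assume "length ys = length xs"
  then have "stops sstep (k, s(6 := [], 1 := (ys @ [b]) @ s 1)) n" by (intro Cons.prems(2)) simp
  moreover have "(s(6 := xs, 1 := b # s 1))(6 := [], 1 := ys @ (s(6 := xs, 1 := b # s 1)) 1)
    = s(6 := [], 1 := (ys @ [b]) @ s 1)"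
   by (auto simp: fun_eq_iff)
  ultimately show "stops sstep (k, (s(6 := xs, 1 := b # s 1))(6 := [], 1 := ys @ (s(6 := xs, 1 := b # s 1)) 1)) n"
   by simp
 qed simp
 then have "stops sstep x (2 * length xs + Suc n)" if "sstep (Guess 1 # fill # k, s(6 := xs)) x" for x
  using that unfolding sstep_def by auto
 from stops_branch[OF this]
 have G: "stops sstep (Guess 1 # fill # k, s(6 := xs)) (Suc (2 * length xs + Suc n))" .
 have "stops sstep x (Suc (2 * length xs + Suc n))" if "sstep (fill # k, s) x" for x
  using that G Cons.prems(1) unfolding sstep_def fill_step by auto
 from stops_branch[OF this] show ?case by simp
qed

lemma sacc_fill:
 "s 6 = xs ==> sacc (fill # k, s) \<longleftrightarrow> (\<exists>ys. length ys = length xs \<and> sacc (k, s(6 := [], 1 := ys @ s 1)))"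
proof (induction xs arbitrary: s)
 case Nil
 have eq: "s(6 := [], 1 := [] @ s 1) = s" using Nil(1) by (auto simp: fun_eq_iff)
 have "(\<exists>ys. length ys = length [] \<and> sacc (k, s(6 := [], 1 := ys @ s 1))) \<longleftrightarrow> sacc (k, s(6 := [], 1 := [] @ s 1))"
  by (metis length_0_conv list.size(3))
 then have "(\<exists>ys. length ys = length [] \<and> sacc (k, s(6 := [], 1 := ys @ s 1))) \<longleftrightarrow> sacc (k, s)"
  by (simp only: eq)
 moreover have "sacc (fill # k, s) \<longleftrightarrow> sacc (k, s)"
  using Nil sacc_step'[of "(fill # k, s)"] by (simp add: fill_step)
 ultimately show ?case by blast
next
 case (Cons a xs)
 have eq: "(s(6 := xs, 1 := b # s 1))(6 := [], 1 := ys @ (s(6 := xs, 1 := b # s 1)) 1)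
   = s(6 := [], 1 := (ys @ [b]) @ s 1)" for ys b
  by (auto simp: fun_eq_iff)
 have IH: "sacc (fill # k, s(6 := xs, 1 := b # s 1)) \<longleftrightarrow>
   (\<exists>ys. length ys = length xs \<and> sacc (k, s(6 := [], 1 := (ys @ [b]) @ s 1)))" for b
  by (rule Cons.IH[of "s(6 := xs, 1 := b # s 1)", unfolded eq]) simp
 have "sacc (fill # k, s) \<longleftrightarrow> sacc (Guess 1 # fill # k, s(6 := xs))"
  using Cons.prems sacc_step'[of "(fill # k, s)"] by (simp add: fill_step)
 also have "\<dots> \<longleftrightarrow> (\<exists>b. sacc (fill # k, s(6 := xs, 1 := b # s 1)))"
  using sacc_step'[of "(Guess 1 # fill # k, s(6 := xs))"] by (auto intro: exI[of _ True] exI[of _ False]) (metis (full_types))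
 also have "\<dots> \<longleftrightarrow> (\<exists>b ys. length ys = length xs \<and> sacc (k, s(6 := [], 1 := (ys @ [b]) @ s 1)))"
  unfolding IH ..
 also have "\<dots> \<longleftrightarrow> (\<exists>ys. length ys = length (a # xs) \<and> sacc (k, s(6 := [], 1 := ys @ s 1)))"
 proof
  assume "\<exists>b ys. length ys = length xs \<and> sacc (k, s(6 := [], 1 := (ys @ [b]) @ s 1))"
  then obtain b ys where "length (ys @ [b]) = length (a # xs)" "sacc (k, s(6 := [], 1 := (ys @ [b]) @ s 1))"
   by auto
  then show "\<exists>ys. length ys = length (a # xs) \<and> sacc (k, s(6 := [], 1 := ys @ s 1))" by blast
 next
  assume "\<exists>ys. length ys = length (a # xs) \<and> sacc (k, s(6 := [], 1 := ys @ s 1))"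
  then obtain ys where ys: "length ys = length (a # xs)" "sacc (k, s(6 := [], 1 := ys @ s 1))" by blast
  then obtain zs b where "ys = zs @ [b]" by (cases ys rule: rev_cases) auto
  with ys have "length zs = length xs \<and> sacc (k, s(6 := [], 1 := (zs @ [b]) @ s 1))" by simp
  then show "\<exists>b ys. length ys = length xs \<and> sacc (k, s(6 := [], 1 := (ys @ [b]) @ s 1))" by blast
 qed
 finally show ?case .
qed

text \<open>Guessed bits need not begin with the code of a tree. In that case the reader runs out of
  bits and blocks in \<open>Fail\<close>; the time until then matters, since the bound of the
  machine model concerns all branches.\<close>

lemma load_fails_aux:
 "s i = ys ==> s 4 = replicate n True ==> i ~= 3 ==> i ~= 4 ==>
  (\<exists>ts r. length ts = n \<and> ys = concat (map code ts) @ r) \<or>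
  (\<exists>m\<le>7 * length ys + 3. \<exists>d. (forced sstep ^^ m)
   (Loop 4 True Skip (Case i Fail (Push 3 False) (Push 3 True ;; Push 4 True ;; Push 4 True)) # k, s) d \<and>
   snx d = {} \<and> fst d ~= [])"
 (is "_ ==> _ ==> _ ==> _ ==> ?A n ys \<or> ?B s ys")
proof (induction ys arbitrary: s n)
 case Nil
 let ?C = "Case i Fail (Push 3 False) (Push 3 True ;; Push 4 True ;; Push 4 True)"
 let ?P = "Loop 4 True Skip ?C"
 show ?case
 proof (cases n)
  case 0
  then show ?thesis by simp
 next
  case (Suc n')
  let ?s0 = "s(4 := replicate n' True)"
  have 1: "forced sstep (?P # k, s) (?C # ?P # k, ?s0)"
   by (rule forced_sstep) (use Nil.prems Suc in auto)
  have 2: "forced sstep (?C # ?P # k, ?s0) (Fail # ?P # k, ?s0)"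
   by (rule forced_sstep) (use Nil.prems Suc in auto)
  have "(forced sstep ^^ Suc (Suc 0)) (?P # k, s) (Fail # ?P # k, ?s0)"
   using 1 2 by auto
  then show ?thesis
   by (intro disjI2 exI[of _ "Suc (Suc 0)"] conjI exI[of _ "(Fail # ?P # k, ?s0)"]) simp_all
 qed
next
 case (Cons b ys)
 let ?C = "Case i Fail (Push 3 False) (Push 3 True ;; Push 4 True ;; Push 4 True)"
 let ?P = "Loop 4 True Skip ?C"
 show ?case
 proof (cases n)
  case 0
  then show ?thesis by simp
 next
  case (Suc n')
  let ?s0 = "s(4 := replicate n' True)"
  let ?n = "if b then Suc (Suc n') else n'"
  let ?s1 = "?s0(i := ys, 3 := b # s 3, 4 := replicate ?n True)"
  have B: "runs ?C ?s0 6 ?s1"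
  proof (cases b)
   case True
   show ?thesis
    by (rule runs_weaken[OF runs_Case_True[OF _ runs_Seq[OF runs_Push runs_Seq[OF runs_Push runs_Push]]]])
     (use Cons.prems True in \<open>auto simp: fun_eq_iff\<close>)
  next
   case False
   show ?thesis
    by (rule runs_weaken[OF runs_Case_False[OF _ runs_Push]])
     (use Cons.prems False in \<open>auto simp: fun_eq_iff\<close>)
  qed
  then obtain m where m: "m \<le> 6" "(forced sstep ^^ m) (?C # ?P # k, ?s0) (?P # k, ?s1)"
   unfolding runs_def by blast
  have 1: "forced sstep (?P # k, s) (?C # ?P # k, ?s0)"
   by (rule forced_sstep) (use Cons.prems Suc in auto)
  have 2: "(forced sstep ^^ Suc m) (?P # k, s) (?P # k, ?s1)" by (rule relpowp_Suc_I2[OF 1 m(2)])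
  have "?A ?n ys \<or> ?B ?s1 ys"
   by (rule Cons.IH) (use Cons.prems in auto)
  then show ?thesis
  proof
   assume "?A ?n ys"
   then obtain ts r where 1: "length ts = ?n" "ys = concat (map code ts) @ r" by blast
   have "?A n (b # ys)"
   proof (cases b)
    case True
    with 1 obtain t1 t2 us where "ts = t1 # t2 # us" by (auto simp: length_Suc_conv)
    with 1 True Suc show ?thesis by (intro exI[of _ "Nd t1 t2 # us"] exI[of _ r]) auto
   next
    case False
    with 1 Suc show ?thesis by (intro exI[of _ "Lf # ts"] exI[of _ r]) auto
   qed
   then show ?thesis by blast
  next
   assume "?B ?s1 ys"
   then obtain m' d where m': "m' \<le> 7 * length ys + 3" "(forced sstep ^^ m') (?P # k, ?s1) d" "snx d = {}" "fst d ~= []"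
    by blast
   have "(forced sstep ^^ (Suc m + m')) (?P # k, s) d"
    by (rule relpowp_trans[OF 2 m'(2)])
   moreover have "Suc m + m' \<le> 7 * length (b # ys) + 3" using m(1) m'(1) by simp
   ultimately have "?B s (b # ys)" using m'(3,4) by blast
   then show ?thesis ..
  qed
 qed
qed

lemma load_cases:
 assumes "s 3 = []" "s 4 = []" "i ~= 3" "i ~= 4"
 obtains t r where "s i = code t @ r"
 | m d where "m \<le> 7 * length (s i) + 5" "(forced sstep ^^ m) (load i # k, s) d" "snx d = {}" "fst d ~= []"
proof -
 let ?P = "Loop 4 True Skip (Case i Fail (Push 3 False) (Push 3 True ;; Push 4 True ;; Push 4 True))"
 let ?s = "s(4 := True # s 4)"
 have a: "forced sstep (load i # k, s) (Push 4 True # ?P # k, s)"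
  by (rule forced_sstep) (simp add: load_def)
 have b: "forced sstep (Push 4 True # ?P # k, s) (?P # k, ?s)"
  by (rule forced_sstep) simp
 have "?s 4 = replicate 1 True" using assms by simp
 from load_fails_aux[of ?s i "s i" 1 k] this assms
 consider "\<exists>ts r. length ts = 1 \<and> s i = concat (map code ts) @ r"
  | m d where "m \<le> 7 * length (s i) + 3" "(forced sstep ^^ m) (?P # k, ?s) d" "snx d = {}" "fst d ~= []"
  by fastforce
 then show ?thesis
 proof cases
  case 1
  then obtain t r where "s i = code t @ r" by (auto simp: length_Suc_conv)
  then show ?thesis by (rule that(1))
 next
  case (2 m d)
  from relpowp_Suc_I2[OF a relpowp_Suc_I2[OF b 2(2)]] 2 show ?thesis
   by (intro that(2)[of "Suc (Suc m)" d]) simp_all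
 qed
qed

text \<open>The unary code of the clock value has length \<open>2 * poly p n + 1\<close>, which is
  the exact number of guessed bits. Shorter certificates are padded, and the padding is thrown away
  before the verifier runs.\<close>

lemma in_NP_tree:
 assumes V: "PT (V :: bool list \<times> tree => bool)" and q: "pb q"
  and sound: "!!w t. V (w, t) ==> w \<in> L"
  and complete: "!!w. w \<in> L ==> \<exists>t. sz t \<le> q (length w) \<and> V (w, t)"
 shows "in_NP L"
proof -
 obtain p :: "nat poly" where p: "!!n. q n \<le> poly p n" using q unfolding pb_def by blast
 define clock where "clock = (\<lambda>w :: bool list. poly p (length w))"
 have "PT clock" unfolding clock_def by (intro PT_rules)
 then obtain c cp where c: "computes c clock cp" unfolding PT_def by blast
 obtain v vp where v: "computes v V vp" using V unfolding PT_def by blast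
 let ?D = "read_in ;; dup 1 2 ;; c ;; shift 1 6"
 \<comment> \<open>The guessed tree has come to stack 3; what remains on stack 1 is padding and is
   cleared.\<close>
 let ?R = "unload 5 ;; Loop 1 False Skip Skip ;; shift 5 1 ;; shift 2 1 ;; Push 1 True ;; v"
 \<comment> \<open>Only a verdict whose code begins with \<open>True\<close> lets the program reach
   its end; otherwise it blocks.\<close>
 let ?F = "Case 1 Fail Fail Skip"
 let ?P = "?D ;; fill ;; load 1 ;; ?R ;; ?F"
 let ?W = "\<lambda>n. 4 * n + (1 :: nat)" and ?N = "\<lambda>n. 2 * poly p n + 1"
 let ?d = "\<lambda>n. Suc ((20 * n + 3) + Suc ((20 * ?W n + 20) + Suc (poly cp (?W n) + (20 * ?N n + 20))))"
 let ?r = "\<lambda>n. Suc ((2 * ?N n + 1) + Suc ((2 * ?N n + 1) + Suc ((20 * ?N n + 20) +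
   Suc ((20 * ?W n + 20) + Suc (Suc 0 + poly vp (?W n + ?N n + 1))))))"
 let ?l = "\<lambda>n. Suc ((7 * ?N n + 5) + Suc (?r n + 5))"
 let ?g = "\<lambda>n. Suc (?d n + Suc (2 * ?N n + Suc (?l n)))"
 define s1 :: "bool list => stacks" where "s1 w = (\<lambda>_. [])(2 := code (enc w), 6 := code (enc (clock w)))" for w :: "bool list"
 have clock: "length (code (enc (clock w))) = ?N (length w)" for w
  using sz_nat[of "clock w"] by (simp add: sz_def clock_def)
 have W: "length (code (enc w)) \<le> ?W (length w)" for w :: "bool list"
  using sz_bool_list[of w] by (simp add: sz_def)
 have D: "runs ?D (input w) (?d (length w)) (s1 w)" for w
 proof -
  let ?a = "(\<lambda>_. [])(1 := code (enc w)) :: stacks"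
  let ?b = "?a(2 := code (enc w) @ ?a 2)"
  let ?c = "?b(1 := code (enc (clock w)) @ [])"
  have 2: "runs (dup 1 2) ?a (20 * length (code (enc w)) + 20) ?b"
   by (rule runs_dup[where r="[]"]) auto
  have 3: "runs c ?b (poly cp (?W (length w))) ?c"
   by (rule computes_runs[OF c]) (use W[of w] in \<open>auto simp: free_def sz_def\<close>)
  have 4: "runs (shift 1 6) ?c (20 * length (code (enc (clock w))) + 20) (?c(1 := [], 6 := code (enc (clock w)) @ ?c 6))"
   by (rule runs_shift) auto
  show ?thesis
   by (rule runs_weaken[OF runs_Seq[OF runs_read_in runs_Seq[OF 2 runs_Seq[OF 3 4]]]])
    (use W[of w] clock[of w] in \<open>auto simp: s1_def fun_eq_iff\<close>)
 qed
 let ?s2 = "\<lambda>w ys. (s1 w)(6 := [], 1 := ys)"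
 let ?K = "(load 1 ;; ?R ;; ?F)"
 have R: "runs ?R ((?s2 w (code t @ r))(1 := r, 3 := rev (code t))) (?r (length w))
   ((\<lambda>_. [])(1 := code (enc (V (w, t)))))"
  if len: "length (code t @ r) = ?N (length w)" for w t r
 proof -
  let ?a = "(?s2 w (code t @ r))(1 := r, 3 := rev (code t))"
  let ?b = "?a(3 := [], 5 := rev (rev (code t)) @ ?a 5)"
  let ?c = "?b(1 := [])"
  let ?d = "?c(5 := [], 1 := code t @ ?c 1)"
  let ?e = "?d(2 := [], 1 := code (enc w) @ ?d 1)"
  let ?f = "?e(1 := True # ?e 1)"
  have le: "length (code t) \<le> ?N (length w)" "length r \<le> ?N (length w)" using len by auto
  have 1: "runs (unload 5) ?a (2 * length (rev (code t)) + 1) ?b"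
   by (rule runs_unload) auto
  have 2: "runs (Loop 1 False Skip Skip) ?b (2 * length r + 1) ?c"
   by (rule runs_clear) auto
  have 3: "runs (shift 5 1) ?c (20 * length (code t) + 20) ?d"
   by (rule runs_shift) (auto simp: s1_def)
  have 4: "runs (shift 2 1) ?d (20 * length (code (enc w)) + 20) ?e"
   by (rule runs_shift) (auto simp: s1_def)
  have 5: "runs (Push 1 True) ?e (Suc 0) ?f" by (rule runs_Push)
  have 6: "runs v ?f (poly vp (?W (length w) + ?N (length w) + 1)) (?f(1 := code (enc (V (w, t))) @ []))"
  proof (rule computes_runs[OF v])
   show "?f 1 = code (enc (w, t)) @ []" by (simp add: enc_tree_def)
   show "free ?f" by (auto simp: free_def s1_def)
   show "sz (w, t) \<le> ?W (length w) + ?N (length w) + 1"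
    using W[of w] le by (simp add: sz_def enc_tree_def)
  qed
  show ?thesis
   by (rule runs_weaken[OF runs_Seq[OF 1 runs_Seq[OF 2 runs_Seq[OF 3 runs_Seq[OF 4 runs_Seq[OF 5 6]]]]]])
    (use le W[of w] in \<open>auto simp: fun_eq_iff s1_def\<close>)
 qed
 have K: "stops sstep ([?K], ?s2 w ys) (?l (length w)) \<and>
   (sacc ([?K], ?s2 w ys) \<longleftrightarrow> (\<exists>t r. ys = code t @ r \<and> V (w, t)))"
  if len: "length ys = ?N (length w)" for w ys
 proof -
  have 0: "(forced sstep ^^ 1) ([?K], ?s2 w ys) ([load 1, ?R ;; ?F], ?s2 w ys)"
   unfolding relpowp_1 by (rule forced_sstep) simp
  have s: "?s2 w ys 3 = []" "?s2 w ys 4 = []" by (auto simp: s1_def)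
  consider t r where "ys = code t @ r"
   | m d where "m \<le> 7 * length ys + 5" "(forced sstep ^^ m) ([load 1, ?R ;; ?F], ?s2 w ys) d" "snx d = {}" "fst d ~= []"
    "\<nexists>t r. ys = code t @ r"
  proof (cases "\<exists>t r. ys = code t @ r")
   case True
   then show ?thesis using that(1) by blast
  next
   case no: False
   note fin = that(2)
   have ys: "?s2 w ys 1 = ys" by simp
   show ?thesis
   proof (rule load_cases[where i = 1 and k = "[?R ;; ?F]", OF s])
    show "(1 :: nat) ~= 3" "(1 :: nat) ~= 4" by simp_all
    show thesis if "?s2 w ys 1 = code t @ r" for t r using no that unfolding ys by blast
    show thesis if "m \<le> 7 * length (?s2 w ys 1) + 5"
      "(forced sstep ^^ m) ([load 1, ?R ;; ?F], ?s2 w ys) d" "snx d = {}" "fst d ~= []" for m d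
     by (rule fin[OF that[unfolded ys] no])
   qed
  qed
  then show ?thesis
  proof cases
   case (1 t r)
   let ?s = "(\<lambda>_. [])(1 := code (enc (V (w, t)))) :: stacks"
   have "runs (load 1) (?s2 w ys) (7 * length (code t) + 3) ((?s2 w ys)(1 := r, 3 := rev (code t)))"
    by (rule runs_load) (use s 1 in auto)
   then obtain a where a: "a \<le> 7 * length (code t) + 3"
    "(forced sstep ^^ a) ([load 1, ?R ;; ?F], ?s2 w ys) ([?R ;; ?F], (?s2 w ys)(1 := r, 3 := rev (code t)))"
    unfolding runs_def by blast
   have b: "(forced sstep ^^ 1) ([?R ;; ?F], (?s2 w ys)(1 := r, 3 := rev (code t))) ([?R, ?F], (?s2 w ys)(1 := r, 3 := rev (code t)))"
    unfolding relpowp_1 by (rule forced_sstep) simp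
   obtain e where e: "e \<le> ?r (length w)" "(forced sstep ^^ e) ([?R, ?F], (?s2 w ys)(1 := r, 3 := rev (code t))) ([?F], ?s)"
    using R[of t r w] len unfolding 1 runs_def by blast
   have f: "snx ([?F], ?s) = {([if V (w, t) then Skip else Fail], (?s(1 := tl (code (enc (V (w, t)))))))}"
    by (simp add: enc_bool_def)
   have Fs: "stops sstep ([?F], ?s) 2"
   proof -
    have Sk: "stops sstep ([Skip], u) (Suc 0)" for u :: stacks
    proof (rule stops_branch)
     fix x assume "sstep ([Skip], u) x"
     then have "x = ([], u)" by (simp add: sstep_def)
     then show "stops sstep x 0" by (intro stops_halt) (simp add: sstep_def)
    qed
    have Fl: "stops sstep ([Fail], u) (Suc 0)" for u :: stacks
     by (rule stops_halt) (simp add: sstep_def)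
    have "stops sstep x (Suc 0)" if "sstep ([?F], ?s) x" for x
    proof -
     have "x \<in> snx ([?F], ?s)" using that by (simp only: sstep_def)
     then show ?thesis unfolding f using Sk Fl by (cases "V (w, t)") simp_all
    qed
    from stops_branch[OF this] show ?thesis by (simp add: numeral_2_eq_2)
   qed
   have Fa: "sacc ([?F], ?s) \<longleftrightarrow> V (w, t)"
    using sacc_step'[of "([?F], ?s)"] unfolding f
    using sacc_step'[of "([Skip], ?s(1 := tl (code (enc (V (w, t))))))"]
     sacc_step'[of "([Fail], ?s(1 := tl (code (enc (V (w, t))))))"]
    by (cases "V (w, t)") (auto simp: sacc_def)
   have "stops sstep ([?K], ?s2 w ys) (1 + (a + (1 + (e + 2))))"
    by (rule stops_det[OF 0 stops_det[OF a(2) stops_det[OF b stops_det[OF e(2) Fs]]]])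
   then have S: "stops sstep ([?K], ?s2 w ys) (?l (length w))"
    by (rule stops_mono) (use a(1) e(1) len 1 in auto)
   have "sacc ([?K], ?s2 w ys) \<longleftrightarrow> V (w, t)"
    using sacc_forced[OF 0] sacc_forced[OF a(2)] sacc_forced[OF b] sacc_forced[OF e(2)] Fa by simp
   also have "\<dots> \<longleftrightarrow> (\<exists>t r. ys = code t @ r \<and> V (w, t))"
    using 1 code_append_inject by blast
   finally show ?thesis using S by blast
  next
   case (2 m d)
   have "stops sstep d 0" using 2(3) by (auto intro!: stops_halt simp: sstep_def)
   from stops_det[OF 0 stops_det[OF 2(2) this]]
   have S: "stops sstep ([?K], ?s2 w ys) (?l (length w))"
    by (rule stops_mono) (use 2(1) len in auto)
   have "\<not> sacc d" using sacc_step'[OF 2(4)] 2(3) by simp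
   then show ?thesis using sacc_forced[OF 0] sacc_forced[OF 2(2)] S 2(5) by blast
  qed
 qed
 obtain DD where DD: "DD = ?D" by blast
 have start: "\<exists>m\<le>Suc (?d (length w)) + 1. (forced sstep ^^ m) ([?P], input w) ([fill, ?K], s1 w)" for w
 proof -
  obtain m where m: "m \<le> ?d (length w)" "(forced sstep ^^ m) ([?D, fill ;; ?K], input w) ([fill ;; ?K], s1 w)"
   using D[of w] unfolding runs_def by blast
  have a: "forced sstep ([?P], input w) ([?D, fill ;; ?K], input w)"
   by (rule forced_sstep) simp
  have b: "(forced sstep ^^ 1) ([fill ;; ?K], s1 w) ([fill, ?K], s1 w)"
   unfolding relpowp_1 by (rule forced_sstep) simp
  have "(forced sstep ^^ (Suc m + 1)) ([?P], input w) ([fill, ?K], s1 w)"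
   by (rule relpowp_trans[OF relpowp_Suc_I2[OF a m(2)] b])
  moreover have "Suc m + 1 \<le> Suc (?d (length w)) + 1" using m(1) by simp
  ultimately show ?thesis by blast
 qed
 have six: "s1 w 6 = code (enc (clock w))" "s1 w 1 = []" for w by (simp_all add: s1_def)
 show ?thesis
 proof (rule in_NP_program)
  show "okc ?P" using c v ok_read_in by (auto simp: computes_def ok_progs fill_def)
  show "pb (\<lambda>n. Suc (?d n) + 1 + (2 * ?N n + Suc (?l n)))"
   by (intro pb_intros pb_comp[of "poly cp"] pb_comp[of "poly vp"])
  fix w
  obtain m where m: "m \<le> Suc (?d (length w)) + 1" "(forced sstep ^^ m) ([?P], input w) ([fill, ?K], s1 w)"
   using start[of w] by blast
  have "stops sstep ([fill, ?K], s1 w) (2 * length (code (enc (clock w))) + Suc (?l (length w)))"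
   by (rule stops_fill[where s = "s1 w", OF six(1)[of w]]) (use K[of _ w] clock[of w] six(2) in auto)
  from stops_det[OF m(2) this]
  show "stops sstep ([?P], input w) (Suc (?d (length w)) + 1 + (2 * ?N (length w) + Suc (?l (length w))))"
   by (rule stops_mono) (use m(1) clock[of w] in simp)
  have "sacc ([?P], input w) \<longleftrightarrow> (\<exists>ys. length ys = ?N (length w) \<and> (\<exists>t r. ys = code t @ r \<and> V (w, t)))"
   unfolding sacc_forced[OF m(2)] sacc_fill[where s = "s1 w", OF six(1)[of w]] clock six(2) using K[of _ w] by auto
  also have "\<dots> \<longleftrightarrow> w \<in> L"
  proof
   assume "w \<in> L"
   then obtain t where t: "sz t \<le> q (length w)" "V (w, t)" using complete by blast
   then have "length (code t) \<le> ?N (length w)" using p[of "length w"] by (simp add: sz_def enc_tree_def)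
   \<comment> \<open>Any padding works because codes are self-delimiting.\<close>
   then have "length (code t @ replicate (?N (length w) - length (code t)) False) = ?N (length w)" by simp
   then show "\<exists>ys. length ys = ?N (length w) \<and> (\<exists>t r. ys = code t @ r \<and> V (w, t))" using t(2) by blast
  qed (use sound in blast)
  finally show "w \<in> L \<longleftrightarrow> sacc ([?P], input w)" by simp
 qed
qed

subsection \<open>Certificates\<close>

text \<open>Every tree is the code of exactly one list of trees, namely of the left subtrees along
  its right spine. This makes list functions applicable to trees of unknown origin.\<close>

definition spine :: "tree => tree list" where
 "spine t = (THE l. enc l = t)"

lemma enc_tree_list_surj: "\<exists>l :: tree list. enc l = t"
proof (induction t)
 case Lf
 show ?case by (rule exI[of _ "[]"]) simp
next
 case (Nd a b)
 then obtain l :: "tree list" where "enc l = b" by blast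
 then show ?case by (intro exI[of _ "a # l"]) (simp add: enc_tree_def)
qed

lemma enc_spine: "enc (spine t) = t"
 unfolding spine_def
proof (rule theI')
 show "\<exists>!l :: tree list. enc l = t" using enc_tree_list_surj[of t] enc_inject by (metis (no_types))
qed

lemma spine_enc: "spine (enc l) = l"
 using enc_spine[of "enc l"] enc_inject by blast

lemma spine_simps [simp]: "spine Lf = []" "spine (Nd a b) = a # spine b"
proof -
 have "enc (a # spine b) = Nd a b" by (simp add: enc_spine enc_tree_def)
 then show "spine (Nd a b) = a # spine b" using spine_enc by metis
 show "spine Lf = []" using spine_enc[of "[]"] by simp
qed

lemma PT_spine [PT_rules]: "PT f ==> PT (\<lambda>x. spine (f x))"
 by (rule PT_enc_cong) (auto simp: enc_spine enc_tree_def)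

fun tfst :: "tree => tree" where
 "tfst Lf = Lf" | "tfst (Nd a b) = a"

fun tsnd :: "tree => tree" where
 "tsnd Lf = Lf" | "tsnd (Nd a b) = b"

lemma PT_tfst [PT_rules]:
 assumes "PT f"
 shows "PT (\<lambda>x. tfst (f x))"
proof (rule PT_comp[OF _ assms])
 have "PT (\<lambda>t. if spine t = [] then Lf else hd (spine t))" by (intro PT_rules)
 moreover have "(if spine t = [] then Lf else hd (spine t)) = tfst t" for t by (cases t) auto
 ultimately show "PT tfst" by simp
qed

lemma PT_tsnd [PT_rules]:
 assumes "PT f"
 shows "PT (\<lambda>x. tsnd (f x))"
proof (rule PT_comp[OF _ assms])
 have "PT (\<lambda>t. tl (spine t))" by (intro PT_rules)
 then show "PT tsnd"
 proof (rule PT_enc_cong)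
  show "enc (tsnd t) = enc (tl (spine t))" for t by (cases t) (auto simp: enc_spine enc_tree_def)
 qed
qed

text \<open>\<open>dec\<close> is total: an ill-formed guess is read as some value, so that
  verifiers may be written for typed certificates.\<close>

class cert = enc +
 fixes dec :: "tree => 'a"
 assumes dec_enc: "dec (enc x) = x"

instantiation bool :: cert
begin
definition dec_bool :: "tree => bool" where "dec_bool t \<longleftrightarrow> t ~= Lf"
instance by standard (simp add: dec_bool_def enc_bool_def)
end

instantiation prod :: (cert, cert) cert
begin
definition dec_prod :: "tree => 'a \<times> 'b" where "dec_prod t = (dec (tfst t), dec (tsnd t))"
instance
proof
 show "dec (enc x) = x" for x :: "'a \<times> 'b" by (cases x) (simp add: dec_prod_def dec_enc)
qed
end

instantiation list :: (cert) cert
begin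
definition dec_list :: "tree => 'a list" where "dec_list t = map dec (spine t)"
instance
proof
 show "dec (enc x) = x" for x :: "'a list"
  unfolding dec_list_def by (induction x) (auto simp: dec_enc)
qed
end

instantiation nat :: cert
begin
definition dec_nat :: "tree => nat" where "dec_nat t = length (spine t)"
instance
proof
 show "dec (enc x) = x" for x :: nat
  unfolding dec_nat_def enc_nat_def by (induction x) auto
qed
end

instantiation int :: cert
begin
definition dec_int :: "tree => int" where
 "dec_int t = (if dec (tfst t) then - int (val (dec (tsnd t))) else int (val (dec (tsnd t))))"
instance
proof
 show "dec (enc x) = x" for x :: int
  by (simp add: dec_int_def enc_int_def dec_enc dec_prod_def val_bits)
qed
end

instantiation edge :: cert
begin
definition dec_edge :: "tree => edge" where
 "dec_edge t = (if dec (tfst t) then Ver (dec (tsnd t)) else Hor (dec (tsnd t)))"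
instance
proof
 show "dec (enc x) = x" for x :: edge
  by (cases x) (simp_all add: dec_edge_def dec_enc)
qed
end

lemma PT_dec_bool [PT_rules]: "PT f ==> PT (\<lambda>x. dec (f x) :: bool)"
 unfolding dec_bool_def by (intro PT_rules)

lemma PT_dec_prod [PT_rules]:
 assumes "PT (dec :: tree => 'a::cert)" "PT (dec :: tree => 'b::cert)" "PT f"
 shows "PT (\<lambda>x. dec (f x) :: 'a \<times> 'b)"
 unfolding dec_prod_def by (intro PT_rules PT_comp[OF assms(1)] PT_comp[OF assms(2)] assms(3))

lemma PT_dec_list [PT_rules]:
 assumes "PT (dec :: tree => 'a::cert)" "PT f"
 shows "PT (\<lambda>x. dec (f x) :: 'a list)"
 unfolding dec_list_def by (intro PT_map PT_comp[OF assms(1)] PT_rules assms(2))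

lemma PT_dec_nat [PT_rules]: "PT f ==> PT (\<lambda>x. dec (f x) :: nat)"
 unfolding dec_nat_def by (intro PT_rules)

lemma PT_dec_int [PT_rules]: "PT f ==> PT (\<lambda>x. dec (f x) :: int)"
 unfolding dec_int_def by (intro PT_int_abs PT_rules PT_dec_list PT_dec_bool[OF PT_id])

lemma PT_dec_edge [PT_rules]: "PT f ==> PT (\<lambda>x. dec (f x) :: edge)"
 unfolding dec_edge_def by (intro PT_rules PT_dec_prod PT_dec_int[OF PT_id])

theorem in_NP_certificate:
 fixes V :: "bool list \<times> 'c::cert => bool"
 assumes V: "PT V" and D: "PT (dec :: tree => 'c)" and q: "pb q"
  and sound: "!!w c. V (w, c) ==> w \<in> L"
  and complete: "!!w. w \<in> L ==> \<exists>c. sz c \<le> q (length w) \<and> V (w, c)"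
 shows "in_NP L"
proof (rule in_NP_tree[OF _ q])
 show "PT (\<lambda>p. V (fst p, dec (snd p)))"
  by (rule PT_comp[OF V]) (intro PT_rules PT_comp[OF D])
 show "w \<in> L" if "V (fst (w, t), dec (snd (w, t)))" for w t using sound that by simp
 show "\<exists>t. sz t \<le> q (length w) \<and> V (fst (w, t), dec (snd (w, t)))" if w: "w \<in> L" for w
 proof -
  obtain c where "sz c \<le> q (length w)" "V (w, c)" using complete[OF w] by blast
  then show ?thesis by (intro exI[of _ "enc c"]) (simp add: dec_enc sz_def enc_tree_def)
 qed
qed

section \<open>Simply connected sets of cells\<close>

definition area :: "cell set => (real \<times> real) set" where
 "area P = (\<Union>c\<in>P. square c)"

lemma square_Times: "square c = {of_int (fst c) .. of_int (fst c) + 1} \<times> {of_int (snd c) .. of_int (snd c) + 1}"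
 by (cases c) simp

lemma closed_area: "finite P ==> closed (area P)"
 unfolding area_def by (auto intro!: closed_UN closed_Times simp: square_Times)

lemma chk_single [simp]: "chk P [a] \<longleftrightarrow> P a []"
 by (simp add: chk_def)

lemma chk_append1: "chk P (xs @ ys) ==> chk P xs"
proof (induction ys rule: rev_induct)
 case (snoc y ys)
 then have "chk P ((xs @ ys) @ [y])" by simp
 then show ?case using snoc.IH by (simp only: chk_snoc)
qed simp

lemma disconnected_Un:
 "closed A ==> closed B ==> A \<inter> B = {} ==> A ~= {} ==> B ~= {} ==> \<not> connected (A \<union> B)"
 unfolding connected_closed by blast

lemma area_row:
 assumes "a < b"
 shows "area ({a..<b} \<times> {y}) = {of_int a .. of_int b} \<times> {of_int y .. of_int y + 1}"
proof -
 have "(\<exists>x\<in>{a..<b}. u \<in> {of_int x .. of_int x + 1 :: real}) \<longleftrightarrow> u \<in> {of_int a .. of_int b}" for u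
 proof
  assume "\<exists>x\<in>{a..<b}. u \<in> {of_int x .. of_int x + 1 :: real}"
  then obtain x where x: "a \<le> x" "x + 1 \<le> b" "of_int x \<le> u" "u \<le> of_int x + 1" by auto
  have "of_int a \<le> (of_int x :: real)" "of_int x + 1 \<le> (of_int b :: real)" using x(1,2) by linarith+
  then show "u \<in> {of_int a .. of_int b}" using x(3,4) by auto
 next
  assume u: "u \<in> {of_int a .. of_int b}"
  show "\<exists>x\<in>{a..<b}. u \<in> {of_int x .. of_int x + 1 :: real}"
  \<comment> \<open>At the right end the floor would name the cell beyond the row.\<close>
  proof (cases "u = of_int b")
   case True
   then show ?thesis using assms by (intro bexI[of _ "b - 1"]) auto
  next
   case False
   with u have "a \<le> \<lfloor>u\<rfloor>" "\<lfloor>u\<rfloor> < b" by (auto simp: le_floor_iff floor_less_iff)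
   moreover have "of_int \<lfloor>u\<rfloor> \<le> u" "u \<le> of_int \<lfloor>u\<rfloor> + 1" by linarith+
   ultimately show ?thesis by (intro bexI[of _ "\<lfloor>u\<rfloor>"]) auto
  qed
 qed
 then show ?thesis unfolding area_def by (auto simp: square_Times)
qed

section \<open>Contact of closed squares and horizontal runs\<close>

fun near :: "cell => cell => bool" where
 "near (x, y) (x', y') \<longleftrightarrow> (x' = x \<or> x' = x + 1 \<or> x = x' + 1) \<and> (y' = y \<or> y' = y + 1 \<or> y = y' + 1)"

lemma near_square: "square c \<inter> square d ~= {} \<longleftrightarrow> near c d"
proof -
 have *: "{of_int x .. of_int x + 1 :: real} \<inter> {of_int x' .. of_int x' + 1} ~= {} \<longleftrightarrow>
   x' = x \<or> x' = x + 1 \<or> x = x' + 1" for x x' :: int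
 proof
  assume "{of_int x .. of_int x + 1 :: real} \<inter> {of_int x' .. of_int x' + 1} ~= {}"
  then have "of_int x \<le> (of_int x' + 1 :: real)" "of_int x' \<le> (of_int x + 1 :: real)" by auto
  then have "x \<le> x' + 1" "x' \<le> x + 1" by linarith+
  then show "x' = x \<or> x' = x + 1 \<or> x = x' + 1" by auto
 next
  assume "x' = x \<or> x' = x + 1 \<or> x = x' + 1"
  then have "of_int x \<in> {of_int x .. of_int x + 1 :: real} \<inter> {of_int x' .. of_int x' + 1} \<or>
    of_int x + 1 \<in> {of_int x .. of_int x + 1 :: real} \<inter> {of_int x' .. of_int x' + 1}" by auto
  then show "{of_int x .. of_int x + 1 :: real} \<inter> {of_int x' .. of_int x' + 1} ~= {}" by blast
 qed
 obtain x y x' y' where "c = (x, y)" "d = (x', y')" by (cases c; cases d)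
 then show ?thesis using *[of x x'] *[of y y'] by (simp add: Times_Int_Times)
qed

text \<open>\<open>chk\<close> hands over the earlier cells latest first, so \<open>hd seen\<close>
  is the left neighbour.\<close>

definition is_run :: "cell list => bool" where
 "is_run r \<longleftrightarrow> r ~= [] \<and> chk (\<lambda>c seen. seen ~= [] --> c = (fst (hd seen) + 1, snd (hd seen))) r"

lemma is_run_row:
 assumes "is_run r"
 obtains a b y where "a < b" "set r = {a..<b} \<times> {y}"
proof -
 have "chk (\<lambda>c seen. seen ~= [] --> c = (fst (hd seen) + 1, snd (hd seen))) r ==> r ~= [] ==>
   \<exists>a b y. a < b \<and> set r = {a..<b} \<times> {y} \<and> last r = (b - 1, y)"
 proof (induction r rule: rev_induct)
  case (snoc c r)
  show ?case
  proof (cases "r = []")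
   case True
   then show ?thesis
    by (intro exI[of _ "fst c"] exI[of _ "fst c + 1"] exI[of _ "snd c"]) auto
  next
   case False
   with snoc obtain a b y where r: "a < b" "set r = {a..<b} \<times> {y}" "last r = (b - 1, y)" by auto
   moreover have "c = (fst (last r) + 1, snd (last r))"
    using snoc.prems False by (simp add: hd_rev)
   ultimately have c: "c = (b, y)" by simp
   have "{a..<b + 1} = insert b {a..<b}" using r(1) by auto
   then have "set (r @ [c]) = {a..<b + 1} \<times> {y}" using r(2) c by auto
   moreover have "last (r @ [c]) = (b + 1 - 1, y)" "a < b + 1" using c r(1) by simp_all
   ultimately show ?thesis by blast
  qed
 qed simp
 with assms that show ?thesis unfolding is_run_def by blast
qed

definition row_list :: "int => int => int => cell list" where
 "row_list a b y = map (\<lambda>x. (x, y)) [a..b - 1]"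

lemma set_row_list: "set (row_list a b y) = {a..<b} \<times> {y}"
 by (auto simp: row_list_def)

lemma is_run_row_list:
 assumes "a < b"
 shows "is_run (row_list a b y)"
proof -
 have "chk (\<lambda>c seen. seen ~= [] --> c = (fst (hd seen) + 1, snd (hd seen))) (row_list a (a + int n) y)" for n
 proof (induction n)
  case 0
  show ?case by (simp add: row_list_def)
 next
  case (Suc n)
  have "row_list a (a + int (Suc n)) y = row_list a (a + int n) y @ [(a + int n, y)]"
   unfolding row_list_def using upto_rec2[of a "a + int n"] by (simp add: algebra_simps)
  moreover have "hd (rev (row_list a (a + int n) y)) = (a + int n - 1, y)" if "row_list a (a + int n) y ~= []"
  proof -
   have "n ~= 0" using that by (auto simp: row_list_def)
   then have "row_list a (a + int n) y = row_list a (a + int n - 1) y @ [(a + int n - 1, y)]"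
    unfolding row_list_def using upto_rec2[of a "a + int n - 1"] by simp
   then show ?thesis by simp
  qed
  ultimately show ?case using Suc by auto
 qed
 from this[of "nat (b - a)"] show ?thesis using assms
  by (auto simp: is_run_def row_list_def)
qed

definition touches :: "cell list => cell list => bool" where
 "touches r s \<longleftrightarrow> list_ex (\<lambda>c. list_ex (near c) s) r"

lemma touches_area: "touches r s \<longleftrightarrow> area (set r) \<inter> area (set s) ~= {}"
 unfolding touches_def list_ex_iff near_square[symmetric] area_def by blast

text \<open>Contact includes corners, in keeping with the closed squares of the topological
  condition: a ring that closes only at a corner must not pass as a tree.\<close>

definition tree_runs :: "cell list list => bool" where
 "tree_runs rs \<longleftrightarrow> chk (\<lambda>r seen. is_run r \<and> (seen ~= [] --> length (filter (touches r) seen) = 1)) rs"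

lemma convex_run: "is_run r ==> convex (area (set r)) \<and> area (set r) ~= {}"
 by (elim is_run_row) (auto simp: area_row convex_Times intro!: convex_Times)

lemma area_Union: "area (\<Union>(set ` set rs)) = (\<Union>r\<in>set rs. area (set r))"
 unfolding area_def by blast

text \<open>A run meets the union of the earlier ones in its intersection with a single run, which
  is convex and nonempty. Gluing two closed absolute retracts along an absolute retract gives an
  absolute retract, hence a contractible set.\<close>

lemma tree_runs_AR:
 "tree_runs rs ==> rs ~= [] ==> AR (\<Union>r\<in>set rs. area (set r))"
proof (induction rs rule: rev_induct)
 case (snoc r rs)
 let ?S = "\<Union>r\<in>set rs. area (set r)"
 have r: "is_run r" and rs: "tree_runs rs" using snoc.prems by (simp_all add: tree_runs_def)
 have AR: "AR (area (set r))" using convex_run[OF r] convex_imp_AR by blast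
 show ?case
 proof (cases "rs = []")
  case True
  then have "(\<Union>r\<in>set (rs @ [r]). area (set r)) = area (set r)" by simp
  then show ?thesis using AR by (simp only:)
 next
  case False
  then have "length (filter (touches r) (rev rs)) = 1" using snoc.prems by (simp add: tree_runs_def)
  then obtain s where s: "filter (touches r) (rev rs) = [s]" by (auto simp: length_Suc_conv)
  have "set (filter (touches r) (rev rs)) = {s}" unfolding s by simp
  then have uniq: "{s' \<in> set rs. touches r s'} = {s}" by simp
  have run: "is_run s'" if "s' \<in> set rs" for s'
  proof -
   obtain us vs where "rs = us @ s' # vs" using \<open>s' \<in> set rs\<close> by (meson split_list)
   then have eq: "rs = (us @ [s']) @ vs" by simp
   have "tree_runs (us @ [s'])" using rs unfolding eq tree_runs_def by (rule chk_append1)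
   then show ?thesis by (simp add: tree_runs_def)
  qed
  have s: "s \<in> set rs" "touches r s" using uniq by blast+
  have "area (set r) \<inter> area (set s') = {}" if "s' \<in> set rs" "s' ~= s" for s'
   using that uniq unfolding touches_area by blast
  then have eq: "?S \<inter> area (set r) = area (set r) \<inter> area (set s)" using s(1) by blast
  have "convex (area (set r))" "convex (area (set s))"
   using convex_run[OF r] convex_run[OF run[OF s(1)]] by blast+
  then have "convex (area (set r) \<inter> area (set s))" by (rule convex_Int)
  then have "AR (?S \<inter> area (set r))"
   unfolding eq using s(2) unfolding touches_area by (rule convex_imp_AR)
  moreover have "AR ?S" by (rule snoc.IH[OF rs False])
  moreover have "closed ?S" "closed (area (set r))"
   using closed_area[of "\<Union>(set ` set rs)"] closed_area[of "set r"] unfolding area_Union by simp_all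
  ultimately have "AR (?S \<union> area (set r))" using AR AR_closed_Un by blast
  moreover have "(\<Union>r\<in>set (rs @ [r]). area (set r)) = ?S \<union> area (set r)" by auto
  ultimately show ?thesis by (simp only:)
 qed
qed simp

lemma tree_runs_simply_connected:
 assumes "tree_runs rs" "rs ~= []"
 shows "simply_connected (area (\<Union>(set ` set rs)))"
 using tree_runs_AR[OF assms] AR_imp_contractible contractible_imp_simply_connected
 unfolding area_Union by blast

text \<open>Greedy extension; the assumption on \<open>R\<close> is connectedness, in the form that
  a proper part always has a neighbour outside. It serves runs as well as cells.\<close>

lemma enumeration:
 assumes fin: "finite R" and R: "!!A. A \<subseteq> R ==> A ~= {} ==> A ~= R ==> \<exists>b\<in>R - A. \<exists>a\<in>A. t b a"
 obtains rs where "distinct rs" "set rs = R" "chk (\<lambda>r seen. seen ~= [] --> (\<exists>s\<in>set seen. t r s)) rs"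
proof -
 have "n \<le> card R ==> \<exists>rs. distinct rs \<and> length rs = n \<and> set rs \<subseteq> R \<and>
   chk (\<lambda>r seen. seen ~= [] --> (\<exists>s\<in>set seen. t r s)) rs" for n
 proof (induction n)
  case (Suc n)
  then obtain rs where rs: "distinct rs" "length rs = n" "set rs \<subseteq> R"
   "chk (\<lambda>r seen. seen ~= [] --> (\<exists>s\<in>set seen. t r s)) rs" by auto
  have ne: "set rs ~= R" using rs Suc.prems distinct_card[of rs] by auto
  have "\<exists>b\<in>R - set rs. rs ~= [] --> (\<exists>a\<in>set rs. t b a)"
  proof (cases "rs = []")
   case True
   then show ?thesis using ne by auto
  next
   case False
   then show ?thesis using R[of "set rs"] rs ne by auto
  qed
  then obtain b where "b \<in> R - set rs" "rs ~= [] --> (\<exists>a\<in>set rs. t b a)" by blast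
  with rs show ?case by (intro exI[of _ "rs @ [b]"]) auto
 qed (auto intro: exI[of _ "[]"])
 from this[of "card R"] obtain rs where rs: "distinct rs" "length rs = card R" "set rs \<subseteq> R"
  "chk (\<lambda>r seen. seen ~= [] --> (\<exists>s\<in>set seen. t r s)) rs" by auto
 then have "set rs = R" using fin distinct_card[of rs] by (metis card_subset_eq)
 with rs that show ?thesis by blast
qed

section \<open>Maximal runs of a simply connected region\<close>

definition maximal_run :: "cell set => cell list => bool" where
 "maximal_run P r \<longleftrightarrow> (\<exists>a b y. a < b \<and> r = row_list a b y \<and> {a..<b} \<times> {y} \<subseteq> P \<and> (a - 1, y) \<notin> P \<and> (b, y) \<notin> P)"

lemma maximal_run_exists:
 assumes "finite P" "c \<in> P"
 obtains r where "maximal_run P r" "c \<in> set r"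
proof -
 obtain x y where c: "c = (x, y)" by (cases c)
 have inf: "\<exists>k. (g k, y) \<notin> P" if "inj g" for g :: "nat => int"
 proof (rule ccontr)
  assume "\<nexists>k. (g k, y) \<notin> P"
  then have "range (\<lambda>k. (g k, y)) \<subseteq> P" by auto
  moreover have "inj (\<lambda>k. (g k, y))" using that by (auto simp: inj_on_def)
  ultimately show False using assms(1) finite_subset range_inj_infinite by metis
 qed
 define k where "k = (LEAST k. (x - int k - 1, y) \<notin> P)"
 define m where "m = (LEAST m. (x + int m + 1, y) \<notin> P)"
 have k: "(x - int k - 1, y) \<notin> P" unfolding k_def
  by (rule LeastI_ex[OF inf]) (auto simp: inj_on_def)
 have m: "(x + int m + 1, y) \<notin> P" unfolding m_def
  by (rule LeastI_ex[OF inf]) (auto simp: inj_on_def)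
 have k': "(x - int j - 1, y) \<in> P" if "j < k" for j
  using not_less_Least[OF that[unfolded k_def]] by simp
 have m': "(x + int j + 1, y) \<in> P" if "j < m" for j
  using not_less_Least[OF that[unfolded m_def]] by simp
 have "(z, y) \<in> P" if z: "x - int k \<le> z" "z < x + int m + 1" for z
 proof -
  consider "z = x" | "z < x" | "z > x" by linarith
  then show ?thesis
  proof cases
   case 1
   then show ?thesis using assms c by simp
  next
   case 2
   then show ?thesis using k'[of "nat (x - z - 1)"] z by auto
  next
   case 3
   then show ?thesis using m'[of "nat (z - x - 1)"] z by auto
  qed
 qed
 then have "maximal_run P (row_list (x - int k) (x + int m + 1) y)"
  unfolding maximal_run_def using k m
  by (intro exI[of _ "x - int k"] exI[of _ "x + int m + 1"] exI[of _ y]) auto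
 moreover have "c \<in> set (row_list (x - int k) (x + int m + 1) y)" by (auto simp: c set_row_list)
 ultimately show ?thesis by (rule that)
qed

lemma maximal_run_row:
 assumes "maximal_run P r"
 obtains a b y where "a < b" "r = row_list a b y" "area (set r) = {of_int a .. of_int b} \<times> {of_int y .. of_int y + 1}"
  "{a..<b} \<times> {y} \<subseteq> P" "(a - 1, y) \<notin> P" "(b, y) \<notin> P"
proof -
 obtain a b y where *: "a < b" "r = row_list a b y" "{a..<b} \<times> {y} \<subseteq> P" "(a - 1, y) \<notin> P" "(b, y) \<notin> P"
  using assms unfolding maximal_run_def by blast
 show ?thesis
  by (rule that[OF *(1,2) _ *(3-5)]) (simp only: *(2) set_row_list area_row[OF *(1)])
qed

text \<open>Two different runs of one row that overlap or merely abut would extend one another,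
  against maximality.\<close>

lemma maximal_runs_apart:
 assumes r: "maximal_run P (row_list a b y)" "a < b" and s: "maximal_run P (row_list a' b' y)" "a' < b'"
  and ne: "area ({a..<b} \<times> {y}) \<inter> area ({a'..<b'} \<times> {y}) ~= {}"
 shows "a = a' \<and> b = b'"
proof -
 have inj: "u = u' \<and> v = v' \<and> w = w'" if "row_list u v w = row_list u' v' w'" "u < v" for u v w u' v' w'
 proof -
  have eq: "{u..<v} \<times> {w} = {u'..<v'} \<times> {w'}" using arg_cong[OF that(1), of set] by (simp add: set_row_list)
  have "(u, w) \<in> {u..<v} \<times> {w}" "(v - 1, w) \<in> {u..<v} \<times> {w}" using that(2) by auto
  then have "(u, w) \<in> {u'..<v'} \<times> {w'}" "(v - 1, w) \<in> {u'..<v'} \<times> {w'}" unfolding eq by auto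
  moreover from this have "(u', w') \<in> {u'..<v'} \<times> {w'}" "(v' - 1, w') \<in> {u'..<v'} \<times> {w'}" by auto
  then have "(u', w') \<in> {u..<v} \<times> {w}" "(v' - 1, w') \<in> {u..<v} \<times> {w}" unfolding eq[symmetric] by auto
  ultimately show ?thesis by auto
 qed
 have ends: "{u..<v} \<times> {y} \<subseteq> P \<and> (u - 1, y) \<notin> P \<and> (v, y) \<notin> P"
  if uv: "maximal_run P (row_list u v y)" "u < v" for u v
 proof -
  obtain u' v' y' where *: "row_list u v y = row_list u' v' y'"
   "{u'..<v'} \<times> {y'} \<subseteq> P" "(u' - 1, y') \<notin> P" "(v', y') \<notin> P"
   using uv(1) unfolding maximal_run_def by blast
  from inj[OF *(1) uv(2)] *(2-4) show ?thesis by simp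
 qed
 have A: "{a..<b} \<times> {y} \<subseteq> P" "(a - 1, y) \<notin> P" "(b, y) \<notin> P" using ends[OF r] by simp_all
 have B: "{a'..<b'} \<times> {y} \<subseteq> P" "(a' - 1, y) \<notin> P" "(b', y) \<notin> P" using ends[OF s] by simp_all
 have "of_int a \<le> (of_int b' :: real)" "of_int a' \<le> (of_int b :: real)"
  using ne unfolding area_row[OF r(2)] area_row[OF s(2)] by auto
 then have le: "a \<le> b'" "a' \<le> b" by simp_all
 have mem: "(x, y) \<in> P" if "a \<le> x \<and> x < b \<or> a' \<le> x \<and> x < b'" for x
  using that A(1) B(1) by auto
 have "\<not> (a \<le> a' - 1 \<and> a' - 1 < b)" "\<not> (a' \<le> a - 1 \<and> a - 1 < b')" "\<not> (a' \<le> b \<and> b < b')" "\<not> (a \<le> b' \<and> b' < b)"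
  using mem A B by blast+
 then show ?thesis using le r(2) s(2) by auto
qed

lemma connected_runs:
 assumes "chk (\<lambda>r seen. seen ~= [] --> (\<exists>s\<in>set seen. touches r s)) rs" "!!r. r \<in> set rs ==> is_run r"
 shows "connected (\<Union>r\<in>set rs. area (set r))"
 using assms
proof (induction rs rule: rev_induct)
 case (snoc r rs)
 have c: "connected (\<Union>r\<in>set rs. area (set r))"
  by (rule snoc.IH) (use snoc.prems in \<open>simp_all del: UN_simps\<close>)
 have c2: "connected (area (set r))"
  by (rule convex_connected[OF conjunct1[OF convex_run]]) (use snoc.prems(2) in simp)
 note c = c c2
 show ?case
 proof (cases "rs = []")
  case False
  then obtain s where "s \<in> set rs" "area (set r) \<inter> area (set s) ~= {}"
   using snoc.prems(1) unfolding touches_area chk_snoc by (metis set_rev rev_is_Nil_conv)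
  then have "(\<Union>r\<in>set rs. area (set r)) \<inter> area (set r) ~= {}" by blast
  from connected_Un[OF c this] have "connected ((\<Union>r\<in>set rs. area (set r)) \<union> area (set r))" .
  moreover have "(\<Union>r\<in>set (rs @ [r]). area (set r)) = (\<Union>r\<in>set rs. area (set r)) \<union> area (set r)" by auto
  ultimately show ?thesis by (simp only:)
 next
  case True
  then have "(\<Union>r\<in>set (rs @ [r]). area (set r)) = area (set r)" by simp
  then show ?thesis using c(2) by (simp only:)
 qed
qed simp

text \<open>The last run is peeled off. The whole union is simply connected and locally path
  connected, hence unicoherent, so the last run meets the union of the others in a connected set. As
  it meets different earlier runs in disjoint closed sets, only one of them is touched. The rest is
  a retract of the whole, hence simply connected again.\<close>

lemma simply_connected_chain_tree:
 assumes "chk (\<lambda>r seen. seen ~= [] --> (\<exists>s\<in>set seen. touches r s)) rs" "distinct rs"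
  "!!r. r \<in> set rs ==> maximal_run P r"
  "simply_connected (\<Union>r\<in>set rs. area (set r))"
 shows "tree_runs rs"
 using assms
proof (induction rs rule: rev_induct)
 case Nil
 show ?case by (simp add: tree_runs_def)
next
 case (snoc r rs)
 have run: "is_run s" if "maximal_run P s" for s
  using that is_run_row_list unfolding maximal_run_def by blast
 have runs: "is_run s" if "s \<in> set (rs @ [r])" for s using run snoc.prems(3) that by blast
 let ?T = "\<Union>r\<in>set rs. area (set r)" and ?S = "area (set r)"
 have clS: "closed (area (set s))" for s by (rule closed_area) simp
 have clT: "closed (\<Union>s\<in>A. area (set s))" if "finite A" for A using that clS by (intro closed_UN) auto
 have U: "(\<Union>r\<in>set (rs @ [r]). area (set r)) = ?S \<union> ?T" by auto
 have sc: "simply_connected (?S \<union> ?T)" using snoc.prems(4) unfolding U .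
 show ?case
 proof (cases "rs = []")
  case True
  then show ?thesis using runs by (simp add: tree_runs_def)
 next
  case False
  then obtain s where s: "s \<in> set rs" "touches r s" using snoc.prems(1) by auto
  have "ANR (\<Union>((\<lambda>s. area (set s)) ` set (rs @ [r])))"
  proof (rule ANR_finite_Union_convex_closed)
   fix C assume "C \<in> (\<lambda>s. area (set s)) ` set (rs @ [r])"
   then obtain s where "s \<in> set (rs @ [r])" "C = area (set s)" by blast
   then show "closed C" "convex C" using clS convex_run[OF runs] by auto
  qed simp
  then have "locally path_connected (?S \<union> ?T)" unfolding U using ANR_imp_locally_path_connected by blast
  then have uni: "unicoherent (?S \<union> ?T)"
   using sc simply_connected_imp_Borsukian Borsukian_imp_unicoherent by blast
  have conT: "connected ?T" by (rule connected_runs) (use snoc.prems(1) runs in auto)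
  have conS: "connected ?S"
   by (rule convex_connected[OF conjunct1[OF convex_run]]) (use runs in simp)
  have con: "connected (?S \<inter> ?T)"
   by (rule unicoherentD[OF uni conS conT refl])
    (use clS clT[of "set rs"] in \<open>auto intro!: closed_subset\<close>)
  \<comment> \<open>A common point would lie in three different rows, but a height lies in at most
    two closed unit intervals.\<close>
  have apart: "?S \<inter> area (set u) \<inter> area (set v) = {}"
   if uv: "u \<in> set rs" "v \<in> set rs" "u ~= v" "touches r u" for u v
  proof (rule ccontr)
   assume ne: "?S \<inter> area (set u) \<inter> area (set v) ~= {}"
   have P: "maximal_run P u" "maximal_run P v" "maximal_run P r" using snoc.prems(3) uv by auto
   obtain a1 b1 y1 where 1: "a1 < b1" "u = row_list a1 b1 y1"
     "area (set u) = {of_int a1 .. of_int b1} \<times> {of_int y1 .. of_int y1 + 1}"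
    by (rule maximal_run_row[OF P(1)])
   obtain a2 b2 y2 where 2: "a2 < b2" "v = row_list a2 b2 y2"
     "area (set v) = {of_int a2 .. of_int b2} \<times> {of_int y2 .. of_int y2 + 1}"
    by (rule maximal_run_row[OF P(2)])
   obtain a3 b3 y3 where 3: "a3 < b3" "r = row_list a3 b3 y3"
     "area (set r) = {of_int a3 .. of_int b3} \<times> {of_int y3 .. of_int y3 + 1}"
    by (rule maximal_run_row[OF P(3)])
   obtain p q where pq: "(p, q) \<in> ?S" "(p, q) \<in> area (set u)" "(p, q) \<in> area (set v)" using ne by auto
   have same: "l = l'" if "maximal_run P l" "maximal_run P l'" "l = row_list a b y" "l' = row_list a' b' y"
     "a < b" "a' < b'" "(p, q) \<in> area (set l)" "(p, q) \<in> area (set l')" for l l' a b a' b' y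
   proof -
    have "area ({a..<b} \<times> {y}) \<inter> area ({a'..<b'} \<times> {y}) ~= {}"
     using that(7,8) unfolding that(3,4) set_row_list by blast
    with maximal_runs_apart[of P a b y a' b'] that show ?thesis by simp
   qed
   have nr: "u ~= r" "v ~= r" using snoc.prems(2) uv by auto
   have "y1 ~= y2" using same[OF P(1,2) 1(2), of a2 b2] 1 2 pq uv(3) by blast
   moreover have "y1 ~= y3" using same[OF P(1,3) 1(2), of a3 b3] 1 3 pq nr(1) by blast
   moreover have "y2 ~= y3" using same[OF P(2,3) 2(2), of a3 b3] 2 3 pq nr(2) by blast
   moreover have "of_int y1 \<le> q" "q \<le> of_int y1 + 1" "of_int y2 \<le> q" "q \<le> of_int y2 + 1"
     "of_int y3 \<le> q" "q \<le> of_int y3 + 1"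
    using pq unfolding 1(3) 2(3) 3(3) by auto
   ultimately show False by linarith
  qed
  have uniq: "v = s" if "v \<in> set rs" "touches r v" for v
  proof (rule ccontr)
   assume "v ~= s"
   let ?A = "?S \<inter> area (set s)" and ?B = "?S \<inter> (\<Union>u\<in>set rs - {s}. area (set u))"
   have e: "?S \<inter> ?T = ?A \<union> ?B" using s(1) by blast
   have "\<not> connected (?A \<union> ?B)"
   proof (rule disconnected_Un)
    show "?A \<inter> ?B = {}" using apart[OF s(1) _ _ s(2)] by blast
    show "?A ~= {}" using s(2) unfolding touches_area .
    show "?B ~= {}" using that \<open>v ~= s\<close> unfolding touches_area by blast
    show "closed ?A" "closed ?B" using clS clT[of "set rs - {s}"] by (simp_all add: closed_Int del: UN_simps)
   qed
   with con e show False by (simp only:)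
  qed
  have "v \<in> set (filter (touches r) (rev rs)) \<longleftrightarrow> v = s" for v
   unfolding set_filter set_rev using uniq[of v] s by fast
  then have single: "set (filter (touches r) (rev rs)) = {s}" by (intro set_eqI) (simp only: singleton_iff)
  have "distinct rs" using snoc.prems(2) by (simp only: distinct_append)
  then have "distinct (filter (touches r) (rev rs))" by (intro distinct_filter) (simp only: distinct_rev)
  from distinct_card[OF this] have len: "length (filter (touches r) (rev rs)) = 1" unfolding single by simp
  let ?K = "?S \<inter> area (set s)"
  have K: "?S \<inter> ?T = ?K" using uniq s(1) unfolding touches_area by blast
  have Kc: "convex ?K" "closed ?K" "?K ~= {}"
  proof -
   show "convex ?K"
    by (rule convex_Int[OF conjunct1[OF convex_run[OF runs]] conjunct1[OF convex_run[OF runs]]]) (simp_all add: s(1))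
   show "closed ?K" by (rule closed_Int[OF clS]) (rule closed_area, simp)
   show "?K ~= {}" using s(2) unfolding touches_area .
  qed
  \<comment> \<open>The last run is projected onto its convex intersection \<open>?K\<close> with
    the rest; a point of \<open>?K\<close> is its own nearest point, so both branches agree
    there.\<close>
  let ?h = "\<lambda>x. if x \<in> ?T then x else closest_point ?K x"
  have "continuous_on (?T \<union> ?S) ?h"
  proof (rule continuous_on_cases)
   show "closed ?T" "closed ?S" using clT[of "set rs"] clS by auto
   show "continuous_on ?T (\<lambda>x. x)" by (rule continuous_on_id)
   show "continuous_on ?S (closest_point ?K)" using continuous_on_closest_point[OF Kc] by blast
   show "\<forall>x. x \<in> ?T \<and> x \<notin> ?T \<or> x \<in> ?S \<and> x \<in> ?T --> x = closest_point ?K x"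
   proof (intro allI impI)
    fix x assume "x \<in> ?T \<and> x \<notin> ?T \<or> x \<in> ?S \<and> x \<in> ?T"
    then have "x \<in> ?S \<inter> ?T" by blast
    then show "x = closest_point ?K x" unfolding K by (simp only: closest_point_self)
   qed
  qed
  then have cont: "continuous_on (?S \<union> ?T) ?h" by (simp only: Un_commute)
  have "?K \<subseteq> ?T" using K by blast
  then have to_T: "?h x \<in> ?T" for x
   using closest_point_in_set[OF Kc(2,3), of x] by (auto simp del: UN_iff)
  have fix_T: "?h x = x" if "x \<in> ?T" for x using that by (simp only: if_True)
  have "retraction (?S \<union> ?T) ?T ?h"
   unfolding retraction_def
  proof (intro conjI)
   show "?T \<subseteq> ?S \<union> ?T" by (rule Un_upper2)
   show "continuous_on (?S \<union> ?T) ?h" by (rule cont)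
   show "?h \<in> (?S \<union> ?T) \<rightarrow> ?T" by (rule Pi_I) (rule to_T)
   show "\<forall>x\<in>?T. ?h x = x" by (rule ballI) (rule fix_T)
  qed
  then have "simply_connected ?T" using retract_of_simply_connected[OF sc] retract_of_def by blast
  then have "tree_runs rs" using snoc.IH snoc.prems by auto
  then show ?thesis using len runs by (simp add: tree_runs_def)
 qed
qed

text \<open>The bound on the number of runs and the absence of repetitions keep the list small
  enough for a certificate.\<close>

theorem simply_connected_runs:
 assumes "finite P" "P ~= {}" "simply_connected (area P)"
 obtains rs where "tree_runs rs" "rs ~= []" "\<Union>(set ` set rs) = P" "length rs \<le> card P" "!!r. r \<in> set rs ==> distinct r"
proof -
 obtain f where f: "!!c. c \<in> P ==> maximal_run P (f c) \<and> c \<in> set (f c)"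
 proof -
  have "\<forall>c\<in>P. \<exists>r. maximal_run P r \<and> c \<in> set r"
   using maximal_run_exists[OF assms(1)] by blast
  from bchoice[OF this] show ?thesis using that by blast
 qed
 let ?R = "f ` P"
 have run: "is_run r \<and> maximal_run P r \<and> set r \<subseteq> P \<and> distinct r" if "r \<in> ?R" for r
 proof -
  have max: "maximal_run P r" using that f by auto
  then obtain a b y where r: "a < b" "r = row_list a b y" "{a..<b} \<times> {y} \<subseteq> P"
   unfolding maximal_run_def by blast
  have "distinct r" unfolding r(2) row_list_def by (simp add: distinct_map inj_on_def)
  then show ?thesis using max is_run_row_list[OF r(1)] r by (simp add: set_row_list)
 qed
 have UR: "\<Union>(set ` ?R) = P" using f run by blast
 have area: "(\<Union>r\<in>?R. area (set r)) = area P" using UR unfolding area_def by blast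
 have con: "connected (area P)" using assms(3) simply_connected_imp_connected by blast
 have "\<exists>rs. distinct rs \<and> set rs = ?R \<and> chk (\<lambda>r seen. seen ~= [] --> (\<exists>s\<in>set seen. touches r s)) rs"
 \<comment> \<open>Without contact the area would split into two disjoint nonempty closed sets,
   contrary to connectedness.\<close>
 proof (rule enumeration[of ?R touches])
  show "finite ?R" using assms(1) by simp
  fix A assume A: "A \<subseteq> ?R" "A ~= {}" "A ~= ?R"
  let ?X = "\<Union>r\<in>A. area (set r)" and ?Y = "\<Union>r\<in>?R - A. area (set r)"
  have fin: "finite A" "finite (?R - A)" using A assms(1) finite_subset by auto
  have cl: "closed ?X" "closed ?Y"
   using fin closed_area by (auto intro!: closed_UN)
  have U: "area P = ?X \<union> ?Y" unfolding area[symmetric] using A(1) by blast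
  have area_ne: "area (set r) ~= {}" if "r \<in> ?R" for r using run[OF that] convex_run[of r] by simp
  obtain a where a: "a \<in> A" using A(2) by auto
  obtain b where b: "b \<in> ?R - A" using A(1,3) by auto
  have "area (set a) ~= {}" "area (set b) ~= {}" using a b A(1) by (auto intro!: area_ne)
  then have ne: "?X ~= {}" "?Y ~= {}" using a b by (fastforce simp del: image_eqI)+
  have "connected (?X \<union> ?Y)" using con by (simp only: U)
  then have "?X \<inter> ?Y ~= {}" using disconnected_Un[OF cl _ ne] by blast
  then show "\<exists>b\<in>?R - A. \<exists>a\<in>A. touches b a" unfolding touches_area by blast
 qed blast
 then obtain rs where rs: "distinct rs" "set rs = ?R"
  "chk (\<lambda>r seen. seen ~= [] --> (\<exists>s\<in>set seen. touches r s)) rs" by blast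
 have "tree_runs rs"
  by (rule simply_connected_chain_tree[OF rs(3,1), of P]) (use run rs(2) area assms(3) in auto)
 moreover have "rs ~= []" using rs(2) assms(2) by auto
 moreover have "length rs \<le> card P" using distinct_card[OF rs(1)] rs(2) card_image_le[OF assms(1), of f] by simp
 moreover have "\<Union>(set ` set rs) = P" unfolding rs(2) by (rule UR)
 moreover have "distinct r" if "r \<in> set rs" for r using run that unfolding rs(2) by blast
 ultimately show ?thesis using that by blast
qed

subsection \<open>Edge connectivity\<close>

definition adjacent :: "cell => cell => bool" where
 "adjacent c d \<longleftrightarrow> cell_edges c \<inter> cell_edges d ~= {}"

definition linked :: "cell list => bool" where
 "linked cs \<longleftrightarrow> chk (\<lambda>c seen. seen ~= [] --> (\<exists>d\<in>set seen. adjacent c d)) cs"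

lemma edge_connected_linked:
 assumes "finite P" "edge_connected P"
 obtains cs where "distinct cs" "set cs = P" "linked cs"
proof (rule enumeration[of P adjacent])
 fix A assume A: "A \<subseteq> P" "A ~= {}" "A ~= P"
 then obtain a b where ab: "a \<in> A" "b \<in> P - A" by blast
 then have "(a, b) \<in> {(a, b). a \<in> P \<and> b \<in> P \<and> cell_edges a \<inter> cell_edges b ~= {}}\<^sup>*"
  using assms(2) A(1) unfolding edge_connected_def by blast
 \<comment> \<open>Some step of the path leaves \<open>A\<close>.\<close>
 then have "a \<in> A ==> b \<notin> A ==> \<exists>b\<in>P - A. \<exists>a\<in>A. adjacent b a"
 proof (induction rule: rtrancl_induct)
  case (step y z)
  then show ?case unfolding adjacent_def by (cases "y \<in> A") blast+
 qed simp
 then show "\<exists>b\<in>P - A. \<exists>a\<in>A. adjacent b a" using ab by blast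
qed (use assms that in \<open>auto simp: linked_def\<close>)

lemma linked_edge_connected: "linked cs ==> edge_connected (set cs)"
proof (induction cs rule: rev_induct)
 case Nil
 show ?case by (simp add: edge_connected_def)
next
 case (snoc c cs)
 let ?r = "\<lambda>P. {(a, b). a \<in> P \<and> b \<in> P \<and> cell_edges a \<inter> cell_edges b ~= {}}"
 have IH: "edge_connected (set cs)" using snoc by (simp add: linked_def)
 have mono: "(?r (set cs))\<^sup>* \<subseteq> (?r (set (cs @ [c])))\<^sup>*" by (rule rtrancl_mono) auto
 have sym: "(b, a) \<in> (?r P)\<^sup>*" if "(a, b) \<in> (?r P)\<^sup>*" for a b P
 proof -
  have "sym (?r P)" by (auto simp: sym_def)
  then show ?thesis using that sym_rtrancl[of "?r P"] by (auto dest: symD)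
 qed
 show ?case
 proof (cases "cs = []")
  case True
  then show ?thesis by (simp add: edge_connected_def)
 next
  case False
  then obtain d where d: "d \<in> set cs" "adjacent c d" using snoc.prems by (auto simp: linked_def)
  have dc: "(d, c) \<in> (?r (set (cs @ [c])))\<^sup>*"
   using d unfolding adjacent_def by (intro r_into_rtrancl) auto
  have "(d, x) \<in> (?r (set (cs @ [c])))\<^sup>*" if "x \<in> set (cs @ [c])" for x
  proof (cases "x \<in> set cs")
   case True
   then have "(d, x) \<in> (?r (set cs))\<^sup>*" using IH d(1) unfolding edge_connected_def by blast
   then show ?thesis using mono by blast
  next
   case False
   then show ?thesis using that dc by simp
  qed
  note d_to = this
  show ?thesis
   unfolding edge_connected_def
  proof (intro ballI)
   fix x y assume "x \<in> set (cs @ [c])" "y \<in> set (cs @ [c])"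
   from rtrancl_trans[OF sym[OF d_to[OF this(1)]] d_to[OF this(2)]]
   show "(x, y) \<in> (?r (set (cs @ [c])))\<^sup>*" .
  qed
 qed
qed

section \<open>Tiling a region is in NP\<close>

text \<open>Coordinates are offsets from the position of the tile, and \<open>True\<close> marks a
  vertical segment. Offsets are natural numbers, so placing a tile takes only a few successor steps
  on binary coordinates.\<close>

type_synonym tile_table = "(nat \<times> nat) list \<times> ((bool \<times> nat \<times> nat) \<times> nat) list"

definition mk_cell :: "cell => nat \<times> nat => cell" where
 "mk_cell v c = (fst v + int (fst c), snd v + int (snd c))"

definition mk_edge :: "cell => bool \<times> nat \<times> nat => edge" where
 "mk_edge v e = (if fst e then Ver (mk_cell v (snd e)) else Hor (mk_cell v (snd e)))"

definition tcells :: "cell \<times> tile_table => cell list" where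
 "tcells p = map (mk_cell (fst p)) (fst (snd p))"

definition tedges :: "cell \<times> tile_table => (edge \<times> nat) list" where
 "tedges p = map (\<lambda>e. (mk_edge (fst p) (fst e), snd e)) (snd (snd p))"

definition tile_at :: "cell \<times> tile_table => colored_cells" where
 "tile_at p = (set (tcells p), map_of (tedges p))"

lemma mk_cell_inject: "mk_cell v c = mk_cell v d \<longleftrightarrow> c = d"
 by (auto simp: mk_cell_def prod_eq_iff)

lemma mk_edge_inject: "mk_edge v e = mk_edge v d \<longleftrightarrow> e = d"
 by (cases e; cases d) (simp add: mk_edge_def mk_cell_inject)

lemma translate_mk_edge: "translate_edge (- u) e = mk_edge v d \<longleftrightarrow> e = mk_edge (v + u) d"
 by (cases e) (auto simp: mk_edge_def mk_cell_def algebra_simps prod_eq_iff)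

lemma translate_tile_at: "translate u (tile_at (v, t)) = tile_at (v + u, t)"
proof -
 have "map_of (map (\<lambda>e. (mk_edge v (fst e), snd e)) es) (translate_edge (- u) e) =
   map_of (map (\<lambda>e. (mk_edge (v + u) (fst e), snd e)) es) e" for e and es :: "((bool \<times> nat \<times> nat) \<times> nat) list"
  by (induction es) (auto simp: translate_mk_edge)
 moreover have "mk_cell v c + u = mk_cell (v + u) c" for c by (simp add: mk_cell_def prod_eq_iff)
 then have "(\<lambda>c. c + u) ` set (map (mk_cell v) cs) = set (map (mk_cell (v + u)) cs)" for cs
  by (simp add: image_image)
 ultimately show ?thesis unfolding translate_def tile_at_def by (auto simp: tcells_def tedges_def)
qed

section \<open>Boundary segments and certificates\<close>

definition edge_list :: "cell => edge list" where
 "edge_list c = [Hor c, Hor (fst c, snd c + 1), Ver c, Ver (fst c + 1, snd c)]"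

lemma set_edge_list: "set (edge_list c) = cell_edges c"
 by (cases c) (auto simp: edge_list_def)

definition edge_mult :: "cell list => edge => nat" where
 "edge_mult cs e = length (filter (\<lambda>c. e \<in> set (edge_list c)) cs)"

lemma boundary_mult: "distinct cs ==> e \<in> boundary_edges (set cs) \<longleftrightarrow> edge_mult cs e = 1"
proof -
 assume "distinct cs"
 then have "edge_mult cs e = card {c \<in> set cs. e \<in> cell_edges c}"
  unfolding edge_mult_def set_edge_list by (metis distinct_card distinct_filter set_filter)
 then have "edge_mult cs e = 1 \<longleftrightarrow> (\<exists>c. {c \<in> set cs. e \<in> cell_edges c} = {c})" by (simp add: card_1_singleton_iff)
 also have "\<dots> \<longleftrightarrow> (\<exists>!c. c \<in> set cs \<and> e \<in> cell_edges c)" unfolding set_eq_iff mem_Collect_eq singleton_iff by metis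
 finally show ?thesis unfolding boundary_edges_def by simp
qed

text \<open>The region is repeated inside the witness: the verifier encodes it anew and compares the
  result with the input, which avoids decoding the input. It is followed by an enumeration for edge
  connectivity, the runs, and the placed tiles.\<close>

type_synonym witness = "(cell list \<times> (edge \<times> nat) list) \<times> (cell list \<times> cell list list) \<times> (cell \<times> tile_table) list"

text \<open>Both kinds of matching, between copies and with the boundary, amount to this list being
  functional.\<close>

definition all_edges :: "(edge \<times> nat) list => (cell \<times> tile_table) list => (edge \<times> nat) list" where
 "all_edges bs q = concat (map tedges q) @ bs"

definition verify :: "tile_table list => bool list \<times> witness => bool" where
 "verify ts p = (let w = fst p; cs = fst (fst (snd p)); bs = snd (fst (snd p));
   co = fst (fst (snd (snd p))); rs = snd (fst (snd (snd p))); q = snd (snd (snd p)) in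
  w = region_code cs bs \<and> distinct cs \<and> distinct (map fst bs) \<and> cs ~= [] \<and>
  list_all (\<lambda>c. c \<in> set co) cs \<and> list_all (\<lambda>c. c \<in> set cs) co \<and>
  chk (\<lambda>c seen. seen ~= [] --> list_ex (\<lambda>d. list_ex (\<lambda>e. e \<in> set (edge_list d)) (edge_list c)) seen) co \<and>
  list_all (\<lambda>c. c \<in> set (concat rs)) cs \<and> list_all (\<lambda>c. c \<in> set cs) (concat rs) \<and> tree_runs rs \<and>
  list_all (\<lambda>e. edge_mult cs e = 1) (map fst bs) \<and>
  list_all (\<lambda>c. list_all (\<lambda>e. edge_mult cs e = 1 --> e \<in> set (map fst bs)) (edge_list c)) cs \<and>
  list_all (\<lambda>p. snd p \<in> set ts) q \<and>
  list_all (\<lambda>c. c \<in> set (concat (map tcells q))) cs \<and> list_all (\<lambda>c. c \<in> set cs) (concat (map tcells q)) \<and>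
  distinct (concat (map tcells q)) \<and>
  list_all (\<lambda>a. list_all (\<lambda>b. fst a = fst b --> snd a = snd b) (all_edges bs q)) (all_edges bs q))"

subsection \<open>Verification in polynomial time\<close>

lemma length_bits_mono_Suc: "length (bits (Suc n)) \<le> Suc (length (bits n))"
proof (induction n rule: less_induct)
 case (less n)
 show ?case
 proof (cases "n = 0")
  case True
  then show ?thesis by (simp add: bits.simps[of "Suc 0"])
 next
  case False
  have b: "bits n = odd n # bits (n div 2)" "bits (Suc n) = odd (Suc n) # bits (Suc n div 2)"
   using False bits.simps[of n] bits.simps[of "Suc n"] by simp_all
  show ?thesis
  proof (cases "even n")
   case True
   then have "Suc n div 2 = n div 2" by presburger
   then show ?thesis unfolding b by simp
  next
   case odd: False
   then have "Suc n div 2 = Suc (n div 2)" by presburger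
   moreover have "n div 2 < n" using False by simp
   ultimately show ?thesis unfolding b using less by simp
  qed
 qed
qed

lemma length_bits_add: "length (bits (m + n)) \<le> length (bits m) + n"
proof (induction n)
 case (Suc n)
 then show ?case using length_bits_mono_Suc[of "m + n"] by simp
qed simp

lemma length_bits_mono: "m \<le> n ==> length (bits m) \<le> length (bits n)"
proof (induction n arbitrary: m rule: less_induct)
 case (less n)
 show ?case
 proof (cases "m = 0")
  case False
  then have "bits m = odd m # bits (m div 2)" "bits n = odd n # bits (n div 2)"
   using less.prems bits.simps[of m] bits.simps[of n] by simp_all
  moreover have "length (bits (m div 2)) \<le> length (bits (n div 2))"
   by (rule less.IH) (use less.prems False in \<open>auto simp: div_le_mono\<close>)
  ultimately show ?thesis by simp
 qed simp
qed

lemma sz_int: "sz (z :: int) = Suc (sz (z < 0) + sz (bits (nat \<bar>z\<bar>)))"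
 by (simp add: sz_def enc_int_def)

lemma sz_int_le: "sz (z :: int) \<le> 4 * length (bits (nat \<bar>z\<bar>)) + 5"
 using sz_bool[of "z < 0"] sz_bool_list[of "bits (nat \<bar>z\<bar>)"] by (simp add: sz_int)

text \<open>The second summand is unary, so repeated successors take polynomial time; the binary
  length grows by at most one bit per step.\<close>

lemma PT_int_add [PT_rules]:
 assumes "PT z" "PT n"
 shows "PT (\<lambda>x. z x + int (n x))"
proof -
 have f: "fold (\<lambda>_ z. z + 1) us z = z + int (length us)" for us :: "unit list" and z
  by (induction us arbitrary: z) auto
 have "PT (\<lambda>p :: int \<times> nat. fold (\<lambda>_ z. z + 1) (replicate (snd p) ()) (fst p))"
 proof (rule PT_fold[where F="\<lambda>_ _ z. z + 1"])
  show "PT (\<lambda>p :: (int \<times> nat) \<times> unit \<times> int. snd (snd p) + 1)" by (intro PT_rules)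
  show "pb (\<lambda>n. 4 * (n + n) + 5)" by (intro pb_intros)
  fix p :: "int \<times> nat" and ys zs
  assume "replicate (snd p) () = ys @ zs"
  from arg_cong[OF this, of length] have le: "length ys \<le> snd p" by simp
  have "nat \<bar>fst p + int (length ys)\<bar> \<le> nat \<bar>fst p\<bar> + length ys" by linarith
  from length_bits_mono[OF this] length_bits_add[of "nat \<bar>fst p\<bar>" "length ys"]
  have "length (bits (nat \<bar>fst p + int (length ys)\<bar>)) \<le> length (bits (nat \<bar>fst p\<bar>)) + length ys" by simp
  moreover have "length (bits (nat \<bar>fst p\<bar>)) \<le> sz (fst p)"
   using length_le_sz[of "bits (nat \<bar>fst p\<bar>)"] by (simp add: sz_int)
  moreover have "length ys \<le> sz (snd p)" using le by (simp add: sz_nat)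
  ultimately have "4 * length (bits (nat \<bar>fst p + int (length ys)\<bar>)) + 5 \<le> 4 * (sz p + sz p) + 5"
   by (cases p) simp
  then show "sz (fold (\<lambda>_ z. z + 1) ys (fst p)) \<le> 4 * (sz p + sz p) + 5"
   unfolding f using sz_int_le[of "fst p + int (length ys)"] by simp
 qed (intro PT_rules)+
 then have "PT (\<lambda>p :: int \<times> nat. fst p + int (snd p))" unfolding f by simp
 from PT_comp[OF this PT_Pair[OF assms]] show ?thesis by simp
qed

lemma PT_mk_cell [PT_rules]: "PT v ==> PT c ==> PT (\<lambda>x. mk_cell (v x) (c x))"
 unfolding mk_cell_def by (intro PT_rules)

lemma PT_mk_edge [PT_rules]: "PT v ==> PT e ==> PT (\<lambda>x. mk_edge (v x) (e x))"
 unfolding mk_edge_def by (intro PT_rules)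

lemma PT_tcells [PT_rules]: "PT p ==> PT (\<lambda>x. tcells (p x))"
 by (rule PT_comp[of tcells]) (unfold tcells_def, intro PT_rules)

lemma PT_tedges [PT_rules]: "PT p ==> PT (\<lambda>x. tedges (p x))"
 by (rule PT_comp[of tedges]) (unfold tedges_def, intro PT_rules)

lemma PT_edge_list [PT_rules]: "PT c ==> PT (\<lambda>x. edge_list (c x))"
 by (rule PT_comp[of edge_list]) (unfold edge_list_def, intro PT_rules)

lemma PT_mult_edge [PT_rules]: "PT cs ==> PT e ==> PT (\<lambda>x. edge_mult (cs x) (e x))"
proof -
 assume a: "PT cs" "PT e"
 have "PT (\<lambda>p. edge_mult (fst p) (snd p))" unfolding edge_mult_def by (intro PT_rules)
 from PT_comp[OF this PT_Pair[OF a]] show ?thesis by simp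
qed

lemma near_iff: "near c d \<longleftrightarrow>
  (fst d = fst c \<or> fst d = fst c + 1 \<or> fst c = fst d + 1) \<and> (snd d = snd c \<or> snd d = snd c + 1 \<or> snd c = snd d + 1)"
 by (cases c; cases d) simp

lemma PT_touches [PT_rules]: "PT r ==> PT s ==> PT (\<lambda>x. touches (r x) (s x))"
proof -
 assume a: "PT r" "PT s"
 have "PT (\<lambda>p. touches (fst p) (snd p))" unfolding touches_def near_iff by (intro PT_rules)
 from PT_comp[OF this PT_Pair[OF a]] show ?thesis by simp
qed

lemma PT_is_run [PT_rules]: "PT r ==> PT (\<lambda>x. is_run (r x))"
 by (rule PT_comp[of is_run]) (unfold is_run_def, intro PT_rules)

lemma PT_tree_runs [PT_rules]: "PT r ==> PT (\<lambda>x. tree_runs (r x))"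
 by (rule PT_comp[of tree_runs]) (unfold tree_runs_def, intro PT_rules)

lemma PT_all_edges [PT_rules]: "PT bs ==> PT q ==> PT (\<lambda>x. all_edges (bs x) (q x))"
 unfolding all_edges_def by (intro PT_rules)

lemma PT_verify: "PT (verify ts)"
 unfolding verify_def Let_def by (intro PT_rules)

subsection \<open>Correctness\<close>

text \<open>The origin is required as a cell of each table so that the position of a placed tile is
  a cell of the region; this bounds the size of positions in certificates.\<close>

locale tile_set =
 fixes ts :: "tile_table list"
 assumes ts: "!!t. t \<in> set ts ==> distinct (fst t) \<and> distinct (map fst (snd t)) \<and> (0, 0) \<in> set (fst t)"
  and boundary: "!!v t. t \<in> set ts ==> dom (snd (tile_at (v, t))) = boundary_edges (fst (tile_at (v, t)))"
begin

definition tiles :: "colored_cells set" where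
 "tiles = (\<lambda>t. tile_at ((0, 0), t)) ` set ts"

lemma copies: "{translate v t | v t. t \<in> tiles} = {tile_at (v, t) | v t. t \<in> set ts}"
proof -
 have "translate v (tile_at ((0, 0), t)) = tile_at (v, t)" for v t
  by (simp add: translate_tile_at flip: zero_prod_def)
 moreover have "{translate v t | v t. t \<in> tiles} = {translate v (tile_at ((0, 0), t)) | v t. t \<in> set ts}"
  unfolding tiles_def by blast
 ultimately show ?thesis by (simp only:)
qed

lemma tile_edges:
 assumes "snd p \<in> set ts"
 shows "snd (tile_at p) e = Some k \<longleftrightarrow> (e, k) \<in> set (tedges p)"
  and "e \<in> boundary_edges (fst (tile_at p)) \<longleftrightarrow> e \<in> fst ` set (tedges p)"
proof -
 have "distinct (map fst (snd (snd p)))" using ts[OF assms] by simp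
 then have "distinct (map fst (tedges p))"
  unfolding tedges_def by (auto simp: distinct_map inj_on_def mk_edge_inject)
 then show 1: "snd (tile_at p) e = Some k \<longleftrightarrow> (e, k) \<in> set (tedges p)"
  unfolding tile_at_def by simp
 show "e \<in> boundary_edges (fst (tile_at p)) \<longleftrightarrow> e \<in> fst ` set (tedges p)"
  using boundary[OF assms, of "fst p"] unfolding prod.collapse tile_at_def by (auto simp: dom_map_of_conv_image_fst)
qed

lemma tile_distinct: "snd p \<in> set ts ==> distinct (tcells p) \<and> tcells p ~= []"
 using ts[of "snd p"] by (auto simp: tcells_def distinct_map inj_on_def mk_cell_inject)

lemma edges_nonempty: "e \<in> boundary_edges P ==> \<exists>c\<in>P. e \<in> cell_edges c"
 unfolding boundary_edges_def by blast

lemma distinct_concat_disjoint: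
 "distinct (concat (map f q)) ==> p \<in> set q ==> p' \<in> set q ==> p ~= p' ==> set (f p) \<inter> set (f p') = {}"
 by (induction q) auto

lemma linked_iff:
 "linked co \<longleftrightarrow>
  chk (\<lambda>c seen. seen ~= [] --> list_ex (\<lambda>d. list_ex (\<lambda>e. e \<in> set (edge_list d)) (edge_list c)) seen) co"
proof -
 have "list_ex (\<lambda>d. list_ex (\<lambda>e. e \<in> set (edge_list d)) (edge_list c)) seen \<longleftrightarrow> (\<exists>d\<in>set seen. adjacent c d)" for c seen
  unfolding list_ex_iff set_edge_list adjacent_def by blast
 then show ?thesis unfolding linked_def by simp
qed

lemma verify_sound:
 assumes "verify ts (w, x)"
 shows "w \<in> tiling_problem tiles"
proof -
 obtain cs bs co rs q where x: "x = ((cs, bs), (co, rs), q)" by (metis prod.collapse)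
 from assms have w: "w = region_code cs bs" and cs: "distinct cs" "cs ~= []" and bs: "distinct (map fst bs)"
  and co: "set co = set cs" and linked: "linked co"
  and rs: "set (concat rs) = set cs" "tree_runs rs"
  and bnd: "!!e. e \<in> fst ` set bs ==> edge_mult cs e = 1"
   "!!c e. c \<in> set cs ==> e \<in> cell_edges c ==> edge_mult cs e = 1 ==> e \<in> fst ` set bs"
  and q: "!!p. p \<in> set q ==> snd p \<in> set ts" "set (concat (map tcells q)) = set cs" "distinct (concat (map tcells q))"
  and E: "!!e k k'. (e, k) \<in> set (all_edges bs q) ==> (e, k') \<in> set (all_edges bs q) ==> k = k'"
  unfolding x verify_def Let_def linked_iff[symmetric] fst_conv snd_conv
  unfolding list_all_iff set_edge_list by auto
 have "rs ~= []" using rs(1) cs(2) by auto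
 have "\<Union>(set ` set rs) = set cs" using rs(1) by auto
 with tree_runs_simply_connected[OF rs(2) \<open>rs ~= []\<close>] have sc: "simply_connected (\<Union>c\<in>set cs. square c)"
  by (simp add: area_def)
 have ec: "edge_connected (set cs)" using linked_edge_connected[OF linked] co by simp
 have poly: "polyomino (set cs)" unfolding polyomino_def using sc ec cs(2) by simp
 have dom: "dom (map_of bs) = boundary_edges (set cs)"
  unfolding dom_map_of_conv_image_fst
 proof (intro set_eqI iffI)
  fix e assume "e \<in> fst ` set bs"
  from bnd(1)[OF this] show "e \<in> boundary_edges (set cs)" using boundary_mult[OF cs(1), of e] by simp
 next
  fix e assume e: "e \<in> boundary_edges (set cs)"
  then obtain c where c: "c \<in> set cs" "e \<in> cell_edges c" using edges_nonempty by blast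
  from bnd(2)[OF this] show "e \<in> fst ` set bs" using e boundary_mult[OF cs(1), of e] by simp
 qed
 have col: "colored_polyomino (set cs, map_of bs)" unfolding colored_polyomino_def using poly dom by simp
 have "tiles_region tiles (set cs, map_of bs)"
  unfolding tiles_region_def copies
 proof (intro exI[of _ "tile_at ` set q"] conjI ballI impI)
  show "tile_at ` set q \<subseteq> {tile_at (v, t) | v t. t \<in> set ts}" using q(1) by force
  show "(\<Union>t\<in>tile_at ` set q. fst t) = fst (set cs, map_of bs)"
   using q(2) by (auto simp: tile_at_def)
  fix a b assume ab: "a \<in> tile_at ` set q" "b \<in> tile_at ` set q"
  then obtain p p' where p: "p \<in> set q" "a = tile_at p" "p' \<in> set q" "b = tile_at p'" by blast
  show "fst a \<inter> fst b = {}" if "a ~= b"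
  proof -
   have "p ~= p'" using that p by auto
   then show ?thesis using distinct_concat_disjoint[OF q(3) p(1,3)] p by (simp add: tile_at_def)
  qed
  show "snd a e = snd b e" if e: "e \<in> boundary_edges (fst a) \<inter> boundary_edges (fst b)" for e
  proof -
   obtain k k' where k: "(e, k) \<in> set (tedges p)" "(e, k') \<in> set (tedges p')"
    using e tile_edges(2)[OF q(1)[OF p(1)]] tile_edges(2)[OF q(1)[OF p(3)]] p by force
   then have "k = k'" using E[of e k k'] p by (auto simp: all_edges_def)
   then show ?thesis using k tile_edges(1)[OF q(1)[OF p(1)]] tile_edges(1)[OF q(1)[OF p(3)]] p by metis
  qed
  show "snd a e = snd (set cs, map_of bs) e"
   if e: "e \<in> boundary_edges (fst a) \<inter> boundary_edges (fst (set cs, map_of bs))" for e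
  proof -
   obtain k where k: "(e, k) \<in> set (tedges p)"
    using e tile_edges(2)[OF q(1)[OF p(1)]] p by force
   obtain k' where k': "map_of bs e = Some k'" using e dom by auto
   then have "(e, k') \<in> set bs" by (rule map_of_SomeD)
   then have "k = k'" using E[of e k k'] k p by (auto simp: all_edges_def)
   then show ?thesis using k k' tile_edges(1)[OF q(1)[OF p(1)]] p by simp
  qed
 qed
 then show ?thesis unfolding tiling_problem_def w using cs(1) bs col by blast
qed

section \<open>Size of certificates\<close>

definition table_size :: nat where
 "table_size = (\<Sum>t\<leftarrow>ts. sz t)"

lemma table_size: "t \<in> set ts ==> sz t \<le> table_size"
 unfolding table_size_def by (simp add: member_le_sum_list)

text \<open>Colors are binary in the input but unary in the witness. In a tileable region every
  boundary color occurs on a tile, so its unary length is bounded by a constant of the tile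
  set.\<close>

lemma color_size: "snd p \<in> set ts ==> (e, k) \<in> set (tedges p) ==> sz k \<le> table_size"
proof -
 assume p: "snd p \<in> set ts" and "(e, k) \<in> set (tedges p)"
 then obtain d where "(d, k) \<in> set (snd (snd p))" unfolding tedges_def by auto
 from sz_mem[OF this] have "sz k \<le> sz (snd (snd p))" by simp
 also have "\<dots> \<le> sz (snd p)" by (cases "snd p") simp
 finally show ?thesis using table_size[OF p] by simp
qed

lemma length_list_code: "length (list_code f xs) = (\<Sum>x\<leftarrow>xs. Suc (length (f x))) + 1"
 by (induction xs) (auto simp: list_code_def)

lemma list_code_bounds:
 "x \<in> set xs ==> length (f x) \<le> length (list_code f xs)" "length xs \<le> length (list_code f xs)"
proof -
 show "length (f x) \<le> length (list_code f xs)" if "x \<in> set xs"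
  using member_le_sum_list[of "Suc (length (f x))" "map (\<lambda>x. Suc (length (f x))) xs"] that
  unfolding length_list_code by auto
 show "length xs \<le> length (list_code f xs)"
  unfolding length_list_code by (induction xs) auto
qed

lemma sz_int_code: "sz (z :: int) \<le> 4 * length (int_code z) + 5"
proof -
 have "length (bits n) \<le> length (nat_code n)" for n
  unfolding nat_code_def by (rule list_code_bounds(2))
 from this[of "nat \<bar>z\<bar>"] sz_int_le[of z] show ?thesis by (simp add: int_code_def)
qed

lemma sz_cell_code: "sz (c :: cell) \<le> 4 * length (cell_code c) + 11"
 using sz_int_code[of "fst c"] sz_int_code[of "snd c"] by (cases c) simp

lemma sz_edge_code: "sz e \<le> 4 * length (edge_code e) + 15"
proof -
 have "sz (Hor p) = sz (False, p)" "sz (Ver p) = sz (True, p)" for p by (simp_all add: sz_def)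
 moreover have "sz (b, p) \<le> 4 * length (cell_code p) + 15" for b :: bool and p :: cell
  using sz_cell_code[of p] sz_bool[of b] unfolding sz_Pair by linarith
 then have "sz (b, p) \<le> 4 * Suc (length (cell_code p)) + 15" for b :: bool and p :: cell
  by (rule le_trans) simp
 ultimately show ?thesis by (cases e) (auto simp del: cell_code.simps sz_Pair intro: le_trans)
qed

text \<open>\<open>m\<close> bounds a cell, an edge or a color, \<open>l\<close> a list of distinct
  cells; the summands follow the components of the witness.\<close>

definition cert_bound :: "nat => nat" where
 "cert_bound n = (let m = 4 * n + 15 + table_size + 1; l = n * (m + 1) + 1 in
  5 + (l + (n * (m + m + 1) + 1) + l + (n * (l + 1) + 1) + (n * (m + m + 1) + 1)))"

lemma verify_complete:
 assumes "w \<in> tiling_problem tiles"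
 shows "\<exists>x. sz x \<le> cert_bound (length w) \<and> verify ts (w, x)"
proof -
 obtain cs bs where w: "w = region_code cs bs" and cs: "distinct cs" and bs: "distinct (map fst bs)"
  and col: "colored_polyomino (set cs, map_of bs)" and tr: "tiles_region tiles (set cs, map_of bs)"
  using assms unfolding tiling_problem_def by blast
 have dom: "fst ` set bs = boundary_edges (set cs)"
  using col unfolding colored_polyomino_def by (simp add: dom_map_of_conv_image_fst)
 have poly: "set cs ~= {}" "edge_connected (set cs)" "simply_connected (area (set cs))"
  using col unfolding colored_polyomino_def polyomino_def area_def by simp_all
 obtain co where co: "distinct co" "set co = set cs" "linked co"
  by (rule edge_connected_linked[OF finite_set poly(2)]) (rule that)
 obtain rs where rs: "tree_runs rs" "rs ~= []" "\<Union>(set ` set rs) = set cs" "length rs \<le> card (set cs)"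
   "\<forall>r\<in>set rs. distinct r"
 proof (rule simply_connected_runs[OF finite_set poly(1) poly(3)])
  fix rs assume 1: "tree_runs rs" "rs ~= []" "\<Union>(set ` set rs) = set cs" "length rs \<le> card (set cs)"
   and 2: "!!r. r \<in> set rs ==> distinct r"
  have "\<forall>r\<in>set rs. distinct r" by (rule ballI) (rule 2)
  from that[OF 1 this] show thesis .
 qed
 from tr[unfolded tiles_region_def copies fst_conv snd_conv]
 obtain Q where Q: "Q \<subseteq> {tile_at (v, t) | v t. t \<in> set ts}" and UQ: "(\<Union>t\<in>Q. fst t) = set cs"
  and disj0: "\<forall>a\<in>Q. \<forall>b\<in>Q. a ~= b --> fst a \<inter> fst b = {}"
  and match0: "\<forall>a\<in>Q. \<forall>b\<in>Q. \<forall>e\<in>boundary_edges (fst a) \<inter> boundary_edges (fst b). snd a e = snd b e"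
  and border0: "\<forall>a\<in>Q. \<forall>e\<in>boundary_edges (fst a) \<inter> boundary_edges (set cs). snd a e = map_of bs e"
  by (elim exE conjE) (rule that)
 note disj = disj0[rule_format]
 have match: "snd a e = snd b e" if "a \<in> Q" "b \<in> Q" "e \<in> boundary_edges (fst a)" "e \<in> boundary_edges (fst b)" for a b e
  by (rule bspec[OF bspec[OF bspec[OF match0 that(1)] that(2)] IntI[OF that(3,4)]])
 have border: "snd a e = map_of bs e" if "a \<in> Q" "e \<in> boundary_edges (fst a)" "e \<in> boundary_edges (set cs)" for a e
  by (rule bspec[OF bspec[OF border0 that(1)] IntI[OF that(2,3)]])
 have "\<forall>a\<in>Q. \<exists>p. snd p \<in> set ts \<and> a = tile_at p" using Q by force
 then obtain f where f: "!!a. a \<in> Q ==> snd (f a) \<in> set ts \<and> a = tile_at (f a)" by (metis bchoice)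
 have ne: "fst a ~= {}" "fst a \<subseteq> set cs" if "a \<in> Q" for a
 proof -
  have "fst a = set (tcells (f a))" using f[OF that] by (metis fst_conv tile_at_def)
  then show "fst a ~= {}" using tile_distinct f[OF that] by auto
  show "fst a \<subseteq> set cs" using UQ that by blast
 qed
 have inj: "inj_on fst Q"
  using disj ne(1) by (metis Int_absorb inj_onI)
 have "finite (fst ` Q)" using ne(2) by (intro finite_subset[of "fst ` Q" "Pow (set cs)"]) auto
 then have finQ: "finite Q" using inj finite_imageD by blast
 \<comment> \<open>A cell picked from each copy: copies are disjoint, so there are at most as many
   copies as cells.\<close>
 define g where "g a = (SOME c. c \<in> fst a)" for a :: colored_cells
 have g: "g a \<in> fst a" if "a \<in> Q" for a unfolding g_def using ne(1)[OF that] by (simp add: some_in_eq)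
 have "inj_on g Q" using g disj by (metis disjoint_iff inj_onI)
 moreover have "g ` Q \<subseteq> set cs" using g ne(2) by blast
 ultimately have cardQ: "card Q \<le> length cs"
  using card_inj_on_le[of g Q "set cs"] distinct_card[OF cs] by simp
 obtain l where l: "distinct l" "set l = Q" using finite_distinct_list[OF finQ] by blast
 define q where "q = map f l"
 have len_q: "length q \<le> length cs" using cardQ distinct_card[OF l(1)] l(2) by (simp add: q_def)
 have q: "snd p \<in> set ts \<and> tile_at p \<in> Q" if "p \<in> set q" for p
  using that f l(2) unfolding q_def by force
 have tc: "set (tcells (f a)) = fst a" if "a \<in> Q" for a
  using f[OF that] by (metis fst_conv tile_at_def)
 have cover: "set (concat (map tcells q)) = set cs"
  unfolding q_def using UQ tc l(2) by auto
 have dist: "distinct (concat (map tcells q))"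
 proof -
  have "set k \<subseteq> Q ==> distinct k ==> distinct (concat (map tcells (map f k)))" for k
  proof (induction k)
   case (Cons a k)
   have "distinct (tcells (f a))" using tile_distinct f Cons.prems by simp
   moreover have "set (tcells (f a)) \<inter> set (concat (map tcells (map f k))) = {}"
   proof (rule ccontr)
    assume "set (tcells (f a)) \<inter> set (concat (map tcells (map f k))) ~= {}"
    then obtain b c where "b \<in> set k" "c \<in> set (tcells (f a))" "c \<in> set (tcells (f b))" by auto
    moreover from this have "b ~= a" "a \<in> Q" "b \<in> Q" using Cons.prems by auto
    ultimately show False using disj[of a b] tc by auto
   qed
   ultimately show ?case using Cons by simp
  qed simp
  then show ?thesis unfolding q_def using l by simp
 qed
 \<comment> \<open>The only cell of the region at such a segment belongs to some copy, and the
   segment then lies on the boundary of that copy.\<close>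
 have bsQ: "\<exists>p\<in>set q. (e, k) \<in> set (tedges p)" if ek: "(e, k) \<in> set bs" for e k
 proof -
  have e: "e \<in> boundary_edges (set cs)" using ek dom by force
  then obtain c where c: "c \<in> set cs" "e \<in> cell_edges c" "!!d. d \<in> set cs ==> e \<in> cell_edges d ==> d = c"
   unfolding boundary_edges_def by blast
  then obtain a where a: "a \<in> Q" "c \<in> fst a" using UQ by blast
  have "e \<in> boundary_edges (fst a)" unfolding boundary_edges_def using a c ne(2)[OF a(1)] by blast
  with border[OF a(1) this e] have "snd a e = Some k" using ek bs by simp
  then have "(e, k) \<in> set (tedges (f a))" using tile_edges(1)[of "f a"] f[OF a(1)] by simp
  then show ?thesis using a(1) l(2) unfolding q_def by auto
 qed
 have E: "k = k'" if "(e, k) \<in> set (all_edges bs q)" "(e, k') \<in> set (all_edges bs q)" for e k k'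
 proof -
  have in_q: "\<exists>p\<in>set q. (e, k) \<in> set (tedges p)" if "(e, k) \<in> set (all_edges bs q)" for k
   using that bsQ unfolding all_edges_def by auto
  note p_ex = in_q[OF that(1)] and p'_ex = in_q[OF that(2)]
  obtain p where p: "p \<in> set q" "(e, k) \<in> set (tedges p)" using p_ex by blast
  obtain p' where p': "p' \<in> set q" "(e, k') \<in> set (tedges p')" using p'_ex by blast
  have 1: "snd (tile_at p) e = Some k" "snd (tile_at p') e = Some k'"
   using p p' tile_edges(1) q by blast+
  have img: "e \<in> fst ` set (tedges p)" "e \<in> fst ` set (tedges p')"
   using imageI[OF p(2), of fst] imageI[OF p'(2), of fst] by simp_all
  have b: "e \<in> boundary_edges (fst (tile_at p))" "e \<in> boundary_edges (fst (tile_at p'))"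
   using img tile_edges(2)[of p e] tile_edges(2)[of p' e] q[OF p(1)] q[OF p'(1)] by simp_all
  have "snd (tile_at p) e = snd (tile_at p') e"
   by (rule match[OF conjunct2[OF q[OF p(1)]] conjunct2[OF q[OF p'(1)]] b])
  with 1 show ?thesis by simp
 qed
 let ?x = "((cs, bs), (co, rs), q)"
 have "verify ts (w, ?x)"
  unfolding verify_def Let_def fst_conv snd_conv
 proof (intro conjI)
  show "chk (\<lambda>c seen. seen ~= [] --> list_ex (\<lambda>d. list_ex (\<lambda>e. e \<in> set (edge_list d)) (edge_list c)) seen) co"
   using co(3) unfolding linked_iff .
  show "list_all (\<lambda>e. edge_mult cs e = 1) (map fst bs)"
   unfolding list_all_iff boundary_mult[OF cs, symmetric] using dom by simp
  show "list_all (\<lambda>c. list_all (\<lambda>e. edge_mult cs e = 1 --> e \<in> set (map fst bs)) (edge_list c)) cs"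
   unfolding list_all_iff boundary_mult[OF cs, symmetric] using dom by simp
  show "list_all (\<lambda>a. list_all (\<lambda>b. fst a = fst b --> snd a = snd b) (all_edges bs q)) (all_edges bs q)"
   unfolding list_all_iff using E by (metis prod.collapse)
 qed (use w cs bs poly(1) co rs q cover dist in \<open>auto simp: list_all_iff\<close>)
 moreover have "sz ?x \<le> cert_bound (length w)"
 proof -
  let ?n = "length w"
  let ?m = "4 * ?n + 15 + table_size + 1"
  let ?l = "?n * (?m + 1) + 1"
  have n: "length cs \<le> ?n" "length bs \<le> ?n"
   unfolding w region_code_def using list_code_bounds(2)[of cs cell_code] list_code_bounds(2)[of bs colored_edge_code] by auto
  have cell: "sz c \<le> ?m" if "c \<in> set cs" for c
   using sz_cell_code[of c] list_code_bounds(1)[OF that, of cell_code] unfolding w region_code_def by simp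
  have cells: "sz d \<le> ?l" if "distinct d" "set d \<subseteq> set cs" for d
  proof -
   have "length d \<le> length cs" using that cs by (metis card_mono distinct_card finite_set)
   moreover have "sz d \<le> length d * (?m + 1) + 1" by (rule sz_list_le) (use that cell in blast)
   ultimately show ?thesis using n(1) mult_le_mono1[of "length d" ?n "?m + 1"] by linarith
  qed
  have szbs: "sz bs \<le> ?n * (?m + ?m + 1) + 1"
  proof -
   have "sz b \<le> ?m + ?m" if "b \<in> set bs" for b
   proof -
    obtain e k where b: "b = (e, k)" by (cases b)
    have "length (colored_edge_code b) \<le> ?n"
     using list_code_bounds(1)[OF that, of colored_edge_code] unfolding w region_code_def by simp
    then have "length (edge_code e) \<le> ?n" unfolding b by simp
    then have "sz e \<le> 4 * ?n + 15" using sz_edge_code[of e] by simp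
    moreover have "sz k \<le> table_size" using bsQ[of e k] that b color_size q by blast
    ultimately show ?thesis unfolding b by simp
   qed
   from sz_list_le[of bs, OF this] n(2) mult_le_mono1[of "length bs" ?n "?m + ?m + 1"] show ?thesis by linarith
  qed
  have szrs: "sz rs \<le> ?n * (?l + 1) + 1"
  proof -
   have "sz r \<le> ?l" if "r \<in> set rs" for r by (rule cells) (use rs(3) bspec[OF rs(5) that] that in auto)
   from sz_list_le[of rs, OF this] have "sz rs \<le> length rs * (?l + 1) + 1" .
   moreover have "length rs \<le> ?n" using rs(4) distinct_card[OF cs] n(1) by simp
   ultimately show ?thesis using mult_le_mono1[of "length rs" ?n "?l + 1"] by linarith
  qed
  have szq: "sz q \<le> ?n * (?m + ?m + 1) + 1"
  proof -
   have "sz p \<le> ?m + ?m" if p: "p \<in> set q" for p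
   proof -
    have "(0, 0) \<in> set (fst (snd p))" using ts q[OF p] by blast
    then have "mk_cell (fst p) (0, 0) \<in> set (tcells p)" unfolding tcells_def by auto
    then have "fst p \<in> set cs" using cover p by (auto simp: mk_cell_def)
    from cell[OF this] have "sz (fst p) \<le> ?m" .
    moreover have "sz (snd p) \<le> table_size" using q[OF p] table_size by blast
    ultimately show ?thesis by (cases p) simp
   qed
   from sz_list_le[of q, OF this] len_q n(1) mult_le_mono1[of "length q" ?n "?m + ?m + 1"] show ?thesis by linarith
  qed
  have "sz cs \<le> ?l" "sz co \<le> ?l" using cells[OF cs] cells[OF co(1)] co(2) by auto
  with szbs szrs szq show ?thesis unfolding cert_bound_def Let_def sz_Pair by linarith
 qed
 ultimately show ?thesis by blast
qed

theorem in_NP_tiling: "in_NP (tiling_problem tiles)"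
proof (rule in_NP_certificate)
 show "PT (verify ts)" by (rule PT_verify)
 show "PT (dec :: tree => witness)" by (intro PT_rules)
 show "pb cert_bound" unfolding cert_bound_def Let_def by (intro pb_intros)
 show "w \<in> tiling_problem tiles" if "verify ts (w, x)" for w x using that by (rule verify_sound)
 show "\<exists>x. sz x \<le> cert_bound (length w) \<and> verify ts (w, x)" if "w \<in> tiling_problem tiles" for w
  using that by (rule verify_complete)
qed

end

section \<open>Queue programs\<close>

text \<open>
 An instruction \<open>(\<alpha>, k, \<beta>)\<close> acts on a queue of bits: the constants \<open>\<alpha>\<close> are put in front, then
 the first two bits are treated by the operation \<open>k\<close>, and the result has to begin with the
 constants \<open>\<beta>\<close>, which are removed.
\<close>

datatype kind = Shift | Gate

type_synonym instr = "bool list \<times> kind \<times> bool list"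

text \<open>For the gate, a true \<open>a\<close> forces \<open>t\<close> to be the negation of
  \<open>y\<close>, while a false \<open>a\<close> requires a true \<open>y\<close> and leaves
  \<open>t\<close> free.\<close>

fun act :: "kind => bool list => bool list => bool" where
 "act Shift (a # b # r) z \<longleftrightarrow> z = a # r @ [b]"
| "act Gate (a # y # r) z \<longleftrightarrow> (\<exists>t. (y \<longleftrightarrow> \<not> (a \<and> t)) \<and> z = t # t # r)"
| "act _ _ z \<longleftrightarrow> False"

fun istep :: "instr => bool list => bool list => bool" where
 "istep (\<alpha>, k, \<beta>) xs ys \<longleftrightarrow> act k (\<alpha> @ xs) (\<beta> @ ys)"

primrec qrun :: "instr list => bool list => bool list => bool" where
 "qrun [] xs zs \<longleftrightarrow> xs = zs"
| "qrun (i # p) xs zs \<longleftrightarrow> (\<exists>ys. istep i xs ys \<and> qrun p ys zs)"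

text \<open>The row of a shift has one cell more than there are bits in the constants and the queue
  together; the extra column lies at the right end.\<close>

definition shift_of :: "kind => nat" where
 "shift_of k = (case k of Shift => 1 | Gate => 0)"

text \<open>The side conditions on lengths that are needed when a program is laid out in the plane.\<close>

primrec qlens :: "instr list => nat => nat => bool" where
 "qlens [] n n' \<longleftrightarrow> 1 \<le> n \<and> n = n'"
| "qlens (i # p) n n' \<longleftrightarrow> (case i of (\<alpha>, k, \<beta>) => 1 \<le> n \<and> 2 \<le> n + length \<alpha> \<and>
   length \<alpha> \<le> 2 \<and> length \<beta> \<le> 2 \<and> length \<alpha> \<le> length \<beta> + shift_of k \<and> length \<beta> + 1 \<le> n + length \<alpha> \<and>
   qlens p (n + length \<alpha> - length \<beta>) n')"

lemma qrun_append: "qrun (p @ q) xs zs \<longleftrightarrow> (\<exists>ys. qrun p xs ys \<and> qrun q ys zs)"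
 by (induction p arbitrary: xs) auto

lemma qlens_append: "qlens p n m ==> qlens q m l ==> qlens (p @ q) n l"
 by (induction p arbitrary: n) auto

text \<open>The block at the front is consumed and the result appended at the rear, whatever lies
  between; so the same program can be repeated for the next block. Lengths are checked with at least
  two bits behind the block.\<close>

definition blk :: "instr list => nat => nat => (bool list => bool list => bool) => bool" where
 "blk u k l R \<longleftrightarrow>
  (\<forall>x rest z. length x = k --> (qrun u (x @ rest) z \<longleftrightarrow> (\<exists>y. R x y \<and> z = rest @ y))) \<and>
  (\<forall>x y. length x = k --> R x y --> length y = l) \<and> (\<forall>m\<ge>2. qlens u (k + m) (l + m))"

lemma blk_cong:
 assumes "blk u k l R" "!!x y. length x = k ==> R x y \<longleftrightarrow> S x y"
 shows "blk u k l S"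
proof -
 have "(\<exists>y. R x y \<and> z = rest @ y) \<longleftrightarrow> (\<exists>y. S x y \<and> z = rest @ y)" if "length x = k" for x rest z :: "bool list"
  using assms(2)[OF that] by blast
 then show ?thesis using assms unfolding blk_def by simp
qed

lemma blk_append:
 assumes "blk u k l R" "blk v k' l' S"
 shows "blk (u @ v) (k + k') (l + l') (\<lambda>x y. \<exists>y1 y2. R (take k x) y1 \<and> S (drop k x) y2 \<and> y = y1 @ y2)"
 unfolding blk_def
proof (intro conjI allI impI)
 fix x rest z :: "bool list" assume x: "length x = k + k'"
 have "qrun (u @ v) (x @ rest) z \<longleftrightarrow> (\<exists>ys. qrun u (take k x @ drop k x @ rest) ys \<and> qrun v ys z)"
  unfolding qrun_append by (simp flip: append_assoc)
 also have "\<dots> \<longleftrightarrow> (\<exists>y1. R (take k x) y1 \<and> qrun v (drop k x @ rest @ y1) z)"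
  using assms(1) x unfolding blk_def by (auto simp: min_def)
 also have "\<dots> \<longleftrightarrow> (\<exists>y1 y2. R (take k x) y1 \<and> S (drop k x) y2 \<and> z = rest @ y1 @ y2)"
  using assms(2) x unfolding blk_def by auto
 also have "\<dots> \<longleftrightarrow>
   (\<exists>y. (\<exists>y1 y2. R (take k x) y1 \<and> S (drop k x) y2 \<and> y = y1 @ y2) \<and> z = rest @ y)" by auto
 finally show "qrun (u @ v) (x @ rest) z \<longleftrightarrow>
   (\<exists>y. (\<exists>y1 y2. R (take k x) y1 \<and> S (drop k x) y2 \<and> y = y1 @ y2) \<and> z = rest @ y)" .
next
 fix m :: nat assume m: "2 \<le> m"
 have "qlens u (k + (k' + m)) (l + (k' + m))" "qlens v (k' + (l + m)) (l' + (l + m))"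
  using assms m by (simp_all add: blk_def)
 then show "qlens (u @ v) (k + k' + m) (l + l' + m)"
  by (intro qlens_append[of u _ "l + k' + m"]) (simp_all add: ac_simps)
next
 fix x y assume x: "length x = k + k'" and "\<exists>y1 y2. R (take k x) y1 \<and> S (drop k x) y2 \<and> y = y1 @ y2"
 then obtain y1 y2 where y: "R (take k x) y1" "S (drop k x) y2" "y = y1 @ y2" by blast
 have "length (take k x) = k" "length (drop k x) = k'" using x by simp_all
 then have "length y1 = l" "length y2 = l'" using assms y(1,2) unfolding blk_def by blast+
 then show "length y = l + l'" using y(3) by simp
qed

definition local_rel :: "nat => nat => (bool list => bool list => bool) => bool list => bool list => bool" where
 "local_rel a j R x y \<longleftrightarrow> (\<exists>v. R (take j (drop a x)) v \<and> y = take a x @ v @ drop (a + j) x)"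

text \<open>With the constant \<open>False\<close> in front, which is taken away again, the shift
  moves the first bit of the queue to the rear.\<close>

abbreviation "rot_instr \<equiv> ([False], Shift, [False]) :: instr"

lemma length_1: "length x = Suc 0 \<longleftrightarrow> (\<exists>a. x = [a])"
 and length_2: "length x = Suc (Suc 0) \<longleftrightarrow> (\<exists>a b. x = [a, b])"
 by (auto simp: length_Suc_conv)

lemma blk_id: "blk (replicate a rot_instr) a a (=)"
proof (induction a)
 case 0
 show ?case by (auto simp: blk_def)
next
 case (Suc a)
 have "blk [rot_instr] 1 1 (=)"
  by (auto simp: blk_def length_1 shift_of_def)
 from blk_append[OF this Suc] show ?case by (auto intro: blk_cong)
qed

text \<open>Rotations move the \<open>a\<close> bits before and the \<open>b\<close> bits after the
  treated part to the rear unchanged.\<close>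

lemma blk_local:
 assumes "blk u j l R"
 shows "\<exists>v. blk v (a + j + b) (a + l + b) (local_rel a j R)"
proof -
 let ?v = "(replicate a rot_instr @ u) @ replicate b rot_instr"
 have "blk ?v (a + j + b) (a + l + b) (local_rel a j R)"
  by (rule blk_cong[OF blk_append[OF blk_append[OF blk_id assms] blk_id]])
   (auto simp: local_rel_def take_drop add.commute)
 then show ?thesis by blast
qed

text \<open>After one block program the result lies at the rear, behind all other blocks. A second
  relation can be applied to it only when these have been treated as well; therefore compositions
  are lists of programs, one for each sweep, with block lengths that may change in between.\<close>

primrec chain :: "instr list list => nat => nat => (bool list => bool list => bool) => bool" where
 "chain [] k l R \<longleftrightarrow> 1 \<le> k \<and> k = l \<and> (\<forall>x y. length x = k --> (R x y \<longleftrightarrow> x = y))"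
| "chain (u # us) k l R \<longleftrightarrow> 1 \<le> k \<and>
  (\<exists>j S T. blk u k j S \<and> chain us j l T \<and> (\<forall>x y. length x = k --> (R x y \<longleftrightarrow> (S OO T) x y)))"

definition sweeps :: "instr list list => nat => instr list" where
 "sweeps us B = concat (map (\<lambda>u. concat (replicate B u)) us)"

text \<open>Finished blocks gather behind \<open>rest\<close>, which is why the induction needs an
  arbitrary \<open>rest\<close>.\<close>

lemma sweep_rest:
 assumes "blk u k l R" "!!x. x \<in> set X ==> length x = k"
 shows "qrun (concat (replicate (length X) u)) (concat X @ rest) z \<longleftrightarrow> (\<exists>Y. list_all2 R X Y \<and> z = rest @ concat Y)"
 using assms(2)
proof (induction X arbitrary: rest)
 case (Cons x X)
 have "qrun (concat (replicate (length (x # X)) u)) (concat (x # X) @ rest) z \<longleftrightarrow>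
   (\<exists>y. R x y \<and> qrun (concat (replicate (length X) u)) (concat X @ (rest @ y)) z)"
  using assms(1) Cons.prems unfolding blk_def by (auto simp: qrun_append)
 also have "\<dots> \<longleftrightarrow> (\<exists>y Y. R x y \<and> list_all2 R X Y \<and> z = rest @ y @ concat Y)"
  using Cons.IH Cons.prems by simp
 also have "\<dots> \<longleftrightarrow> (\<exists>Y. list_all2 R (x # X) Y \<and> z = rest @ concat Y)"
  unfolding list_all2_Cons1 by force
 finally show ?case .
qed auto

lemma sweep_lens:
 assumes "blk u k l R" "1 \<le> k" "1 \<le> l" "3 \<le> j + m"
 shows "qlens (concat (replicate j u)) (j * k + m) (j * l + m)"
 using assms(4)
proof (induction j arbitrary: m)
 case (Suc j)
 have "2 \<le> j * k + m" using Suc.prems assms(2) by (cases k) auto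
 then have "qlens u (k + (j * k + m)) (l + (j * k + m))" using assms(1) unfolding blk_def by blast
 moreover have "qlens (concat (replicate j u)) (j * k + (l + m)) (j * l + (l + m))"
  by (rule Suc.IH) (use Suc.prems assms(3) in simp)
 ultimately show ?case by (auto intro!: qlens_append simp: ac_simps)
qed simp

lemma chain_sizes: "chain us k l R ==> 1 \<le> k \<and> 1 \<le> l"
 by (induction us arbitrary: k R) auto

lemma list_all2_relcomp: "list_all2 (R OO S) X Z \<longleftrightarrow> (\<exists>Y. list_all2 R X Y \<and> list_all2 S Y Z)"
 by (simp add: list.rel_compp relcompp_apply)

lemma qrun_sweeps:
 assumes "chain us k l R" "!!x. x \<in> set X ==> length x = k"
 shows "qrun (sweeps us (length X)) (concat X) z \<longleftrightarrow> (\<exists>Y. list_all2 R X Y \<and> z = concat Y)"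
 using assms
proof (induction us arbitrary: k R X)
 case Nil
 have "list_all2 R X Y \<longleftrightarrow> X = Y" for Y
 proof -
  have "list_all2 R X Y \<longleftrightarrow> list_all2 (=) X Y" using Nil by (intro list.rel_cong_simp) (auto simp: simp_implies_def)
  then show ?thesis by (simp add: list.rel_eq)
 qed
 then show ?case by (auto simp: sweeps_def)
next
 case (Cons u us)
 obtain j S T where u: "blk u k j S" and us: "chain us j l T"
  and R: "!!x y. length x = k ==> R x y \<longleftrightarrow> (S OO T) x y" using Cons.prems(1) by auto
 have len: "length y = j" if "list_all2 S X Y" "y \<in> set Y" for y Y
 proof -
  note Y = that
  obtain i where i: "i < length Y" "Y ! i = y" using Y(2) by (auto simp: in_set_conv_nth)
  with Y(1) have "i < length X" "S (X ! i) y" by (auto simp: list_all2_conv_all_nth)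
  then show ?thesis using u Cons.prems(2)[of "X ! i"] unfolding blk_def by simp
 qed
 have "qrun (sweeps (u # us) (length X)) (concat X) z \<longleftrightarrow>
   (\<exists>Y. list_all2 S X Y \<and> qrun (sweeps us (length X)) (concat Y) z)"
  using sweep_rest[OF u, of X "[]"] Cons.prems(2) by (auto simp: sweeps_def qrun_append)
 also have "\<dots> \<longleftrightarrow> (\<exists>Y Z. list_all2 S X Y \<and> list_all2 T Y Z \<and> z = concat Z)"
  using Cons.IH[OF us] len by (metis list_all2_lengthD)
 also have "\<dots> \<longleftrightarrow> (\<exists>Z. list_all2 (S OO T) X Z \<and> z = concat Z)"
  unfolding list_all2_relcomp by blast
 also have "\<dots> \<longleftrightarrow> (\<exists>Z. list_all2 R X Z \<and> z = concat Z)"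
 proof -
  have "list_all2 R X Z \<longleftrightarrow> list_all2 (S OO T) X Z" for Z
   using R Cons.prems(2) by (intro list.rel_cong_simp) (simp_all add: simp_implies_def)
  then show ?thesis by simp
 qed
 finally show ?case .
qed

text \<open>While one of at least three nonempty blocks is treated, the others supply the two
  further bits that \<open>blk\<close> asks for.\<close>

lemma qlens_sweeps: "chain us k l R ==> 3 \<le> B ==> qlens (sweeps us B) (B * k) (B * l)"
proof (induction us arbitrary: k R)
 case Nil
 then show ?case by (auto simp: sweeps_def)
next
 case (Cons u us)
 then obtain j S T where u: "blk u k j S" and us: "chain us j l T" by auto
 have "qlens (concat (replicate B u)) (B * k + 0) (B * j + 0)"
  by (rule sweep_lens[OF u]) (use Cons.prems chain_sizes[OF us] in auto)
 then show ?case using Cons.IH[OF us Cons.prems(2)] by (auto simp: sweeps_def intro: qlens_append)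
qed

subsection \<open>Realizable relations\<close>

definition realizable :: "nat => nat => (bool list => bool list => bool) => bool" where
 "realizable k l R \<longleftrightarrow> (\<exists>us. chain us k l R)"

lemma chain_cong: "chain us k l R ==> (!!x y. length x = k ==> R x y \<longleftrightarrow> S x y) ==> chain us k l S"
 by (cases us) auto

lemma realizable_cong: "realizable k l R ==> (!!x y. length x = k ==> R x y \<longleftrightarrow> S x y) ==> realizable k l S"
 unfolding realizable_def using chain_cong by blast

lemma realizable_id: "1 \<le> k ==> realizable k k (=)"
 unfolding realizable_def by (intro exI[of _ "[]"]) simp

lemma realizable_comp:
 assumes "realizable k j R" "realizable j l S"
 shows "realizable k l (R OO S)"
proof -
 obtain us vs where "chain us k j R" and vs: "chain vs j l S" using assms unfolding realizable_def by blast
 then have "chain (us @ vs) k l (R OO S)"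
 proof (induction us arbitrary: k R)
  case Nil
  then show ?case by (auto intro!: chain_cong[OF vs] simp: relcompp_apply)
 next
  case (Cons u us)
  from Cons.prems obtain i S' T where 1: "1 \<le> k" "blk u k i S'" "chain us i j T"
   "!!x y. length x = k ==> R x y \<longleftrightarrow> (S' OO T) x y" by auto
  have "chain (us @ vs) i l (T OO S)" by (rule Cons.IH[OF 1(3) vs])
  moreover have "(R OO S) x y \<longleftrightarrow> (S' OO T OO S) x y" if "length x = k" for x y
   using 1(4)[OF that] by (auto simp: relcompp_apply)
  ultimately show ?case using 1(1,2) unfolding append_Cons chain.simps by blast
 qed
 then show ?thesis unfolding realizable_def by blast
qed

lemma realizable_then:
 assumes "realizable k j R" "realizable j l S"
  "!!x y. length x = k ==> (\<exists>z. R x z \<and> S z y) \<longleftrightarrow> T x y"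
 shows "realizable k l T"
 by (rule realizable_cong[OF realizable_comp[OF assms(1,2)]]) (simp add: relcompp_apply assms(3))

lemma realizable_blk:
 assumes "blk u j l R" "1 \<le> a + j + b" "1 \<le> a + l + b"
 shows "realizable (a + j + b) (a + l + b) (local_rel a j R)"
proof -
 obtain v where v: "blk v (a + j + b) (a + l + b) (local_rel a j R)" using blk_local[OF assms(1)] by blast
 have "chain [v] (a + j + b) (a + l + b) (local_rel a j R)"
  unfolding chain.simps
  using assms(2,3) v
  by (intro conjI exI[of _ "a + l + b"] exI[of _ "local_rel a j R"] exI[of _ "(=)"]) auto
 then show ?thesis unfolding realizable_def by blast
qed

text \<open>The condition on lengths places the second relation on exactly the output of the
  first.\<close>

lemma local_relcomp:
 assumes "length x = a + k + b" "!!u v. length u = k ==> R u v ==> length v = j"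
 shows "(\<exists>z. local_rel a k R x z \<and> local_rel a j S z y) \<longleftrightarrow> local_rel a k (R OO S) x y"
proof -
 have step: "local_rel a j S (take a x @ v @ drop (a + k) x) y \<longleftrightarrow> (\<exists>w. S v w \<and> y = take a x @ w @ drop (a + k) x)"
  if "R (take k (drop a x)) v" for v
 proof -
  have "length v = j" using assms(2)[OF _ that] assms(1) by simp
  moreover have "length (take a x) = a" using assms(1) by simp
  ultimately show ?thesis unfolding local_rel_def by simp
 qed
 show ?thesis
 proof
  assume "\<exists>z. local_rel a k R x z \<and> local_rel a j S z y"
  then obtain v where v: "R (take k (drop a x)) v" "local_rel a j S (take a x @ v @ drop (a + k) x) y"
   unfolding local_rel_def[of a k] by blast
  then obtain w where "S v w" "y = take a x @ w @ drop (a + k) x" unfolding step[OF v(1)] by blast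
  with v(1) show "local_rel a k (R OO S) x y" unfolding local_rel_def by blast
 next
  assume "local_rel a k (R OO S) x y"
  then obtain v w where v: "R (take k (drop a x)) v" "S v w" "y = take a x @ w @ drop (a + k) x"
   unfolding local_rel_def by blast
  then have "local_rel a j S (take a x @ v @ drop (a + k) x) y" unfolding step[OF v(1)] by blast
  moreover have "local_rel a k R x (take a x @ v @ drop (a + k) x)" unfolding local_rel_def using v(1) by blast
  ultimately show "\<exists>z. local_rel a k R x z \<and> local_rel a j S z y" by blast
 qed
qed

text \<open>Each sweep is localized separately, and the localized relations compose because the
  surroundings keep their place.\<close>

lemma realizable_local:
 assumes "realizable j l R"
 shows "realizable (a + j + b) (a + l + b) (local_rel a j R)"
proof -
 obtain us where "chain us j l R" using assms unfolding realizable_def by blast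
 then show ?thesis
 proof (induction us arbitrary: j R)
  case Nil
  then have eq: "j = l" and R: "!!x y. length x = l ==> R x y \<longleftrightarrow> x = y" and "1 \<le> l" by auto
  then have "realizable (a + l + b) (a + l + b) (=)" by (intro realizable_id) auto
  then show ?case unfolding eq
  proof (rule realizable_cong)
   fix x y :: "bool list" assume "length x = a + l + b"
   then show "x = y \<longleftrightarrow> local_rel a l R x y"
    unfolding local_rel_def using R[of "take l (drop a x)"]
    by (auto simp: append_assoc[symmetric] take_add[symmetric] simp del: append_assoc)
  qed
 next
  case (Cons u us)
  then obtain i S T where 1: "1 \<le> j" "blk u j i S" "chain us i l T"
   "!!x y. length x = j ==> R x y \<longleftrightarrow> (S OO T) x y" by auto
  show ?case
  proof (rule realizable_then[OF realizable_blk[OF 1(2)] Cons.IH[OF 1(3)]])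
   fix x y :: "bool list" assume x: "length x = a + j + b"
   show "(\<exists>z. local_rel a j S x z \<and> local_rel a i T z y) \<longleftrightarrow> local_rel a j R x y"
    unfolding local_relcomp[OF x, of S i] using 1(2) 1(4) x
    by (subst local_relcomp[OF x]) (auto simp: blk_def local_rel_def)
  qed (use 1(1) chain_sizes[OF 1(3)] in auto)
 qed
qed

section \<open>The tile set\<close>

text \<open>
 Colors 0 and 1 are bits.  The row for an instruction begins with a domino, whose left color is 4
 for a shift and 5 for a gate; crosses pass the other bits upwards, and the row for a shift ends with
 a tile that turns the bit moving to the right upwards.  A row of crosses with right-moving bit 0
 separates consecutive instructions.
\<close>

definition bit_color :: "bool => nat" where
 "bit_color b = (if b then 1 else 0)"

lemma bit_color_inject [simp]: "bit_color b = bit_color c \<longleftrightarrow> b = c"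
 by (simp add: bit_color_def)

lemma bit_color_neq [simp]: "bit_color b ~= 2" "bit_color b ~= 3" "bit_color b ~= 4" "bit_color b ~= 5"
 "2 ~= bit_color b" "3 ~= bit_color b" "4 ~= bit_color b" "5 ~= bit_color b"
 by (simp_all add: bit_color_def)

lemma map_bit_color_inject [simp]: "map bit_color xs = map bit_color ys \<longleftrightarrow> xs = ys"
 by (simp add: inj_map_eq_map inj_def)

definition cross :: "bool => bool => tile_table" where
 "cross h v = ([(0, 0)], [((True, 0, 0), bit_color h), ((True, 1, 0), bit_color h),
  ((False, 0, 0), bit_color v), ((False, 0, 1), bit_color v)])"

text \<open>Colors 2 to 5 never occur on sides of tiles that could face each other, so they appear
  only on the boundary of a region. In this way the boundary dictates where turns and dominoes
  lie.\<close>

definition turn :: "bool => tile_table" where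
 "turn h = ([(0, 0)], [((True, 0, 0), bit_color h), ((True, 1, 0), 3),
  ((False, 0, 0), 3), ((False, 0, 1), bit_color h)])"

text \<open>The second bit leaves to the right and the first one takes its column; above the first
  cell, color 2 lets the next row begin one column later.\<close>

definition shift_tile :: "bool => bool => tile_table" where
 "shift_tile a b = ([(0, 0), (1, 0)], [((True, 0, 0), 4), ((True, 2, 0), bit_color b),
  ((False, 0, 0), bit_color a), ((False, 1, 0), bit_color b), ((False, 0, 1), 2), ((False, 1, 1), bit_color a)])"

text \<open>No bit has to travel to the right, so a fixed one is emitted, which the crosses hand on
  to the end of the row.\<close>

definition gate_tile :: "bool => bool => tile_table" where
 "gate_tile a t = ([(0, 0), (1, 0)], [((True, 0, 0), 5), ((True, 2, 0), bit_color False),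
  ((False, 0, 0), bit_color a), ((False, 1, 0), bit_color (\<not> (a \<and> t))),
  ((False, 0, 1), bit_color t), ((False, 1, 1), bit_color t)])"

definition tables :: "tile_table list" where
 "tables = [cross False False, cross False True, cross True False, cross True True, turn False, turn True,
  shift_tile False False, shift_tile False True, shift_tile True False, shift_tile True True,
  gate_tile False False, gate_tile False True, gate_tile True False, gate_tile True True]"

lemma set_tables: "set tables = {cross h v | h v. True} \<union> {turn h | h. True} \<union>
  {shift_tile a b | a b. True} \<union> {gate_tile a t | a t. True}"
 unfolding tables_def by (auto simp: ex_bool_eq)

definition width :: "tile_table => nat" where
 "width t = length (fst t)"

lemma tables_cases:
 assumes "t \<in> set tables"
 obtains (Cross) h v where "t = cross h v" | (Turn) h where "t = turn h"
  | (Shift) a b where "t = shift_tile a b" | (Gate) a u where "t = gate_tile a u"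
 using assms unfolding set_tables by blast

lemma tcells_table:
 assumes "t \<in> set tables"
 shows "set (tcells (v, t)) = {fst v..<fst v + int (width t)} \<times> {snd v}" "1 \<le> width t"
proof -
 have two: "{x..<x + 2} = {x, x + 1}" for x :: int by auto
 show "set (tcells (v, t)) = {fst v..<fst v + int (width t)} \<times> {snd v}"
  by (cases rule: tables_cases[OF assms])
   (auto simp: two tcells_def mk_cell_def width_def cross_def turn_def shift_tile_def gate_tile_def)
 show "1 \<le> width t"
  by (cases rule: tables_cases[OF assms]) (auto simp: width_def cross_def turn_def shift_tile_def gate_tile_def)
qed

lemma edge_cells:
 "Hor (x, y) \<in> cell_edges c \<longleftrightarrow> c = (x, y) \<or> c = (x, y - 1)"
 "Ver (x, y) \<in> cell_edges c \<longleftrightarrow> c = (x, y) \<or> c = (x - 1, y)"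
 by (cases c; auto)+

lemma boundary_Hor: "Hor (x, y) \<in> boundary_edges P \<longleftrightarrow> ((x, y) \<in> P) ~= ((x, y - 1) \<in> P)"
proof -
 have "(x, y) ~= (x, y - 1)" by simp
 then show ?thesis unfolding boundary_edges_def mem_Collect_eq edge_cells by metis
qed

lemma boundary_Ver: "Ver (x, y) \<in> boundary_edges P \<longleftrightarrow> ((x, y) \<in> P) ~= ((x - 1, y) \<in> P)"
proof -
 have "(x, y) ~= (x - 1, y)" by simp
 then show ?thesis unfolding boundary_edges_def mem_Collect_eq edge_cells by metis
qed

lemma keys_table:
 assumes "t \<in> set tables"
 shows "fst ` set (tedges (v, t)) = boundary_edges (set (tcells (v, t)))"
proof -
 obtain x y where v: "v = (x, y)" by (cases v)
 have "e \<in> fst ` set (tedges ((x, y), t)) \<longleftrightarrow> e \<in> boundary_edges ({x..<x + int (width t)} \<times> {y})" for e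
 proof (cases e)
  case (Hor p)
  show ?thesis unfolding Hor by (cases p, cases rule: tables_cases[OF assms])
   (auto simp: boundary_Hor tedges_def mk_edge_def mk_cell_def width_def cross_def turn_def shift_tile_def gate_tile_def)
 next
  case (Ver p)
  show ?thesis unfolding Ver by (cases p, cases rule: tables_cases[OF assms])
   (auto simp: boundary_Ver tedges_def mk_edge_def mk_cell_def width_def cross_def turn_def shift_tile_def gate_tile_def)
 qed
 then show ?thesis unfolding v tcells_table(1)[OF assms] fst_conv snd_conv by blast
qed

interpretation tile_set tables
proof
 fix t assume t: "t \<in> set tables"
 show "distinct (fst t) \<and> distinct (map fst (snd t)) \<and> (0, 0) \<in> set (fst t)"
  using t by (cases rule: tables_cases) (auto simp: cross_def turn_def shift_tile_def gate_tile_def)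
 show "dom (snd (tile_at (v, t))) = boundary_edges (fst (tile_at (v, t)))" for v
  unfolding tile_at_def fst_conv snd_conv dom_map_of_conv_image_fst by (rule keys_table[OF t])
qed

section \<open>The tiles as generalized Wang tiles\<close>

lemma row_polyomino:
 assumes "a < b"
 shows "polyomino ({a..<b} \<times> {y})"
proof -
 let ?r = "row_list a b y"
 have "tree_runs [?r]" unfolding tree_runs_def using is_run_row_list[OF assms] by (simp add: chk_single)
 from tree_runs_simply_connected[OF this] have "simply_connected (area (set ?r))" by simp
 moreover have "edge_connected ({a..<b} \<times> {y})"
  unfolding edge_connected_def
 proof (intro ballI)
  let ?E = "{(c, d). c \<in> {a..<b} \<times> {y} \<and> d \<in> {a..<b} \<times> {y} \<and> cell_edges c \<inter> cell_edges d ~= {}}"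
  have go: "((a, y), (a + int n, y)) \<in> ?E\<^sup>* \<and> ((a + int n, y), (a, y)) \<in> ?E\<^sup>*" if "a + int n < b" for n
   using that
  proof (induction n)
   case (Suc n)
   have "Ver (a + int (Suc n), y) \<in> cell_edges (a + int n, y) \<inter> cell_edges (a + int (Suc n), y)" by simp
   then have "((a + int n, y), (a + int (Suc n), y)) \<in> ?E" "((a + int (Suc n), y), (a + int n, y)) \<in> ?E"
    using Suc.prems by auto
   moreover have "a + int n < b" using Suc.prems by simp
   ultimately show ?case using Suc.IH by (meson rtrancl.rtrancl_into_rtrancl converse_rtrancl_into_rtrancl)
  qed simp
  fix c d assume "c \<in> {a..<b} \<times> {y}" "d \<in> {a..<b} \<times> {y}"
  then obtain x z where c: "c = (x, y)" "d = (z, y)" "a \<le> x" "x < b" "a \<le> z" "z < b" by auto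
  then have "(c, (a, y)) \<in> ?E\<^sup>*" "((a, y), d) \<in> ?E\<^sup>*"
   using go[of "nat (x - a)"] go[of "nat (z - a)"] by simp_all
  then show "(c, d) \<in> ?E\<^sup>*" by (rule rtrancl_trans)
 qed
 ultimately show ?thesis unfolding polyomino_def area_def using assms by (simp add: set_row_list)
qed

lemma tile_at_inject:
 assumes "tile_at (v, s) = tile_at ((0, 0), t)" "s \<in> set tables" "t \<in> set tables"
 shows "s = t"
proof -
 have "{fst v..<fst v + int (width s)} \<times> {snd v} = {0..<int (width t)} \<times> {0}"
  using arg_cong[OF assms(1), of fst] tcells_table(1)[OF assms(2), of v] tcells_table(1)[OF assms(3), of "(0, 0)"]
  by (simp add: tile_at_def)
 moreover have "v \<in> {fst v..<fst v + int (width s)} \<times> {snd v}" "(0, 0) \<in> {0..<int (width t)} \<times> {0}"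
  using tcells_table(2)[OF assms(2)] tcells_table(2)[OF assms(3)] by (cases v; simp)+
 ultimately have "v \<in> {0..<int (width t)} \<times> {0}" "(0, 0) \<in> {fst v..<fst v + int (width s)} \<times> {snd v}" by auto
 then have v: "v = (0, 0)" by (cases v) auto
 \<comment> \<open>The colors of these five segments tell all tables apart; \<open>None\<close>
   reveals the width of the tile.\<close>
 define sig where "sig p = map (snd (tile_at p)) [Ver (0, 0), Ver (1, 0), Hor (0, 0), Hor (0, 1), Hor (1, 0)]" for p
 have sig: "sig ((0, 0), s) = sig ((0, 0), t)" unfolding sig_def using assms(1) v by simp
 have sigs: "sig ((0, 0), cross h u) = [Some (bit_color h), Some (bit_color h), Some (bit_color u), Some (bit_color u), None]"
  "sig ((0, 0), turn h) = [Some (bit_color h), Some 3, Some 3, Some (bit_color h), None]"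
  "sig ((0, 0), shift_tile h u) = [Some 4, None, Some (bit_color h), Some 2, Some (bit_color u)]"
  "sig ((0, 0), gate_tile h u) = [Some 5, None, Some (bit_color h), Some (bit_color u), Some (bit_color (\<not> (h \<and> u)))]" for h u
  unfolding sig_def tile_at_def tedges_def mk_edge_def mk_cell_def cross_def turn_def shift_tile_def gate_tile_def by simp_all
 show ?thesis using assms(2)
 proof (cases rule: tables_cases)
  case (Cross h u)
  show ?thesis using assms(3) by (cases rule: tables_cases) (use sig Cross sigs in auto)
 next
  case (Turn h)
  show ?thesis using assms(3) by (cases rule: tables_cases) (use sig Turn sigs in auto)
 next
  case (Shift a b)
  show ?thesis using assms(3) by (cases rule: tables_cases) (use sig Shift sigs in auto)
 next
  case (Gate a b)
  show ?thesis using assms(3) by (cases rule: tables_cases) (use sig Gate sigs in \<open>auto simp: sigs(4)\<close>)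
 qed
qed

lemma distinct_tables: "distinct tables"
 unfolding tables_def cross_def turn_def shift_tile_def gate_tile_def bit_color_def by simp

lemma card_tiles: "card tiles = 14"
proof -
 have "inj_on (\<lambda>t. tile_at ((0, 0), t)) (set tables)" by (rule inj_onI) (rule tile_at_inject)
 then have "card tiles = card (set tables)" unfolding tiles_def by (rule card_image)
 also have "\<dots> = length tables" by (rule distinct_card[OF distinct_tables])
 finally show ?thesis by (simp add: tables_def)
qed

lemma wang_tiles: "wang_tile_set tiles"
 unfolding wang_tile_set_def
proof (intro conjI ballI allI impI)
 fix s assume "s \<in> tiles"
 then obtain t where t: "t \<in> set tables" "s = tile_at ((0, 0), t)" unfolding tiles_def by blast
 have "polyomino ({0..<int (width t)} \<times> {0})" by (rule row_polyomino) (use tcells_table(2)[OF t(1)] in simp)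
 then have "polyomino (fst s)" using tcells_table(1)[OF t(1), of "(0, 0)"] unfolding t(2) tile_at_def by simp
 then show "colored_polyomino s" unfolding colored_polyomino_def t(2) using boundary[OF t(1)] by blast
next
 fix s t v assume "s \<in> tiles" "t \<in> tiles" "t = translate v s"
 then obtain s' t' where "s' \<in> set tables" "s = tile_at ((0, 0), s')" "t' \<in> set tables" "t = tile_at ((0, 0), t')"
  "tile_at (v, s') = tile_at ((0, 0), t')"
  unfolding tiles_def by (auto simp: translate_tile_at simp flip: zero_prod_def)
 then show "s = t" using tile_at_inject by blast
qed

section \<open>Tilings of stacks of rows\<close>

text \<open>A coloring of all segments is fixed in advance, so that matching becomes a condition on
  each copy alone and rows can be tiled independently.\<close>

definition tileable :: "cell set => (edge => nat) => bool" where
 "tileable P col \<longleftrightarrow> (\<exists>Q. (\<forall>p\<in>Q. snd p \<in> set tables \<and> (\<forall>(e, k)\<in>set (tedges p). col e = k)) \<and>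
  (\<Union>p\<in>Q. set (tcells p)) = P \<and> (\<forall>p\<in>Q. \<forall>q\<in>Q. p ~= q --> set (tcells p) \<inter> set (tcells q) = {}))"

text \<open>Matching copies agree on shared segments and therefore define one coloring; it extends
  the boundary colors because every boundary segment of the region belongs to some copy.\<close>

lemma tiles_region_tileable:
 assumes "dom bd = boundary_edges P"
 shows "tiles_region tiles (P, bd) \<longleftrightarrow> (\<exists>col. tileable P col \<and> (\<forall>e k. bd e = Some k --> col e = k))"
proof
 assume "tiles_region tiles (P, bd)"
 then obtain Q where Q: "Q \<subseteq> {tile_at (v, t) | v t. t \<in> set tables}" "(\<Union>q\<in>Q. fst q) = P"
   "\<forall>q\<in>Q. \<forall>r\<in>Q. q ~= r --> fst q \<inter> fst r = {}"
   "\<forall>q\<in>Q. \<forall>r\<in>Q. \<forall>e\<in>boundary_edges (fst q) \<inter> boundary_edges (fst r). snd q e = snd r e"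
   "\<forall>q\<in>Q. \<forall>e\<in>boundary_edges (fst q) \<inter> boundary_edges P. snd q e = bd e"
  unfolding tiles_region_def copies fst_conv snd_conv by (elim exE conjE) (rule that)
 define R where "R = {p. snd p \<in> set tables \<and> tile_at p \<in> Q}"
 have QR: "\<exists>p\<in>R. q = tile_at p" if "q \<in> Q" for q
 proof -
  obtain v t where "t \<in> set tables" "q = tile_at (v, t)" using Q(1) \<open>q \<in> Q\<close> by blast
  then have "(v, t) \<in> R" using \<open>q \<in> Q\<close> by (simp add: R_def)
  then show ?thesis using \<open>q = tile_at (v, t)\<close> by blast
 qed
 have keys: "e \<in> boundary_edges (fst (tile_at p))" "snd (tile_at p) e = Some k" if "p \<in> R" "(e, k) \<in> set (tedges p)" for p e k
 proof -
  have p: "snd p \<in> set tables" using that(1) by (simp add: R_def)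
  show "snd (tile_at p) e = Some k" using tile_edges(1)[OF p] that(2) by blast
  have "e \<in> fst ` set (tedges p)" using imageI[OF that(2), of fst] by simp
  then show "e \<in> boundary_edges (fst (tile_at p))" using tile_edges(2)[OF p] by blast
 qed
 \<comment> \<open>A segment that no copy carries gets an arbitrary value, here 0.\<close>
 define col where "col e = (if \<exists>p\<in>R. \<exists>k. (e, k) \<in> set (tedges p) then (SOME k. \<exists>p\<in>R. (e, k) \<in> set (tedges p)) else 0)" for e
 have col: "col e = k" if "p \<in> R" "(e, k) \<in> set (tedges p)" for p e k
 proof -
  have "\<exists>p\<in>R. (e, col e) \<in> set (tedges p)"
  proof -
   have ex: "\<exists>k. \<exists>p\<in>R. (e, k) \<in> set (tedges p)" using that by blast
   then have "col e = (SOME k. \<exists>p\<in>R. (e, k) \<in> set (tedges p))" unfolding col_def using that by auto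
   then show ?thesis using someI_ex[OF ex] by simp
  qed
  then obtain r where r: "r \<in> R" "(e, col e) \<in> set (tedges r)" by blast
  have "snd (tile_at p) e = snd (tile_at r) e"
   using Q(4) keys[OF that] keys[OF r] that(1) r(1) unfolding R_def by blast
  then show ?thesis using keys(2)[OF that] keys(2)[OF r] by simp
 qed
 have tileable: "tileable P col"
  unfolding tileable_def
 proof (intro exI[of _ R] conjI ballI impI)
  show "(\<Union>p\<in>R. set (tcells p)) = P"
  proof -
   have "(\<Union>p\<in>R. fst (tile_at p)) = (\<Union>q\<in>Q. fst q)" using QR by (fastforce simp: R_def)
   then show ?thesis using Q(2) by (simp add: tile_at_def)
  qed
  fix p q assume pq: "p \<in> R" "q \<in> R" "p ~= q"
  show "set (tcells p) \<inter> set (tcells q) = {}"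
  proof (cases "tile_at p = tile_at q")
   \<comment> \<open>Tables are distinguishable up to translation, so equal copies come from equal
     pairs.\<close>
   case True
   obtain v s w t where p: "p = (v, s)" "q = (w, t)" by (cases p; cases q)
   have st: "s \<in> set tables" "t \<in> set tables" using pq p by (auto simp: R_def)
   have "translate (- w) (tile_at (v, s)) = translate (- w) (tile_at (w, t))" using True p by simp
   then have eq: "tile_at (v - w, s) = tile_at ((0, 0), t)" by (simp add: translate_tile_at zero_prod_def)
   then have "s = t" using tile_at_inject st by blast
   have "set (tcells (v, s)) = set (tcells (w, t))" using True p by (simp add: tile_at_def)
   then have "{fst v..<fst v + int (width t)} \<times> {snd v} = {fst w..<fst w + int (width t)} \<times> {snd w}"
    using tcells_table(1) st \<open>s = t\<close> by simp
   then have "v = w" using tcells_table(2)[OF st(2)]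
    by (auto simp: times_eq_iff atLeastLessThan_eq_iff prod_eq_iff)
   then show ?thesis using pq(3) p \<open>s = t\<close> by simp
  next
   case False
   then have "fst (tile_at p) \<inter> fst (tile_at q) = {}" using Q(3) pq(1,2) unfolding R_def by blast
   then show ?thesis by (simp add: tile_at_def)
  qed
 qed (use col in \<open>auto simp: R_def\<close>)
 have bd_col: "col e = k" if bd: "bd e = Some k" for e k
 proof -
  have e: "e \<in> boundary_edges P" using bd assms by blast
  then obtain c where c: "c \<in> P" "e \<in> cell_edges c" "!!d. d \<in> P ==> e \<in> cell_edges d ==> d = c"
   unfolding boundary_edges_def by blast
  obtain q where q: "q \<in> Q" "c \<in> fst q" using c(1) Q(2) by blast
  obtain p where p: "p \<in> R" "q = tile_at p" using QR[OF q(1)] by blast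
  have "fst q \<subseteq> P" using q(1) Q(2) by blast
  then have eq: "e \<in> boundary_edges (fst q)" unfolding boundary_edges_def using c q(2) by blast
  then have "snd q e = Some k" using Q(5) q(1) e bd by simp
  then have "(e, k) \<in> set (tedges p)" using tile_edges(1) p by (auto simp: R_def)
  then show ?thesis by (rule col[OF p(1)])
 qed
 show "\<exists>col. tileable P col \<and> (\<forall>e k. bd e = Some k --> col e = k)"
  by (intro exI[of _ col] conjI tileable allI impI bd_col)
next
 assume "\<exists>col. tileable P col \<and> (\<forall>e k. bd e = Some k --> col e = k)"
 then obtain col where tileable: "tileable P col" and bd_col: "\<forall>e k. bd e = Some k --> col e = k"
  by (elim exE conjE) (rule that)
 from tileable[unfolded tileable_def] obtain R
  where R1: "\<forall>p\<in>R. snd p \<in> set tables \<and> (\<forall>(e, k)\<in>set (tedges p). col e = k)"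
   and R2: "(\<Union>p\<in>R. set (tcells p)) = P"
   and R3: "\<forall>p\<in>R. \<forall>q\<in>R. p ~= q --> set (tcells p) \<inter> set (tcells q) = {}"
  by (elim exE conjE) (rule that)
 have R: "!!p. p \<in> R ==> snd p \<in> set tables" "!!p e k. p \<in> R ==> (e, k) \<in> set (tedges p) ==> col e = k"
   "(\<Union>p\<in>R. set (tcells p)) = P" "!!p q. p \<in> R ==> q \<in> R ==> p ~= q ==> set (tcells p) \<inter> set (tcells q) = {}"
 proof -
  show "snd p \<in> set tables" if "p \<in> R" for p using bspec[OF R1 that] by (rule conjunct1)
  show "col e = k" if "p \<in> R" "(e, k) \<in> set (tedges p)" for p e k
   using bspec[OF conjunct2[OF bspec[OF R1 that(1)]] that(2)] by simp
  show "(\<Union>p\<in>R. set (tcells p)) = P" by (rule R2)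
  show "set (tcells p) \<inter> set (tcells q) = {}" if "p \<in> R" "q \<in> R" "p ~= q" for p q
   by (rule mp[OF bspec[OF bspec[OF R3 that(1)] that(2)] that(3)])
 qed
 note col = bd_col[rule_format]
 have val: "snd (tile_at p) e = Some (col e)" if "p \<in> R" "e \<in> boundary_edges (fst (tile_at p))" for p e
 proof -
  note p = that
  obtain k where k: "(e, k) \<in> set (tedges p)" using tile_edges(2)[OF R(1)[OF p(1)], of e] p(2) by auto
  then show ?thesis using tile_edges(1)[OF R(1)[OF p(1)], of e k] R(2)[OF p(1) k] by simp
 qed
 show "tiles_region tiles (P, bd)"
  unfolding tiles_region_def copies fst_conv snd_conv
 proof (intro exI[of _ "tile_at ` R"] conjI ballI impI)
  show "tile_at ` R \<subseteq> {tile_at (v, t) | v t. t \<in> set tables}"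
  proof
   fix q assume "q \<in> tile_at ` R"
   then obtain v t where "(v, t) \<in> R" "q = tile_at (v, t)" by auto
   moreover from this have "t \<in> set tables" using R(1)[of "(v, t)"] by simp
   ultimately show "q \<in> {tile_at (v, t) | v t. t \<in> set tables}" by blast
  qed
  show "(\<Union>q\<in>tile_at ` R. fst q) = P" using R(3) by (simp add: tile_at_def)
  fix a b assume "a \<in> tile_at ` R" "b \<in> tile_at ` R"
  then obtain p q where p: "p \<in> R" "a = tile_at p" "q \<in> R" "b = tile_at q" by blast
  show "fst a \<inter> fst b = {}" if "a ~= b" using R(4)[OF p(1,3)] p(2,4) that by (auto simp: tile_at_def)
  show "snd a e = snd b e" if "e \<in> boundary_edges (fst a) \<inter> boundary_edges (fst b)" for e
   using that val p by simp
  show "snd a e = bd e" if e: "e \<in> boundary_edges (fst a) \<inter> boundary_edges P" for e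
  proof -
   obtain k where "bd e = Some k" using e assms by blast
   then show ?thesis using col[of e k] val[OF p(1), of e] p(2) e by simp
  qed
 qed
qed

text \<open>Every tile has height one, hence lies in a single row, and cutting between rows never
  cuts a tile.\<close>

lemma tileable_Un:
 assumes "snd ` P \<inter> snd ` P' = {}"
 shows "tileable (P \<union> P') col \<longleftrightarrow> tileable P col \<and> tileable P' col"
proof
 assume "tileable (P \<union> P') col"
 then obtain Q where Q: "\<forall>p\<in>Q. snd p \<in> set tables \<and> (\<forall>(e, k)\<in>set (tedges p). col e = k)"
  "(\<Union>p\<in>Q. set (tcells p)) = P \<union> P'" "\<forall>p\<in>Q. \<forall>q\<in>Q. p ~= q --> set (tcells p) \<inter> set (tcells q) = {}"
  unfolding tileable_def by (elim exE conjE) (rule that)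
 have part: "tileable A col" if A: "P \<union> P' = A \<union> B" "snd ` A \<inter> snd ` B = {}" for A B
  unfolding tileable_def
 proof (intro exI[of _ "{p \<in> Q. snd (fst p) \<in> snd ` A}"] conjI)
  show "(\<Union>p\<in>{p \<in> Q. snd (fst p) \<in> snd ` A}. set (tcells p)) = A"
  proof (intro set_eqI iffI)
   fix c assume "c \<in> (\<Union>p\<in>{p \<in> Q. snd (fst p) \<in> snd ` A}. set (tcells p))"
   then obtain p where p: "p \<in> Q" "snd (fst p) \<in> snd ` A" "c \<in> set (tcells p)" by blast
   have "snd c = snd (fst p)" using tcells_table(1)[of "snd p" "fst p"] p Q(1) by auto
   moreover have "c \<in> A \<union> B" using p Q(2) A(1) by blast
   ultimately show "c \<in> A" using p(2) A(2) by force
  next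
   fix c assume c: "c \<in> A"
   then obtain p where p: "p \<in> Q" "c \<in> set (tcells p)" using A(1) Q(2) by blast
   have "snd c = snd (fst p)" using tcells_table(1)[of "snd p" "fst p"] p Q(1) by auto
   then have "snd (fst p) \<in> snd ` A" using c by (metis imageI)
   then show "c \<in> (\<Union>p\<in>{p \<in> Q. snd (fst p) \<in> snd ` A}. set (tcells p))" using p by blast
  qed
 qed (use Q(1,3) in auto)
 show "tileable P col \<and> tileable P' col"
  using part[of P P'] part[of P' P] assms by (simp add: Un_commute Int_commute)
next
 assume "tileable P col \<and> tileable P' col"
 then obtain Q Q' where
  Q: "\<forall>p\<in>Q. snd p \<in> set tables \<and> (\<forall>(e, k)\<in>set (tedges p). col e = k)"
   "(\<Union>p\<in>Q. set (tcells p)) = P" "\<forall>p\<in>Q. \<forall>q\<in>Q. p ~= q --> set (tcells p) \<inter> set (tcells q) = {}"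
  and Q': "\<forall>p\<in>Q'. snd p \<in> set tables \<and> (\<forall>(e, k)\<in>set (tedges p). col e = k)"
   "(\<Union>p\<in>Q'. set (tcells p)) = P'" "\<forall>p\<in>Q'. \<forall>q\<in>Q'. p ~= q --> set (tcells p) \<inter> set (tcells q) = {}"
  unfolding tileable_def by (elim exE conjE) (rule that)
 have disj: "P \<inter> P' = {}" using assms by blast
 have cross: "set (tcells p) \<inter> set (tcells q) = {}" if "p \<in> Q" "q \<in> Q'" for p q
  using that Q(2) Q'(2) disj by blast
 show "tileable (P \<union> P') col"
  unfolding tileable_def
 proof (intro exI[of _ "Q \<union> Q'"] conjI ballI impI)
  show "(\<Union>p\<in>Q \<union> Q'. set (tcells p)) = P \<union> P'" using Q(2) Q'(2) by blast
  fix p q assume "p \<in> Q \<union> Q'" "q \<in> Q \<union> Q'" "p ~= q"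
  then show "set (tcells p) \<inter> set (tcells q) = {}"
   using Q(3) Q'(3) cross[of p q] cross[of q p] by (elim UnE) (simp_all add: Int_commute)
 qed (use Q(1) Q'(1) in auto)
qed

lemma tileable_empty: "tileable {} col"
 unfolding tileable_def by (intro exI[of _ "{}"]) simp

text \<open>The tile over the leftmost cell has to begin there, so a row is read from left to
  right.\<close>

lemma tileable_row_step:
 assumes "a < b"
 shows "tileable ({a..<b} \<times> {y}) col \<longleftrightarrow> (\<exists>t\<in>set tables. a + int (width t) \<le> b \<and>
  (\<forall>(e, k)\<in>set (tedges ((a, y), t)). col e = k) \<and> tileable ({a + int (width t)..<b} \<times> {y}) col)"
proof
 assume "tileable ({a..<b} \<times> {y}) col"
 then obtain Q where Q: "\<forall>p\<in>Q. snd p \<in> set tables \<and> (\<forall>(e, k)\<in>set (tedges p). col e = k)"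
  "(\<Union>p\<in>Q. set (tcells p)) = {a..<b} \<times> {y}" "\<forall>p\<in>Q. \<forall>q\<in>Q. p ~= q --> set (tcells p) \<inter> set (tcells q) = {}"
  unfolding tileable_def by (elim exE conjE) (rule that)
 have "(a, y) \<in> (\<Union>p\<in>Q. set (tcells p))" using assms Q(2) by simp
 then obtain v t where p: "(v, t) \<in> Q" "(a, y) \<in> set (tcells (v, t))" by auto
 have t: "t \<in> set tables" using Q(1) p(1) by force
 have cells: "set (tcells (v, t)) = {fst v..<fst v + int (width t)} \<times> {snd v}" "1 \<le> width t"
  using tcells_table[OF t] by auto
 have sub: "set (tcells (v, t)) \<subseteq> {a..<b} \<times> {y}" using Q(2) p(1) by blast
 have "v \<in> set (tcells (v, t))" unfolding cells(1) using cells(2) by (cases v) simp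
 then have "a \<le> fst v" "snd v = y" using sub by (cases v; auto)+
 moreover have "fst v \<le> a" using p(2) unfolding cells(1) by simp
 ultimately have v: "v = (a, y)" by (simp add: prod_eq_iff)
 have "(a + int (width t) - 1, y) \<in> set (tcells (v, t))" unfolding cells(1) using v cells(2) by simp
 then have "(a + int (width t) - 1, y) \<in> {a..<b} \<times> {y}" using sub by blast
 then have w: "a + int (width t) \<le> b" by simp
 have "tileable ({a + int (width t)..<b} \<times> {y}) col"
  unfolding tileable_def
 proof (intro exI[of _ "Q - {(v, t)}"] conjI)
  have "(\<Union>p\<in>Q - {(v, t)}. set (tcells p)) = {a..<b} \<times> {y} - set (tcells (v, t))"
   using Q(2,3) p(1) by blast
  also have "\<dots> = {a + int (width t)..<b} \<times> {y}" unfolding cells(1) using v by auto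
  finally show "(\<Union>p\<in>Q - {(v, t)}. set (tcells p)) = {a + int (width t)..<b} \<times> {y}" .
 qed (use Q(1,3) in auto)
 moreover have "\<forall>(e, k)\<in>set (tedges ((a, y), t)). col e = k" using conjunct2[OF bspec[OF Q(1) p(1)]] v by simp
 ultimately show "\<exists>t\<in>set tables. a + int (width t) \<le> b \<and>
  (\<forall>(e, k)\<in>set (tedges ((a, y), t)). col e = k) \<and> tileable ({a + int (width t)..<b} \<times> {y}) col"
  using t w by (intro bexI[of _ t] conjI)
next
 assume "\<exists>t\<in>set tables. a + int (width t) \<le> b \<and>
  (\<forall>(e, k)\<in>set (tedges ((a, y), t)). col e = k) \<and> tileable ({a + int (width t)..<b} \<times> {y}) col"
 then obtain t Q where t: "t \<in> set tables" "a + int (width t) \<le> b" "\<forall>(e, k)\<in>set (tedges ((a, y), t)). col e = k"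
  and Q: "\<forall>p\<in>Q. snd p \<in> set tables \<and> (\<forall>(e, k)\<in>set (tedges p). col e = k)"
  "(\<Union>p\<in>Q. set (tcells p)) = {a + int (width t)..<b} \<times> {y}"
  "\<forall>p\<in>Q. \<forall>q\<in>Q. p ~= q --> set (tcells p) \<inter> set (tcells q) = {}"
  unfolding tileable_def by (elim bexE exE conjE) (rule that)
 have cells: "set (tcells ((a, y), t)) = {a..<a + int (width t)} \<times> {y}" using tcells_table(1)[OF t(1)] by simp
 have disj: "set (tcells ((a, y), t)) \<inter> set (tcells q) = {}" if "q \<in> Q" for q
 proof -
  have "set (tcells q) \<subseteq> {a + int (width t)..<b} \<times> {y}" using that Q(2) by blast
  then show ?thesis unfolding cells by auto
 qed
 show "tileable ({a..<b} \<times> {y}) col"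
  unfolding tileable_def
 proof (intro exI[of _ "insert ((a, y), t) Q"] conjI ballI impI)
  show "(\<Union>p\<in>insert ((a, y), t) Q. set (tcells p)) = {a..<b} \<times> {y}"
   using t(2) unfolding UN_insert cells Q(2) by auto
  fix p q assume "p \<in> insert ((a, y), t) Q" "q \<in> insert ((a, y), t) Q" "p ~= q"
  then show "set (tcells p) \<inter> set (tcells q) = {}"
   using Q(3) disj[of p] disj[of q] by (elim insertE) (simp_all add: Int_commute)
 qed (use Q(1) t in auto)
qed

subsection \<open>Rows of instructions\<close>

primrec hcol :: "(edge => nat) => int => int => nat => nat list" where
 "hcol col x y 0 = []"
| "hcol col x y (Suc m) = col (Hor (x, y)) # hcol col (x + 1) y m"

primrec vcol :: "(edge => nat) => int => int => nat => nat list" where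
 "vcol col x y 0 = []"
| "vcol col x y (Suc m) = col (Ver (x, y)) # vcol col (x + 1) y m"

lemma length_hcol [simp]: "length (hcol col x y m) = m"
 by (induction m arbitrary: x) auto

lemma nth_hcol: "i < m ==> hcol col x y m ! i = col (Hor (x + int i, y))"
 by (induction m arbitrary: x i) (auto simp: nth_Cons algebra_simps split: nat.split)

lemma hcol_eqI:
 "length B = m ==> (!!i. i < m ==> col (Hor (x + int i, y)) = B ! i) ==> hcol col x y m = B"
 by (rule nth_equalityI) (simp_all add: nth_hcol)

lemma length_vcol [simp]: "length (vcol col x y m) = m"
 by (induction m arbitrary: x) auto

lemma nth_vcol: "i < m ==> vcol col x y m ! i = col (Ver (x + int i, y))"
 by (induction m arbitrary: x i) (auto simp: nth_Cons algebra_simps split: nat.split)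

lemma vcol_eqI:
 "length B = m ==> (!!i. i < m ==> col (Ver (x + int i, y)) = B ! i) ==> vcol col x y m = B"
 by (rule nth_equalityI) (simp_all add: nth_vcol)

lemma hcol_add: "hcol col x y (m + n) = hcol col x y m @ hcol col (x + int m) y n"
 by (induction m arbitrary: x) (auto simp: algebra_simps)

lemma bex_tables: "(\<exists>t\<in>set tables. Q t) \<longleftrightarrow> (\<exists>h v. Q (cross h v)) \<or> (\<exists>h. Q (turn h)) \<or>
  (\<exists>a b. Q (shift_tile a b)) \<or> (\<exists>a t. Q (gate_tile a t))"
 unfolding set_tables by blast

lemma table_matches:
 "(\<forall>(e, k)\<in>set (tedges ((a, y), cross h v)). col e = k) \<longleftrightarrow> col (Ver (a, y)) = bit_color h \<and>
  col (Ver (a + 1, y)) = bit_color h \<and> col (Hor (a, y)) = bit_color v \<and> col (Hor (a, y + 1)) = bit_color v"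
 "(\<forall>(e, k)\<in>set (tedges ((a, y), turn h)). col e = k) \<longleftrightarrow> col (Ver (a, y)) = bit_color h \<and>
  col (Ver (a + 1, y)) = 3 \<and> col (Hor (a, y)) = 3 \<and> col (Hor (a, y + 1)) = bit_color h"
 "(\<forall>(e, k)\<in>set (tedges ((a, y), shift_tile p q)). col e = k) \<longleftrightarrow> col (Ver (a, y)) = 4 \<and>
  col (Ver (a + 2, y)) = bit_color q \<and> col (Hor (a, y)) = bit_color p \<and> col (Hor (a + 1, y)) = bit_color q \<and>
  col (Hor (a, y + 1)) = 2 \<and> col (Hor (a + 1, y + 1)) = bit_color p"
 "(\<forall>(e, k)\<in>set (tedges ((a, y), gate_tile p t)). col e = k) \<longleftrightarrow> col (Ver (a, y)) = 5 \<and>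
  col (Ver (a + 2, y)) = bit_color False \<and> col (Hor (a, y)) = bit_color p \<and>
  col (Hor (a + 1, y)) = bit_color (\<not> (p \<and> t)) \<and>
  col (Hor (a, y + 1)) = bit_color t \<and> col (Hor (a + 1, y + 1)) = bit_color t"
 by (auto simp: tedges_def mk_edge_def mk_cell_def cross_def turn_def shift_tile_def gate_tile_def)

lemma widths: "width (cross h v) = 1" "width (turn h) = 1" "width (shift_tile p q) = 2" "width (gate_tile p q) = 2"
 by (simp_all add: width_def cross_def turn_def shift_tile_def gate_tile_def)

text \<open>Left and bottom color leave a single candidate for the next tile; the gate alone may
  leave a choice.\<close>

lemma peel_cross:
 assumes "a < b" "col (Ver (a, y)) = bit_color h" "col (Hor (a, y)) = bit_color v"
 shows "tileable ({a..<b} \<times> {y}) col \<longleftrightarrow> col (Ver (a + 1, y)) = bit_color h \<and> col (Hor (a, y + 1)) = bit_color v \<and>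
  tileable ({a + 1..<b} \<times> {y}) col"
 unfolding tileable_row_step[OF assms(1)] bex_tables table_matches widths using assms by auto

lemma peel_turn:
 assumes "a < b" "col (Ver (a, y)) = bit_color h" "col (Hor (a, y)) = 3"
 shows "tileable ({a..<b} \<times> {y}) col \<longleftrightarrow> col (Ver (a + 1, y)) = 3 \<and> col (Hor (a, y + 1)) = bit_color h \<and>
  tileable ({a + 1..<b} \<times> {y}) col"
 unfolding tileable_row_step[OF assms(1)] bex_tables table_matches widths using assms by auto

lemma peel_shift:
 assumes "a < b" "col (Ver (a, y)) = 4"
 shows "tileable ({a..<b} \<times> {y}) col \<longleftrightarrow> (\<exists>p q. a + 2 \<le> b \<and>
  col (Ver (a + 2, y)) = bit_color q \<and> col (Hor (a, y)) = bit_color p \<and> col (Hor (a + 1, y)) = bit_color q \<and>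
  col (Hor (a, y + 1)) = 2 \<and> col (Hor (a + 1, y + 1)) = bit_color p \<and> tileable ({a + 2..<b} \<times> {y}) col)"
 unfolding tileable_row_step[OF assms(1)] bex_tables table_matches widths using assms by auto

lemma peel_gate:
 assumes "a < b" "col (Ver (a, y)) = 5"
 shows "tileable ({a..<b} \<times> {y}) col \<longleftrightarrow> (\<exists>p t. a + 2 \<le> b \<and>
  col (Ver (a + 2, y)) = bit_color False \<and> col (Hor (a, y)) = bit_color p \<and>
  col (Hor (a + 1, y)) = bit_color (\<not> (p \<and> t)) \<and>
  col (Hor (a, y + 1)) = bit_color t \<and> col (Hor (a + 1, y + 1)) = bit_color t \<and> tileable ({a + 2..<b} \<times> {y}) col)"
 unfolding tileable_row_step[OF assms(1)] bex_tables table_matches widths using assms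
 by (simp del: de_Morgan_conj)

lemma row_cross:
 assumes "hcol col a y m = map bit_color bs" "col (Ver (a, y)) = bit_color h"
 shows "tileable ({a..<a + int m} \<times> {y}) col \<longleftrightarrow>
  hcol col a (y + 1) m = map bit_color bs \<and> vcol col (a + 1) y m = replicate m (bit_color h)"
 using assms
proof (induction m arbitrary: a bs)
 case 0
 then show ?case by (simp add: tileable_empty)
next
 case (Suc m)
 from Suc.prems(1) obtain b bs' where bs: "bs = b # bs'" "col (Hor (a, y)) = bit_color b"
  "hcol col (a + 1) y m = map bit_color bs'" by (cases bs) auto
 have e: "a + int (Suc m) = a + 1 + int m" by simp
 have "tileable ({a..<a + int (Suc m)} \<times> {y}) col \<longleftrightarrow> col (Ver (a + 1, y)) = bit_color h \<and>
   col (Hor (a, y + 1)) = bit_color b \<and> tileable ({a + 1..<a + 1 + int m} \<times> {y}) col"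
  unfolding e[symmetric] by (rule peel_cross) (use Suc.prems(2) bs(2) in simp_all)
 then show ?case using Suc.IH[OF bs(3)] bs(1) by auto
qed

text \<open>The crosses carry the bit from the left to the last column, where color 3 below calls
  for the turn.\<close>

lemma row_cross_turn:
 assumes "hcol col a y (Suc m) = map bit_color bs @ [3]" "col (Ver (a, y)) = bit_color h"
 shows "tileable ({a..<a + int (Suc m)} \<times> {y}) col \<longleftrightarrow>
  hcol col a (y + 1) (Suc m) = map bit_color (bs @ [h]) \<and> vcol col (a + 1) y (Suc m) = replicate m (bit_color h) @ [3]"
 using assms
proof (induction m arbitrary: a bs)
 case 0
 then have "bs = []" "col (Hor (a, y)) = 3" by (cases bs; simp)+
 then show ?case using peel_turn[of a "a + 1" col y h] 0 by (auto simp: tileable_empty)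
next
 case (Suc m)
 from Suc.prems(1) obtain b bs' where bs: "bs = b # bs'" "col (Hor (a, y)) = bit_color b"
  "hcol col (a + 1) y (Suc m) = map bit_color bs' @ [3]" by (cases bs) auto
 have e: "a + int (Suc (Suc m)) = a + 1 + int (Suc m)" by simp
 have "tileable ({a..<a + int (Suc (Suc m))} \<times> {y}) col \<longleftrightarrow> col (Ver (a + 1, y)) = bit_color h \<and>
   col (Hor (a, y + 1)) = bit_color b \<and> tileable ({a + 1..<a + 1 + int (Suc m)} \<times> {y}) col"
  unfolding e[symmetric] by (rule peel_cross) (use Suc.prems(2) bs(2) in simp_all)
 moreover have "hcol col a (y + 1) (Suc (Suc m)) = col (Hor (a, y + 1)) # hcol col (a + 1) (y + 1) (Suc m)"
  "vcol col (a + 1) y (Suc (Suc m)) = col (Ver (a + 1, y)) # vcol col (a + 1 + 1) y (Suc m)" by simp_all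
 ultimately show ?case using Suc.IH[OF bs(3)] bs(1) by (auto simp del: hcol.simps vcol.simps)
qed

lemma row_shift:
 assumes "hcol col a y (Suc m) = map bit_color (p # q # r) @ [3]" "col (Ver (a, y)) = 4"
 shows "tileable ({a..<a + int (Suc m)} \<times> {y}) col \<longleftrightarrow>
  hcol col a (y + 1) (Suc m) = 2 # map bit_color (p # r @ [q]) \<and>
  vcol col (a + 2) y m = replicate (m - 1) (bit_color q) @ [3]"
proof -
 have "length (hcol col a y (Suc m)) = length (map bit_color (p # q # r) @ [3])" using assms(1) by simp
 then have m: "m = Suc (Suc (length r))" by simp
 from assms(1) have h: "col (Hor (a, y)) = bit_color p" "col (Hor (a + 1, y)) = bit_color q"
  "hcol col (a + 2) y (Suc (length r)) = map bit_color r @ [3]" unfolding m by (simp_all add: add.assoc)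
 have e: "a + int (Suc m) = a + 2 + int (Suc (length r))" unfolding m by simp
 have "tileable ({a..<a + int (Suc m)} \<times> {y}) col \<longleftrightarrow> col (Ver (a + 2, y)) = bit_color q \<and> col (Hor (a, y + 1)) = 2 \<and>
   col (Hor (a + 1, y + 1)) = bit_color p \<and> tileable ({a + 2..<a + 2 + int (Suc (length r))} \<times> {y}) col"
  unfolding e by (subst peel_shift) (use assms(2) h in auto)
 also have "\<dots> \<longleftrightarrow> col (Ver (a + 2, y)) = bit_color q \<and> col (Hor (a, y + 1)) = 2 \<and>
   col (Hor (a + 1, y + 1)) = bit_color p \<and> hcol col (a + 2) (y + 1) (Suc (length r)) = map bit_color (r @ [q]) \<and>
   vcol col (a + 2 + 1) y (Suc (length r)) = replicate (length r) (bit_color q) @ [3]"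
  using row_cross_turn[OF h(3)] by blast
 also have "\<dots> \<longleftrightarrow> hcol col a (y + 1) (Suc m) = 2 # map bit_color (p # r @ [q]) \<and>
  vcol col (a + 2) y m = replicate (m - 1) (bit_color q) @ [3]"
 proof -
  have "hcol col a (y + 1) (Suc m) = col (Hor (a, y + 1)) # col (Hor (a + 1, y + 1)) # hcol col (a + 2) (y + 1) (Suc (length r))"
   "vcol col (a + 2) y m = col (Ver (a + 2, y)) # vcol col (a + 2 + 1) y (Suc (length r))"
   unfolding m by (simp_all add: add.assoc)
  then show ?thesis unfolding m by (auto simp del: hcol.simps vcol.simps)
 qed
 finally show ?thesis .
qed

lemma row_gate:
 assumes "hcol col a y m = map bit_color (p # q # r)" "col (Ver (a, y)) = 5"
 shows "tileable ({a..<a + int m} \<times> {y}) col \<longleftrightarrow>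
  (\<exists>t. (q \<longleftrightarrow> \<not> (p \<and> t)) \<and> hcol col a (y + 1) m = map bit_color (t # t # r)) \<and>
  vcol col (a + 2) y (m - 1) = replicate (m - 1) (bit_color False)"
proof -
 have "length (hcol col a y m) = length (map bit_color (p # q # r))" using assms(1) by simp
 then have m: "m = Suc (Suc (length r))" by simp
 from assms(1) have h: "col (Hor (a, y)) = bit_color p" "col (Hor (a + 1, y)) = bit_color q"
  "hcol col (a + 2) y (length r) = map bit_color r" unfolding m by (simp_all add: add.assoc)
 have e: "a + int m = a + 2 + int (length r)" unfolding m by simp
 have "tileable ({a..<a + int m} \<times> {y}) col \<longleftrightarrow> (\<exists>t. col (Ver (a + 2, y)) = bit_color False \<and> (q \<longleftrightarrow> \<not> (p \<and> t)) \<and>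
   col (Hor (a, y + 1)) = bit_color t \<and> col (Hor (a + 1, y + 1)) = bit_color t \<and>
   tileable ({a + 2..<a + 2 + int (length r)} \<times> {y}) col)"
  unfolding e by (subst peel_gate) (use assms(2) h in \<open>auto simp del: de_Morgan_conj\<close>)
 also have "\<dots> \<longleftrightarrow> (\<exists>t. (q \<longleftrightarrow> \<not> (p \<and> t)) \<and> col (Hor (a, y + 1)) = bit_color t \<and> col (Hor (a + 1, y + 1)) = bit_color t \<and>
   hcol col (a + 2) (y + 1) (length r) = map bit_color r) \<and> col (Ver (a + 2, y)) = bit_color False \<and>
   vcol col (a + 2 + 1) y (length r) = replicate (length r) (bit_color False)"
  using row_cross[OF h(3)] by blast
 also have "\<dots> \<longleftrightarrow> (\<exists>t. (q \<longleftrightarrow> \<not> (p \<and> t)) \<and> hcol col a (y + 1) m = map bit_color (t # t # r)) \<and>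
  vcol col (a + 2) y (m - 1) = replicate (m - 1) (bit_color False)"
 proof -
  have "hcol col a (y + 1) m = col (Hor (a, y + 1)) # col (Hor (a + 1, y + 1)) # hcol col (a + 2) (y + 1) (length r)"
   "vcol col (a + 2) y (m - 1) = col (Ver (a + 2, y)) # vcol col (a + 2 + 1) y (length r)"
   unfolding m by (simp_all add: add.assoc)
  then show ?thesis unfolding m by (auto simp del: hcol.simps vcol.simps de_Morgan_conj)
 qed
 finally show ?thesis .
qed

definition left_color :: "kind => nat" where "left_color k = (case k of Shift => 4 | Gate => 5)"
definition right_color :: "kind => nat" where "right_color k = (case k of Shift => 3 | Gate => 0)"
definition top_mark :: "kind => nat list" where "top_mark k = (case k of Shift => [2] | Gate => [])"
definition bottom_mark :: "kind => nat list" where "bottom_mark k = (case k of Shift => [3] | Gate => [])"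

lemmas kind_defs = left_color_def right_color_def top_mark_def bottom_mark_def shift_of_def

lemma length_marks: "length (top_mark k) = shift_of k" "length (bottom_mark k) = shift_of k"
 by (cases k; simp add: kind_defs)+

text \<open>Two implications instead of an equivalence: soundness forgets the vertical colors inside
  the row, completeness has to prescribe them. The bit \<open>bs ! 1\<close> is the one that a shift
  sends to the right.\<close>

lemma row_kind:
 assumes "length bs = m" "2 \<le> m" "hcol col a y (m + shift_of k) = map bit_color bs @ bottom_mark k"
  "col (Ver (a, y)) = left_color k"
 shows "tileable ({a..<a + int (m + shift_of k)} \<times> {y}) col ==>
   \<exists>z. act k bs z \<and> hcol col a (y + 1) (m + shift_of k) = top_mark k @ map bit_color z"
  and "act k bs z ==> hcol col a (y + 1) (m + shift_of k) = top_mark k @ map bit_color z ==>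
   vcol col (a + 2) y (m + shift_of k - 1) =
    replicate (m - 1) (if k = Shift then bit_color (bs ! 1) else 0) @ bottom_mark k ==>
   tileable ({a..<a + int (m + shift_of k)} \<times> {y}) col"
proof -
 obtain p q r where bs: "bs = p # q # r"
  using assms(1,2) by (cases bs; cases "tl bs") auto
 have 0: "bit_color False = 0" by (simp add: bit_color_def)
 have shift: "tileable ({a..<a + int (m + shift_of k)} \<times> {y}) col \<longleftrightarrow>
   hcol col a (y + 1) (m + shift_of k) = top_mark k @ map bit_color (p # r @ [q]) \<and>
   vcol col (a + 2) y (m + shift_of k - 1) = replicate (m - 1) (bit_color q) @ bottom_mark k" if k: "k = Shift"
 proof -
  have 3: "hcol col a y (Suc m) = map bit_color (p # q # r) @ [3]" "col (Ver (a, y)) = 4"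
   using assms(3,4) unfolding k bs kind_defs kind.case by (simp_all del: hcol.simps)
  have 4: "m + shift_of k = Suc m" "m + shift_of k - 1 = m" "top_mark k = [2]" "bottom_mark k = [3]"
   unfolding k kind_defs kind.case by simp_all
  show ?thesis unfolding 4 row_shift[OF 3] by (simp del: hcol.simps)
 qed
 have gate: "tileable ({a..<a + int (m + shift_of k)} \<times> {y}) col \<longleftrightarrow>
   (\<exists>t. (q \<longleftrightarrow> \<not> (p \<and> t)) \<and> hcol col a (y + 1) (m + shift_of k) = top_mark k @ map bit_color (t # t # r)) \<and>
   vcol col (a + 2) y (m + shift_of k - 1) = replicate (m - 1) 0 @ bottom_mark k" if k: "k = Gate"
 proof -
  have 3: "hcol col a y m = map bit_color (p # q # r)" "col (Ver (a, y)) = 5"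
   using assms(3,4) unfolding k bs kind_defs kind.case by (simp_all del: hcol.simps)
  have 4: "m + shift_of k = m" "m + shift_of k - 1 = m - 1" "top_mark k = []" "bottom_mark k = []"
   unfolding k kind_defs kind.case by simp_all
  show ?thesis unfolding 4 row_gate[OF 3] 0 append_Nil append_Nil2 ..
 qed
 show "\<exists>z. act k bs z \<and> hcol col a (y + 1) (m + shift_of k) = top_mark k @ map bit_color z"
  if t: "tileable ({a..<a + int (m + shift_of k)} \<times> {y}) col"
 proof (cases k)
  case Shift
  have "act k bs (p # r @ [q])" unfolding bs Shift by simp
  with shift[OF Shift] t show ?thesis by blast
 next
  case Gate
  obtain u where u: "q \<longleftrightarrow> \<not> (p \<and> u)" "hcol col a (y + 1) (m + shift_of k) = top_mark k @ map bit_color (u # u # r)"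
   using gate[OF Gate] t by blast
  have "act k bs (u # u # r)" unfolding bs Gate act.simps using u(1) by blast
  with u(2) show ?thesis by blast
 qed
 show "tileable ({a..<a + int (m + shift_of k)} \<times> {y}) col"
  if h1: "act k bs z" and h2: "hcol col a (y + 1) (m + shift_of k) = top_mark k @ map bit_color z"
   and h3: "vcol col (a + 2) y (m + shift_of k - 1) =
    replicate (m - 1) (if k = Shift then bit_color (bs ! 1) else 0) @ bottom_mark k"
 proof (cases k)
  case Shift
  have "z = p # r @ [q]" using h1 unfolding bs Shift act.simps .
  moreover have "(if k = Shift then bit_color (bs ! 1) else 0) = bit_color q" unfolding bs Shift by simp
  ultimately show ?thesis unfolding shift[OF Shift] using h2 h3 by simp
 next
  case Gate
  from h1[unfolded bs Gate act.simps] obtain u where u: "q \<longleftrightarrow> \<not> (p \<and> u)" "z = u # u # r"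
   by (elim exE conjE) (rule that)
  have c: "(if k = Shift then bit_color (bs ! 1) else 0) = 0" unfolding Gate by simp
  have "\<exists>t. (q \<longleftrightarrow> \<not> (p \<and> t)) \<and> hcol col a (y + 1) (m + shift_of k) = top_mark k @ map bit_color (t # t # r)"
   using u(1) h2[unfolded u(2)] by blast
  then show ?thesis unfolding gate[OF Gate] using h3[unfolded c] by (rule conjI)
 qed
qed

section \<open>The two rows of an instruction and their boundary\<close>

primrec hlist :: "int => int => nat list => (edge \<times> nat) list" where
 "hlist x y [] = []"
| "hlist x y (c # cs) = (Hor (x, y), c) # hlist (x + 1) y cs"

definition agree :: "(edge => nat) => (edge \<times> nat) list => bool" where
 "agree col L \<longleftrightarrow> (\<forall>(e, k)\<in>set L. col e = k)"

lemma agree_simps [simp]: "agree col []" "agree col ((e, k) # L) \<longleftrightarrow> col e = k \<and> agree col L"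
 "agree col (L @ L') \<longleftrightarrow> agree col L \<and> agree col L'"
 by (simp_all add: agree_def ball_Un)

lemma agree_hlist: "agree col (hlist x y cs) \<longleftrightarrow> hcol col x y (length cs) = cs"
 by (induction cs arbitrary: x) auto

lemma keys_hlist: "fst ` set (hlist x y cs) = {Hor (i, y) | i. x \<le> i \<and> i < x + int (length cs)}"
proof (induction cs arbitrary: x)
 case (Cons c cs)
 have "{i. x \<le> i \<and> i < x + int (length (c # cs))} = insert x {i. x + 1 \<le> i \<and> i < x + 1 + int (length cs)}" by auto
 then show ?case using Cons[of "x + 1"] by (auto simp: set_eq_iff)
qed simp

lemma distinct_hlist: "distinct (map fst (hlist x y cs))"
proof (induction cs arbitrary: x)
 case (Cons c cs)
 have "Hor (x, y) \<notin> fst ` set (hlist (x + 1) y cs)" unfolding keys_hlist by auto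
 then show ?case using Cons[of "x + 1"] by simp
qed simp

text \<open>
 \<open>f\<close> is the column of the first bit of the queue, \<open>y\<close> the height of the row for the next
 instruction and \<open>n\<close> the length of the queue.
\<close>

definition moved :: "instr => int => int" where
 "moved i f = (case i of (\<alpha>, k, \<beta>) => f + int (length \<beta> + shift_of k - length \<alpha>))"

definition left_over :: "instr => nat => nat" where
 "left_over i n = (case i of (\<alpha>, k, \<beta>) => n + length \<alpha> - length \<beta>)"

text \<open>The colored boundary of both rows apart from the wires of the queue below and above;
  those are shared with the neighbouring instructions or form the two ends of the program.\<close>

definition instr_sides :: "instr => int => int => nat => (edge \<times> nat) list" where
 "instr_sides i f y n = (case i of (\<alpha>, k, \<beta>) =>
  hlist (f - int (length \<alpha>)) y (map bit_color \<alpha>) @ hlist (f + int n) y (bottom_mark k) @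
  (Ver (f - int (length \<alpha>), y), left_color k) # (Ver (f + int (n + shift_of k), y), right_color k) #
  hlist (f - int (length \<alpha>)) (y + 1) (top_mark k @ map bit_color \<beta>) @
  [(Ver (moved i f, y + 1), 0), (Ver (moved i f + int (left_over i n), y + 1), 0)])"

definition instr_row :: "instr => int => nat => int \<times> int" where
 "instr_row i f n = (case i of (\<alpha>, k, \<beta>) => (f - int (length \<alpha>), f + int (n + shift_of k)))"

definition instr_ok :: "instr => nat => bool" where
 "instr_ok i n \<longleftrightarrow> (case i of (\<alpha>, k, \<beta>) => 1 \<le> n \<and> 2 \<le> n + length \<alpha> \<and>
   length \<alpha> \<le> 2 \<and> length \<beta> \<le> 2 \<and> length \<alpha> \<le> length \<beta> + shift_of k \<and> length \<beta> + 1 \<le> n + length \<alpha>)"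

lemma qlens_Cons: "qlens (i # p) n n' \<longleftrightarrow> instr_ok i n \<and> qlens p (left_over i n) n'"
 by (cases i) (simp add: instr_ok_def left_over_def)

abbreviation row_cells :: "int \<times> int => int => cell set" where
 "row_cells I y \<equiv> {fst I..<snd I} \<times> {y}"

lemma act_length: "act k bs z ==> length z = length bs"
 by (induction k bs z rule: act.induct) auto

text \<open>The prescribed sides supply the constants below and force the removed ones above; the
  row of crosses then hands the rest of the result up unchanged.\<close>

lemma instr_sound:
 assumes ok: "instr_ok i n" and len: "length xs = n"
  and bot: "hcol col f y n = map bit_color xs"
  and sides: "agree col (instr_sides i f y n)"
  and tiled: "tileable (row_cells (instr_row i f n) y) col"
   "tileable (row_cells (moved i f, moved i f + int (left_over i n)) (y + 1)) col"
 shows "\<exists>ys. length ys = left_over i n \<and> hcol col (moved i f) (y + 2) (left_over i n) = map bit_color ys \<and> istep i xs ys"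
proof -
 obtain \<alpha> k \<beta> where i: "i = (\<alpha>, k, \<beta>)" by (cases i)
 let ?a = "f - int (length \<alpha>)" and ?s = "shift_of k" and ?m = "length \<alpha> + n"
 let ?f = "moved i f" and ?n = "left_over i n"
 note ok' = ok[unfolded i instr_ok_def prod.case]
 have s: "hcol col ?a y (length \<alpha>) = map bit_color \<alpha>" "hcol col (f + int n) y ?s = bottom_mark k"
  "col (Ver (?a, y)) = left_color k" "hcol col ?a (y + 1) (?s + length \<beta>) = top_mark k @ map bit_color \<beta>"
  "col (Ver (?f, y + 1)) = bit_color False"
  using sides unfolding i instr_sides_def by (simp_all add: agree_hlist length_marks bit_color_def)
 have "hcol col ?a y (length \<alpha> + (n + ?s)) = map bit_color \<alpha> @ map bit_color xs @ bottom_mark k"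
  unfolding hcol_add using s(1,2) bot by simp
 then have bots: "hcol col ?a y (?m + ?s) = map bit_color (\<alpha> @ xs) @ bottom_mark k" by (simp add: add.assoc)
 have e: "?a + int (?m + ?s) = f + int (n + ?s)" by simp
 obtain z where z: "act k (\<alpha> @ xs) z" "hcol col ?a (y + 1) (?m + ?s) = top_mark k @ map bit_color z"
  using row_kind(1)[OF _ _ bots s(3)] tiled(1) len ok' unfolding e by (auto simp: i instr_row_def)
 have f: "?a + int (?s + length \<beta>) = ?f" using ok' by (simp add: i moved_def)
 have mn: "?m + ?s = (?s + length \<beta>) + ?n" using ok' by (simp add: i left_over_def)
 have "top_mark k @ map bit_color \<beta> @ hcol col ?f (y + 1) ?n = top_mark k @ map bit_color z"
  using z(2) unfolding mn hcol_add[of col ?a "y + 1" "?s + length \<beta>" ?n] s(4) f by simp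
 then have zz: "map bit_color z = map bit_color \<beta> @ hcol col ?f (y + 1) ?n" by simp
 define w where "w = drop (length \<beta>) z"
 have "take (length \<beta>) (map bit_color z) = map bit_color \<beta>" "drop (length \<beta>) (map bit_color z) = hcol col ?f (y + 1) ?n"
  unfolding zz by simp_all
 then have w: "take (length \<beta>) z = \<beta>" "hcol col ?f (y + 1) ?n = map bit_color w"
  unfolding w_def take_map drop_map by simp_all
 have "z = \<beta> @ w" using append_take_drop_id[of "length \<beta>" z] w(1) unfolding w_def by simp
 have "hcol col ?f (y + 1 + 1) ?n = map bit_color w"
  using row_cross[OF w(2) s(5)] tiled(2) by simp
 then have top: "hcol col ?f (y + 2) ?n = map bit_color w" by (simp add: add.assoc)
 have "?n = length w" using arg_cong[OF top, of length] by (simp only: length_hcol length_map)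
 then show ?thesis using top z(1) \<open>z = \<beta> @ w\<close> by (intro exI[of _ w]) (simp add: i)
qed

lemma instr_complete:
 assumes ok: "instr_ok i n" and len: "length xs = n" "length ys = left_over i n" and step: "istep i xs ys"
 shows "\<exists>col. hcol col f y n = map bit_color xs \<and> hcol col (moved i f) (y + 2) (left_over i n) = map bit_color ys \<and>
  agree col (instr_sides i f y n) \<and> tileable (row_cells (instr_row i f n) y) col \<and>
  tileable (row_cells (moved i f, moved i f + int (left_over i n)) (y + 1)) col"
proof -
 obtain \<alpha> k \<beta> where i: "i = (\<alpha>, k, \<beta>)" by (cases i)
 let ?a = "f - int (length \<alpha>)" and ?s = "shift_of k" and ?m = "length \<alpha> + n"
 let ?f = "moved i f" and ?n = "left_over i n"
 note ok' = ok[unfolded i instr_ok_def prod.case]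
 have act: "act k (\<alpha> @ xs) (\<beta> @ ys)" using step by (simp add: i)
 define L0 where "L0 = map bit_color (\<alpha> @ xs) @ bottom_mark k"
 define L1 where "L1 = top_mark k @ map bit_color (\<beta> @ ys)"
 \<comment> \<open>The second entry is a filler: this segment lies inside the domino and is not a
   side of any tile of the row.\<close>
 define V where "V = left_color k # 0 # replicate (?m - 1) (if k = Shift then bit_color ((\<alpha> @ xs) ! 1) else 0) @ bottom_mark k"
 define col where "col e = (case e of
   Hor p => if snd p = y then L0 ! nat (fst p - ?a) else if snd p = y + 1 then L1 ! nat (fst p - ?a)
    else map bit_color ys ! nat (fst p - ?f)
  | Ver p => if snd p = y then V ! nat (fst p - ?a) else 0)" for e
 have L: "length L0 = ?m + ?s" "length L1 = ?m + ?s"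
  using act_length[OF act] len(1) by (simp_all add: L0_def L1_def length_marks)
 have V: "length V = Suc (?m + ?s)" using ok' by (simp add: V_def length_marks)
 have 0: "hcol col ?a y (?m + ?s) = L0" by (rule hcol_eqI) (simp_all add: L col_def)
 have 1: "hcol col ?a (y + 1) (?m + ?s) = L1" by (rule hcol_eqI) (simp_all add: L col_def)
 have 2: "hcol col ?f (y + 2) ?n = map bit_color ys" by (rule hcol_eqI) (simp_all add: len col_def)
 have 3: "vcol col ?a y (Suc (?m + ?s)) = V" by (rule vcol_eqI) (simp_all add: V col_def)
 have f: "?a + int (?s + length \<beta>) = ?f" using ok' by (simp add: i moved_def)
 have mn: "?m + ?s = (?s + length \<beta>) + ?n" using ok' by (simp add: i left_over_def)
 have "hcol col ?a y (length \<alpha> + (n + ?s)) = map bit_color \<alpha> @ map bit_color xs @ bottom_mark k"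
  using 0 by (simp add: L0_def add.assoc)
 then have b: "hcol col ?a y (length \<alpha>) = map bit_color \<alpha>" "hcol col f y n = map bit_color xs"
   "hcol col (f + int n) y ?s = bottom_mark k"
  unfolding hcol_add by (simp_all add: append_eq_append_conv len(1))
 have "hcol col ?a (y + 1) (?s + length \<beta>) @ hcol col ?f (y + 1) ?n = (top_mark k @ map bit_color \<beta>) @ map bit_color ys"
  using 1 unfolding mn hcol_add[of col ?a "y + 1" "?s + length \<beta>" ?n] f L1_def by simp
 note tops = this
 have t: "hcol col ?a (y + 1) (?s + length \<beta>) = top_mark k @ map bit_color \<beta>" "hcol col ?f (y + 1) ?n = map bit_color ys"
 proof -
  from tops have "hcol col ?a (y + 1) (?s + length \<beta>) = top_mark k @ map bit_color \<beta> \<and>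
    hcol col ?f (y + 1) ?n = map bit_color ys"
   by (subst (asm) append_eq_append_conv) (simp_all add: length_marks len)
  then show "hcol col ?a (y + 1) (?s + length \<beta>) = top_mark k @ map bit_color \<beta>"
   "hcol col ?f (y + 1) ?n = map bit_color ys" by simp_all
 qed
 have vl: "col (Ver (?a, y)) = left_color k" by (simp add: col_def V_def)
 have vr: "col (Ver (f + int (n + ?s), y)) = right_color k"
 proof -
  have "nat (f + int (n + ?s) - ?a) = ?m + ?s" by simp
  then have "col (Ver (f + int (n + ?s), y)) = V ! (?m + ?s)" by (simp add: col_def)
  also have "\<dots> = right_color k" using ok' by (cases k) (auto simp: V_def kind_defs nth_append nth_Cons')
  finally show ?thesis .
 qed
 have v2: "vcol col (?a + 2) y (?m + ?s - 1) =
   replicate (?m - 1) (if k = Shift then bit_color ((\<alpha> @ xs) ! 1) else 0) @ bottom_mark k"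
 proof -
  have "Suc (?m + ?s) = Suc (Suc (?m + ?s - 1))" using ok' by simp
  then have "vcol col ?a y (Suc (?m + ?s)) = col (Ver (?a, y)) # col (Ver (?a + 1, y)) # vcol col (?a + 2) y (?m + ?s - 1)"
   by (simp only: vcol.simps add.assoc one_add_one)
  then show ?thesis using 3 unfolding V_def by simp
 qed
 have e: "?a + int (?m + ?s) = f + int (n + ?s)" by simp
 have T1: "tileable (row_cells (instr_row i f n) y) col"
  using row_kind(2)[OF _ _ 0[unfolded L0_def] vl act 1[unfolded L1_def] v2] len(1) ok' unfolding e
  by (simp add: i instr_row_def)
 have Vz: "col (Ver (x, y + 1)) = 0" for x by (simp add: col_def)
 have T2: "tileable (row_cells (?f, ?f + int ?n) (y + 1)) col"
  unfolding fst_conv snd_conv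
 proof (subst row_cross[OF t(2)])
  show "col (Ver (?f, y + 1)) = bit_color False" by (simp add: Vz bit_color_def)
  have "vcol col (?f + 1) (y + 1) ?n = replicate ?n (bit_color False)"
   by (rule vcol_eqI) (simp_all add: Vz bit_color_def)
  then show "hcol col ?f (y + 1 + 1) ?n = map bit_color ys \<and> vcol col (?f + 1) (y + 1) ?n = replicate ?n (bit_color False)"
   using 2 by (simp add: add.assoc)
 qed
 have "agree col (instr_sides i f y n)"
  unfolding instr_sides_def i prod.case
  using b t vl vr by (simp add: agree_hlist length_marks Vz)
 then show ?thesis using b(2) 2 T1 T2 by blast
qed

subsection \<open>Regions of programs\<close>

primrec lay :: "(instr => int => int => nat => 'a list) => instr list => int => int => nat => 'a list" where
 "lay g [] f y n = []"
| "lay g (i # p) f y n = g i f y n @ lay g p (moved i f) (y + 2) (left_over i n)"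

primrec final_col :: "instr list => int => int" where
 "final_col [] f = f"
| "final_col (i # p) f = final_col p (moved i f)"

text \<open>The second row consists of crosses. Without it, constants removed on top of one
  instruction and constants entering the next one from below could share segments, which would then
  not be on the boundary.\<close>

definition instr_rows :: "instr => int => int => nat => (int \<times> int) list" where
 "instr_rows i f y n = [instr_row i f n, (moved i f, moved i f + int (left_over i n))]"

definition instr_cells :: "instr => int => int => nat => cell list" where
 "instr_cells i f y n = row_list (fst (instr_row i f n)) (snd (instr_row i f n)) y @
  row_list (moved i f) (moved i f + int (left_over i n)) (y + 1)"

fun stack_cells :: "int => (int \<times> int) list => cell set" where
 "stack_cells y [] = {}"
| "stack_cells y (I # J) = row_cells I y \<union> stack_cells (y + 1) J"

fun height :: "edge => int" where
 "height (Hor p) = snd p"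
| "height (Ver p) = snd p"

lemma stack_cells_height: "c \<in> stack_cells y J ==> y \<le> snd c \<and> snd c < y + int (length J)"
proof (induction J arbitrary: y)
 case (Cons I J)
 show ?case
 proof (cases "c \<in> row_cells I y")
  case True
  then have "snd c = y" by auto
  then show ?thesis by simp
 next
  case False
  then have "c \<in> stack_cells (y + 1) J" using Cons.prems by simp
  from Cons.IH[OF this] show ?thesis by simp
 qed
qed simp

lemma set_cells: "set (lay instr_cells p f y n) = stack_cells y (lay instr_rows p f y n)"
 by (induction p arbitrary: f y n) (simp_all add: instr_cells_def instr_rows_def set_row_list Un_assoc add.assoc)

lemma length_rows: "length (lay instr_rows p f y n) = 2 * length p"
 by (induction p arbitrary: f y n) (simp_all add: instr_rows_def)

lemma height_hlist: "(e, k) \<in> set (hlist x y cs) ==> height e = y"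
 by (induction cs arbitrary: x) auto

lemma height_instr_sides: "(e, k) \<in> set (instr_sides i f y n) ==> height e = y \<or> height e = y + 1"
 by (cases i) (auto simp: instr_sides_def dest: height_hlist)

lemma height_sides: "(e, k) \<in> set (lay instr_sides p f y n) ==> y \<le> height e \<and> height e < y + 2 * int (length p)"
proof (induction p arbitrary: f y n)
 case (Cons i p)
 from Cons.prems consider "(e, k) \<in> set (instr_sides i f y n)"
  | "(e, k) \<in> set (lay instr_sides p (moved i f) (y + 2) (left_over i n))" by auto
 then show ?case
 proof cases
  case 1
  from height_instr_sides[OF this] show ?thesis by auto
 next
  case 2
  from Cons.IH[OF this] show ?thesis by auto
 qed
qed simp

lemma tileable_cong:
 assumes "tileable P col" "!!c e. c \<in> P ==> e \<in> cell_edges c ==> col e = col' e"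
 shows "tileable P col'"
proof -
 from assms(1)[unfolded tileable_def] obtain Q
  where Q: "\<forall>p\<in>Q. snd p \<in> set tables \<and> (\<forall>(e, k)\<in>set (tedges p). col e = k)"
   "(\<Union>p\<in>Q. set (tcells p)) = P" "\<forall>p\<in>Q. \<forall>q\<in>Q. p ~= q --> set (tcells p) \<inter> set (tcells q) = {}"
  by (elim exE conjE) (rule that)
 have "col' e = k" if p: "p \<in> Q" "(e, k) \<in> set (tedges p)" for p e k
 proof -
  have "snd p \<in> set tables" "col e = k" using bspec[OF Q(1) p(1)] p(2) by auto
  have "e \<in> fst ` set (tedges p)" using imageI[OF p(2), of fst] by simp
  then have "e \<in> boundary_edges (set (tcells p))"
   using keys_table[OF \<open>snd p \<in> set tables\<close>, of "fst p"] by simp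
  then obtain c where "c \<in> set (tcells p)" "e \<in> cell_edges c" unfolding boundary_edges_def by blast
  then have "col e = col' e" using assms(2)[of c e] Q(2) p(1) by blast
  then show ?thesis using \<open>col e = k\<close> by simp
 qed
 then have "\<forall>p\<in>Q. snd p \<in> set tables \<and> (\<forall>(e, k)\<in>set (tedges p). col' e = k)"
  using Q(1) by (auto split: prod.splits)
 then show ?thesis unfolding tileable_def using Q(2,3) by (intro exI[of _ Q] conjI)
qed

lemma tileable_rows:
 "tileable (stack_cells y (lay instr_rows (i # p) f y n)) col \<longleftrightarrow>
  tileable (row_cells (instr_row i f n) y) col \<and>
  tileable (row_cells (moved i f, moved i f + int (left_over i n)) (y + 1)) col \<and>
  tileable (stack_cells (y + 2) (lay instr_rows p (moved i f) (y + 2) (left_over i n))) col"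
proof -
 let ?r1 = "row_cells (instr_row i f n) y" and ?r2 = "row_cells (moved i f, moved i f + int (left_over i n)) (y + 1)"
 let ?s = "stack_cells (y + 2) (lay instr_rows p (moved i f) (y + 2) (left_over i n))"
 have e: "stack_cells y (lay instr_rows (i # p) f y n) = ?r1 \<union> (?r2 \<union> ?s)" by (simp add: instr_rows_def add.assoc)
 have h: "y + 2 \<le> snd c" if "c \<in> ?s" for c using stack_cells_height[OF that] by simp
 have "tileable (?r2 \<union> ?s) col \<longleftrightarrow> tileable ?r2 col \<and> tileable ?s col"
  by (rule tileable_Un) (force dest: h)
 moreover have "tileable (?r1 \<union> (?r2 \<union> ?s)) col \<longleftrightarrow> tileable ?r1 col \<and> tileable (?r2 \<union> ?s) col"
  by (rule tileable_Un) (force dest: h)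
 ultimately show ?thesis unfolding e by blast
qed

lemma layout_sound:
 assumes "qlens p n n'" "length xs = n" "length zs = n'"
  "hcol col f y n = map bit_color xs"
  "hcol col (final_col p f) (y + 2 * int (length p)) n' = map bit_color zs"
  "agree col (lay instr_sides p f y n)" "tileable (stack_cells y (lay instr_rows p f y n)) col"
 shows "qrun p xs zs"
 using assms
proof (induction p arbitrary: f y n xs)
 case Nil
 then show ?case by simp
next
 case (Cons i p)
 have q: "instr_ok i n" "qlens p (left_over i n) n'" using Cons.prems(1) unfolding qlens_Cons by auto
 note t = Cons.prems(7)[unfolded tileable_rows]
 have s: "agree col (instr_sides i f y n)" "agree col (lay instr_sides p (moved i f) (y + 2) (left_over i n))"
  using Cons.prems(6) by simp_all
 obtain ys where ys: "length ys = left_over i n" "hcol col (moved i f) (y + 2) (left_over i n) = map bit_color ys" "istep i xs ys"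
  using instr_sound[OF q(1) Cons.prems(2,4) s(1)] t by blast
 have "hcol col (final_col p (moved i f)) (y + 2 + 2 * int (length p)) n' = map bit_color zs"
  using Cons.prems(5) by (simp add: algebra_simps)
 from Cons.IH[OF q(2) ys(1) Cons.prems(3) ys(2) this s(2)] t have "qrun p ys zs" by blast
 then show ?case using ys(3) by auto
qed

lemma istep_length: "istep i xs ys ==> length ys = left_over i (length xs)"
 by (cases i) (auto simp: left_over_def dest: act_length)

lemma layout_complete:
 assumes "qlens p n n'" "length xs = n" "length zs = n'" "qrun p xs zs"
 shows "\<exists>col. hcol col f y n = map bit_color xs \<and>
  hcol col (final_col p f) (y + 2 * int (length p)) n' = map bit_color zs \<and>
  agree col (lay instr_sides p f y n) \<and> tileable (stack_cells y (lay instr_rows p f y n)) col"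
 using assms
proof (induction p arbitrary: f y n xs)
 case Nil
 have "hcol (\<lambda>e. case e of Hor q => map bit_color xs ! nat (fst q - f) | Ver q => 0) f y n = map bit_color xs"
  by (rule hcol_eqI) (use Nil in simp_all)
 then show ?case using Nil by (auto simp: tileable_empty)
next
 case (Cons i p)
 have q: "instr_ok i n" "qlens p (left_over i n) n'" using Cons.prems(1) unfolding qlens_Cons by auto
 obtain ys where ys: "istep i xs ys" "qrun p ys zs" using Cons.prems(4) by auto
 have ly: "length ys = left_over i n" using istep_length[OF ys(1)] Cons.prems(2) by simp
 let ?f = "moved i f" and ?n = "left_over i n"
 obtain c1 where c1: "hcol c1 f y n = map bit_color xs" "hcol c1 ?f (y + 2) ?n = map bit_color ys"
  "agree c1 (instr_sides i f y n)" "tileable (row_cells (instr_row i f n) y) c1"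
  "tileable (row_cells (?f, ?f + int ?n) (y + 1)) c1"
  using instr_complete[OF q(1) Cons.prems(2) ly ys(1), of f y] by blast
 obtain c2 where c2: "hcol c2 ?f (y + 2) ?n = map bit_color ys"
  "hcol c2 (final_col p ?f) (y + 2 + 2 * int (length p)) n' = map bit_color zs"
  "agree c2 (lay instr_sides p ?f (y + 2) ?n)" "tileable (stack_cells (y + 2) (lay instr_rows p ?f (y + 2) ?n)) c2"
  using Cons.IH[OF q(2) ly Cons.prems(3) ys(2), of ?f "y + 2"] by blast
 \<comment> \<open>Both colorings show \<open>ys\<close> on the wires at height
   \<open>y + 2\<close>, so they can be pasted there.\<close>
 define col where "col e = (if height e \<le> y + 1 then c1 e else c2 e)" for e
 have same: "c1 (Hor (x, y + 2)) = c2 (Hor (x, y + 2))" if "?f \<le> x" "x < ?f + int ?n" for x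
 proof -
  have i: "nat (x - ?f) < ?n" using that by simp
  have "hcol c1 ?f (y + 2) ?n ! nat (x - ?f) = hcol c2 ?f (y + 2) ?n ! nat (x - ?f)" using c1(2) c2(1) by simp
  then show ?thesis unfolding nth_hcol[OF i] using that by simp
 qed
 have hc: "hcol col x h m = hcol c1 x h m" if "h \<le> y + 1" for x h m
  by (rule hcol_eqI) (use that in \<open>simp_all add: col_def nth_hcol\<close>)
 have hc2: "hcol col x h m = hcol c2 x h m" if "y + 1 < h" for x h m
  by (rule hcol_eqI) (use that in \<open>simp_all add: col_def nth_hcol\<close>)
 have t1: "tileable (row_cells (instr_row i f n) y) col"
 proof (rule tileable_cong[OF c1(4)])
  fix c e assume "c \<in> row_cells (instr_row i f n) y" "e \<in> cell_edges c"
  then have "height e \<le> y + 1" by (cases c) auto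
  then show "c1 e = col e" by (simp add: col_def)
 qed
 have t2: "tileable (row_cells (?f, ?f + int ?n) (y + 1)) col"
 proof (rule tileable_cong[OF c1(5)])
  fix c e assume c: "c \<in> row_cells (?f, ?f + int ?n) (y + 1)" "e \<in> cell_edges c"
  then obtain x where x: "c = (x, y + 1)" "?f \<le> x" "x < ?f + int ?n" by auto
  have "e = Hor (x, y + 1) \<or> e = Hor (x, y + 2) \<or> e = Ver (x, y + 1) \<or> e = Ver (x + 1, y + 1)"
   using c(2) unfolding x(1) by (simp add: add.assoc)
  then show "c1 e = col e" using same[OF x(2,3)] by (auto simp: col_def)
 qed
 have t3: "tileable (stack_cells (y + 2) (lay instr_rows p ?f (y + 2) ?n)) col"
 proof (rule tileable_cong[OF c2(4)])
  fix c e assume c: "c \<in> stack_cells (y + 2) (lay instr_rows p ?f (y + 2) ?n)" "e \<in> cell_edges c"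
  have "y + 2 \<le> height e" using stack_cells_height[OF c(1)] c(2) by (cases c) auto
  then show "c2 e = col e" by (simp add: col_def)
 qed
 have a1: "agree col (instr_sides i f y n)"
  unfolding agree_def
 proof (intro ballI, clarify)
  fix e k assume e: "(e, k) \<in> set (instr_sides i f y n)"
  then have "c1 e = k" using bspec[OF c1(3)[unfolded agree_def] e] by simp
  then show "col e = k" using height_instr_sides[OF e] by (auto simp: col_def)
 qed
 have a2: "agree col (lay instr_sides p ?f (y + 2) ?n)"
  unfolding agree_def
 proof (intro ballI, clarify)
  fix e k assume e: "(e, k) \<in> set (lay instr_sides p ?f (y + 2) ?n)"
  then have "c2 e = k" using bspec[OF c2(3)[unfolded agree_def] e] by simp
  then show "col e = k" using height_sides[OF e] by (auto simp: col_def)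
 qed
 have "hcol col f y n = map bit_color xs" using hc c1(1) by simp
 moreover have "hcol col (final_col (i # p) f) (y + 2 * int (length (i # p))) n' = map bit_color zs"
  using hc2[of "y + 2 + 2 * int (length p)" "final_col p ?f" n'] c2(2) by (simp add: algebra_simps)
 moreover have "agree col (lay instr_sides (i # p) f y n)" using a1 a2 by simp
 moreover have "tileable (stack_cells y (lay instr_rows (i # p) f y n)) col"
  unfolding tileable_rows using t1 t2 t3 by blast
 ultimately show ?case by blast
qed

subsection \<open>Boundaries of stacks\<close>

definition wires :: "int => int => nat => edge set" where
 "wires f y n = {Hor (x, y) | x. f \<le> x \<and> x < f + int n}"

text \<open>A segment has only two cells at its sides, so boundaries of disjoint sets add modulo
  two.\<close>

lemma boundary_Un:
 assumes "P \<inter> P' = {}"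
 shows "e \<in> boundary_edges (P \<union> P') \<longleftrightarrow> (e \<in> boundary_edges P) ~= (e \<in> boundary_edges P')"
proof (cases e)
 case (Hor q)
 then show ?thesis using assms by (cases q) (auto simp: boundary_Hor)
next
 case (Ver q)
 then show ?thesis using assms by (cases q) (auto simp: boundary_Ver)
qed

text \<open>The side conditions make the truncated subtractions exact.\<close>

lemma moved_arith:
 assumes "instr_ok (\<alpha>, k, \<beta>) n"
 shows "moved (\<alpha>, k, \<beta>) f = f - int (length \<alpha>) + int (shift_of k) + int (length \<beta>)"
  "moved (\<alpha>, k, \<beta>) f + int (left_over (\<alpha>, k, \<beta>) n) = f + int n + int (shift_of k)"
  "1 \<le> n" "1 \<le> left_over (\<alpha>, k, \<beta>) n"
 using assms by (auto simp: instr_ok_def moved_def left_over_def)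

lemma keys_instr_sides:
 fixes f :: int
 assumes "instr_ok (\<alpha>, k, \<beta>) n"
 defines "f' \<equiv> moved (\<alpha>, k, \<beta>) f"
 shows "fst ` set (instr_sides (\<alpha>, k, \<beta>) f y n) =
  {Hor (x, y) | x. f - int (length \<alpha>) \<le> x \<and> x < f} \<union> {Hor (x, y) | x. f + int n \<le> x \<and> x < f + int n + int (shift_of k)} \<union>
  {Hor (x, y + 1) | x. f - int (length \<alpha>) \<le> x \<and> x < f'} \<union>
  {Ver (f - int (length \<alpha>), y), Ver (f + int n + int (shift_of k), y), Ver (f', y + 1), Ver (f + int n + int (shift_of k), y + 1)}"
 using moved_arith(1,2)[OF assms(1), of f] moved_arith(3,4)[OF assms(1)] unfolding instr_sides_def f'_def prod.case set_append image_Un keys_hlist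
  list.set image_insert fst_conv image_empty
 by (auto simp: length_marks)

lemma boundary_instr:
 assumes "instr_ok i n"
 shows "e \<in> boundary_edges (row_cells (instr_row i f n) y \<union> row_cells (moved i f, moved i f + int (left_over i n)) (y + 1)) \<longleftrightarrow>
  ((e \<in> fst ` set (instr_sides i f y n)) ~= (e \<in> wires f y n)) ~= (e \<in> wires (moved i f) (y + 2) (left_over i n))"
proof -
 obtain \<alpha> k \<beta> where i: "i = (\<alpha>, k, \<beta>)" by (cases i)
 note m = moved_arith(1,2)[OF assms[unfolded i], of f, folded i] moved_arith(3,4)[OF assms[unfolded i], folded i]
 note keys = keys_instr_sides[OF assms[unfolded i], of f y, folded i]
 let ?P = "row_cells (instr_row i f n) y \<union> row_cells (moved i f, moved i f + int (left_over i n)) (y + 1)"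
 define F where "F = moved i f"
 define a b s where "a = int (length \<alpha>)" and "b = int (length \<beta>)" and "s = int (shift_of k)"
 have F: "F = f - a + s + b" using m(1) by (simp add: F_def a_def b_def s_def)
 have FN: "F + int (left_over i n) = f + int n + s" using m(2) by (simp add: F_def s_def)
 have pos: "0 \<le> a" "0 \<le> b" "0 \<le> s" "1 \<le> int n" "F + 1 \<le> f + int n + s"
  using m(3,4) FN by (simp_all add: a_def b_def s_def)
 have P: "(x, h) \<in> ?P \<longleftrightarrow> (h = y \<and> f - a \<le> x \<and> x < f + int n + s) \<or> (h = y + 1 \<and> F \<le> x \<and> x < f + int n + s)" for x h
  using FN by (auto simp: i instr_row_def a_def s_def F_def)
 show ?thesis
 proof (cases e)
  case (Hor q)
  obtain x h where q: "q = (x, h)" by (cases q)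
  have K: "Hor (x, h) \<in> fst ` set (instr_sides i f y n) \<longleftrightarrow>
    (h = y \<and> (f - a \<le> x \<and> x < f \<or> f + int n \<le> x \<and> x < f + int n + s)) \<or> (h = y + 1 \<and> f - a \<le> x \<and> x < F)"
   unfolding keys by (auto simp: a_def s_def F_def)
  have W: "Hor (x, h) \<in> wires f y n \<longleftrightarrow> h = y \<and> f \<le> x \<and> x < f + int n"
   "Hor (x, h) \<in> wires (moved i f) (y + 2) (left_over i n) \<longleftrightarrow> h = y + 2 \<and> F \<le> x \<and> x < f + int n + s"
   using FN by (auto simp: wires_def F_def)
  consider "h = y" | "h = y + 1" | "h = y + 2" | "h ~= y" "h ~= y + 1" "h ~= y + 2" by blast
  then show ?thesis unfolding Hor q boundary_Hor P K W
   by cases (use F pos in auto)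
 next
  case (Ver q)
  obtain x h where q: "q = (x, h)" by (cases q)
  have K: "Ver (x, h) \<in> fst ` set (instr_sides i f y n) \<longleftrightarrow>
    (h = y \<and> (x = f - a \<or> x = f + int n + s)) \<or> (h = y + 1 \<and> (x = F \<or> x = f + int n + s))"
   unfolding keys by (auto simp: a_def s_def F_def)
  have W: "Ver (x, h) \<notin> wires f' y' n'" for f' y' n' by (simp add: wires_def)
  consider "h = y" | "h = y + 1" | "h ~= y" "h ~= y + 1" by blast
  then show ?thesis unfolding Ver q boundary_Ver P K using W
   by cases (use F pos in auto)
 qed
qed

lemma height_wires: "e \<in> wires f y n ==> height e = y"
 by (auto simp: wires_def)

lemma height_keys: "e \<in> fst ` set (lay instr_sides p f y n) ==> y \<le> height e \<and> height e < y + 2 * int (length p)"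
 using height_sides by auto

lemma height_instr_keys: "e \<in> fst ` set (instr_sides i f y n) ==> height e < y + 2"
 using height_instr_sides by fastforce

text \<open>Modulo two the wires between consecutive instructions cancel, and only those at the
  bottom and at the top of the stack remain.\<close>

lemma boundary_layout:
 assumes "qlens p n n'"
 shows "e \<in> boundary_edges (stack_cells y (lay instr_rows p f y n)) \<longleftrightarrow>
  ((e \<in> fst ` set (lay instr_sides p f y n)) ~= (e \<in> wires f y n)) ~= (e \<in> wires (final_col p f) (y + 2 * int (length p)) n')"
 using assms
proof (induction p arbitrary: f y n)
 case Nil
 then show ?case by (auto simp: boundary_edges_def)
next
 case (Cons i p)
 have q: "instr_ok i n" "qlens p (left_over i n) n'" using Cons.prems(1) unfolding qlens_Cons by auto
 let ?f = "moved i f" and ?n = "left_over i n"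
 let ?A = "row_cells (instr_row i f n) y \<union> row_cells (?f, ?f + int ?n) (y + 1)"
 let ?B = "stack_cells (y + 2) (lay instr_rows p ?f (y + 2) ?n)"
 have s: "stack_cells y (lay instr_rows (i # p) f y n) = ?A \<union> ?B" by (simp add: instr_rows_def add.assoc Un_assoc)
 have "?A \<inter> ?B = {}"
 proof (rule equals0I, elim IntE)
  fix c assume "c \<in> ?A"
  then have "snd c \<le> y + 1" by auto
  moreover assume "c \<in> ?B"
  ultimately show False using stack_cells_height by fastforce
 qed
 note U = boundary_Un[OF this, of e]
 have IH: "e \<in> boundary_edges ?B \<longleftrightarrow> ((e \<in> fst ` set (lay instr_sides p ?f (y + 2) ?n)) ~= (e \<in> wires ?f (y + 2) ?n)) ~=
   (e \<in> wires (final_col p ?f) (y + 2 + 2 * int (length p)) n')" by (rule Cons.IH[OF q(2)])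
 have nd: "\<not> (e \<in> fst ` set (instr_sides i f y n) \<and> e \<in> fst ` set (lay instr_sides p ?f (y + 2) ?n))"
 proof (rule notI, elim conjE)
  assume "e \<in> fst ` set (instr_sides i f y n)" "e \<in> fst ` set (lay instr_sides p ?f (y + 2) ?n)"
  from height_instr_keys[OF this(1)] height_keys[OF this(2)] show False by simp
 qed
 have K: "e \<in> fst ` set (lay instr_sides (i # p) f y n) \<longleftrightarrow>
   (e \<in> fst ` set (instr_sides i f y n)) ~= (e \<in> fst ` set (lay instr_sides p ?f (y + 2) ?n))"
  unfolding lay.simps set_append image_Un Un_iff using nd by blast
 have e: "y + 2 * int (length (i # p)) = y + 2 + 2 * int (length p)" by simp
 show ?case unfolding s U K e final_col.simps IH boundary_instr[OF q(1)] by blast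
qed

lemma distinct_instr_sides:
 assumes "instr_ok i n"
 shows "distinct (map fst (instr_sides i f y n))"
proof -
 obtain \<alpha> k \<beta> where i: "i = (\<alpha>, k, \<beta>)" by (cases i)
 note m = moved_arith(1,2)[OF assms[unfolded i], of f] moved_arith(3,4)[OF assms[unfolded i]]
 have k: "set (map fst (hlist x z cs)) = {Hor (j, z) | j. x \<le> j \<and> j < x + int (length cs)}" for x z cs
  using keys_hlist[of x z cs] by simp
 show ?thesis
  unfolding i instr_sides_def prod.case map_append list.map distinct_append distinct.simps set_append k list.set fst_conv
  using m distinct_hlist by (auto simp: length_marks)
qed

lemma distinct_sides:
 assumes "qlens p n n'"
 shows "distinct (map fst (lay instr_sides p f y n))"
 using assms
proof (induction p arbitrary: f y n)
 case (Cons i p)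
 have q: "instr_ok i n" "qlens p (left_over i n) n'" using Cons.prems(1) unfolding qlens_Cons by auto
 have "set (map fst (instr_sides i f y n)) \<inter> set (map fst (lay instr_sides p (moved i f) (y + 2) (left_over i n))) = {}"
 proof (rule equals0I, elim IntE)
  fix e assume "e \<in> set (map fst (instr_sides i f y n))"
   "e \<in> set (map fst (lay instr_sides p (moved i f) (y + 2) (left_over i n)))"
  from height_instr_keys[OF this(1)[unfolded set_map]] height_keys[OF this(2)[unfolded set_map]] show False by simp
 qed
 then show ?case using Cons.IH[OF q(2)] distinct_instr_sides[OF q(1)] by simp
qed simp

lemma sides_bottom:
 assumes "qlens p n n'" "e \<in> wires f y n"
 shows "e \<notin> fst ` set (lay instr_sides p f y n)"
proof (cases p)
 case (Cons i r)
 obtain \<alpha> k \<beta> where i: "i = (\<alpha>, k, \<beta>)" by (cases i)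
 have ok: "instr_ok (\<alpha>, k, \<beta>) n" using assms(1) unfolding Cons qlens_Cons i by simp
 have "e \<notin> fst ` set (instr_sides i f y n)"
  unfolding i keys_instr_sides[OF ok] using assms(2) by (auto simp: wires_def)
 moreover have "e \<notin> fst ` set (lay instr_sides r (moved i f) (y + 2) (left_over i n))"
 proof
  assume "e \<in> fst ` set (lay instr_sides r (moved i f) (y + 2) (left_over i n))"
  from height_keys[OF this] height_wires[OF assms(2)] show False by simp
 qed
 ultimately show ?thesis unfolding Cons by (simp add: image_Un)
qed simp

subsection \<open>Stacks are polyominoes\<close>

primrec overlapping :: "(int \<times> int) list => bool" where
 "overlapping [] \<longleftrightarrow> True"
| "overlapping (I # J) \<longleftrightarrow> fst I < snd I \<and> (J ~= [] --> fst I < snd (hd J) \<and> fst (hd J) < snd I) \<and> overlapping J"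

lemma overlapping_nth:
 "overlapping J ==> i < length J ==> fst (J ! i) < snd (J ! i)"
 "overlapping J ==> Suc i < length J ==> fst (J ! i) < snd (J ! Suc i) \<and> fst (J ! Suc i) < snd (J ! i)"
proof -
 show "overlapping J ==> i < length J ==> fst (J ! i) < snd (J ! i)"
  by (induction J arbitrary: i) (auto simp: nth_Cons split: nat.split)
 show "overlapping J ==> Suc i < length J ==> fst (J ! i) < snd (J ! Suc i) \<and> fst (J ! Suc i) < snd (J ! i)"
 proof (induction J arbitrary: i)
  case (Cons I J)
  then show ?case by (cases i) (auto simp: hd_conv_nth)
 qed simp
qed

lemma stack_cells_nth: "stack_cells y J = (\<Union>i<length J. row_cells (J ! i) (y + int i))"
proof (induction J arbitrary: y)
 case (Cons I J)
 have "{..<length (I # J)} = insert 0 (Suc ` {..<length J})" by (simp add: lessThan_Suc_eq_insert_0)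
 then show ?case using Cons[of "y + 1"] by (simp add: algebra_simps)
qed simp

lemma touches_row_list:
 "touches (row_list a b y) (row_list c d z) \<longleftrightarrow> (\<exists>x u. a \<le> x \<and> x < b \<and> c \<le> u \<and> u < d \<and> near (x, y) (u, z))"
proof
 assume "touches (row_list a b y) (row_list c d z)"
 then obtain p q where pq: "p \<in> {a..<b} \<times> {y}" "q \<in> {c..<d} \<times> {z}" "near p q"
  unfolding touches_def list_ex_iff set_row_list by blast
 then have "p = (fst p, y)" "q = (fst q, z)" "a \<le> fst p" "fst p < b" "c \<le> fst q" "fst q < d"
  by (auto simp: prod_eq_iff)
 with pq(3) show "\<exists>x u. a \<le> x \<and> x < b \<and> c \<le> u \<and> u < d \<and> near (x, y) (u, z)" by metis
next
 assume "\<exists>x u. a \<le> x \<and> x < b \<and> c \<le> u \<and> u < d \<and> near (x, y) (u, z)"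
 then obtain x u where "(x, y) \<in> {a..<b} \<times> {y}" "(u, z) \<in> {c..<d} \<times> {z}" "near (x, y) (u, z)" by auto
 then show "touches (row_list a b y) (row_list c d z)" unfolding touches_def list_ex_iff set_row_list by blast
qed

lemma edge_connected_Un:
 assumes "edge_connected A" "edge_connected B" "a \<in> A" "b \<in> B" "cell_edges a \<inter> cell_edges b ~= {}"
 shows "edge_connected (A \<union> B)"
proof -
 let ?r = "\<lambda>P. {(c, d). c \<in> P \<and> d \<in> P \<and> cell_edges c \<inter> cell_edges d ~= {}}"
 have monoA: "(?r A)\<^sup>* \<subseteq> (?r (A \<union> B))\<^sup>*" and monoB: "(?r B)\<^sup>* \<subseteq> (?r (A \<union> B))\<^sup>*" by (rule rtrancl_mono; auto)+
 have ab: "(a, b) \<in> (?r (A \<union> B))\<^sup>*" "(b, a) \<in> (?r (A \<union> B))\<^sup>*"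
  by (rule r_into_rtrancl; use assms(3-5) in auto)+
 have to_a: "(c, a) \<in> (?r (A \<union> B))\<^sup>* \<and> (a, c) \<in> (?r (A \<union> B))\<^sup>*" if c: "c \<in> A \<union> B" for c
 proof (cases "c \<in> A")
  case True
  then have "(c, a) \<in> (?r A)\<^sup>*" "(a, c) \<in> (?r A)\<^sup>*" using assms(1,3) unfolding edge_connected_def by blast+
  then show ?thesis using monoA by blast
 next
  case False
  then have "(c, b) \<in> (?r B)\<^sup>*" "(b, c) \<in> (?r B)\<^sup>*" using c assms(2,4) unfolding edge_connected_def by blast+
  then have "(c, b) \<in> (?r (A \<union> B))\<^sup>*" "(b, c) \<in> (?r (A \<union> B))\<^sup>*" using monoB by blast+
  then show ?thesis using rtrancl_trans[OF _ ab(2)] rtrancl_trans[OF ab(1)] by simp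
 qed
 show ?thesis
  unfolding edge_connected_def
 proof (intro ballI)
  fix c d assume "c \<in> A \<union> B" "d \<in> A \<union> B"
  from rtrancl_trans[OF conjunct1[OF to_a[OF this(1)]] conjunct2[OF to_a[OF this(2)]]]
  show "(c, d) \<in> (?r (A \<union> B))\<^sup>*" .
 qed
qed

text \<open>Listed from below, each row touches exactly one earlier row: the previous one shares a
  column with it, and all others are too far away.\<close>

lemma stack_polyomino:
 assumes J: "overlapping J" "J ~= []"
 shows "polyomino (stack_cells y J)"
proof -
 define run where "run i = row_list (fst (J ! i)) (snd (J ! i)) (y + int i)" for i
 have set_run: "set (run i) = row_cells (J ! i) (y + int i)" for i by (simp add: run_def set_row_list)
 have far: "\<not> touches (run m) (run i)" if "Suc i < m" for i m
  unfolding run_def touches_row_list using that by auto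
 have close: "touches (run (Suc i)) (run i)" if i: "Suc i < length J" for i
  unfolding run_def touches_row_list
  by (intro exI[of _ "max (fst (J ! i)) (fst (J ! Suc i))"])
   (use overlapping_nth(2)[OF J(1) i] overlapping_nth(1)[OF J(1), of i] overlapping_nth(1)[OF J(1) i] i in auto)
 have tree: "tree_runs (map run [0..<m])" if "m \<le> length J" for m
  using that
 proof (induction m)
  case 0
  show ?case by (simp add: tree_runs_def)
 next
  case (Suc m)
  have r: "is_run (run m)" unfolding run_def by (rule is_run_row_list) (use overlapping_nth(1)[OF J(1), of m] Suc.prems in simp)
  have "length (filter (touches (run m)) (rev (map run [0..<m]))) = 1" if m: "m ~= 0"
  proof -
   obtain j where j: "m = Suc j" using m by (cases m) auto
   have none: "filter (touches (run m)) (rev (map run [0..<j])) = []"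
    using far unfolding j by (auto simp: filter_empty_conv)
   have e: "rev (map run [0..<m]) = run j # rev (map run [0..<j])" unfolding j by simp
   have "touches (run m) (run j)" using close[of j] Suc.prems unfolding j by simp
   then show ?thesis unfolding e using none by simp
  qed
  then show ?case using Suc r by (auto simp: tree_runs_def)
 qed
 have ne: "map run [0..<length J] ~= []" using J(2) by simp
 have all: "\<Union>(set ` set (map run [0..<length J])) = stack_cells y J"
  unfolding stack_cells_nth by (auto simp: set_run)
 have sc: "simply_connected (area (stack_cells y J))"
  using tree_runs_simply_connected[OF tree[OF order_refl] ne] unfolding all .
 have ec: "edge_connected (\<Union>i<Suc m. row_cells (J ! i) (y + int i))" if "m < length J" for m
  using that
 proof (induction m)
  case 0
  then show ?case using row_polyomino[OF overlapping_nth(1)[OF J(1), of 0], of y] by (simp add: polyomino_def lessThan_Suc)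
 next
  case (Suc m)
  let ?A = "\<Union>i<Suc m. row_cells (J ! i) (y + int i)" and ?B = "row_cells (J ! Suc m) (y + int (Suc m))"
  let ?x = "max (fst (J ! m)) (fst (J ! Suc m))"
  note o = overlapping_nth(2)[OF J(1) Suc.prems] overlapping_nth(1)[OF J(1), of m] overlapping_nth(1)[OF J(1) Suc.prems]
  have "edge_connected (?A \<union> ?B)"
  proof (rule edge_connected_Un[of _ _ "(?x, y + int m)" "(?x, y + int (Suc m))"])
   show "edge_connected ?A" by (rule Suc.IH) (use Suc.prems in simp)
   show "edge_connected ?B" using row_polyomino[OF o(3)] by (simp add: polyomino_def)
   have "(?x, y + int m) \<in> row_cells (J ! m) (y + int m)" using o Suc.prems by auto
   then show "(?x, y + int m) \<in> ?A" by blast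
   show "(?x, y + int (Suc m)) \<in> ?B" using o by auto
   have "Hor (?x, y + int (Suc m)) \<in> cell_edges (?x, y + int m) \<inter> cell_edges (?x, y + int (Suc m))"
    by (simp add: add.assoc)
   then show "cell_edges (?x, y + int m) \<inter> cell_edges (?x, y + int (Suc m)) ~= {}" by blast
  qed
  moreover have "(\<Union>i<Suc (Suc m). row_cells (J ! i) (y + int i)) = ?A \<union> ?B" by (subst lessThan_Suc) blast
  ultimately show ?case by simp
 qed
 obtain m where m: "length J = Suc m" using J(2) by (cases J) auto
 have "edge_connected (stack_cells y J)" using ec[of m] m by (simp add: stack_cells_nth)
 moreover have "finite (stack_cells y J)" unfolding stack_cells_nth by simp
 moreover have "stack_cells y J ~= {}" using J by (cases J) auto
 ultimately show ?thesis using sc unfolding polyomino_def area_def by blast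
qed

text \<open>Consecutive rows have the columns of the wires between them in common, and there is at
  least one wire.\<close>

lemma overlapping_rows: "qlens p n n' ==> overlapping (lay instr_rows p f y n)"
proof (induction p arbitrary: f y n)
 case (Cons i p)
 have q: "instr_ok i n" "qlens p (left_over i n) n'" using Cons.prems(1) unfolding qlens_Cons by auto
 obtain \<alpha> k \<beta> where i: "i = (\<alpha>, k, \<beta>)" by (cases i)
 let ?f = "moved i f" and ?n = "left_over i n"
 note m = moved_arith(1,2)[OF q(1)[unfolded i], of f, folded i] moved_arith(3,4)[OF q(1)[unfolded i], folded i]
 have next_row: "fst (instr_row j ?f ?n) \<le> ?f \<and> ?f + int ?n \<le> snd (instr_row j ?f ?n)" for j
  by (cases j) (simp add: instr_row_def)
 have hd: "?f < snd (hd (lay instr_rows p ?f (y + 2) ?n)) \<and> fst (hd (lay instr_rows p ?f (y + 2) ?n)) < ?f + int ?n"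
  if "lay instr_rows p ?f (y + 2) ?n ~= []"
 proof -
  note ne = that
  obtain j r where p: "p = j # r" using ne by (cases p) auto
  show ?thesis using next_row[of j] m(4) unfolding p by (simp add: instr_rows_def)
 qed
 have row: "fst (instr_row i f n) \<le> f" "snd (instr_row i f n) = ?f + int ?n" "fst (instr_row i f n) \<le> ?f"
  using m(1,2) by (simp_all add: i instr_row_def)
 have e: "lay instr_rows (i # p) f y n = instr_row i f n # (?f, ?f + int ?n) # lay instr_rows p ?f (y + 2) ?n"
  by (simp add: instr_rows_def)
 show ?case unfolding e using row Cons.IH[OF q(2), of ?f "y + 2"] hd m(3,4) by simp
qed simp

lemma distinct_cells: "distinct (lay instr_cells p f y n)"
proof (induction p arbitrary: f y n)
 case (Cons i p)
 have d: "distinct (row_list a b z)" for a b z by (simp add: row_list_def distinct_map inj_on_def)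
 have "set (lay instr_cells p (moved i f) (y + 2) (left_over i n)) \<inter> set (instr_cells i f y n) = {}"
 proof (rule equals0I, elim IntE)
  fix c assume "c \<in> set (lay instr_cells p (moved i f) (y + 2) (left_over i n))"
  then have "y + 2 \<le> snd c" unfolding set_cells using stack_cells_height by blast
  moreover assume "c \<in> set (instr_cells i f y n)"
  then have "snd c \<le> y + 1" unfolding instr_cells_def set_append set_row_list by auto
  ultimately show False by simp
 qed
 moreover have "distinct (instr_cells i f y n)" unfolding instr_cells_def by (auto simp: d set_row_list)
 ultimately show ?case using Cons.IH by (simp add: Int_commute)
qed simp

definition region_edges :: "instr list => int => int => bool list => bool list => (edge \<times> nat) list" where
 "region_edges p f y xs zs = lay instr_sides p f y (length xs) @ hlist f y (map bit_color xs) @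
  hlist (final_col p f) (y + 2 * int (length p)) (map bit_color zs)"

text \<open>The wires at the bottom and at the top lie on the boundary; coloring them by
  \<open>xs\<close> and \<open>zs\<close> prescribes the input and the output of the
  program.\<close>

theorem region:
 fixes f y :: int
 assumes q: "qlens p (length xs) (length zs)" and p: "p ~= []"
 defines "cs \<equiv> lay instr_cells p f y (length xs)" and "bs \<equiv> region_edges p f y xs zs"
 shows "distinct (map fst bs)" "colored_polyomino (set cs, map_of bs)"
  "tiles_region tiles (set cs, map_of bs) \<longleftrightarrow> qrun p xs zs"
proof -
 let ?S = "lay instr_sides p f y (length xs)" and ?fe = "final_col p f" and ?ye = "y + 2 * int (length p)"
 have ye: "y < ?ye" using p by simp
 have w: "fst ` set (hlist x h (map bit_color us)) = wires x h (length us)" for x h us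
  by (simp add: keys_hlist wires_def)
 have disj: "fst ` set ?S \<inter> wires f y (length xs) = {}" "fst ` set ?S \<inter> wires ?fe ?ye (length zs) = {}"
  "wires f y (length xs) \<inter> wires ?fe ?ye (length zs) = {}"
 proof -
  show "fst ` set ?S \<inter> wires f y (length xs) = {}" using sides_bottom[OF q] by blast
  show "fst ` set ?S \<inter> wires ?fe ?ye (length zs) = {}"
  proof (rule equals0I, elim IntE)
   fix e assume "e \<in> fst ` set ?S" "e \<in> wires ?fe ?ye (length zs)"
   from height_keys[OF this(1)] height_wires[OF this(2)] show False by simp
  qed
  show "wires f y (length xs) \<inter> wires ?fe ?ye (length zs) = {}"
  proof (rule equals0I, elim IntE)
   fix e assume "e \<in> wires f y (length xs)" "e \<in> wires ?fe ?ye (length zs)"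
   from height_wires[OF this(1)] height_wires[OF this(2)] ye show False by simp
  qed
 qed
 show dist: "distinct (map fst bs)"
  unfolding bs_def region_edges_def using distinct_sides[OF q] distinct_hlist disj by (auto simp: w)
 have keys: "fst ` set bs = boundary_edges (set cs)"
 proof (rule set_eqI)
  fix e
  have "e \<in> fst ` set bs \<longleftrightarrow> e \<in> fst ` set ?S \<or> e \<in> wires f y (length xs) \<or> e \<in> wires ?fe ?ye (length zs)"
   unfolding bs_def region_edges_def by (simp add: image_Un w)
  also have "\<dots> \<longleftrightarrow> e \<in> boundary_edges (set cs)"
   unfolding cs_def set_cells boundary_layout[OF q] using disj by blast
  finally show "e \<in> fst ` set bs \<longleftrightarrow> e \<in> boundary_edges (set cs)" .
 qed
 have dom: "dom (map_of bs) = boundary_edges (set cs)" unfolding dom_map_of_conv_image_fst by (rule keys)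
 have "lay instr_rows p f y (length xs) ~= []" using length_rows[of p f y "length xs"] p by auto
 from stack_polyomino[OF overlapping_rows[OF q] this] have "polyomino (set cs)" unfolding cs_def set_cells .
 then show "colored_polyomino (set cs, map_of bs)" unfolding colored_polyomino_def using dom by simp
 have "tiles_region tiles (set cs, map_of bs) \<longleftrightarrow> (\<exists>col. tileable (set cs) col \<and> agree col bs)"
  unfolding tiles_region_tileable[OF dom] agree_def using dist by auto
 also have "\<dots> \<longleftrightarrow> (\<exists>col. tileable (stack_cells y (lay instr_rows p f y (length xs))) col \<and> agree col ?S \<and>
   hcol col f y (length xs) = map bit_color xs \<and> hcol col ?fe ?ye (length zs) = map bit_color zs)"
  unfolding cs_def set_cells bs_def region_edges_def by (simp add: agree_hlist)
 also have "\<dots> \<longleftrightarrow> qrun p xs zs"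
 proof
  assume "\<exists>col. tileable (stack_cells y (lay instr_rows p f y (length xs))) col \<and> agree col ?S \<and>
   hcol col f y (length xs) = map bit_color xs \<and> hcol col ?fe ?ye (length zs) = map bit_color zs"
  then show "qrun p xs zs" using layout_sound[OF q refl refl] by blast
 next
  assume "qrun p xs zs"
  from layout_complete[OF q refl refl this, of f y]
  show "\<exists>col. tileable (stack_cells y (lay instr_rows p f y (length xs))) col \<and> agree col ?S \<and>
   hcol col f y (length xs) = map bit_color xs \<and> hcol col ?fe ?ye (length zs) = map bit_color zs" by blast
 qed
 finally show "tiles_region tiles (set cs, map_of bs) \<longleftrightarrow> qrun p xs zs" .
qed

section \<open>The reduction\<close>

instantiation kind :: enc
begin
definition enc_kind :: "kind => tree" where "enc_kind k = enc (k = Shift)"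
instance
proof
 fix x y :: kind
 show "enc x = enc y \<longleftrightarrow> x = y" by (cases x; cases y) (simp_all add: enc_kind_def enc_inject)
qed
end

section \<open>The region as a polynomial-time function of the program\<close>

lemma PT_drop [PT_rules]:
 fixes l :: "'x::enc => 'a::enc list"
 assumes "PT n" "PT l"
 shows "PT (\<lambda>x. drop (n x) (l x))"
proof -
 have f: "fold (\<lambda>_ l. tl l) us l = drop (length us) l" for us :: "unit list" and l :: "'a list"
  by (induction us arbitrary: l) (auto simp: drop_Suc)
 have "PT (\<lambda>p :: nat \<times> 'a list. fold (\<lambda>_ l. tl l) (replicate (fst p) ()) (snd p))"
 proof (rule PT_fold_add[where F="\<lambda>_ _ l. tl l"])
  show "PT (\<lambda>p :: (nat \<times> 'a list) \<times> unit \<times> 'a list. tl (snd (snd p)))" by (intro PT_rules)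
  show "pb (\<lambda>n. 0)" by (intro pb_intros)
  show "sz (tl st) \<le> sz st + 0" for st :: "'a list" by (cases st) auto
 qed (intro PT_rules)+
 then have "PT (\<lambda>p :: nat \<times> 'a list. drop (fst p) (snd p))" unfolding f by simp
 from PT_comp[OF this PT_Pair[OF assms]] show ?thesis by simp
qed

lemma PT_nat_diff [PT_rules]:
 assumes "PT m" "PT n"
 shows "PT (\<lambda>x. m x - n x :: nat)"
proof -
 have "PT (\<lambda>x. length (drop (n x) (replicate (m x) ())))" by (intro PT_rules assms)
 then show ?thesis by simp
qed

lemma PT_take [PT_rules]:
 fixes l :: "'x::enc => 'b::enc list"
 assumes "PT n" "PT l"
 shows "PT (\<lambda>x. take (n x) (l x))"
proof -
 have "PT (\<lambda>x. rev (drop (length (l x) - n x) (rev (l x))))" by (intro PT_rules assms)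
 moreover have "rev (drop (length l - n) (rev l)) = take n l" for n and l :: "'b list"
  by (cases "n \<le> length l") (simp_all add: rev_drop)
 ultimately show ?thesis by (simp only:)
qed

lemma PT_nth [PT_rules]:
 fixes l :: "'x::enc => 'a::enc list"
 assumes "PT l" "PT n"
 shows "PT (\<lambda>x. hd (drop (n x) (l x)))"
 by (intro PT_rules assms)

lemma PT_upt [PT_rules]:
 assumes "PT n"
 shows "PT (\<lambda>x. [0..<n x])"
proof -
 have f: "fold (\<lambda>_ l. length l # l) us [] = rev [0..<length us]" for us :: "unit list"
  by (induction us rule: rev_induct) auto
 have "PT (\<lambda>n :: nat. fold (\<lambda>_ l. length l # l) (replicate n ()) [])"
 proof (rule PT_fold[where F="\<lambda>_ _ l. length l # l"])
  show "PT (\<lambda>p :: nat \<times> unit \<times> nat list. length (snd (snd p)) # snd (snd p))" by (intro PT_rules)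
  show "pb (\<lambda>n. n * (2 * n + 1 + 1) + 1)" by (intro pb_intros)
  fix n :: nat and ys zs assume "replicate n () = ys @ zs"
  from arg_cong[OF this, of length] have le: "length ys \<le> n" by simp
  have "sz (rev [0..<length ys]) \<le> length (rev [0..<length ys]) * (2 * n + 1 + 1) + 1"
   by (rule sz_list_le) (use le in \<open>auto simp: sz_nat\<close>)
  also have "\<dots> \<le> sz n * (2 * sz n + 1 + 1) + 1"
   using le by (intro add_mono mult_mono) (auto simp: sz_nat)
  finally show "sz (fold (\<lambda>_ l. length l # l) ys []) \<le> sz n * (2 * sz n + 1 + 1) + 1" unfolding f .
 qed (intro PT_rules)+
 then have "PT (\<lambda>n :: nat. rev [0..<n])" unfolding f by simp
 from PT_rev[OF this] have "PT (\<lambda>n :: nat. [0..<n])" by (simp only: rev_rev_ident)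
 from PT_comp[OF this assms] show ?thesis .
qed

lemma PT_int_diff:
 assumes "PT m" "PT n"
 shows "PT (\<lambda>x. int (m x) - int (n x))"
proof -
 have "PT (\<lambda>x. if n x - m x = 0 then int (m x - n x)
   else (if True then - int (val (bits (n x - m x))) else int (val (bits (n x - m x)))))"
  by (intro PT_rules PT_int_abs assms)
 then have "PT (\<lambda>x. if n x - m x = 0 then int (m x - n x) else - int (n x - m x))" unfolding if_True val_bits .
 moreover have "(if b - a = 0 then int (a - b) else - int (b - a)) = int a - int b" for a b :: nat by auto
 ultimately show ?thesis by (simp only:)
qed

lemma PT_row_list:
 assumes "PT a" "PT m" "PT y"
 shows "PT (\<lambda>x. row_list (a x) (a x + int (m x)) (y x))"
proof -
 have "row_list a (a + int m) y = map (\<lambda>j. (a + int j, y)) [0..<m]" for a y and m :: nat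
 proof -
  have "[a..a + int m - 1] = map (\<lambda>j. a + int j) [0..<m]" by (rule nth_equalityI) simp_all
  then show ?thesis unfolding row_list_def by simp
 qed
 moreover have "PT (\<lambda>x. map (\<lambda>j. (a x + int j, y x)) [0..<m x])"
  by (intro PT_rules PT_comp[OF assms(1)] PT_comp[OF assms(3)] assms)
 ultimately show ?thesis by simp
qed

lemma PT_hlist:
 assumes "PT a" "PT y" "PT cs"
 shows "PT (\<lambda>x. hlist (a x) (y x) (cs x))"
proof -
 have "hlist a y cs = map (\<lambda>j. (Hor (a + int j, y), hd (drop j cs))) [0..<length cs]" for a y cs
 proof (induction cs arbitrary: a)
  case (Cons c cs)
  show ?case
   by (simp only: length_Cons upt_conv_Cons[OF zero_less_Suc] map_Suc_upt[symmetric] list.map map_map o_def hlist.simps Cons)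
    (simp add: algebra_simps)
 qed simp
 moreover have "PT (\<lambda>x. map (\<lambda>j. (Hor (a x + int j, y x), hd (drop j (cs x)))) [0..<length (cs x)])"
  by (intro PT_rules PT_comp[OF assms(1)] PT_comp[OF assms(2)] PT_comp[OF assms(3)] assms)
 ultimately show ?thesis by simp
qed

text \<open>Column and queue length as natural numbers, which is possible because the column never
  decreases.\<close>

definition next_state :: "instr => nat \<times> nat => nat \<times> nat" where
 "next_state i s = (fst s + (length (snd (snd i)) + shift_of (fst (snd i)) - length (fst i)), left_over i (snd s))"

lemma shift_of_if: "shift_of k = (if k = Shift then 1 else 0)"
 by (cases k) (simp_all add: shift_of_def)

lemma left_over_alt: "left_over i n = n + length (fst i) - length (snd (snd i))"
 by (cases i) (simp add: left_over_def)

lemma moved_state: "moved i (int f) = int (fst (next_state i (f, n)))"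
 by (cases i) (simp add: moved_def next_state_def)

lemma PT_next_states:
 fixes p :: "'x::enc => instr list"
 assumes "PT p" "PT s"
 shows "PT (\<lambda>x. fold next_state (p x) (s x))"
proof (rule PT_fold_add[where F="\<lambda>_. next_state"])
 show "PT (\<lambda>q :: 'x \<times> instr \<times> nat \<times> nat. next_state (fst (snd q)) (snd (snd q)))"
  unfolding next_state_def shift_of_if left_over_alt by (intro PT_rules)
 show "pb (\<lambda>n. 4 * n + 2)" by (intro pb_intros)
 fix x :: 'x and a :: instr and st :: "nat \<times> nat"
 obtain \<alpha> k \<beta> where a: "a = (\<alpha>, k, \<beta>)" by (cases a)
 have "shift_of k \<le> 1" by (simp add: shift_of_if)
 moreover have "length \<alpha> \<le> sz \<alpha>" "length \<beta> \<le> sz \<beta>" by (rule length_le_sz)+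
 ultimately show "sz (next_state a st) \<le> sz st + (4 * (sz x + sz a) + 2)"
  unfolding a next_state_def left_over_alt by (cases st) (simp add: sz_nat)
qed (intro assms)+

text \<open>The recursion becomes a map over indices, each of which recomputes its position from the
  preceding instructions; maps are available as polynomial-time functions.\<close>

lemma lay_upt:
 "lay g p (int f) y n = concat (map (\<lambda>j. g (hd (drop j p)) (int (fst (fold next_state (take j p) (f, n))))
  (y + int (j + j)) (snd (fold next_state (take j p) (f, n)))) [0..<length p])"
proof (induction p arbitrary: f y n)
 case (Cons i p)
 obtain f' n' where s: "next_state i (f, n) = (f', n')" by (cases "next_state i (f, n)")
 have 1: "moved i (int f) = int f'" "left_over i n = n'"
  using moved_state[of i f n] s by (simp_all add: next_state_def)
 have "concat (map (\<lambda>j. g (hd (drop j (i # p))) (int (fst (fold next_state (take j (i # p)) (f, n))))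
   (y + int (j + j)) (snd (fold next_state (take j (i # p)) (f, n)))) [0..<length (i # p)]) =
  g i (int f) y n @ concat (map (\<lambda>j. g (hd (drop j p)) (int (fst (fold next_state (take j p) (f', n'))))
   (y + 2 + int (j + j)) (snd (fold next_state (take j p) (f', n')))) [0..<length p])"
  unfolding length_Cons upt_conv_Cons[OF zero_less_Suc] map_Suc_upt[symmetric] list.map map_map o_def concat.simps
  by (simp add: s algebra_simps)
 then show ?case unfolding lay.simps 1 Cons by simp
qed simp

lemma PT_lay:
 fixes p :: "'x::enc => instr list" and g :: "instr => int => int => nat => 'a::enc list"
 assumes g: "PT (\<lambda>q :: instr \<times> nat \<times> nat \<times> nat. g (fst q) (int (fst (snd q))) (int (fst (snd (snd q)))) (snd (snd (snd q))))"
  and "PT p" "PT n"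
 shows "PT (\<lambda>x. lay g (p x) (int 2) 0 (n x))"
proof -
 have st: "PT (\<lambda>q :: 'x \<times> nat. fold next_state (take (snd q) (p (fst q))) (2, n (fst q)))"
  by (intro PT_next_states PT_rules PT_comp[OF assms(2)] PT_comp[OF assms(3)])
 have "PT (\<lambda>q :: 'x \<times> nat. (hd (drop (snd q) (p (fst q))), fst (fold next_state (take (snd q) (p (fst q))) (2, n (fst q))),
   snd q + snd q, snd (fold next_state (take (snd q) (p (fst q))) (2, n (fst q)))))"
  by (intro PT_rules PT_comp[OF assms(2)] PT_fst[OF st] PT_snd[OF st])
 from PT_comp[OF g this]
 have "PT (\<lambda>q :: 'x \<times> nat. g (hd (drop (snd q) (p (fst q)))) (int (fst (fold next_state (take (snd q) (p (fst q))) (2, n (fst q)))))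
   (int (snd q + snd q)) (snd (fold next_state (take (snd q) (p (fst q))) (2, n (fst q)))))" by simp
 then have "PT (\<lambda>x. concat (map (\<lambda>j. g (hd (drop j (p x))) (int (fst (fold next_state (take j (p x)) (2, n x))))
   (int (j + j)) (snd (fold next_state (take j (p x)) (2, n x)))) [0..<length (p x)]))"
  by (intro PT_concat PT_map PT_upt PT_length assms(2))
 then show ?thesis unfolding lay_upt by simp
qed

lemma PT_instr_cells:
 "PT (\<lambda>q :: instr \<times> nat \<times> nat \<times> nat. instr_cells (fst q) (int (fst (snd q))) (int (fst (snd (snd q)))) (snd (snd (snd q))))"
proof -
 have e: "instr_cells i (int f) (int y) n =
   row_list (int f - int (length (fst i))) ((int f - int (length (fst i))) + int (length (fst i) + n + shift_of (fst (snd i)))) (int y) @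
   row_list (int (fst (next_state i (f, n)))) (int (fst (next_state i (f, n))) + int (left_over i n)) (int (y + 1))" for i f y n
  unfolding instr_cells_def moved_state[of i f n] by (cases i) (simp add: instr_row_def algebra_simps)
 show ?thesis unfolding e next_state_def left_over_alt shift_of_if
  by (intro PT_append PT_row_list PT_int_diff) ((simp only: fst_conv snd_conv)?, intro PT_rules)+
qed

lemma PT_instr_sides:
 "PT (\<lambda>q :: instr \<times> nat \<times> nat \<times> nat. instr_sides (fst q) (int (fst (snd q))) (int (fst (snd (snd q)))) (snd (snd (snd q))))"
proof -
 have e: "instr_sides i (int f) (int y) n =
   hlist (int f - int (length (fst i))) (int y) (map bit_color (fst i)) @
   hlist (int (f + n)) (int y) (if fst (snd i) = Shift then [3] else []) @
   [(Ver (int f - int (length (fst i)), int y), if fst (snd i) = Shift then 4 else 5),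
   (Ver (int (f + (n + shift_of (fst (snd i)))), int y), if fst (snd i) = Shift then 3 else 0)] @
   hlist (int f - int (length (fst i))) (int (y + 1)) ((if fst (snd i) = Shift then [2] else []) @ map bit_color (snd (snd i))) @
   [(Ver (int (fst (next_state i (f, n))), int (y + 1)), 0),
   (Ver (int (fst (next_state i (f, n)) + left_over i n), int (y + 1)), 0)]" for i f y n
 proof -
  obtain \<alpha> k \<beta> where i: "i = (\<alpha>, k, \<beta>)" by (cases i)
  have m: "moved i (int f) = int (fst (next_state i (f, n)))" by (rule moved_state)
  show ?thesis unfolding instr_sides_def m by (cases k) (simp_all add: i kind_defs add.commute)
 qed
 show ?thesis unfolding e next_state_def left_over_alt shift_of_if bit_color_def
  by (intro PT_append PT_hlist PT_Cons PT_Pair PT_Ver PT_int_diff PT_const) ((simp only: fst_conv snd_conv)?, intro PT_rules)+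
qed

lemma PT_final_col:
 fixes p :: "'x::enc => instr list" and n :: "'x => nat"
 assumes "PT p" "PT n"
 shows "PT (\<lambda>x. final_col (p x) (int 2))"
proof -
 have e: "final_col p (int f) = int (fst (fold next_state p (f, n)))" for p f n
 proof (induction p arbitrary: f n)
  case (Cons i p)
  obtain f' n' where s: "next_state i (f, n) = (f', n')" by (cases "next_state i (f, n)")
  show ?case using Cons[of f' n'] moved_state[of i f n] s by simp
 qed simp
 have "PT (\<lambda>x. int (fst (fold next_state (p x) (2, n x))))"
  by (intro PT_int PT_fst PT_next_states assms PT_Pair PT_const)
 moreover have "final_col (p x) (int 2) = int (fst (fold next_state (p x) (2, n x)))" for x by (rule e)
 ultimately show ?thesis by simp
qed

lemma PT_region:
 fixes p :: "'a::enc => instr list"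
 assumes p: "PT p" and xs: "PT xs" and zs: "PT zs"
 shows "PT (\<lambda>x. region_code (lay instr_cells (p x) (int 2) 0 (length (xs x))) (region_edges (p x) (int 2) 0 (xs x) (zs x)))"
proof -
 have y: "0 + 2 * int (length q) = int (length q + length q)" for q :: "instr list" by simp
 have bits: "PT (\<lambda>x. map bit_color (l x))" if l: "PT l" for l :: "'a => bool list"
  unfolding bit_color_def by (intro PT_rules l)
 have len: "PT (\<lambda>x. length (xs x))" by (intro PT_rules xs)
 have len_p: "PT (\<lambda>x. int (length (p x) + length (p x)))" by (intro PT_rules p)
 show ?thesis
  unfolding region_edges_def y
  by (intro PT_region_code PT_append PT_lay PT_instr_cells PT_instr_sides PT_hlist PT_final_col[OF p len] bits PT_const p xs zs len len_p)
qed

section \<open>Relations realized by shifts and gates\<close>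

definition konst :: "bool list => bool list => bool list => bool list => bool" where
 "konst u v x y \<longleftrightarrow> x = u \<and> y = v"

text \<open>The second constant takes the place of the bit that a shift carries to the rear.\<close>

lemma blk_push: "blk [([False, b], Shift, [False])] 0 1 (konst [] [b])"
 by (auto simp: blk_def konst_def shift_of_def)

text \<open>A plain shift sends the second bit to the rear, and the rotation sends the first one
  after it.\<close>

lemma blk_swap: "blk [([], Shift, []), rot_instr] 2 2 (\<lambda>x y. y = [x ! 1, x ! 0])"
 by (auto simp: blk_def length_2 numeral_2_eq_2 shift_of_def)

lemma blk_gate: "blk [([], Gate, []), rot_instr, rot_instr] 2 2 (\<lambda>x y. \<exists>t. (x ! 1 \<longleftrightarrow> \<not> (x ! 0 \<and> t)) \<and> y = [t, t])"
proof -
 have run: "qrun [([], Gate, []), rot_instr, rot_instr] (a # c # rest) z \<longleftrightarrow>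
   (\<exists>t. (c \<longleftrightarrow> \<not> (a \<and> t)) \<and> z = rest @ [t, t])" for a c rest z
 proof -
  have rot: "qrun [rot_instr, rot_instr] (t # t # rest) z \<longleftrightarrow> z = rest @ [t, t]" for t by auto
  have step: "istep ([], Gate, []) (a # c # rest) ys \<longleftrightarrow> (\<exists>t. (c \<longleftrightarrow> \<not> (a \<and> t)) \<and> ys = t # t # rest)" for ys by simp
  have "qrun [([], Gate, []), rot_instr, rot_instr] (a # c # rest) z \<longleftrightarrow>
    (\<exists>ys. istep ([], Gate, []) (a # c # rest) ys \<and> qrun [rot_instr, rot_instr] ys z)" by (rule qrun.simps(2))
  also have "\<dots> \<longleftrightarrow> (\<exists>t. (c \<longleftrightarrow> \<not> (a \<and> t)) \<and> qrun [rot_instr, rot_instr] (t # t # rest) z)"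
   unfolding step by blast
  finally show ?thesis unfolding rot .
 qed
 show ?thesis
  unfolding blk_def
 proof (intro conjI allI impI)
  fix x rest z :: "bool list" assume "length x = 2"
  then obtain a c where "x = [a, c]" by (auto simp: length_2 numeral_2_eq_2)
  then show "qrun [([], Gate, []), rot_instr, rot_instr] (x @ rest) z \<longleftrightarrow>
    (\<exists>y. (\<exists>t. (x ! 1 \<longleftrightarrow> \<not> (x ! 0 \<and> t)) \<and> y = [t, t]) \<and> z = rest @ y)"
   by (simp del: qrun.simps de_Morgan_conj add: run) blast
 qed (auto simp: shift_of_def)
qed

text \<open>The removed constants force \<open>t\<close> to be true, so the gate demands that its
  second input be the negation of the first.\<close>

lemma blk_assert: "blk [([\<not> b], Gate, [True, True])] 1 0 (konst [b] [])"
 by (cases b) (auto simp: blk_def konst_def length_1 shift_of_def)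

lemma real_push: "1 \<le> a + b ==> n = a + b ==> m = Suc n ==> realizable n m (local_rel a 0 (konst [] [c]))"
 using realizable_blk[OF blk_push, of a b c] by simp

lemma real_assert: "1 \<le> a + b ==> n = a + b ==> m = Suc n ==> realizable m n (local_rel a 1 (konst [c] []))"
 using realizable_blk[OF blk_assert, of a b c] by simp

lemma real_swap: "n = a + 2 + b ==> realizable n n (local_rel a 2 (\<lambda>x y. y = [x ! 1, x ! 0]))"
 using realizable_blk[OF blk_swap, of a b] by simp

lemma real_gate:
 "n = a + 2 + b ==> realizable n n (local_rel a 2 (\<lambda>x y. \<exists>t. (x ! 1 \<longleftrightarrow> \<not> (x ! 0 \<and> t)) \<and> y = [t, t]))"
 using realizable_blk[OF blk_gate, of a b] by (simp del: de_Morgan_conj)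

lemma real_local:
 "realizable j l R ==> n = a + j + b ==> m = a + l + b ==> realizable n m (local_rel a j R)"
 using realizable_local by simp

lemmas length_simps = length_Suc_conv numeral_eq_Suc local_rel_def konst_def

lemma ex_twin: "(\<exists>b. (\<exists>t. P t \<and> b = [t, t]) \<and> Q b) \<longleftrightarrow> (\<exists>t. P t \<and> Q [t, t])"
 by blast

lemma ex_image: "(\<exists>z. (\<exists>t. z = f t) \<and> Q z) \<longleftrightarrow> (\<exists>t. Q (f t))"
 by blast

lemma ex_image2: "(\<exists>z. (\<exists>t s. P t s \<and> z = f t s) \<and> Q z) \<longleftrightarrow> (\<exists>t s. P t s \<and> Q (f t s))"
 by blast

text \<open>A gate with inputs \<open>x\<close> and \<open>True\<close> always admits the output
  \<open>False\<close>, whatever \<open>x\<close> is. Asserting both copies of this output to be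
  \<open>False\<close> removes them.\<close>

lemma real_discard:
 assumes "1 \<le> a + b" "n = a + b" "m = Suc n"
 shows "realizable m n (local_rel a 1 (\<lambda>x y. y = []))"
proof -
 have 1: "realizable (a + 1 + b) (a + 2 + b) (local_rel a 1 (\<lambda>x y. y = x @ [True]))"
 proof (rule realizable_cong)
  show "realizable (a + 1 + b) (a + 2 + b) (local_rel (a + 1) 0 (konst [] [True]))"
   by (rule real_push[of _ b]) simp_all
  fix x y :: "bool list" assume "length x = a + 1 + b"
  then show "local_rel (a + 1) 0 (konst [] [True]) x y \<longleftrightarrow> local_rel a 1 (\<lambda>x y. y = x @ [True]) x y"
   by (simp add: local_rel_def konst_def take_add take_Suc_conv_app_nth take_Suc hd_drop_conv_nth)
 qed
 have 3: "realizable (a + 2 + b) (a + 1 + b) (local_rel a 2 (\<lambda>x y. x ! 0 = False \<and> y = [x ! 1]))"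
 proof (rule realizable_cong)
  show "realizable (a + 2 + b) (a + 1 + b) (local_rel a 1 (konst [False] []))"
   by (rule real_assert[of _ "b + 1"]) simp_all
  fix x y :: "bool list" assume x: "length x = a + 2 + b"
  then have "length (drop a x) = Suc (Suc b)" by simp
  then obtain v w s where "drop a x = v # w # s" unfolding length_Suc_conv by blast
  then have "x = take a x @ v # w # s" by (metis append_take_drop_id)
  moreover have "length (take a x) = a" using x by simp
  ultimately obtain u where "x = u @ v # w # s" "length u = a" by blast
  then show "local_rel a 1 (konst [False] []) x y \<longleftrightarrow> local_rel a 2 (\<lambda>x y. x ! 0 = False \<and> y = [x ! 1]) x y"
   by (auto simp: local_rel_def konst_def numeral_2_eq_2)
 qed
 note 2 = real_gate[of "a + 2 + b" a b, OF refl]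
 have 4: "realizable (a + 1 + b) (a + b) (local_rel a 1 (konst [False] []))"
  by (rule real_assert[OF assms(1)]) simp_all
 have 5: "realizable (a + 1 + b) (a + b) (local_rel a 1
   (((\<lambda>x y. y = x @ [True]) OO (\<lambda>x y. \<exists>t. (x ! 1 \<longleftrightarrow> \<not> (x ! 0 \<and> t)) \<and> y = [t, t])) OO
   ((\<lambda>x y. x ! 0 = False \<and> y = [x ! 1]) OO konst [False] [])))"
 proof (rule realizable_then[OF realizable_then[OF 1 2] realizable_then[OF 3 4]])
  fix x y :: "bool list" assume x: "length x = a + 2 + b"
  show "(\<exists>z. local_rel a 2 (\<lambda>x y. x ! 0 = False \<and> y = [x ! 1]) x z \<and> local_rel a 1 (konst [False] []) z y) \<longleftrightarrow>
   local_rel a 2 ((\<lambda>x y. x ! 0 = False \<and> y = [x ! 1]) OO konst [False] []) x y"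
   by (rule local_relcomp[OF x]) auto
 next
  fix x y :: "bool list" assume x: "length x = a + 1 + b"
  show "(\<exists>z. local_rel a 1 (\<lambda>x y. y = x @ [True]) x z \<and>
    local_rel a 2 (\<lambda>x y. \<exists>t. (x ! 1 \<longleftrightarrow> \<not> (x ! 0 \<and> t)) \<and> y = [t, t]) z y) \<longleftrightarrow>
   local_rel a 1 ((\<lambda>x y. y = x @ [True]) OO (\<lambda>x y. \<exists>t. (x ! 1 \<longleftrightarrow> \<not> (x ! 0 \<and> t)) \<and> y = [t, t])) x y"
   by (rule local_relcomp[OF x]) auto
  show "(\<exists>z. local_rel a 1 ((\<lambda>x y. y = x @ [True]) OO (\<lambda>x y. \<exists>t. (x ! 1 \<longleftrightarrow> \<not> (x ! 0 \<and> t)) \<and> y = [t, t])) x z \<and>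
    local_rel a 2 ((\<lambda>x y. x ! 0 = False \<and> y = [x ! 1]) OO konst [False] []) z y) \<longleftrightarrow>
   local_rel a 1 (((\<lambda>x y. y = x @ [True]) OO (\<lambda>x y. \<exists>t. (x ! 1 \<longleftrightarrow> \<not> (x ! 0 \<and> t)) \<and> y = [t, t])) OO
   ((\<lambda>x y. x ! 0 = False \<and> y = [x ! 1]) OO konst [False] [])) x y"
   by (rule local_relcomp[OF x]) (auto simp: relcompp_apply)
 qed
 have mn: "m = a + 1 + b" "n = a + b" using assms by simp_all
 show ?thesis unfolding mn
  by (rule realizable_cong[OF 5])
   (auto simp: local_rel_def relcompp_apply konst_def length_1 nth_append ex_twin)
qed

text \<open>From here on, relations are given by their effect on explicit lists of wires.\<close>

lemma real_not2: "realizable 1 2 (\<lambda>x y. y = [\<not> x ! 0, \<not> x ! 0])"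
proof -
  have 1: "realizable 1 2 (local_rel 1 0 (konst [] [True]))" by (rule real_push[of _ 0]) simp_all
  have 2: "realizable 2 2 (local_rel 0 2 (\<lambda>x y. y = [x ! 1, x ! 0]))" by (rule real_swap[of _ _ 0]) simp
  have 3: "realizable 2 2 (local_rel 0 2 (\<lambda>x y. \<exists>t. (x ! 1 \<longleftrightarrow> \<not> (x ! 0 \<and> t)) \<and> y = [t, t]))"
   by (rule real_gate[of _ _ 0]) simp
  \<comment> \<open>With first input \<open>True\<close> the gate yields the negation of the
    second.\<close>
  have 12: "realizable 1 2 (\<lambda>x y. y = [True, x ! 0])"
   by (rule realizable_then[OF 1 2]) (auto simp: length_simps)
  show ?thesis by (rule realizable_then[OF 12 3]) (auto simp: length_simps)
qed

lemma real_dup: "realizable 1 2 (\<lambda>x y. y = [x ! 0, x ! 0])"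
proof -
 note not2 = real_not2
 have 1: "realizable 2 3 (local_rel 0 1 (\<lambda>x y. y = [\<not> x ! 0, \<not> x ! 0]))"
  by (rule real_local[OF not2, of _ _ 1]) simp_all
 have 2: "realizable 3 2 (local_rel 2 1 (\<lambda>x y. y = []))"
  by (rule real_discard[of _ 0]) simp_all
 show ?thesis by (rule realizable_then[OF realizable_then[OF not2 1] 2]) (auto simp: length_simps)
qed

lemma real_not: "realizable 1 1 (\<lambda>x y. y = [\<not> x ! 0])"
proof -
 have "realizable 2 1 (local_rel 0 1 (\<lambda>x y. y = []))" by (rule real_discard[of _ 1]) simp_all
 from real_not2 this show ?thesis by (rule realizable_then) (auto simp: length_simps)
qed

text \<open>A gate with inputs \<open>False\<close> and \<open>True\<close> leaves its output free;
  this is how bits are guessed.\<close>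

lemma real_twin:
 assumes "1 \<le> k"
 shows "realizable k (k + 2) (\<lambda>x y. \<exists>t. y = x @ [t, t])"
proof -
 have 1: "realizable k (k + 1) (local_rel k 0 (konst [] [False]))" by (rule real_push[of _ 0]) (use assms in simp_all)
 have 2: "realizable (k + 1) (k + 2) (local_rel (k + 1) 0 (konst [] [True]))" by (rule real_push[of _ 0]) simp_all
 have 12: "realizable k (k + 2) (\<lambda>x y. y = x @ [False, True])"
  by (rule realizable_then[OF 1 2]) (auto simp: local_rel_def konst_def)
 have 3: "realizable (k + 2) (k + 2) (local_rel k 2 (\<lambda>x y. \<exists>t. (x ! 1 \<longleftrightarrow> \<not> (x ! 0 \<and> t)) \<and> y = [t, t]))"
  by (rule real_gate[of _ _ 0]) simp
 show ?thesis by (rule realizable_then[OF 12 3]) (auto simp: local_rel_def)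
qed

lemma real_guess:
 assumes "1 \<le> k"
 shows "realizable k (k + 1) (\<lambda>x y. \<exists>t. y = x @ [t])"
proof -
 have "realizable (k + 2) (k + 1) (local_rel (k + 1) 1 (\<lambda>x y. y = []))" by (rule real_discard[of _ 0]) simp_all
 from real_twin[OF assms] this show ?thesis by (rule realizable_then) (auto simp: local_rel_def)
qed

text \<open>
 The output of a gate is guessed as \<open>c\<close>, a gate with inputs \<open>a\<close> and \<open>c\<close> supplies a bit \<open>t\<close>
 with \<open>c = nand a t\<close>, and a gate with inputs \<open>t\<close> and \<open>\<not> b\<close> whose output must be true compares
 \<open>t\<close> with \<open>b\<close>.
\<close>

lemma real_nand: "realizable 2 1 (\<lambda>x y. y = [\<not> (x ! 0 \<and> x ! 1)])"
proof -
 have 1: "realizable 2 4 (\<lambda>x y. \<exists>t. y = x @ [t, t])" using real_twin[of 2] by simp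
 have 2: "realizable 4 4 (local_rel 1 2 (\<lambda>x y. y = [x ! 1, x ! 0]))" by (rule real_swap[of _ _ 1]) simp
 have 3: "realizable 4 4 (local_rel 0 2 (\<lambda>x y. \<exists>t. (x ! 1 \<longleftrightarrow> \<not> (x ! 0 \<and> t)) \<and> y = [t, t]))"
  by (rule real_gate[of _ _ 2]) simp
 have 4: "realizable 4 4 (local_rel 2 1 (\<lambda>x y. y = [\<not> x ! 0]))" by (rule real_local[OF real_not, of _ _ 1]) simp_all
 have 5: "realizable 4 4 (local_rel 1 2 (\<lambda>x y. \<exists>t. (x ! 1 \<longleftrightarrow> \<not> (x ! 0 \<and> t)) \<and> y = [t, t]))"
  by (rule real_gate[of _ _ 1]) simp
 have 6: "realizable 4 3 (local_rel 1 1 (konst [True] []))" by (rule real_assert[of _ 2]) simp_all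
 have 7: "realizable 3 2 (local_rel 1 1 (konst [True] []))" by (rule real_assert[of _ 1]) simp_all
 have 8: "realizable 2 1 (local_rel 0 1 (\<lambda>x y. y = []))" by (rule real_discard[of _ 1]) simp_all
 \<comment> \<open>At this point \<open>t\<close> is not yet tied to the second input; its two
   copies stand first and the guess last.\<close>
 have A: "realizable 2 4 (\<lambda>x y. \<exists>t. y = [t, t, x ! 1, \<not> (x ! 0 \<and> t)])"
  by (rule realizable_then[OF realizable_then[OF 1 2] 3]) (auto simp: length_simps ex_bool_eq)
 have B: "realizable 2 4 (\<lambda>x y. \<exists>t. y = [t, t, \<not> x ! 1, \<not> (x ! 0 \<and> t)])"
  by (rule realizable_then[OF A 4]) (unfold ex_image, auto simp: local_rel_def numeral_eq_Suc)
 have C: "realizable 2 4 (\<lambda>x y. \<exists>t s. (\<not> x ! 1 \<longleftrightarrow> \<not> (t \<and> s)) \<and> y = [t, s, s, \<not> (x ! 0 \<and> t)])"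
 proof (rule realizable_then[OF B 5])
  fix x y :: "bool list"
  have "local_rel 1 2 (\<lambda>x y. \<exists>t. (x ! 1 \<longleftrightarrow> \<not> (x ! 0 \<and> t)) \<and> y = [t, t]) [t, t, p, q] y \<longleftrightarrow>
    (\<exists>s. (p \<longleftrightarrow> \<not> (t \<and> s)) \<and> y = [t, s, s, q])" for t p q
   unfolding local_rel_def ex_twin by simp
  then show "(\<exists>z. (\<exists>t. z = [t, t, \<not> x ! 1, \<not> (x ! 0 \<and> t)]) \<and>
    local_rel 1 2 (\<lambda>x y. \<exists>t. (x ! 1 \<longleftrightarrow> \<not> (x ! 0 \<and> t)) \<and> y = [t, t]) z y) \<longleftrightarrow>
    (\<exists>t s. (\<not> x ! 1 \<longleftrightarrow> \<not> (t \<and> s)) \<and> y = [t, s, s, \<not> (x ! 0 \<and> t)])"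
   by (simp only: ex_image)
 qed
 \<comment> \<open>Asserting \<open>s\<close> turns the second gate into the equality of
   \<open>t\<close> and the second input.\<close>
 have D: "realizable 2 3 (\<lambda>x y. y = [x ! 1, True, \<not> (x ! 0 \<and> x ! 1)])"
 proof (rule realizable_then[OF C 6])
  fix x y :: "bool list"
  have *: "local_rel 1 1 (konst [True] []) [t, s, s', q] y \<longleftrightarrow> s \<and> y = [t, s', q]" for t s s' q
   by (simp add: local_rel_def konst_def)
  show "(\<exists>z. (\<exists>t s. (\<not> x ! 1 \<longleftrightarrow> \<not> (t \<and> s)) \<and> z = [t, s, s, \<not> (x ! 0 \<and> t)]) \<and>
    local_rel 1 1 (konst [True] []) z y) \<longleftrightarrow> y = [x ! 1, True, \<not> (x ! 0 \<and> x ! 1)]"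
   unfolding ex_image2 * by auto
 qed
 have E: "realizable 2 2 (\<lambda>x y. y = [x ! 1, \<not> (x ! 0 \<and> x ! 1)])"
  by (rule realizable_then[OF D 7]) (auto simp: local_rel_def konst_def)
 show ?thesis by (rule realizable_then[OF E 8]) (auto simp: length_simps)
qed

text \<open>The first bit is moved to the end by swaps of neighbours.\<close>

lemma real_rotate1: "realizable (Suc m) (Suc m) (\<lambda>x y. y = rotate1 x)"
proof (induction m)
 case 0
 show ?case by (rule realizable_cong[OF realizable_id]) (auto simp: length_1)
next
 case (Suc m)
 have 1: "realizable (Suc (Suc m)) (Suc (Suc m)) (local_rel 0 2 (\<lambda>x y. y = [x ! 1, x ! 0]))"
  by (rule real_swap[of _ _ m]) simp
 have 2: "realizable (Suc (Suc m)) (Suc (Suc m)) (local_rel 1 (Suc m) (\<lambda>x y. y = rotate1 x))"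
  by (rule real_local[OF Suc, of _ _ 0]) simp_all
 show ?case by (rule realizable_then[OF 1 2]) (auto simp: length_Suc_conv local_rel_def)
qed

text \<open>Wire \<open>i\<close> is doubled in place, and one copy is moved to the end by rotating
  the part of the word that begins with it.\<close>

lemma real_fetch:
 assumes "i < k"
 shows "realizable k (k + 1) (\<lambda>x y. y = x @ [x ! i])"
proof -
 let ?m = "k - i - 1"
 have k: "k = i + 1 + ?m" "k + 1 = i + 2 + ?m" "k + 1 = i + 1 + Suc ?m" using assms by auto
 have 1: "realizable k (k + 1) (local_rel i 1 (\<lambda>x y. y = [x ! 0, x ! 0]))"
  by (rule real_local[OF real_dup, of _ _ ?m]) (use k in simp_all)
 have 2: "realizable (k + 1) (k + 1) (local_rel (i + 1) (Suc ?m) (\<lambda>x y. y = rotate1 x))"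
  by (rule real_local[OF real_rotate1, of _ _ _ 0]) (use k in simp_all)
 show ?thesis
 proof (rule realizable_then[OF 1 2])
  fix x y :: "bool list" assume x: "length x = k"
  have "x = take i x @ x ! i # drop (Suc i) x" using assms x by (simp add: id_take_nth_drop)
  then obtain p c s where p: "x = p @ c # s" "length p = i" "x ! i = c" using assms x by (metis length_take min.absorb4)
  have "length s = ?m" using p x by simp
  then show "(\<exists>z. local_rel i 1 (\<lambda>x y. y = [x ! 0, x ! 0]) x z \<and> local_rel (i + 1) (Suc ?m) (\<lambda>x y. y = rotate1 x) z y)
    \<longleftrightarrow> y = x @ [x ! i]"
   unfolding local_rel_def p(3) unfolding p(1) using p(2) by simp
 qed
qed

text \<open>The arguments are kept, so that further functions can be evaluated on them; gates then
  combine the appended bits.\<close>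

definition computable_bit :: "nat => (bool list => bool) => bool" where
 "computable_bit k f \<longleftrightarrow> realizable k (k + 1) (\<lambda>x y. y = x @ [f x])"

lemma computable_bit_cong: "computable_bit k f ==> (!!x. length x = k ==> f x = g x) ==> computable_bit k g"
 unfolding computable_bit_def by (erule realizable_cong) simp

lemma computable_const: "1 \<le> k ==> computable_bit k (\<lambda>_. c)"
 unfolding computable_bit_def
 by (rule realizable_cong[of k "k + 1" "local_rel k 0 (konst [] [c])"])
  (auto simp: local_rel_def konst_def intro: real_push[of _ 0])

lemma computable_nand:
 assumes "computable_bit k f" "computable_bit k g"
 shows "computable_bit k (\<lambda>x. \<not> (f x \<and> g x))"
proof -
 have 1: "realizable (k + 1) (k + 2) (local_rel 0 k (\<lambda>x y. y = x @ [g x]))"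
  by (rule real_local[OF assms(2)[unfolded computable_bit_def], of _ _ 1]) simp_all
 have 2: "realizable (k + 2) (k + 1) (local_rel k 2 (\<lambda>x y. y = [\<not> (x ! 0 \<and> x ! 1)]))"
  by (rule real_local[OF real_nand, of _ _ 0]) simp_all
 show ?thesis
  unfolding computable_bit_def
  by (rule realizable_then[OF realizable_then[OF assms(1)[unfolded computable_bit_def] 1] 2])
   (auto simp: local_rel_def)
qed

lemma computable_not: "computable_bit k f ==> computable_bit k (\<lambda>x. \<not> f x)"
 using computable_nand[of k f f] by simp

lemma computable_conj: "computable_bit k f ==> computable_bit k g ==> computable_bit k (\<lambda>x. f x \<and> g x)"
 using computable_not[OF computable_nand[of k f g]] by simp

lemma computable_disj: "computable_bit k f ==> computable_bit k g ==> computable_bit k (\<lambda>x. f x \<or> g x)"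
 using computable_nand[OF computable_not computable_not, of k f g] by simp

text \<open>Disjunctive normal form: \<open>f\<close> is the disjunction of the finitely many tests
  \<open>x = v\<close> with \<open>f v\<close>.\<close>

lemma computable_bit:
 assumes "1 \<le> k"
 shows "computable_bit k f"
proof -
 have lit: "computable_bit k (\<lambda>x. x ! i = v ! i)" if "i < k" for v i
 proof -
  have "computable_bit k (\<lambda>x. x ! i)" using real_fetch[OF that] by (simp add: computable_bit_def)
  from this computable_not[OF this] show ?thesis by (cases "v ! i") auto
 qed
 have prefix: "computable_bit k (\<lambda>x. \<forall>i<j. x ! i = v ! i)" if "j \<le> k" for v j
  using that
 proof (induction j)
  case 0
  show ?case using computable_const[OF assms, of True] by simp
 next
  case (Suc j)
  then have "computable_bit k (\<lambda>x. (\<forall>i<j. x ! i = v ! i) \<and> x ! j = v ! j)"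
   by (intro computable_conj lit Suc.IH) auto
  then show ?case by (simp add: less_Suc_eq all_conj_distrib imp_disjL conj_commute)
 qed
 have eq: "computable_bit k (\<lambda>x. x = v)" if "length v = k" for v
  by (rule computable_bit_cong[OF prefix[OF order_refl, of v]]) (use that in \<open>auto simp: list_eq_iff_nth_eq\<close>)
 have fin: "computable_bit k (\<lambda>x. x \<in> S)" if "finite S" "!!v. v \<in> S ==> length v = k" for S
  using that
 proof (induction S)
  case empty
  show ?case using computable_const[OF assms, of False] by simp
 next
  case (insert v S)
  then show ?case using computable_disj[OF eq[of v]] by simp
 qed
 have "finite {v :: bool list. length v = k}" using finite_lists_length_eq[of "UNIV :: bool set" k] by simp
 then have "finite {v. length v = k \<and> f v}" by (rule rev_finite_subset) auto
 from fin[OF this] have "computable_bit k (\<lambda>x. x \<in> {v. length v = k \<and> f v})" by blast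
 then show ?thesis by (rule computable_bit_cong) simp
qed

text \<open>The output is guessed, a Boolean function tests the relation between input and guess,
  and the input is discarded.\<close>

theorem realizable_all:
 assumes "1 \<le> k" "1 \<le> l" "!!x y. length x = k ==> R x y ==> length y = l"
 shows "realizable k l R"
proof -
 have guesses: "realizable k (k + j) (\<lambda>x y. \<exists>v. length v = j \<and> y = x @ v)" for j
 proof (induction j)
  case 0
  show ?case using realizable_id[OF assms(1)] by (auto elim!: realizable_cong)
 next
  case (Suc j)
  have "realizable (k + j) (k + Suc j) (\<lambda>x y. \<exists>t. y = x @ [t])" using real_guess[of "k + j"] assms(1) by simp
  from Suc this show ?case
   by (rule realizable_then) (auto simp: length_Suc_conv_rev)
 qed
 have discards: "realizable (j + l) l (\<lambda>x y. y = drop j x)" for j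
 proof (induction j)
  case 0
  show ?case using realizable_id[OF assms(2)] by (auto elim!: realizable_cong)
 next
  case (Suc j)
  have "realizable (Suc j + l) (j + l) (local_rel 0 1 (\<lambda>x y. y = []))" by (rule real_discard[of _ "j + l"]) (use assms(2) in simp_all)
  from this Suc show ?case
   by (rule realizable_then) (auto simp: local_rel_def)
 qed
 have "computable_bit (k + l) (\<lambda>w. R (take k w) (drop k w))" using assms(1) by (intro computable_bit) simp
 moreover have "realizable (k + l + 1) (k + l) (local_rel (k + l) 1 (konst [True] []))"
  by (rule real_assert[of _ 0]) (use assms(1) in simp_all)
 ultimately have "realizable (k + l) (k + l) (\<lambda>x y. R (take k x) (drop k x) \<and> y = x)"
  unfolding computable_bit_def by (rule realizable_then) (auto simp: local_rel_def konst_def)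
 from guesses this have "realizable k (k + l) (\<lambda>x y. \<exists>v. length v = l \<and> R x v \<and> y = x @ v)"
  by (rule realizable_then) auto
 from this discards[of k] show ?thesis
 proof (rule realizable_then)
  fix x y :: "bool list" assume x: "length x = k"
  show "(\<exists>z. (\<exists>v. length v = l \<and> R x v \<and> z = x @ v) \<and> y = drop k z) \<longleftrightarrow> R x y"
  proof
   assume "\<exists>z. (\<exists>v. length v = l \<and> R x v \<and> z = x @ v) \<and> y = drop k z"
   then show "R x y" using x by auto
  next
   assume "R x y"
   moreover have "y = drop k (x @ y)" using x by simp
   ultimately show "\<exists>z. (\<exists>v. length v = l \<and> R x v \<and> z = x @ v) \<and> y = drop k z"
    using assms(3)[OF x] by blast
  qed
 qed
qed

section \<open>Nondeterministic machines as queue programs\<close>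

datatype letter = Sep | Cell nat | Head nat nat | Done

text \<open>Idling is always possible, since a pair that ought to move may be out of alignment.
  Moves require a \<open>Cell\<close> as neighbour, so the head cannot cross \<open>Sep\<close>;
  \<open>Done\<close> overwrites whatever is to its right.\<close>

inductive pair_rule :: "machine => letter => letter => letter => letter => bool" for M where
 idle: "pair_rule M x y x y"
| right: "(q, a, q', b, Move_Right) \<in> M ==> pair_rule M (Head q a) (Cell c) (Cell b) (Head q' c)"
| left: "(q, a, q', b, Move_Left) \<in> M ==> pair_rule M (Cell c) (Head q a) (Head q' c) (Cell b)"
| stay: "(q, a, q', b, Stay) \<in> M ==> pair_rule M (Head q a) x (Head q' b) x"
| halt: "(!!r. (1, a, r) \<notin> M) ==> pair_rule M (Head 1 a) x Done x"
| spread: "pair_rule M Done x Done Done"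

fun pairs :: "machine => letter list => letter list => bool" where
 "pairs M [] z \<longleftrightarrow> z = []"
| "pairs M [x] z \<longleftrightarrow> False"
| "pairs M (x # y # q) z \<longleftrightarrow> (\<exists>x' y' q'. pair_rule M x y x' y' \<and> pairs M q q' \<and> z = x' # y' # q')"

text \<open>Rotating by one letter changes the pairing, so that, in a word of even length, any two
  cyclic neighbours form a pair in one of two consecutive rounds.\<close>

definition qround :: "machine => letter list => letter list => bool" where
 "qround M q z \<longleftrightarrow> (\<exists>q'. pairs M q q' \<and> z = rotate1 q')"

lemma pairs_length: "pairs M q z ==> length z = length q \<and> even (length q)"
 by (induction M q z rule: pairs.induct) auto

lemma round_length: "qround M q z ==> length z = length q"
 unfolding qround_def using pairs_length by auto

lemma pairs_refl: "even (length q) ==> pairs M q q"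
 by (induction q rule: induct_list012) (auto intro: idle)

lemma pairs_mid:
 "even (length u) ==> even (length v) ==> pair_rule M x y x' y' ==> pairs M (u @ x # y # v) (u @ x' # y' # v)"
proof (induction u rule: induct_list012)
 case 1
 then show ?case using pairs_refl[of v M] by auto
next
 case (3 a b q)
 then show ?case using idle[of M a b] by auto
qed auto

definition letter_at :: "config => int => letter" where
 "letter_at c i = (if i = fst (snd c) then Head (fst c) (snd (snd c) i) else Cell (snd (snd c) i))"

lemma upto_split:
 fixes f :: "int => 'a"
 assumes "lo \<le> i" "i \<le> hi"
 shows "map (f(i := a)) [lo..hi] = map f [lo..i - 1] @ a # map f [i + 1..hi]"
proof -
 have "[lo..hi] = [lo..i - 1] @ i # [i + 1..hi]" using assms by (simp add: upto_split3)
 then show ?thesis by simp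
qed

lemma upto_split_pair:
 fixes f :: "int => 'a"
 assumes "lo \<le> i" "i + 1 \<le> hi"
 shows "map (f(i := a, i + 1 := b)) [lo..hi] = map f [lo..i - 1] @ a # b # map f [i + 2..hi]"
proof -
 have "[i + 1..hi] = (i + 1) # [i + 2..hi]" using assms(2) by (subst upto_rec1) (simp_all add: algebra_simps)
 then have "[lo..hi] = [lo..i - 1] @ i # (i + 1) # [i + 2..hi]" using assms by (simp add: upto_split3)
 then show ?thesis by simp
qed

lemma upto_index:
 fixes f :: "int => 'a"
 assumes "map f [lo..hi] = x @ a # y"
 obtains i where "lo \<le> i" "i \<le> hi" "x = map f [lo..i - 1]" "a = f i" "y = map f [i + 1..hi]"
proof -
 let ?i = "lo + int (length x)"
 have "length (map f [lo..hi]) = length (x @ a # y)" using assms by simp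
 then have i: "lo \<le> ?i" "?i \<le> hi" by simp_all
 have "map f [lo..hi] = map f [lo..?i - 1] @ f ?i # map f [?i + 1..hi]"
  using upto_split[OF i, of f "f ?i"] by simp
 then have "x @ a # y = map f [lo..?i - 1] @ f ?i # map f [?i + 1..hi]" using assms by simp
 then have "x = map f [lo..?i - 1] \<and> a # y = f ?i # map f [?i + 1..hi]"
  by (subst (asm) append_eq_append_conv) simp_all
 with i that show thesis by blast
qed

lemma split_off:
 assumes "u @ a # w = B @ s # A" "a ~= s"
 shows "(\<exists>B2. B = u @ a # B2 \<and> w = B2 @ s # A) \<or> (\<exists>A1. A = A1 @ a # w \<and> u = B @ s # A1)"
 using assms by (auto simp: append_eq_append_conv2 Cons_eq_append_conv append_eq_Cons_conv)

subsection \<open>Soundness\<close>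

text \<open>The words are cyclic, and \<open>Sep\<close> marks where the window begins. The
  alternative \<open>accepts M w\<close> is there because letters \<open>Done\<close> destroy the
  picture, and they arise only after acceptance.\<close>

definition shows_config :: "machine => bool list => int => int => letter list => bool" where
 "shows_config M w lo hi q \<longleftrightarrow> accepts M w \<or>
  (\<exists>c A B. (step M)\<^sup>*\<^sup>* (initial_config w) c \<and> q = B @ Sep # A \<and> A @ B = map (letter_at c) [lo..hi])"

lemma letter_at_range: "letter_at c i ~= Sep \<and> letter_at c i ~= Done"
 by (simp add: letter_at_def)

lemma shows_one:
 assumes "(step M)\<^sup>*\<^sup>* (initial_config w) c" "u @ x # v = B @ Sep # A" "A @ B = map (letter_at c) [lo..hi]"
  "x ~= Sep"
  "!!i. letter_at c i = x ==> \<exists>c'. step M c c' \<and> letter_at c' = (letter_at c)(i := x')"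
 shows "shows_config M w lo hi (u @ x' # v)"
proof -
 have main: thesis if "map (letter_at c) [lo..hi] = p @ x # r"
  "!!c'. (step M)\<^sup>*\<^sup>* (initial_config w) c' ==> map (letter_at c') [lo..hi] = p @ x' # r ==> thesis" for p r thesis
 proof -
  note eq = that(1) and th = that(2)
  obtain i where i: "lo \<le> i" "i \<le> hi" "p = map (letter_at c) [lo..i - 1]" "x = letter_at c i" "r = map (letter_at c) [i + 1..hi]"
   by (rule upto_index[OF eq])
  obtain c' where c': "step M c c'" "letter_at c' = (letter_at c)(i := x')" using assms(5)[OF i(4)[symmetric]] by blast
  show thesis
   by (rule th[of c']) (use assms(1) c' upto_split[OF i(1,2), of "letter_at c" x'] i(3,5) in \<open>auto intro: rtranclp.rtrancl_into_rtrancl\<close>)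
 qed
 from split_off[OF assms(2,4)] show ?thesis
 proof (elim disjE exE conjE)
  fix B2 assume B: "B = u @ x # B2" "v = B2 @ Sep # A"
  have "map (letter_at c) [lo..hi] = (A @ u) @ x # B2" using assms(3) B by simp
  then show ?thesis
  proof (rule main)
   fix c' assume "(step M)\<^sup>*\<^sup>* (initial_config w) c'" "map (letter_at c') [lo..hi] = (A @ u) @ x' # B2"
   then show ?thesis unfolding shows_config_def using B(2)
    by (intro disjI2 exI[of _ c'] exI[of _ A] exI[of _ "u @ x' # B2"]) simp
  qed
 next
  fix A1 assume A: "A = A1 @ x # v" "u = B @ Sep # A1"
  have "map (letter_at c) [lo..hi] = A1 @ x # (v @ B)" using assms(3) A by simp
  then show ?thesis
  proof (rule main)
   fix c' assume "(step M)\<^sup>*\<^sup>* (initial_config w) c'" "map (letter_at c') [lo..hi] = A1 @ x' # (v @ B)"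
   then show ?thesis unfolding shows_config_def using A(2)
    by (intro disjI2 exI[of _ c'] exI[of _ "A1 @ x' # v"] exI[of _ B]) simp
  qed
 qed
qed

lemma shows_two:
 assumes "(step M)\<^sup>*\<^sup>* (initial_config w) c" "u @ x # y # v = B @ Sep # A" "A @ B = map (letter_at c) [lo..hi]"
  "x ~= Sep" "y ~= Sep"
  "!!i. letter_at c i = x ==> letter_at c (i + 1) = y ==>
   \<exists>c'. step M c c' \<and> letter_at c' = (letter_at c)(i := x', i + 1 := y')"
 shows "shows_config M w lo hi (u @ x' # y' # v)"
proof -
 have main: thesis if eq: "map (letter_at c) [lo..hi] = p @ x # y # r"
  and th: "!!c'. (step M)\<^sup>*\<^sup>* (initial_config w) c' ==> map (letter_at c') [lo..hi] = p @ x' # y' # r ==> thesis" for p r thesis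
 proof -
  obtain i where i: "lo \<le> i" "i \<le> hi" "p = map (letter_at c) [lo..i - 1]" "x = letter_at c i" "y # r = map (letter_at c) [i + 1..hi]"
   by (rule upto_index[OF eq])
  have i1: "i + 1 \<le> hi" using i(5) by (cases "i + 1 \<le> hi") simp_all
  have "[i + 1..hi] = (i + 1) # [i + 2..hi]" using i1 by (subst upto_rec1) (simp_all add: algebra_simps)
  then have y: "y = letter_at c (i + 1)" "r = map (letter_at c) [i + 2..hi]" using i(5) by simp_all
  obtain c' where c': "step M c c'" "letter_at c' = (letter_at c)(i := x', i + 1 := y')"
   using assms(6)[OF i(4)[symmetric] y(1)[symmetric]] by blast
  show thesis
  proof (rule th[of c'])
   show "(step M)\<^sup>*\<^sup>* (initial_config w) c'" using assms(1) c'(1) by (rule rtranclp.rtrancl_into_rtrancl)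
   show "map (letter_at c') [lo..hi] = p @ x' # y' # r"
    unfolding c'(2) upto_split_pair[OF i(1) i1] i(3) y(2) ..
  qed
 qed
 from split_off[OF assms(2,4)] show ?thesis
 proof (elim disjE exE conjE)
  fix B2 assume B: "B = u @ x # B2" "y # v = B2 @ Sep # A"
  then obtain B3 where B3: "B2 = y # B3" "v = B3 @ Sep # A" using assms(5) by (cases B2) auto
  have "map (letter_at c) [lo..hi] = (A @ u) @ x # y # B3" using assms(3) B B3 by simp
  then show ?thesis
  proof (rule main)
   fix c' assume "(step M)\<^sup>*\<^sup>* (initial_config w) c'" "map (letter_at c') [lo..hi] = (A @ u) @ x' # y' # B3"
   then show ?thesis unfolding shows_config_def using B3
    by (intro disjI2 exI[of _ c'] exI[of _ A] exI[of _ "u @ x' # y' # B3"]) simp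
  qed
 next
  fix A1 assume A: "A = A1 @ x # y # v" "u = B @ Sep # A1"
  have "map (letter_at c) [lo..hi] = A1 @ x # y # (v @ B)" using assms(3) A by simp
  then show ?thesis
  proof (rule main)
   fix c' assume "(step M)\<^sup>*\<^sup>* (initial_config w) c'" "map (letter_at c') [lo..hi] = A1 @ x' # y' # (v @ B)"
   then show ?thesis unfolding shows_config_def using A(2)
    by (intro disjI2 exI[of _ c'] exI[of _ "A1 @ x' # y' # v"] exI[of _ B]) simp
  qed
 qed
qed

lemma letter_at_Head: "letter_at c i = Head q a ==> \<exists>tau. c = (q, i, tau) \<and> tau i = a"
 by (cases c) (auto simp: letter_at_def split: if_splits)

lemma letter_at_Cell: "letter_at (q, h, tau) i = Cell a ==> i ~= h \<and> tau i = a"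
 by (auto simp: letter_at_def split: if_splits)

lemma shows_rule:
 assumes "shows_config M w lo hi (u @ x @ [y1, y2] @ v)" "x = []" "pair_rule M y1 y2 z1 z2"
 shows "shows_config M w lo hi (u @ z1 # z2 # v)"
proof (cases "accepts M w")
 case True
 then show ?thesis by (simp add: shows_config_def)
next
 case False
 then obtain c A B where c: "(step M)\<^sup>*\<^sup>* (initial_config w) c" "u @ y1 # y2 # v = B @ Sep # A" "A @ B = map (letter_at c) [lo..hi]"
  using assms(1,2) unfolding shows_config_def by auto
 have occurs: "\<exists>i. letter_at c i = y" if "y \<in> set (B @ Sep # A)" "y ~= Sep" for y
 proof -
  have "y \<in> set (A @ B)" using that by auto
  then show ?thesis unfolding c(3) by auto
 qed
 from assms(3) show ?thesis
 proof cases
  case idle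
  then show ?thesis using assms(1,2) by simp
 next
  case (right q a q' b d)
  show ?thesis
  proof (rule shows_two[OF c], goal_cases)
   case (3 i)
   then obtain tau where tau: "c = (q, i, tau)" "tau i = a" "tau (i + 1) = d"
    using letter_at_Head[of c i q a] letter_at_Cell right by blast
   have "step M c (q', i + 1, tau(i := b))" unfolding tau(1) using step.intros[of q tau i q' b Move_Right M] right tau by auto
   moreover have "letter_at (q', i + 1, tau(i := b)) = (letter_at c)(i := z1, i + 1 := z2)"
    using tau right by (auto simp: letter_at_def fun_eq_iff)
   ultimately show ?case by blast
  qed (use right in simp_all)
 next
  case (left q a q' b d)
  show ?thesis
  proof (rule shows_two[OF c], goal_cases)
   case (3 i)
   then obtain tau where tau: "c = (q, i + 1, tau)" "tau (i + 1) = a" "tau i = d"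
    using letter_at_Head[of c "i + 1" q a] letter_at_Cell left by blast
   have "step M c (q', i, tau(i + 1 := b))" unfolding tau(1) using step.intros[of q tau "i + 1" q' b Move_Left M] left tau by auto
   moreover have "letter_at (q', i, tau(i + 1 := b)) = (letter_at c)(i := z1, i + 1 := z2)"
    using tau left by (auto simp: letter_at_def fun_eq_iff)
   ultimately show ?case by blast
  qed (use left in simp_all)
 next
  case (stay q a q' b)
  have "shows_config M w lo hi (u @ z1 # y2 # v)"
  proof (rule shows_one[OF c], goal_cases)
   case (2 i)
   then obtain tau where tau: "c = (q, i, tau)" "tau i = a" using letter_at_Head[of c i q a] stay by blast
   have "step M c (q', i, tau(i := b))" unfolding tau(1) using step.intros[of q tau i q' b Stay M] stay tau by auto
   moreover have "letter_at (q', i, tau(i := b)) = (letter_at c)(i := z1)"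
    using tau stay by (auto simp: letter_at_def fun_eq_iff)
   ultimately show ?case by blast
  qed (use stay in simp_all)
  then show ?thesis using stay by simp
 next
  case (halt a)
  have "y1 \<in> set (B @ Sep # A)" unfolding c(2)[symmetric] by simp
  then obtain i where "letter_at c i = Head 1 a" using occurs[of y1] halt by auto
  then obtain tau where tau: "c = (1, i, tau)" "tau i = a" using letter_at_Head by blast
  have "halting M c" unfolding halting_def tau(1) using halt tau(2) by (auto elim!: step.cases)
  then have "accepts M w" unfolding accepts_def using c(1) tau(1) by (metis fst_conv)
  with False show ?thesis by blast
 next
  \<comment> \<open>A word that shows a configuration has no letter \<open>Done\<close>.\<close>
  case spread
  have "y1 \<in> set (B @ Sep # A)" unfolding c(2)[symmetric] by simp
  then show ?thesis using occurs[of y1] spread letter_at_range by auto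
 qed
qed

lemma shows_pairs: "pairs M q z ==> shows_config M w lo hi (u @ q) ==> shows_config M w lo hi (u @ z)"
proof (induction M q z arbitrary: u rule: pairs.induct)
 case (3 M x y q z)
 then obtain x' y' q' where r: "pair_rule M x y x' y'" "pairs M q q'" "z = x' # y' # q'" by auto
 have "shows_config M w lo hi ((u @ [x', y']) @ q)"
  using shows_rule[of M w lo hi u "[]" x y q x' y'] r(1) 3(3) by simp
 then have "shows_config M w lo hi ((u @ [x', y']) @ q')" by (rule "3.IH"[OF r(2)])
 then show ?case using r(3) by simp
qed auto

lemma shows_rotate1: "shows_config M w lo hi q ==> shows_config M w lo hi (rotate1 q)"
proof (cases "accepts M w")
 case False
 assume "shows_config M w lo hi q"
 with False obtain c A B where c: "(step M)\<^sup>*\<^sup>* (initial_config w) c" "q = B @ Sep # A" "A @ B = map (letter_at c) [lo..hi]"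
  unfolding shows_config_def by blast
 show ?thesis
 proof (cases B)
  case Nil
  then show ?thesis unfolding shows_config_def using c
   by (intro disjI2 exI[of _ c] exI[of _ "[]"] exI[of _ A]) simp
 next
  case (Cons b B')
  then show ?thesis unfolding shows_config_def using c
   by (intro disjI2 exI[of _ c] exI[of _ "A @ [b]"] exI[of _ B']) simp
 qed
qed (simp add: shows_config_def)

lemma shows_rounds: "(qround M ^^ n) q z ==> shows_config M w lo hi q ==> shows_config M w lo hi z"
proof (induction n arbitrary: z)
 case (Suc n)
 then obtain y where y: "(qround M ^^ n) q y" "qround M y z" by (auto elim: relpowp_Suc_E)
 from y(2) obtain y' where "pairs M y y'" "z = rotate1 y'" unfolding qround_def by blast
 then show ?case using shows_pairs[of M y y' w lo hi "[]"] Suc.IH[OF y(1) Suc.prems(2)] shows_rotate1 by simp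
qed simp

text \<open>The final word has no separator, so it shows no configuration and only acceptance
  remains.\<close>

lemma rounds_sound:
 assumes "(qround M ^^ n) (Sep # map (letter_at (initial_config w)) [lo..hi]) (replicate m Done)"
 shows "accepts M w"
proof -
 have "shows_config M w lo hi (Sep # map (letter_at (initial_config w)) [lo..hi])"
  unfolding shows_config_def
  by (intro disjI2 exI[of _ "initial_config w"] exI[of _ "map (letter_at (initial_config w)) [lo..hi]"] exI[of _ "[]"]) simp
 from shows_rounds[OF assms this] have "shows_config M w lo hi (replicate m Done)" .
 moreover have "replicate m Done ~= B @ Sep # A" for A B
 proof
  assume "replicate m Done = B @ Sep # A"
  then have "Sep \<in> set (replicate m Done)" by simp
  then show False by simp
 qed
 ultimately show ?thesis unfolding shows_config_def by blast
qed

subsection \<open>Completeness\<close>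

lemma rotate_even:
 "even (length u) ==> even (length v) ==>
  \<exists>u' v'. even (length u') \<and> even (length v') \<and> (\<forall>x y. rotate (2 * k) (u @ x # y # v) = u' @ x # y # v')"
proof (induction k arbitrary: u v)
 case 0
 then show ?case by (intro exI[of _ u] exI[of _ v]) simp
next
 case (Suc k)
 have rot: "rotate (2 * Suc k) (a # b # s) = rotate (2 * k) (s @ [a, b])" for a b :: 'a and s
 proof -
  have "rotate (2 * Suc k) (a # b # s) = rotate (2 * k) (rotate 2 (a # b # s))" by (simp add: rotate_rotate)
  then show ?thesis by (simp add: numeral_2_eq_2)
 qed
 show ?case
 proof (cases u)
  case Nil
  from Suc.IH[of v "[]"] Suc.prems(2) obtain u' v' where
   "even (length u')" "even (length v')" "!!x y. rotate (2 * k) (v @ [x, y]) = u' @ x # y # v'" by auto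
  then show ?thesis unfolding Nil append_Nil rot by blast
 next
  case (Cons a u1)
  then obtain b u2 where u: "u = a # b # u2" using Suc.prems(1) by (cases u1) auto
  from Suc.IH[of u2 "v @ [a, b]"] Suc.prems u obtain u' v' where
   "even (length u')" "even (length v')" "!!x y. rotate (2 * k) (u2 @ x # y # v @ [a, b]) = u' @ x # y # v'" by auto
  then show ?thesis unfolding u append_Cons rot by (simp only: append_assoc append_Cons) blast
 qed
qed

text \<open>In a word of even length, the place where the pair begins after the rotation has the
  parity of \<open>length u + k\<close>.\<close>

lemma rotate_aligned:
 assumes "even (length u + length v)" "even (length u + k)"
 shows "\<exists>u' v'. even (length u') \<and> even (length v') \<and> (\<forall>x y. rotate k (u @ x # y # v) = u' @ x # y # v')"
proof (cases "even k")
 case True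
 then obtain j where "k = 2 * j" by blast
 then show ?thesis using rotate_even[of u v j] assms True by auto
next
 case False
 then obtain j where j: "k = Suc (2 * j)" by (metis oddE Suc_eq_plus1)
 obtain a u1 where u: "u = a # u1" using assms(2) False by (cases u) auto
 have "rotate k (u @ x # y # v) = rotate (2 * j) (u1 @ x # y # (v @ [a]))" for x y
  unfolding j u by (simp add: rotate1_rotate_swap)
 moreover have "even (length u1)" "even (length (v @ [a]))" using assms False u by auto
 ultimately show ?thesis using rotate_even[of u1 "v @ [a]" j] by simp
qed

lemma round_idle: "even (length q) ==> qround M q (rotate1 q)"
 unfolding qround_def using pairs_refl by blast

lemma rounds_idle: "even (length q) ==> (qround M ^^ n) q (rotate n q)"
proof (induction n)
 case (Suc n)
 have "qround M (rotate n q) (rotate1 (rotate n q))" by (rule round_idle) (simp add: Suc.prems)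
 then show ?case using Suc.IH[OF Suc.prems] by (auto intro: relcomppI)
qed simp

text \<open>In one of the two rounds the pair is aligned and gets rewritten, in the other one
  everything idles.\<close>

lemma two_rounds:
 assumes "even (length u + length v)" "pair_rule M x y x' y'"
 shows "(qround M ^^ 2) (rotate k (u @ x # y # v)) (rotate (Suc (Suc k)) (u @ x' # y' # v))"
proof -
 have now: "qround M (rotate k (u @ x # y # v)) (rotate (Suc k) (u @ x' # y' # v))" if "even (length u + k)" for k
 proof -
  note ev = that
  obtain u' v' where uv: "even (length u')" "even (length v')" "!!x y. rotate k (u @ x # y # v) = u' @ x # y # v'"
   using rotate_aligned[OF assms(1) ev] by blast
  have "pairs M (u' @ x # y # v') (u' @ x' # y' # v')" by (rule pairs_mid[OF uv(1,2) assms(2)])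
  then have "pairs M (rotate k (u @ x # y # v)) (rotate k (u @ x' # y' # v))" unfolding uv(3) .
  then show ?thesis unfolding qround_def by auto
 qed
 have wait: "qround M (rotate k (u @ x # y # v)) (rotate (Suc k) (u @ x # y # v))" for k x y
  using round_idle[of "rotate k (u @ x # y # v)"] assms(1) by simp
 have two: "(qround M ^^ 2) p r" if "qround M p q" "qround M q r" for p q r
  using that by (auto simp: numeral_2_eq_2)
 show ?thesis
 proof (cases "even (length u + k)")
  case True
  from two[OF now[OF True] wait] show ?thesis .
 next
  case False
  then have "even (length u + Suc k)" by simp
  from two[OF wait now[OF this]] show ?thesis .
 qed
qed

lemma rounds_trans: "(qround M ^^ m) p q ==> (qround M ^^ n) q r ==> (qround M ^^ (m + n)) p r"
 by (auto simp: relpowp_add)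

text \<open>The last \<open>Done\<close> of the block overwrites its right neighbour every two
  rounds.\<close>

lemma spread_all:
 "1 \<le> j ==> even (j + length v) ==>
  \<exists>k'. (qround M ^^ (2 * length v)) (rotate k (replicate j Done @ v)) (rotate k' (replicate (j + length v) Done))"
proof (induction v arbitrary: j k)
 case Nil
 show ?case by (intro exI[of _ k]) simp
next
 case (Cons x v)
 obtain i where j: "j = Suc i" using Cons.prems(1) by (cases j) auto
 have "(qround M ^^ 2) (rotate k (replicate i Done @ Done # x # v)) (rotate (Suc (Suc k)) (replicate i Done @ Done # Done # v))"
  by (rule two_rounds[OF _ spread]) (use Cons.prems(2) j in simp)
 moreover have "replicate i Done @ Done # x # v = replicate j Done @ x # v"
  "replicate i Done @ Done # Done # v = replicate (Suc j) Done @ v" unfolding j by (simp_all add: replicate_app_Cons_same)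
 ultimately have 1: "(qround M ^^ 2) (rotate k (replicate j Done @ x # v)) (rotate (Suc (Suc k)) (replicate (Suc j) Done @ v))"
  by simp
 obtain k' where "(qround M ^^ (2 * length v)) (rotate (Suc (Suc k)) (replicate (Suc j) Done @ v)) (rotate k' (replicate (Suc j + length v) Done))"
  using Cons.IH[of "Suc j" "Suc (Suc k)"] Cons.prems by auto
 from rounds_trans[OF 1 this] show ?case by auto
qed

lemma rotate_replicate: "rotate k (replicate n x) = replicate n x"
proof -
 have "rotate k (replicate n x) = replicate (length (rotate k (replicate n x))) x"
  by (rule replicate_length_same[symmetric]) simp
 then show ?thesis by simp
qed

lemma step_rounds:
 assumes "step M c c'" "lo < fst (snd c)" "fst (snd c) < hi" "even (length (Sep # map (letter_at c) [lo..hi]))"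
 shows "\<exists>k'. (qround M ^^ 2) (rotate k (Sep # map (letter_at c) [lo..hi])) (rotate k' (Sep # map (letter_at c') [lo..hi]))"
proof -
 from assms(1) obtain q tau h q' b m where c: "c = (q, h, tau)" "(q, tau h, q', b, m) \<in> M"
  and c': "c' = (q', h + move_offset m, tau(h := b))" by (auto elim: step.cases)
 have h: "lo < h" "h < hi" using assms(2,3) c(1) by simp_all
 have go: ?thesis if i: "lo \<le> i" "i + 1 \<le> hi" and r: "pair_rule M (letter_at c i) (letter_at c (i + 1)) x' y'"
  and e: "letter_at c' = (letter_at c)(i := x', i + 1 := y')" for i x' y'
 proof -
  let ?u = "Sep # map (letter_at c) [lo..i - 1]" and ?v = "map (letter_at c) [i + 2..hi]"
  have 1: "Sep # map (letter_at c) [lo..hi] = ?u @ letter_at c i # letter_at c (i + 1) # ?v"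
   using upto_split_pair[OF i, of "letter_at c" "letter_at c i" "letter_at c (i + 1)"] by simp
  have 2: "Sep # map (letter_at c') [lo..hi] = ?u @ x' # y' # ?v"
   unfolding e using upto_split_pair[OF i, of "letter_at c" x' y'] by simp
  have "even (length ?u + length ?v)" using assms(4) unfolding 1 by simp
  from two_rounds[OF this r] show ?thesis unfolding 1 2 by blast
 qed
 show ?thesis
 proof (cases m)
  case Move_Right
  show ?thesis
  proof (rule go[of h "Cell b" "Head q' (tau (h + 1))"])
   show "pair_rule M (letter_at c h) (letter_at c (h + 1)) (Cell b) (Head q' (tau (h + 1)))"
    using c Move_Right by (simp add: letter_at_def right)
   show "letter_at c' = (letter_at c)(h := Cell b, h + 1 := Head q' (tau (h + 1)))"
    using c c' Move_Right by (auto simp: letter_at_def fun_eq_iff)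
  qed (use h in simp_all)
 next
  case Move_Left
  show ?thesis
  proof (rule go[of "h - 1" "Head q' (tau (h - 1))" "Cell b"])
   show "pair_rule M (letter_at c (h - 1)) (letter_at c (h - 1 + 1)) (Head q' (tau (h - 1))) (Cell b)"
    using c Move_Left by (simp add: letter_at_def left)
   show "letter_at c' = (letter_at c)(h - 1 := Head q' (tau (h - 1)), h - 1 + 1 := Cell b)"
    using c c' Move_Left by (auto simp: letter_at_def fun_eq_iff)
  qed (use h in simp_all)
 next
  case Stay
  show ?thesis
  proof (rule go[of h "Head q' b" "letter_at c (h + 1)"])
   show "pair_rule M (letter_at c h) (letter_at c (h + 1)) (Head q' b) (letter_at c (h + 1))"
    using c Stay by (simp add: letter_at_def stay)
   show "letter_at c' = (letter_at c)(h := Head q' b, h + 1 := letter_at c (h + 1))"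
    using c c' Stay by (auto simp: letter_at_def fun_eq_iff)
  qed (use h in simp_all)
 qed
qed

text \<open>In \<open>m\<close> steps the head stays within distance \<open>m\<close> of cell 0, so
  it never reaches the ends of the window.\<close>

lemma steps_rounds:
 assumes "(step M ^^ m) (initial_config w) c" "lo < - int m" "int m < hi" "odd (length [lo..hi])"
 shows "\<bar>fst (snd c)\<bar> \<le> int m \<and>
  (\<exists>k. (qround M ^^ (2 * m)) (Sep # map (letter_at (initial_config w)) [lo..hi]) (rotate k (Sep # map (letter_at c) [lo..hi])))"
 using assms(1-3)
proof (induction m arbitrary: c)
 case 0
 then show ?case by (auto simp: initial_config_def intro!: exI[of _ 0])
next
 case (Suc m)
 from Suc.prems(1) obtain d where d: "(step M ^^ m) (initial_config w) d" "step M d c" by (auto elim: relpowp_Suc_E)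
 obtain k where h: "\<bar>fst (snd d)\<bar> \<le> int m"
  and k: "(qround M ^^ (2 * m)) (Sep # map (letter_at (initial_config w)) [lo..hi]) (rotate k (Sep # map (letter_at d) [lo..hi]))"
  using Suc.IH[OF d(1)] Suc.prems(2,3) by auto
 obtain k' where k': "(qround M ^^ 2) (rotate k (Sep # map (letter_at d) [lo..hi])) (rotate k' (Sep # map (letter_at c) [lo..hi]))"
 proof -
  have "lo < fst (snd d)" "fst (snd d) < hi" using h Suc.prems(2,3) by linarith+
  moreover have "even (length (Sep # map (letter_at d) [lo..hi]))" using assms(4) by simp
  ultimately show ?thesis using step_rounds[OF d(2), of lo hi k] that by blast
 qed
 have "\<bar>move_offset m\<bar> \<le> 1" for m by (cases m) simp_all
 then have "\<bar>fst (snd c)\<bar> \<le> int (Suc m)" using d(2) h by (auto elim!: step.cases) (smt (verit))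
 moreover have "(qround M ^^ (2 * Suc m)) (Sep # map (letter_at (initial_config w)) [lo..hi]) (rotate k' (Sep # map (letter_at c) [lo..hi]))"
  using rounds_trans[OF k k'] by (simp add: add.commute)
 ultimately show ?case by blast
qed

text \<open>Two rounds for each machine step, two for recognizing the halt, and two for each letter
  overwritten by \<open>Done\<close>; the remaining rounds idle.\<close>

lemma rounds_complete:
 assumes "(step M ^^ m) (initial_config w) c" "halting M c" "fst c = 1"
  and "lo < - int m" "int m < hi" "odd (length [lo..hi])" "2 * m + 2 + 2 * length [lo..hi] \<le> n"
 shows "(qround M ^^ n) (Sep # map (letter_at (initial_config w)) [lo..hi]) (replicate (Suc (length [lo..hi])) Done)"
proof -
 obtain h tau where c: "c = (1, h, tau)" using assms(3) by (cases c) auto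
 obtain k where h: "\<bar>h\<bar> \<le> int m"
  and k: "(qround M ^^ (2 * m)) (Sep # map (letter_at (initial_config w)) [lo..hi]) (rotate k (Sep # map (letter_at c) [lo..hi]))"
  using steps_rounds[OF assms(1,4,5,6)] c by auto
 let ?u = "Sep # map (letter_at c) [lo..h - 1]" and ?v = "map (letter_at c) [h + 2..hi]"
 have i: "lo \<le> h" "h + 1 \<le> hi" using h assms(4,5) by linarith+
 have 1: "Sep # map (letter_at c) [lo..hi] = ?u @ letter_at c h # letter_at c (h + 1) # ?v"
  using upto_split_pair[OF i, of "letter_at c" "letter_at c h" "letter_at c (h + 1)"] by simp
 have len: "length ?u + length ?v + 1 = length [lo..hi]" using arg_cong[OF 1, of length] by simp
 have ev: "even (length ?u + length ?v)" using assms(6) unfolding len[symmetric] by simp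
 have "(1, tau h, r) \<notin> M" for r
 proof
  assume "(1, tau h, r) \<in> M"
  then have "step M c (fst r, h + move_offset (snd (snd r)), tau(h := fst (snd r)))"
   unfolding c by (intro step.intros) simp
  then show False using assms(2) unfolding halting_def by blast
 qed
 then have "pair_rule M (Head 1 (tau h)) (letter_at c (h + 1)) Done (letter_at c (h + 1))" by (rule halt)
 then have "pair_rule M (letter_at c h) (letter_at c (h + 1)) Done (letter_at c (h + 1))"
  using c by (simp add: letter_at_def)
 from rounds_trans[OF k[unfolded 1] two_rounds[OF ev this]]
 have 2: "(qround M ^^ (2 * m + 2)) (Sep # map (letter_at (initial_config w)) [lo..hi]) (rotate (Suc (Suc k)) (?u @ Done # letter_at c (h + 1) # ?v))" .
 \<comment> \<open>The cyclic word is read from the new \<open>Done\<close> on, so that it has the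
   form treated by \<open>spread_all\<close>.\<close>
 have "?u @ Done # letter_at c (h + 1) # ?v = rotate (length (letter_at c (h + 1) # ?v) + 1) (replicate 1 Done @ (letter_at c (h + 1) # ?v) @ ?u)"
  using rotate_append[of "Done # letter_at c (h + 1) # ?v" ?u] by simp
 then have rot: "rotate (Suc (Suc k)) (?u @ Done # letter_at c (h + 1) # ?v) =
   rotate (Suc (Suc k) + (length (letter_at c (h + 1) # ?v) + 1)) (replicate 1 Done @ (letter_at c (h + 1) # ?v) @ ?u)"
  by (simp only: rotate_rotate)
 have len2: "length ((letter_at c (h + 1) # ?v) @ ?u) = length [lo..hi]" using len by simp
 obtain k' where 3: "(qround M ^^ (2 * length [lo..hi])) (rotate (Suc (Suc k)) (?u @ Done # letter_at c (h + 1) # ?v))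
   (rotate k' (replicate (Suc (length [lo..hi])) Done))"
  using spread_all[of 1 "(letter_at c (h + 1) # ?v) @ ?u" M "Suc (Suc k) + (length (letter_at c (h + 1) # ?v) + 1)"] assms(6)
  unfolding rot len2 by auto
 obtain d where d: "n = (2 * m + 2 + 2 * length [lo..hi]) + d" using assms(7) le_Suc_ex by blast
 have "(qround M ^^ d) (replicate (Suc (length [lo..hi])) Done) (rotate d (replicate (Suc (length [lo..hi])) Done))"
  by (rule rounds_idle) (use assms(6) in simp)
 from rounds_trans[OF rounds_trans[OF 2 3[unfolded rotate_replicate]] this[unfolded rotate_replicate]]
 show ?thesis unfolding d .
qed

subsection \<open>Encoding letters by bits\<close>

definition symbols :: "machine => nat set" where
 "symbols M = {0, 1, 2} \<union> (\<lambda>(q, a, q', b, m). a) ` M \<union> (\<lambda>(q, a, q', b, m). b) ` M"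

definition states :: "machine => nat set" where
 "states M = {0, 1} \<union> (\<lambda>(q, a, q', b, m). q) ` M \<union> (\<lambda>(q, a, q', b, m). q') ` M"

definition letters :: "machine => letter set" where
 "letters M = {Sep, Done} \<union> Cell ` symbols M \<union> (\<lambda>(q, a). Head q a) ` (states M \<times> symbols M)"

lemma finite_letters: "finite M ==> finite (letters M)"
 by (simp add: letters_def symbols_def states_def)

lemma letters_simps [simp]:
 "Sep \<in> letters M" "Done \<in> letters M" "Cell a \<in> letters M \<longleftrightarrow> a \<in> symbols M"
 "Head q a \<in> letters M \<longleftrightarrow> q \<in> states M \<and> a \<in> symbols M"
 by (auto simp: letters_def)

lemma table_entries:
 "(q, a, q', b, m) \<in> M ==> b \<in> symbols M \<and> q' \<in> states M"
 by (force simp: symbols_def states_def)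

lemma pair_rule_letters:
 "pair_rule M x y x' y' ==> x \<in> letters M ==> y \<in> letters M ==> x' \<in> letters M \<and> y' \<in> letters M"
 by (induction rule: pair_rule.induct) (auto dest: table_entries)

lemma pairs_letters: "pairs M q z ==> set q \<subseteq> letters M ==> set z \<subseteq> letters M"
proof (induction M q z rule: pairs.induct)
 case (3 M x y q z)
 then show ?case using pair_rule_letters by fastforce
qed auto

lemma qround_letters: "qround M q z ==> set q \<subseteq> letters M ==> set z \<subseteq> letters M"
 unfolding qround_def by (metis pairs_letters set_rotate1)

section \<open>Rounds as sweeps of a queue program\<close>

locale letter_code =
 fixes M :: machine and code :: "letter => bool list" and k :: nat and us :: "instr list list"
 assumes length_code: "length (code x) = k"
  and code_inject: "x \<in> letters M ==> y \<in> letters M ==> code x = code y ==> x = y"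
  and k: "1 \<le> k"
  and us: "chain us (2 * k) (2 * k) (\<lambda>u v. \<exists>x\<in>letters M. \<exists>y\<in>letters M. \<exists>x' y'.
   pair_rule M x y x' y' \<and> u = code x @ code y \<and> v = code x' @ code y')"
begin

definition code_rule :: "bool list => bool list => bool" where
 "code_rule u v \<longleftrightarrow> (\<exists>x\<in>letters M. \<exists>y\<in>letters M. \<exists>x' y'.
   pair_rule M x y x' y' \<and> u = code x @ code y \<and> v = code x' @ code y')"

lemma code_rule:
 assumes "x \<in> letters M" "y \<in> letters M"
 shows "code_rule (code x @ code y) v \<longleftrightarrow> (\<exists>x' y'. pair_rule M x y x' y' \<and> v = code x' @ code y')"
proof
 assume "code_rule (code x @ code y) v"
 then obtain a b x' y' where 1: "a \<in> letters M" "b \<in> letters M" "pair_rule M a b x' y'"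
  "code x @ code y = code a @ code b" "v = code x' @ code y'" unfolding code_rule_def by blast
 then have "code x = code a" "code y = code b" using length_code by (simp_all add: append_eq_append_conv)
 then have "x = a" "y = b" using code_inject assms 1(1,2) by blast+
 with 1 show "\<exists>x' y'. pair_rule M x y x' y' \<and> v = code x' @ code y'" by blast
next
 assume "\<exists>x' y'. pair_rule M x y x' y' \<and> v = code x' @ code y'"
 then show "code_rule (code x @ code y) v" unfolding code_rule_def using assms by blast
qed

abbreviation enc_word :: "letter list => bool list" where
 "enc_word q \<equiv> concat (map code q)"

fun chunks :: "letter list => bool list list" where
 "chunks (x # y # q) = (code x @ code y) # chunks q"
| "chunks _ = []"

lemma chunks:
 "even (length q) ==> concat (chunks q) = enc_word q \<and> length (chunks q) = length q div 2 \<and>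
  (\<forall>u\<in>set (chunks q). length u = 2 * k)"
 by (induction q rule: induct_list012) (auto simp: length_code)

lemma chunks_pairs:
 "even (length q) ==> set q \<subseteq> letters M ==> list_all2 code_rule (chunks q) Y \<longleftrightarrow> (\<exists>q'. pairs M q q' \<and> Y = chunks q')"
proof (induction q arbitrary: Y rule: induct_list012)
 case (3 x y q)
 have "list_all2 code_rule (chunks (x # y # q)) Y \<longleftrightarrow>
   (\<exists>v Z. Y = v # Z \<and> code_rule (code x @ code y) v \<and> list_all2 code_rule (chunks q) Z)"
  by (simp add: list_all2_Cons1)
 also have "\<dots> \<longleftrightarrow> (\<exists>x' y' q'. pair_rule M x y x' y' \<and> pairs M q q' \<and> Y = (code x' @ code y') # chunks q')"
  using 3 by (auto simp: code_rule)
 also have "\<dots> \<longleftrightarrow> (\<exists>q'. pairs M (x # y # q) q' \<and> Y = chunks q')" by force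
 finally show ?case .
qed auto

text \<open>One round on codes: all pairs are rewritten in parallel, and \<open>k\<close> rotations
  of single bits move one whole letter.\<close>

definition supersweep :: "nat => instr list" where
 "supersweep B = sweeps us B @ replicate k rot_instr"

lemma qrun_supersweep:
 assumes "length q = 2 * B" "1 \<le> B" "set q \<subseteq> letters M"
 shows "qrun (supersweep B) (enc_word q) z \<longleftrightarrow> (\<exists>q'. qround M q q' \<and> z = enc_word q')"
proof -
 have ev: "even (length q)" using assms(1) by simp
 have B: "length (chunks q) = B" using chunks[OF ev] assms(1) by simp
 have us': "chain us (2 * k) (2 * k) code_rule"
  by (rule chain_cong[OF us]) (simp add: code_rule_def)
 have 1: "qrun (sweeps us B) (enc_word q) y \<longleftrightarrow> (\<exists>q'. pairs M q q' \<and> y = enc_word q')" for y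
 proof -
  have "qrun (sweeps us (length (chunks q))) (concat (chunks q)) y \<longleftrightarrow> (\<exists>Y. list_all2 code_rule (chunks q) Y \<and> y = concat Y)"
   by (rule qrun_sweeps[OF us']) (use chunks[OF ev] in blast)
  also have "\<dots> \<longleftrightarrow> (\<exists>q'. pairs M q q' \<and> y = concat (chunks q'))" unfolding chunks_pairs[OF ev assms(3)] by blast
  also have "\<dots> \<longleftrightarrow> (\<exists>q'. pairs M q q' \<and> y = enc_word q')"
  proof -
   have "concat (chunks q') = enc_word q'" if "pairs M q q'" for q'
    using chunks[of q'] pairs_length[OF that] by simp
   then show ?thesis by auto
  qed
  finally show ?thesis unfolding B using chunks[OF ev] by simp
 qed
 have 2: "qrun (replicate k rot_instr) (enc_word q') z \<longleftrightarrow> z = enc_word (rotate1 q')" if "length q' = 2 * B" for q'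
 proof -
  note q'_len = that
  obtain x r where q': "q' = x # r" using q'_len assms(2) by (cases q') auto
  have "qrun (replicate k rot_instr) (code x @ enc_word r) z \<longleftrightarrow> (\<exists>y. code x = y \<and> z = enc_word r @ y)"
   using blk_id[of k] length_code[of x] unfolding blk_def by blast
  then show ?thesis unfolding q' by simp
 qed
 have "qrun (supersweep B) (enc_word q) z \<longleftrightarrow> (\<exists>q'. pairs M q q' \<and> qrun (replicate k rot_instr) (enc_word q') z)"
  unfolding supersweep_def qrun_append 1 by blast
 also have "\<dots> \<longleftrightarrow> (\<exists>q'. pairs M q q' \<and> z = enc_word (rotate1 q'))"
 proof -
  have "qrun (replicate k rot_instr) (enc_word q') z \<longleftrightarrow> z = enc_word (rotate1 q')" if "pairs M q q'" for q'
   by (rule 2) (use pairs_length[OF that] assms(1) in simp)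
  then show ?thesis by blast
 qed
 also have "\<dots> \<longleftrightarrow> (\<exists>q'. qround M q q' \<and> z = enc_word q')" unfolding qround_def by blast
 finally show ?thesis .
qed

lemma qrun_supersweeps:
 assumes "length q = 2 * B" "1 \<le> B" "set q \<subseteq> letters M"
 shows "qrun (concat (replicate S (supersweep B))) (enc_word q) z \<longleftrightarrow> (\<exists>q'. (qround M ^^ S) q q' \<and> z = enc_word q')"
 using assms(1,3)
proof (induction S arbitrary: q)
 case 0
 show ?case by auto
next
 case (Suc S)
 have IH: "qrun (concat (replicate S (supersweep B))) (enc_word y) z \<longleftrightarrow> (\<exists>q'. (qround M ^^ S) y q' \<and> z = enc_word q')"
  if "qround M q y" for y
  by (rule Suc.IH) (use round_length[OF that] qround_letters[OF that] Suc.prems in auto)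
 have "qrun (concat (replicate (Suc S) (supersweep B))) (enc_word q) z \<longleftrightarrow>
   (\<exists>y. qround M q y \<and> qrun (concat (replicate S (supersweep B))) (enc_word y) z)"
  unfolding replicate_Suc concat.simps qrun_append qrun_supersweep[OF Suc.prems(1) assms(2) Suc.prems(2)] by blast
 also have "\<dots> \<longleftrightarrow> (\<exists>y q'. qround M q y \<and> (qround M ^^ S) y q' \<and> z = enc_word q')" using IH by blast
 also have "\<dots> \<longleftrightarrow> (\<exists>q'. (qround M ^^ Suc S) q q' \<and> z = enc_word q')"
  unfolding relpowp.simps relpowp_commute[symmetric] by (auto simp: relcompp_apply)
 finally show ?case .
qed

lemma qlens_supersweeps:
 assumes "3 \<le> B"
 shows "qlens (concat (replicate S (supersweep B))) (B * (2 * k)) (B * (2 * k))"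
proof (induction S)
 case 0
 show ?case using assms k by simp
next
 case (Suc S)
 have "2 * k \<le> B * (2 * k)" "k + 2 \<le> 3 * k + 2" using assms by simp_all
 have "qlens (replicate k rot_instr) (k + (B * (2 * k) - k)) (k + (B * (2 * k) - k))"
 proof -
  have "3 * (2 * k) \<le> B * (2 * k)" using assms by simp
  then have "2 \<le> B * (2 * k) - k" using k by linarith
  then show ?thesis using blk_id[of k] unfolding blk_def by blast
 qed
 moreover have "k + (B * (2 * k) - k) = B * (2 * k)"
 proof -
  have "3 * (2 * k) \<le> B * (2 * k)" using assms by simp
  then show ?thesis by linarith
 qed
 ultimately have "qlens (replicate k rot_instr) (B * (2 * k)) (B * (2 * k))" by simp
 from qlens_append[OF qlens_sweeps[OF us assms] this]
 have "qlens (supersweep B) (B * (2 * k)) (B * (2 * k))" unfolding supersweep_def .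
 from qlens_append[OF this Suc.IH] show ?case by simp
qed

lemma enc_word_inject:
 "length q = length q' ==> set q \<subseteq> letters M ==> set q' \<subseteq> letters M ==> enc_word q = enc_word q' ==> q = q'"
proof (induction q q' rule: list_induct2)
 case (Cons x q y q')
 from Cons.prems(3) have "code x = code y \<and> enc_word q = enc_word q'"
  using length_code by (simp add: append_eq_append_conv)
 then show ?case using Cons code_inject by auto
qed simp

end

text \<open>The padding on the right is longer by the length of \<open>tl w\<close>, so that the
  whole word has the even length \<open>2 * (1 + T + length (tl w))\<close>.\<close>

definition initial_word :: "nat => bool list => letter list" where
 "initial_word T w = Sep # replicate T (Cell 0) @ Head 0 (if w = [] then 0 else if hd w then 2 else 1) #
  map (\<lambda>b. if b then Cell 2 else Cell 1) (tl w) @ replicate (T + length (tl w)) (Cell 0)"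

lemma initial_word:
 "initial_word T w = Sep # map (letter_at (initial_config w)) [- int T..int T + 2 * int (length (tl w))]"
proof -
 let ?l = "length (tl w)"
 let ?f = "letter_at (initial_config w)"
 let ?hi = "int T + 2 * int ?l"
 have f: "?f i = (if i = 0 then Head 0 (tape_of w 0) else Cell (tape_of w i))" for i
  by (simp add: letter_at_def initial_config_def)
 have split: "[- int T..?hi] = [- int T.. -1] @ 0 # [1..int ?l] @ [int ?l + 1..?hi]"
 proof -
  have "[- int T..?hi] = [- int T..0 - 1] @ 0 # [0 + 1..?hi]" by (rule upto_split3) simp_all
  moreover have "[1..?hi] = [1..int ?l] @ [int ?l + 1..?hi]"
  proof (cases "?l = 0")
   case False
   then show ?thesis by (intro upto_split2) simp_all
  qed simp
  ultimately show ?thesis by simp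
 qed
 have 1: "map ?f [- int T.. -1] = replicate T (Cell 0)"
  by (rule replicate_eqI) (auto simp: f tape_of_def)
 have 3: "map ?f [int ?l + 1..?hi] = replicate (T + ?l) (Cell 0)"
  by (rule replicate_eqI) (auto simp: f tape_of_def)
 have 2: "map ?f [1..int ?l] = map (\<lambda>b. if b then Cell 2 else Cell 1) (tl w)"
 proof (rule nth_equalityI)
  fix i assume "i < length (map ?f [1..int ?l])"
  then have i: "i < ?l" by simp
  then have "tape_of w (1 + int i) = (if tl w ! i then 2 else 1)"
   by (cases w) (auto simp: tape_of_def nat_add_distrib)
  then show "map ?f [1..int ?l] ! i = map (\<lambda>b. if b then Cell 2 else Cell 1) (tl w) ! i"
   using i by (simp add: f nth_upto)
 qed simp
 have 0: "?f 0 = Head 0 (if w = [] then 0 else if hd w then 2 else 1)"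
  unfolding f by (cases w) (simp_all add: tape_of_def)
 show ?thesis unfolding initial_word_def split map_append list.map 1 2 3 0 by simp
qed

text \<open>If the machine stops after \<open>m < B\<close> steps, \<open>rounds_complete\<close>
  asks for \<open>2 * m + 2\<close> rounds and two more for each of the \<open>2 * B - 1\<close>
  letters of the window, which is less than \<open>8 * B\<close>.\<close>

definition queue_program :: "instr list list => nat => nat => instr list" where
 "queue_program us k B = concat (replicate (8 * B) (sweeps us B @ replicate k rot_instr))"

theorem NP_queue_program:
 assumes "in_NP A"
 obtains us k and code :: "letter => bool list" and p :: "nat poly"
 where "1 \<le> k" "!!x. length (code x) = k"
  "!!w T B. T = poly p (length w) + 2 ==> B = 1 + T + length (tl w) ==>
   (w \<in> A \<longleftrightarrow> qrun (queue_program us k B) (concat (map code (initial_word T w))) (concat (replicate (2 * B) (code Done)))) \<and>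
   qlens (queue_program us k B) (B * (2 * k)) (B * (2 * k))"
proof -
 from assms obtain M and p :: "nat poly" where M: "finite M" and time: "runs_in_time M (poly p)"
  and acc: "!!w. w \<in> A \<longleftrightarrow> accepts M w" unfolding in_NP_def Turing_machine_def by blast
 obtain f :: "letter => nat" and k where f: "f ` letters M = {i. i < k}" "inj_on f (letters M)"
  using finite_imp_inj_to_nat_seg[OF finite_letters[OF M]] by metis
 \<comment> \<open>One-hot code. Letters that do not belong to the machine get some word of the same
   length.\<close>
 define code where "code x = map (\<lambda>i. i = f x) [0..<k]" for x
 have len: "length (code x) = k" for x by (simp add: code_def)
 have "f Sep < k" using f(1) by auto
 then have k: "1 \<le> k" by simp
 have inj: "x = y" if "x \<in> letters M" "y \<in> letters M" "code x = code y" for x y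
 proof -
  have fx: "f x < k" using that(1) f(1) by blast
  then have "code x ! f x" by (simp add: code_def)
  then have "code y ! f x" using that(3) by simp
  then have "f x = f y" using fx by (simp add: code_def)
  then show ?thesis using f(2) that(1,2) by (simp add: inj_on_def)
 qed
 let ?R = "\<lambda>u v. \<exists>x\<in>letters M. \<exists>y\<in>letters M. \<exists>x' y'.
   pair_rule M x y x' y' \<and> u = code x @ code y \<and> v = code x' @ code y'"
 \<comment> \<open>Here the machine enters the program: its rules become one relation on pairs of
   letter codes.\<close>
 have "realizable (2 * k) (2 * k) ?R" by (rule realizable_all) (use k len in auto)
 then obtain us where us: "chain us (2 * k) (2 * k) ?R" unfolding realizable_def by blast
 interpret letter_code M code k us by unfold_locales (use len inj k us in blast)+
 show thesis
 proof (rule that[OF k len])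
  fix w :: "bool list" and T B :: nat
  assume T: "T = poly p (length w) + 2" and B: "B = 1 + T + length (tl w)"
  let ?hi = "int T + 2 * int (length (tl w))"
  let ?q = "initial_word T w"
  have B3: "3 \<le> B" using T B by simp
  have lenq: "length ?q = 2 * B" by (simp add: initial_word_def B)
  have lenu: "length [- int T..?hi] = 2 * B - 1" using B by simp
  have sub: "set ?q \<subseteq> letters M" by (auto simp: initial_word_def symbols_def states_def)
  have prog: "queue_program us k B = concat (replicate (8 * B) (supersweep B))"
   unfolding queue_program_def supersweep_def ..
  have closed: "set z \<subseteq> letters M \<and> length z = 2 * B" if "(qround M ^^ n) ?q z" for n z
   using that
  proof (induction n arbitrary: z)
   case 0
   then show ?case using sub lenq by simp
  next
   case (Suc n)
   then obtain y where y: "(qround M ^^ n) ?q y" "qround M y z" by (auto elim: relpowp_Suc_E)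
   from Suc.IH[OF y(1)] show ?case using qround_letters[OF y(2)] round_length[OF y(2)] by simp
  qed
  have word: "concat (replicate (2 * B) (code Done)) = enc_word (replicate (2 * B) Done)" by simp
  have "qrun (queue_program us k B) (enc_word ?q) (concat (replicate (2 * B) (code Done))) \<longleftrightarrow>
    (\<exists>q'. (qround M ^^ (8 * B)) ?q q' \<and> enc_word (replicate (2 * B) Done) = enc_word q')"
   unfolding prog word using B3 by (intro qrun_supersweeps lenq sub) simp
  also have "\<dots> \<longleftrightarrow> (qround M ^^ (8 * B)) ?q (replicate (2 * B) Done)"
  proof
   assume "\<exists>q'. (qround M ^^ (8 * B)) ?q q' \<and> enc_word (replicate (2 * B) Done) = enc_word q'"
   then obtain q' where q': "(qround M ^^ (8 * B)) ?q q'" "enc_word (replicate (2 * B) Done) = enc_word q'" by blast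
   have "replicate (2 * B) Done = q'"
    by (rule enc_word_inject[OF _ _ _ q'(2)]) (use closed[OF q'(1)] in auto)
   with q'(1) show "(qround M ^^ (8 * B)) ?q (replicate (2 * B) Done)" by simp
  qed blast
  also have "\<dots> \<longleftrightarrow> accepts M w"
  proof
   assume "(qround M ^^ (8 * B)) ?q (replicate (2 * B) Done)"
   then show "accepts M w" unfolding initial_word by (rule rounds_sound)
  next
   assume "accepts M w"
   then obtain c where c: "(step M)\<^sup>*\<^sup>* (initial_config w) c" "halting M c" "fst c = 1" unfolding accepts_def by blast
   then obtain m where m: "(step M ^^ m) (initial_config w) c" using rtranclp_imp_relpowp by metis
   then have "m \<le> poly p (length w)" using time unfolding runs_in_time_def by blast
   then have mT: "m + 2 \<le> T" using T by simp
   have suc: "Suc (length [- int T..?hi]) = 2 * B" using lenu B by simp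
   have "(qround M ^^ (8 * B)) (Sep # map (letter_at (initial_config w)) [- int T..?hi])
     (replicate (Suc (length [- int T..?hi])) Done)"
    by (rule rounds_complete[OF m c(2,3)]) (use mT B lenu in auto)
   then show "(qround M ^^ (8 * B)) ?q (replicate (2 * B) Done)" unfolding initial_word suc .
  qed
  finally show "(w \<in> A \<longleftrightarrow> qrun (queue_program us k B) (concat (map code ?q)) (concat (replicate (2 * B) (code Done)))) \<and>
    qlens (queue_program us k B) (B * (2 * k)) (B * (2 * k))"
   unfolding acc prog using qlens_supersweeps[OF B3] by blast
 qed
qed

section \<open>The reduction from an arbitrary problem in NP\<close>

lemma NP_hard_tiling: "NP_hard (tiling_problem tiles)"
 unfolding NP_hard_def
proof (intro allI impI)
 fix A assume "in_NP A"
 then obtain us k and code :: "letter => bool list" and q :: "nat poly" where k: "1 \<le> k" and len: "!!x. length (code x) = k"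
  and prog: "!!w T B. T = poly q (length w) + 2 ==> B = 1 + T + length (tl w) ==>
   (w \<in> A \<longleftrightarrow> qrun (queue_program us k B) (concat (map code (initial_word T w))) (concat (replicate (2 * B) (code Done)))) \<and>
   qlens (queue_program us k B) (B * (2 * k)) (B * (2 * k))"
  by (rule NP_queue_program) (rule that)
 \<comment> \<open>The surplus 2 keeps the head off the ends of the window and guarantees at least
   three pairs, as the sweeps require.\<close>
 define T where "T w = poly q (length w) + 2" for w :: "bool list"
 define B where "B w = 1 + T w + length (tl w)" for w
 define xs where "xs w = concat (map code (initial_word (T w) w))" for w
 define zs where "zs w = concat (replicate (2 * B w) (code Done))" for w
 \<comment> \<open>Starting in column 2 leaves room for the at most two constants in front of the
   queue, so all coordinates are nonnegative.\<close>
 define f where "f w = region_code (lay instr_cells (queue_program us k (B w)) (int 2) 0 (length (xs w)))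
  (region_edges (queue_program us k (B w)) (int 2) 0 (xs w) (zs w))" for w
 have PT_T: "PT T" unfolding T_def by (intro PT_rules)
 have PT_B: "PT B" unfolding B_def by (intro PT_rules PT_T)
 have PT_prog: "PT (\<lambda>w. queue_program us k (B w))"
  unfolding queue_program_def sweeps_def by (intro PT_rules PT_comp[OF PT_B] PT_B)
 \<comment> \<open>Letters are not encoded as data; the queue is therefore written with the constant
   codes of the few letters that occur.\<close>
 define X where "X w = code Sep @ concat (replicate (T w) (code (Cell 0))) @
   (if w = [] then code (Head 0 0) else if hd w then code (Head 0 2) else code (Head 0 1)) @
   concat (map (\<lambda>b. if b then code (Cell 2) else code (Cell 1)) (tl w)) @
   concat (replicate (T w + length (tl w)) (code (Cell 0)))" for w :: "bool list"
 have xs_X: "xs w = X w" for w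
 proof -
  have m: "map code (map (\<lambda>b. if b then Cell 2 else Cell 1) l) = map (\<lambda>b. if b then code (Cell 2) else code (Cell 1)) l" for l
   by simp
  show ?thesis unfolding xs_def initial_word_def X_def by (simp del: map_map add: m)
 qed
 have PT_X: "PT X" unfolding X_def by (intro PT_rules PT_T)
 have PT_xs: "PT xs" by (rule PT_enc_cong[OF PT_X]) (simp only: xs_X)
 have PT_zs: "PT zs" unfolding zs_def by (intro PT_rules PT_B)
 have "PT f" unfolding f_def by (rule PT_region[OF PT_prog PT_xs PT_zs])
 then have "polytime_computable f" by (rule polytime_computable_PT)
 moreover have "w \<in> A \<longleftrightarrow> f w \<in> tiling_problem tiles" for w
 proof -
  have lc: "length (concat (map code l)) = length l * k" for l by (induction l) (simp_all add: len)
  have lx: "length (xs w) = B w * (2 * k)"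
   unfolding xs_def lc by (simp add: initial_word_def B_def)
  have lz: "length (zs w) = B w * (2 * k)"
   using lc[of "replicate (2 * B w) Done"] unfolding zs_def by simp
  note main = prog[OF T_def B_def, of w]
  have ql: "qlens (queue_program us k (B w)) (length (xs w)) (length (zs w))" unfolding lx lz using main by blast
  have "rot_instr \<in> set (queue_program us k (B w))"
   using k by (auto simp: queue_program_def B_def)
  then have ne: "queue_program us k (B w) ~= []" by auto
  note r = region[OF ql ne, of "int 2" 0]
  have "w \<in> A \<longleftrightarrow> qrun (queue_program us k (B w)) (xs w) (zs w)" unfolding xs_def zs_def using main by blast
  also have "\<dots> \<longleftrightarrow> f w \<in> tiling_problem tiles"
  proof
   assume "qrun (queue_program us k (B w)) (xs w) (zs w)"
   with r(3) have "tiles_region tiles (set (lay instr_cells (queue_program us k (B w)) (int 2) 0 (length (xs w))),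
     map_of (region_edges (queue_program us k (B w)) (int 2) 0 (xs w) (zs w)))" by (rule iffD2)
   then show "f w \<in> tiling_problem tiles"
    unfolding tiling_problem_def f_def mem_Collect_eq
    by (intro exI conjI) (rule refl, rule distinct_cells, rule r(1), rule r(2), assumption)
  next
   assume "f w \<in> tiling_problem tiles"
   then obtain cs bs where e: "f w = region_code cs bs" and t: "tiles_region tiles (set cs, map_of bs)"
    unfolding tiling_problem_def by blast
   \<comment> \<open>The code determines both lists, so the region named by the word is the
     constructed one.\<close>
   note e' = e[unfolded f_def region_code_inject]
   have "tiles_region tiles (set (lay instr_cells (queue_program us k (B w)) (int 2) 0 (length (xs w))),
     map_of (region_edges (queue_program us k (B w)) (int 2) 0 (xs w) (zs w)))"
    unfolding conjunct1[OF e'] conjunct2[OF e'] by (rule t)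
   with r(3) show "qrun (queue_program us k (B w)) (xs w) (zs w)" by (rule iffD1)
  qed
  finally show ?thesis .
 qed
 ultimately show "polytime_reducible A (tiling_problem tiles)" unfolding polytime_reducible_def by blast
qed

theorem mainTheorem3:
 shows "\<exists>T :: colored_cells set.
  card T = 14 \<and> wang_tile_set T \<and> NP_complete (tiling_problem T)"
 unfolding NP_complete_def using card_tiles wang_tiles in_NP_tiling NP_hard_tiling by blast

end
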